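(* Let $F$ be a field of characteristic different from $2$ and let $(A,\sigma)$ be an $F$-algebra with involution. Let $b_1,\ldots,b_t\in F^\times$, let $Y=H(b_1,\ldots,b_t)=\{P\in X_F\mid b_1,\ldots,b_t\in P\}$ and let $a\in\mathrm{Sym}(A,\sigma)^\times$ be such that, for every $\mathcal{P}\in X_{(A,\sigma)}$ with $\mathcal{P}_F\in Y$, $a\in\mathcal{P}\cup-\mathcal{P}$. Then \[\bigcap\{\mathcal{P}\in X_{(A,\sigma)}\mid \mathcal{P}_F\in Y\text{ and }a\in\mathcal{P}\}=\bigcup_{s\in\mathbb{N}}D_{(A,\sigma)}\bigl(s\times\langle\!\langle b_1,\ldots,b_t\rangle\!\rangle\otimes\langle a\rangle_\sigma\bigr).\]
   Context: $X_F$ is the (possibly empty) set of orderings of $F$, an ordering being a subset $P\subseteq F$ with $P+P\subseteq P$, $P\cdot P\subseteq P$, $P\cup -P=F$ and $P\cap -P=\{0\}$ (so $0\in P$). An $F$-algebra with involution is a pair $(A,\sigma)$ where $A$ is a finite-dimensional simple $F$-algebra whose centre $K=Z(A)$ is a field and $\sigma:A\to A$ is an involution (additive, $\sigma(xy)=\sigma(y)\sigma(x)$, $\sigma^2=\mathrm{id}$) such that $F=K\cap \mathrm{Sym}(A,\sigma)$, where $\mathrm{Sym}(A,\sigma)=\{a\in A\mid \sigma(a)=a\}$. $\mathrm{Sym}(A,\sigma)^\times$ is the set of invertible elements of $A$ lying in $\mathrm{Sym}(A,\sigma)$. A prepositive cone on $(A,\sigma)$ is a subset $\mathcal{P}\subseteq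 \mathrm{Sym}(A,\sigma)$ such that (P1) $\mathcal{P}\neq\varnothing$; (P2) $\mathcal{P}+\mathcal{P}\subseteq\mathcal{P}$; (P3) $\sigma(a)\cdot\mathcal{P}\cdot a\subseteq\mathcal{P}$ for every $a\in A$; (P4) $\mathcal{P}_F:=\{u\in F\mid u\mathcal{P}\subseteq\mathcal{P}\}$ is an ordering on $F$; (P5) $\mathcal{P}\cap-\mathcal{P}=\{0\}$. A positive cone is a prepositive cone that is maximal with respect to inclusion; $X_{(A,\sigma)}$ is the set of all positive cones on $(A,\sigma)$. Intersections of families of positive cones are taken inside $\mathrm{Sym}(A,\sigma)$ (the empty intersection is $\mathrm{Sym}(A,\sigma)$). For $a_1,\dots,a_k\in\mathrm{Sym}(A,\sigma)$, $\langle a_1,\ldots,a_k\rangle_\sigma$ is the hermitian form $A^k\times A^k\to A$, $((x_i),(y_i))\mapsto\sum_i\sigma(x_i)a_iy_i$. For a hermitian form $h$ on $M$, $D_{(A,\sigma)}(h)=\{u\in\mathrm{Sym}(A,\sigma)\mid\exists x\in M,\ h(x,x)=u\}$ is the set of elements represented by $h$. $\langle\!\langle b_1,\ldots,b_t\rangle\!\rangle=\langle 1,b_1\rangle\otimes\cdots\otimes\langle 1,b_t\rangle$ is the Pfister form, i.e. the diagonal quadratic form over $F$ whose entries are the products $\prod_{i\in I}b_i$, $I\subseteq\{1,\dots,t\}$; for a diagonal quadratic form $\langle c_1,\ldots,c_m\rangle$ over $F$, $\langle c_1,\ldots,c_m\rangle\otimes\langle a\rangle_\sigma=\langle c_1a,\ldots,c_ma\rangle_\sigma$;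 and $s\times h$ is the orthogonal sum of $s$ copies of $h$. $\mathbb{N}=\{1,2,\dots\}$. *)

theory Defs
  imports Complex_Main
begin

section \<open>Orderings of a field\<close>

definition field_ordering :: "'f::field set \<Rightarrow> bool" where
  "field_ordering P \<longleftrightarrow>
     (\<forall>x\<in>P. \<forall>y\<in>P. x + y \<in> P) \<and>
     (\<forall>x\<in>P. \<forall>y\<in>P. x * y \<in> P) \<and>
     P \<union> uminus ` P = UNIV \<and>
     P \<inter> uminus ` P = {0}"

definition harrison :: "'f::field list \<Rightarrow> 'f set set" where
  "harrison bs = {P. field_ordering P \<and> set bs \<subseteq> P}"


section \<open>Algebras with involution\<close>

definition centre :: "'a::ring_1 set" where
  "centre = {z. \<forall>x. z * x = x * z}"

definition two_sided_ideal :: "'a::ring_1 set \<Rightarrow> bool" where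
  "two_sided_ideal I \<longleftrightarrow>
     0 \<in> I \<and> (\<forall>x\<in>I. \<forall>y\<in>I. x + y \<in> I) \<and> (\<forall>x\<in>I. \<forall>r. r * x \<in> I \<and> x * r \<in> I)"

definition Sym :: "('a::ring_1 \<Rightarrow> 'a) \<Rightarrow> 'a set" where
  "Sym \<sigma> = {a. \<sigma> a = a}"

definition Sym_units :: "('a::ring_1 \<Rightarrow> 'a) \<Rightarrow> 'a set" where
  "Sym_units \<sigma> = {a \<in> Sym \<sigma>. \<exists>c. a * c = 1 \<and> c * a = 1}"

text \<open>
  The base field is a separate type acting by scalar multiplication; it is identified with the
  subfield \<open>range (\<lambda>c. scale c 1)\<close> of the algebra. The class \<open>ring_1\<close> makes the algebra nonzero.
\<close>

locale algebra_with_involution = vector_space scale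
  for scale :: "'f::field \<Rightarrow> 'a::ring_1 \<Rightarrow> 'a" +
  fixes \<sigma> :: "'a \<Rightarrow> 'a"
  assumes scale_mult_left: "scale c (x * y) = scale c x * y"
    and scale_mult_right: "scale c (x * y) = x * scale c y"
    and finite_dimensional: "\<exists>B. finite B \<and> span B = UNIV"
    and simple: "two_sided_ideal (I :: 'a set) \<Longrightarrow> I = {0} \<or> I = UNIV"
    and centre_field: "(z :: 'a) \<in> centre \<Longrightarrow> z \<noteq> 0 \<Longrightarrow> \<exists>w\<in>centre. z * w = 1"
    and involution_add: "\<sigma> (x + y) = \<sigma> x + \<sigma> y"
    and involution_mult: "\<sigma> (x * y) = \<sigma> y * \<sigma> x"
    and involution_involution: "\<sigma> (\<sigma> x) = x"
    and base_field: "range (\<lambda>c. scale c 1) = centre \<inter> Sym \<sigma>"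


section \<open>Positive cones\<close>

definition cone_ordering :: "('f::field \<Rightarrow> 'a::ring_1 \<Rightarrow> 'a) \<Rightarrow> 'a set \<Rightarrow> 'f set" where
  "cone_ordering scale \<P> = {u. \<forall>p\<in>\<P>. scale u p \<in> \<P>}"

definition prepositive_cone ::
    "('f::field \<Rightarrow> 'a::ring_1 \<Rightarrow> 'a) \<Rightarrow> ('a \<Rightarrow> 'a) \<Rightarrow> 'a set \<Rightarrow> bool" where
  "prepositive_cone scale \<sigma> \<P> \<longleftrightarrow>
     \<P> \<subseteq> Sym \<sigma> \<and>
     \<P> \<noteq> {} \<and>
     (\<forall>p\<in>\<P>. \<forall>q\<in>\<P>. p + q \<in> \<P>) \<and>
     (\<forall>a. \<forall>p\<in>\<P>. \<sigma> a * p * a \<in> \<P>) \<and>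
     field_ordering (cone_ordering scale \<P>) \<and>
     \<P> \<inter> uminus ` \<P> = {0}"

definition positive_cones ::
    "('f::field \<Rightarrow> 'a::ring_1 \<Rightarrow> 'a) \<Rightarrow> ('a \<Rightarrow> 'a) \<Rightarrow> 'a set set" where
  "positive_cones scale \<sigma> =
     {\<P>. prepositive_cone scale \<sigma> \<P> \<and>
          (\<forall>\<Q>. prepositive_cone scale \<sigma> \<Q> \<longrightarrow> \<P> \<subseteq> \<Q> \<longrightarrow> \<Q> = \<P>)}"


section \<open>Hermitian forms\<close>

text \<open>
  A form is a pair of the underlying set of its module and the map itself, the latter being
  meaningful only on that set. \<open>A\<^sup>k\<close> is the set of lists of length \<open>k\<close>, and the \<open>s\<close>-fold direct
  sum of a module \<open>M\<close> is the set of lists of length \<open>s\<close> with entries in \<open>M\<close>.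
\<close>

type_synonym ('m, 'a) form = "'m set \<times> ('m \<Rightarrow> 'm \<Rightarrow> 'a)"

definition diag_form :: "('a::ring_1 \<Rightarrow> 'a) \<Rightarrow> 'a list \<Rightarrow> ('a list, 'a) form" where
  "diag_form \<sigma> as =
     ({x. length x = length as}, \<lambda>x y. \<Sum>i<length as. \<sigma> (x ! i) * as ! i * y ! i)"

definition multiple_form :: "nat \<Rightarrow> ('m, 'a::ring_1) form \<Rightarrow> ('m list, 'a) form" where
  "multiple_form s h =
     ({x. length x = s \<and> set x \<subseteq> fst h}, \<lambda>x y. \<Sum>j<s. snd h (x ! j) (y ! j))"

definition represented :: "('a::ring_1 \<Rightarrow> 'a) \<Rightarrow> ('m, 'a) form \<Rightarrow> 'a set" where
  "represented \<sigma> h = {u \<in> Sym \<sigma>. \<exists>x\<in>fst h. snd h x x = u}"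

text \<open>Diagonal quadratic forms over the base field are given by the list of their entries.\<close>

definition diag_tensor :: "'f::field list \<Rightarrow> 'f list \<Rightarrow> 'f list" where
  "diag_tensor cs ds = [c * d. c \<leftarrow> cs, d \<leftarrow> ds]"

definition pfister :: "'f::field list \<Rightarrow> 'f list" where
  "pfister bs = foldr (\<lambda>b. diag_tensor [1, b]) bs [1]"

definition diag_tensor_herm ::
    "('f::field \<Rightarrow> 'a::ring_1 \<Rightarrow> 'a) \<Rightarrow> ('a \<Rightarrow> 'a) \<Rightarrow> 'f list \<Rightarrow> 'a \<Rightarrow> ('a list, 'a) form" where
  "diag_tensor_herm scale \<sigma> cs a = diag_form \<sigma> (map (\<lambda>c. scale c a) cs)"

end

theory Submission
  imports Defs "HOL-Algebra.Algebraic_Closure_Type"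
begin

text \<open>
 Replacing \<open>\<sigma>\<close> by \<open>x \<mapsto> c \<sigma>(x) a\<close> with \<open>c\<close> inverse to \<open>a\<close>, we may assume \<open>a = 1\<close>. Let \<open>S\<close> be the set of products of a Pfister
 entry and a nonzero square, and \<open>C\<close> the cone of sums of elements \<open>s \<sigma>(x) x\<close> with \<open>s \<in> S\<close>. If \<open>C\<close> meets \<open>- C\<close> outside
 \<open>0\<close>, polarisation and simplicity give \<open>C = Sym \<sigma>\<close>. Otherwise there is a symmetric idempotent \<open>e\<close> such that \<open>D = e A e\<close> is a division
 ring, and diagonalisation reduces the claim to a symmetric \<open>d \<in> D\<close> that lies in all the positive cones.

 If \<open>k \<otimes> \<langle>1, - d\<rangle>\<close> is metabolic for some form \<open>k\<close> with entries in \<open>S\<close>, a vector of the Lagrangian shows \<open>d \<in> C\<close>. Otherwise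
 Pfister's local-global principle gives an ordering \<open>P \<supseteq> S\<close> such that \<open>\<langle>1, - d\<rangle>\<close> is not \<open>P\<close>-torsion. Modulo \<open>P\<close>-torsion, however, all
 one-dimensional forms are proportional: \<open>S(w) \<langle>u\<rangle> = S(u) \<langle>w\<rangle>\<close> with integers \<open>S(w)\<close>, obtained by comparing \<open>\<langle>w\<rangle>\<close> with the trace form of a
 maximal subfield \<open>L\<close> of symmetric elements and using that this trace form has positive signature when \<open>P\<close> extends to \<open>L\<close>.
 For \<open>\<bar>S(w)\<bar>\<close> maximal, \<open>w\<close> generates a proper cone over \<open>P\<close>. It is contained in a positive cone, which up to sign contains \<open>1\<close> by
 hypothesis, hence also \<open>d\<close>. So \<open>1\<close> and \<open>d\<close> are jointly anisotropic, which forces \<open>S(1) = S(d)\<close> and makes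
 \<open>\<langle>1, - d\<rangle>\<close> a \<open>P\<close>-torsion form, a contradiction.
\<close>

text \<open>Signatures of hermitian forms over \<open>D\<close> are not presupposed; producing them
  is the main obstacle. The integers \<open>S w\<close> come from regarding \<open>D\<close> as a
  right space over the centraliser of \<open>L\<close>, with the form
  \<open>E (\<sigma> x * w * y)\<close>: since every symmetric element commuting with
  \<open>L\<close> lies in \<open>L\<close>, its diagonal entries lie in a commutative field, where
  an ordering above \<open>P\<close> gives them signs. Translating back multiplies by a form whose
  transferred signature is a nonzero integer, and nonzero integers cancel modulo torsion; this is
  where positivity of the trace form enters. \<open>L\<close> is taken around a \<open>w\<close>
  that is not torsion, because the local-global principle over \<open>L\<close> then yields the
  extension of \<open>P\<close>. Torsion allows multipliers from any multiplicative set, so that one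
  Zorn argument serves both the local-global principle and the choice of an ordering of
  \<open>L\<close>. Witt groups are replaced by the existence of a Lagrangian, with cancellation of
  \<open>{#c, - c#}\<close> as the main tool. If no positive cone lies over Y, nothing changes: a
  form \<langle>1, - d\<rangle> that is not torsion would itself lead to such a cone.\<close>

abbreviation inside :: "'a multiset \<Rightarrow> 'a set \<Rightarrow> bool" (infix "inside" 50) where
 "M inside S \<equiv> set_mset M \<subseteq> S"

abbreviation scl :: "'a::times \<Rightarrow> 'a multiset \<Rightarrow> 'a multiset" where
 "scl x \<equiv> image_mset ((*) x)"

lemmas image_mset_comp = image_mset.compositionality comp_def

section \<open>Dimension over division rings\<close>

text \<open>\<open>dimge n U\<close> says that the space \<open>U\<close> of functions has dimension at least \<open>n\<close>, by successive pivots.\<close>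

primrec dimge :: "nat \<Rightarrow> ('i \<Rightarrow> 'a::zero) set \<Rightarrow> bool" where
 "dimge 0 U = True"
| "dimge (Suc n) U = (\<exists>i. (\<exists>w\<in>U. w i \<noteq> 0) \<and> dimge n {u\<in>U. u i = 0})"

lemma dimge_mono: "dimge n U ==> U \<subseteq> V ==> dimge n V"
proof (induction n arbitrary: U V)
 case (Suc n)
 then obtain i w where i: "w \<in> U" "w i \<noteq> 0" "dimge n {u\<in>U. u i = 0}" by auto
 have "dimge n {u\<in>V. u i = 0}" by (rule Suc.IH[OF i(3)]) (use Suc.prems in auto)
 then show ?case using i Suc.prems by auto
qed auto

lemma dimge_nonzero: "dimge (Suc n) U ==> \<exists>u\<in>U. \<exists>i. u i \<noteq> 0"
 by auto

lemma dimge_less: "dimge n U ==> m \<le> n ==> dimge m U"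
proof (induction n arbitrary: U m)
 case (Suc n)
 show ?case
 proof (cases m)
  case (Suc m')
  obtain i w where i: "w \<in> U" "w i \<noteq> 0" "dimge n {u\<in>U. u i = 0}" using Suc.prems by auto
  then have "dimge m' {u\<in>U. u i = 0}" using Suc.IH Suc Suc.prems by auto
  then show ?thesis using i Suc by auto
 qed auto
qed auto

definition dsum :: "('i \<Rightarrow> 'a) set \<Rightarrow> ('j \<Rightarrow> 'a) set \<Rightarrow> ('i + 'j \<Rightarrow> 'a) set" where
 "dsum U V = {case_sum u v | u v. u \<in> U \<and> v \<in> V}"

lemma dimge_dsum:
 assumes "(\<lambda>_. 0) \<in> U" "(\<lambda>_. 0) \<in> V" "dimge n U" "dimge m V"
 shows "dimge (n + m) (dsum U V)"
 using assms
proof (induction n arbitrary: U)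
 case 0
 have "dimge m (dsum U V)" using 0(1,2,4)
 proof (induction m arbitrary: V)
  case (Suc m)
  then obtain i w where i: "w \<in> V" "w i \<noteq> 0" "dimge m {u\<in>V. u i = 0}" by auto
  have "dimge m (dsum U {u\<in>V. u i = 0})" by (rule Suc.IH) (use Suc.prems i in auto)
  then have "dimge m {u \<in> dsum U V. u (Inr i) = 0}"
   by (rule dimge_mono) (auto simp: dsum_def)
  moreover have "case_sum (\<lambda>_. 0) w \<in> dsum U V" using i Suc.prems by (auto simp: dsum_def)
  ultimately show ?case using i
   by (auto intro!: exI[of _ "Inr i"] bexI[of _ "case_sum (\<lambda>_. 0) w"])
 qed auto
 then show ?case by simp
next
 case (Suc n)
 then obtain i w where i: "w \<in> U" "w i \<noteq> 0" "dimge n {u\<in>U. u i = 0}" by auto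
 have "dimge (n + m) (dsum {u\<in>U. u i = 0} V)" by (rule Suc.IH) (use Suc.prems i in auto)
 then have "dimge (n + m) {u \<in> dsum U V. u (Inl i) = 0}"
  by (rule dimge_mono) (auto simp: dsum_def)
 moreover have "case_sum w (\<lambda>_. 0) \<in> dsum U V" using i Suc.prems by (auto simp: dsum_def)
 ultimately show ?case using i
  by (auto intro!: exI[of _ "Inl i"] bexI[of _ "case_sum w (\<lambda>_. 0)"])
qed

text \<open>The unit \<open>e\<close> need not be the unit of the ambient ring: the case of interest is \<open>D = e A e\<close>.\<close>

locale divring =
 fixes D :: "'a::ring set" and e :: 'a
 assumes D_add: "x \<in> D ==> y \<in> D ==> x + y \<in> D"
  and D_uminus: "x \<in> D ==> - x \<in> D"
  and D_mult: "x \<in> D ==> y \<in> D ==> x * y \<in> D"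
  and e_in: "e \<in> D" and e_nz: "e \<noteq> 0"
  and e_left: "x \<in> D ==> e * x = x" and e_right: "x \<in> D ==> x * e = x"
  and D_inv: "x \<in> D ==> x \<noteq> 0 ==> \<exists>y\<in>D. x * y = e \<and> y * x = e"
begin

lemma D_zero: "0 \<in> D" using D_add[OF e_in D_uminus[OF e_in]] by simp
lemma D_diff: "x \<in> D ==> y \<in> D ==> x - y \<in> D" using D_add[of x "-y"] D_uminus by simp
lemma D_sum: "(\<And>i. i \<in> I ==> f i \<in> D) ==> sum f I \<in> D"
 by (induction I rule: infinite_finite_induct) (auto simp: D_zero D_add)

definition dinv :: "'a \<Rightarrow> 'a" where "dinv x = (SOME y. y \<in> D \<and> x * y = e \<and> y * x = e)"

lemma dinv: assumes "x \<in> D" "x \<noteq> 0"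
 shows "dinv x \<in> D" "x * dinv x = e" "dinv x * x = e"
proof -
 have "dinv x \<in> D \<and> x * dinv x = e \<and> dinv x * x = e"
  unfolding dinv_def by (rule someI_ex) (use D_inv[OF assms] in blast)
 then show "dinv x \<in> D" "x * dinv x = e" "dinv x * x = e" by auto
qed

lemma dinv_nz: assumes "x \<in> D" "x \<noteq> 0" shows "dinv x \<noteq> 0"
 using dinv[OF assms] e_nz by auto

lemma cancel1: assumes "x \<in> D" "x \<noteq> 0" "z \<in> D" shows "x * (dinv x * z) = z"
 using dinv[OF assms(1,2)] assms(3) by (metis e_left mult.assoc)

lemma cancel2: assumes "x \<in> D" "x \<noteq> 0" "z \<in> D" shows "dinv x * (x * z) = z"
 using dinv[OF assms(1,2)] assms(3) by (metis e_left mult.assoc)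

lemma no_zero_div: assumes "x \<in> D" "y \<in> D" "x * y = 0" shows "x = 0 \<or> y = 0"
 using cancel2[OF assms(1) _ assms(2)] assms(3) by auto

lemma mult_nz: "x \<in> D ==> y \<in> D ==> x \<noteq> 0 ==> y \<noteq> 0 ==> x * y \<noteq> 0"
 using no_zero_div by blast

lemma dinv_unique: assumes "x \<in> D" "y \<in> D" "x * y = e" shows "y = dinv x"
proof -
 have "x \<noteq> 0" using assms e_nz by auto
 then show ?thesis using cancel2[OF assms(1) \<open>x \<noteq> 0\<close> assms(2)] assms e_right dinv by metis
qed

text \<open>Scalars act on the right, since \<open>hf\<close> is linear on the right in its second
  argument and matrices act from the left.\<close>

definition rsub :: "('i \<Rightarrow> 'a) set \<Rightarrow> bool" where
 "rsub U \<longleftrightarrow> (\<forall>u\<in>U. \<forall>i. u i \<in> D) \<and> (\<lambda>_. 0) \<in> U \<and> (\<forall>u\<in>U. \<forall>v\<in>U. (\<lambda>i. u i + v i) \<in> U)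
   \<and> (\<forall>u\<in>U. \<forall>x\<in>D. (\<lambda>i. u i * x) \<in> U)"

definition rlin :: "('i \<Rightarrow> 'a) set \<Rightarrow> (('i \<Rightarrow> 'a) \<Rightarrow> 'a) \<Rightarrow> bool" where
 "rlin U l \<longleftrightarrow> (\<forall>u\<in>U. l u \<in> D) \<and> (\<forall>u\<in>U. \<forall>v\<in>U. l (\<lambda>i. u i + v i) = l u + l v)
   \<and> (\<forall>u\<in>U. \<forall>x\<in>D. l (\<lambda>i. u i * x) = l u * x)"

lemma rsubD:
 assumes "rsub U"
 shows "u \<in> U ==> u i \<in> D" "(\<lambda>_. 0) \<in> U" "u \<in> U ==> v \<in> U ==> (\<lambda>i. u i + v i) \<in> U"
  "u \<in> U ==> x \<in> D ==> (\<lambda>i. u i * x) \<in> U"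
 using assms by (auto simp: rsub_def)

lemma rlin_coord: "rsub U ==> rlin U (\<lambda>u. u i)"
 by (auto simp: rsub_def rlin_def)

lemma rlin_sub: "rlin U l ==> V \<subseteq> U ==> rlin V l"
 by (auto simp: rlin_def subset_iff)

lemma rsub_ker: assumes "rsub U" "rlin U l" shows "rsub {u\<in>U. l u = 0}"
proof -
 have "l (\<lambda>i. 0) = l (\<lambda>i. 0) + l (\<lambda>i. 0)"
  using assms unfolding rlin_def rsub_def by fastforce
 then show ?thesis using assms by (auto simp: rlin_def rsub_def)
qed

text \<open>If \<open>l\<close> vanishes on the part of \<open>U\<close> below the first pivot, this
  part already lies in the kernel. Otherwise a vector of that part corrects the first pivot vector
  into the kernel without touching its pivot coordinate, and induction treats the rest.\<close>

lemma dimge_ker: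
 assumes "rsub U" "rlin U l" "dimge (Suc n) U"
 shows "dimge n {u\<in>U. l u = 0}"
 using assms
proof (induction n arbitrary: U)
 case (Suc n)
 then obtain i w where i: "w \<in> U" "w i \<noteq> 0" "dimge (Suc n) {u\<in>U. u i = 0}" by auto
 define U1 where "U1 = {u\<in>U. u i = 0}"
 have U1: "rsub U1" "rlin U1 l" "dimge (Suc n) U1"
  using rsub_ker[OF Suc.prems(1) rlin_coord[OF Suc.prems(1)]] i rlin_sub[OF Suc.prems(2)]
  by (auto simp: U1_def)
 show ?case
 proof (cases "\<exists>u1\<in>U1. l u1 \<noteq> 0")
  case False
  then show ?thesis using U1(3) by (rule_tac dimge_mono[of _ U1]) (auto simp: U1_def)
 next
  case True
  then obtain u1 where u1: "u1 \<in> U1" "l u1 \<noteq> 0" by auto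
  have u1U: "u1 \<in> U" using u1 by (auto simp: U1_def)
  have lD: "l u1 \<in> D" "l w \<in> D" using Suc.prems i u1U by (auto simp: rlin_def)
  define c where "c = - (dinv (l u1) * l w)"
  have c: "c \<in> D" using lD u1 dinv by (auto simp: c_def D_mult D_uminus)
  define w' where "w' = (\<lambda>i. w i + u1 i * c)"
  have u1c: "(\<lambda>i. u1 i * c) \<in> U" using rsubD[OF Suc.prems(1)] u1U c by blast
  have w': "w' \<in> U" using rsubD(3)[OF Suc.prems(1) i(1) u1c] by (simp add: w'_def)
  have "l w' = l w + l (\<lambda>i. u1 i * c)"
   unfolding w'_def using Suc.prems(2) i(1) u1c by (simp add: rlin_def)
  also have "l (\<lambda>i. u1 i * c) = l u1 * c" using Suc.prems(2) u1U c by (auto simp: rlin_def)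
  also have "\<dots> = - l w" using cancel1[OF lD(1) u1(2) lD(2)] by (simp add: c_def)
  finally have "l w' = 0" by simp
  moreover have "w' i \<noteq> 0" using i u1 by (auto simp: w'_def U1_def)
  moreover have "dimge n {u \<in> {u\<in>U. l u = 0}. u i = 0}"
   using Suc.IH[OF U1] by (rule dimge_mono) (auto simp: U1_def)
  ultimately show ?thesis using w' by auto
 qed
qed simp

lemma rsub_kers:
 assumes "finite J" "rsub U" "\<And>j. j \<in> J ==> rlin U (l j)"
 shows "rsub {u\<in>U. \<forall>j\<in>J. l j u = 0}"
 using assms
proof (induction J)
 case (insert k J)
 have "rlin {u\<in>U. \<forall>j\<in>J. l j u = 0} (l k)"
  by (rule rlin_sub[of U]) (use insert in auto)
 then have "rsub {u \<in> {u\<in>U. \<forall>j\<in>J. l j u = 0}. l k u = 0}"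
  using insert by (intro rsub_ker) auto
 moreover have "{u \<in> {u\<in>U. \<forall>j\<in>J. l j u = 0}. l k u = 0} = {u\<in>U. \<forall>j\<in>insert k J. l j u = 0}" by auto
 ultimately show ?case by simp
qed auto

lemma dimge_kers:
 assumes "finite J" "rsub U" "\<And>j. j \<in> J ==> rlin U (l j)" "dimge (card J + n) U"
 shows "dimge n {u\<in>U. \<forall>j\<in>J. l j u = 0}"
 using assms
proof (induction J arbitrary: n)
 case (insert j J)
 have A: "dimge (Suc n) {u\<in>U. \<forall>j\<in>J. l j u = 0}" using insert by (intro insert.IH) auto
 have B: "rsub {u\<in>U. \<forall>j\<in>J. l j u = 0}"
  by (rule rsub_kers) (use insert in auto)
 have "dimge n {u \<in> {u\<in>U. \<forall>j\<in>J. l j u = 0}. l j u = 0}"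
  by (rule dimge_ker[OF B _ A], rule rlin_sub[of U]) (use insert.prems in auto)
 moreover have "{u \<in> {u\<in>U. \<forall>j\<in>J. l j u = 0}. l j u = 0} = {u\<in>U. \<forall>j\<in>insert j J. l j u = 0}" by auto
 ultimately show ?case by simp
qed simp

lemma dimge_exists:
 assumes "finite J" "rsub U" "\<And>j. j \<in> J ==> rlin U (l j)" "dimge n U" "card J < n"
 shows "\<exists>u\<in>U. (\<exists>i. u i \<noteq> 0) \<and> (\<forall>j\<in>J. l j u = 0)"
proof -
 have "dimge (card J + Suc 0) U" using assms(4) by (rule dimge_less) (use assms(5) in auto)
 from dimge_nonzero[OF dimge_kers[OF assms(1,2) _ this, of l]] assms(3) show ?thesis by blast
qed

text \<open>Pivots are not preserved by \<open>f\<close>, but some coordinate \<open>k\<close> of an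
  image is nonzero. Its kernel in \<open>U\<close> loses at most one dimension and maps into the
  vectors of the image that vanish at \<open>k\<close>.\<close>

lemma dimge_inj:
 assumes "rsub U" "\<And>k. rlin U (\<lambda>u. f u k)" "\<And>u. u \<in> U ==> (\<And>k. f u k = 0) ==> (\<And>i. u i = 0)"
  "dimge n U"
 shows "dimge n (f ` U)"
 using assms
proof (induction n arbitrary: U)
 case (Suc n)
 obtain w where w: "w \<in> U" "\<exists>i. w i \<noteq> 0" using dimge_nonzero[OF Suc.prems(4)] by auto
 then obtain k where k: "f w k \<noteq> 0" using Suc.prems(3) by blast
 have "dimge n (f ` {u\<in>U. f u k = 0})"
 proof (rule Suc.IH)
  show "rsub {u\<in>U. f u k = 0}" by (rule rsub_ker[OF Suc.prems(1,2)])
  show "dimge n {u\<in>U. f u k = 0}" by (rule dimge_ker[OF Suc.prems(1,2,4)])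
  show "rlin {u \<in> U. f u k = 0} (\<lambda>u. f u l)" for l by (rule rlin_sub[OF Suc.prems(2)]) auto
 qed (use Suc.prems(3) in auto)
 moreover have "f ` {u\<in>U. f u k = 0} \<subseteq> {v \<in> f ` U. v k = 0}" by auto
 ultimately have "dimge n {v \<in> f ` U. v k = 0}" by (rule dimge_mono)
 then show ?case using w k unfolding dimge.simps by blast
qed simp

text \<open>The coordinates in \<open>J\<close> serve as pivots one after the other, because values
  there, in particular zeros at the earlier ones, can be prescribed. The kernel of the projection
  supplies the other \<open>m\<close> pivots.\<close>

lemma dimge_proj:
 assumes "finite J" "\<And>x. (\<And>j. j \<in> J ==> x j \<in> D) ==> \<exists>u\<in>U. \<forall>j\<in>J. u j = x j"
  "dimge m {u\<in>U. \<forall>j\<in>J. u j = 0}"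
 shows "dimge (card J + m) U"
 using assms
proof (induction J arbitrary: U)
 case (insert j J)
 obtain w where w: "w \<in> U" "w j = e"
  using insert.prems(1)[of "\<lambda>_. e"] e_in by auto
 have "dimge (card J + m) {u\<in>U. u j = 0}"
 proof (rule insert.IH)
  fix x assume x: "\<And>k. k \<in> J ==> x k \<in> D"
  have "\<And>k. k \<in> insert j J ==> (x(j := 0)) k \<in> D" using x D_zero by auto
  then obtain u where "u \<in> U" "\<forall>k\<in>insert j J. u k = (x(j := 0)) k"
   using insert.prems(1) by blast
  then show "\<exists>u\<in>{u \<in> U. u j = 0}. \<forall>j\<in>J. u j = x j"
   using insert.hyps by (intro bexI[of _ u]) auto
 next
  show "dimge m {u \<in> {u \<in> U. u j = 0}. \<forall>j\<in>J. u j = 0}"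
   using insert.prems(2) by (rule dimge_mono) auto
 qed
 then show ?case using w e_nz insert.hyps by auto
qed auto

lemma dimge_proj0:
 assumes "finite J" "\<And>x. (\<And>j. j \<in> J ==> x j \<in> D) ==> \<exists>u\<in>U. \<forall>j\<in>J. u j = x j"
 shows "dimge (card J) U"
 using dimge_proj[OF assms, where m = 0] by simp

definition full :: "'i set \<Rightarrow> ('i \<Rightarrow> 'a) set" where
 "full I = {u. (\<forall>i. u i \<in> D) \<and> (\<forall>i. i \<notin> I \<longrightarrow> u i = 0)}"

lemma rsub_full: "rsub (full I)"
 by (auto simp: rsub_def full_def D_add D_mult D_zero)

lemma dimge_full: assumes "finite I" shows "dimge (card I) (full I)"
proof (rule dimge_proj0[OF assms])
 fix x :: "'b \<Rightarrow> 'a" assume "\<And>j. j \<in> I ==> x j \<in> D"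
 then show "\<exists>u\<in>full I. \<forall>j\<in>I. u j = x j"
  by (intro bexI[of _ "\<lambda>i. if i \<in> I then x i else 0"]) (auto simp: full_def D_zero)
qed

end

section \<open>Hermitian forms up to metabolic forms\<close>

text \<open>A diagonal form is given by the multiset of its entries.\<close>

definition tens :: "'a::semiring_0 multiset \<Rightarrow> 'a multiset \<Rightarrow> 'a multiset" where
 "tens K M = (\<Sum>k\<in>#K. scl k M)"

abbreviation neg :: "'a::ring multiset \<Rightarrow> 'a multiset" where
 "neg M \<equiv> image_mset uminus M"

lemma tens_simps [simp]: "tens {#} M = {#}" "tens (add_mset k K) M = scl k M + tens K M"
 by (simp_all add: tens_def)

lemma tens_add_left [simp]: "tens (K + K') M = tens K M + tens K' M"
 by (simp add: tens_def)

lemma tens_empty_right [simp]: "tens K {#} = {#}"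
 by (induction K) auto

lemma tens_add_right [simp]: "tens K (M + M') = tens K M + tens K M'"
 by (induction K) (auto simp: ac_simps)

lemma tens_image: "tens (scl x K) M = scl x (tens K M)"
 by (induction K) (simp_all add: multiset.map_comp comp_def mult.assoc[abs_def])

lemma tens_tens: "tens (tens K K') M = tens K (tens K' M)"
 by (induction K) (auto simp: tens_image)

lemma tens_neg_right: "tens K (neg M) = neg (tens K (M::'a::ring multiset))"
 by (induction K) (auto simp: image_mset_comp)

lemma set_tens: "set_mset (tens K M) = {k * m | k m. k \<in># K \<and> m \<in># M}"
 by (induction K) auto

lemma tens_comm_out:
 assumes "\<And>k x. k \<in># K ==> x \<in># K' ==> k * x = x * k"
 shows "tens K (tens K' M) = tens K' (tens K M)"
 using assms
proof (induction K)
 case (add k K)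
 have "scl k (tens K' M) = tens K' (scl k M)"
  using add.prems
 proof (induction K')
  case (add x K')
  then have "k * x = x * k" by auto
  then have "k * (x * m) = x * (k * m)" for m by (metis mult.assoc)
  then show ?case using add by (auto simp: image_mset_comp)
 qed auto
 then show ?case using add by auto
qed auto

lemma neg_neg [simp]: "neg (neg M) = (M::'a::ring multiset)"
 by (simp add: image_mset_comp)

lemma size_tens [simp]: "size (tens K M) = size K * size M"
 by (induction K) auto

locale divinv = divring +
 fixes \<sigma> :: "'a::ring \<Rightarrow> 'a"
 assumes s_in: "x \<in> D ==> \<sigma> x \<in> D"
  and s_add: "x \<in> D ==> y \<in> D ==> \<sigma> (x + y) = \<sigma> x + \<sigma> y"
  and s_mult: "x \<in> D ==> y \<in> D ==> \<sigma> (x * y) = \<sigma> y * \<sigma> x"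
  and s_invol: "x \<in> D ==> \<sigma> (\<sigma> x) = x"
begin

lemma s_zero: "\<sigma> 0 = 0" using s_add[OF D_zero D_zero] by simp
lemma s_uminus: "x \<in> D ==> \<sigma> (- x) = - \<sigma> x"
 using s_add[of x "-x"] D_uminus s_zero by (metis add.right_inverse add_eq_0_iff)
lemma s_e: "\<sigma> e = e"
 using s_mult[OF e_in s_in[OF e_in]] s_invol[OF e_in] e_left[OF s_in[OF e_in]] by (metis e_in e_right s_in)
lemma s_sum: "(\<And>i. i \<in> I ==> f i \<in> D) ==> \<sigma> (sum f I) = (\<Sum>i\<in>I. \<sigma> (f i))"
 by (induction I rule: infinite_finite_induct) (auto simp: s_zero s_add D_sum)
lemma s_nz: "x \<in> D ==> x \<noteq> 0 ==> \<sigma> x \<noteq> 0"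
 using s_invol s_zero by metis
lemma s_dinv: assumes "x \<in> D" "x \<noteq> 0" shows "\<sigma> (dinv x) = dinv (\<sigma> x)"
proof (rule dinv_unique)
 show "\<sigma> x * \<sigma> (dinv x) = e" using s_mult[of "dinv x" x] dinv[OF assms] assms s_e by simp
qed (use assms dinv s_in in auto)

definition Hs :: "'a set" where "Hs = {d\<in>D. \<sigma> d = d \<and> d \<noteq> 0}"

lemma HsD: "d \<in> Hs ==> d \<in> D" "d \<in> Hs ==> \<sigma> d = d" "d \<in> Hs ==> d \<noteq> 0"
 by (auto simp: Hs_def)
lemma e_Hs: "e \<in> Hs" by (simp add: Hs_def e_in s_e e_nz)
lemma uminus_Hs: "d \<in> Hs ==> - d \<in> Hs" by (simp add: Hs_def D_uminus s_uminus)
lemma dinv_Hs: "d \<in> Hs ==> dinv d \<in> Hs" by (auto simp: Hs_def dinv s_dinv dinv_nz)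
lemma conj_Hs: assumes "d \<in> Hs" "x \<in> D" "x \<noteq> 0" shows "\<sigma> x * d * x \<in> Hs"
 using assms by (auto simp: Hs_def D_mult s_in s_mult s_invol mult.assoc dest: no_zero_div)
  (metis D_mult mult_nz s_in s_nz)
lemma comm_Hs: "a \<in> Hs ==> b \<in> Hs ==> a * b = b * a ==> a * b \<in> Hs"
 by (auto simp: Hs_def D_mult s_mult dest: no_zero_div)

definition hf :: "'i set \<Rightarrow> ('i \<Rightarrow> 'a) \<Rightarrow> ('i \<Rightarrow> 'a) \<Rightarrow> ('i \<Rightarrow> 'a) \<Rightarrow> 'a" where
 "hf I d u v = (\<Sum>i\<in>I. \<sigma> (u i) * d i * v i)"

text \<open>A totally isotropic subspace of at least half the dimension. Regularity of the form is a
  matter of the entries and is kept out of the definition.\<close>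

definition lagr :: "'i set \<Rightarrow> ('i \<Rightarrow> 'a) \<Rightarrow> ('i \<Rightarrow> 'a) set \<Rightarrow> bool" where
 "lagr I d U \<longleftrightarrow> finite I \<and> rsub U \<and> (\<forall>u\<in>U. \<forall>i. i \<notin> I \<longrightarrow> u i = 0) \<and> (\<forall>u\<in>U. \<forall>v\<in>U. hf I d u v = 0)
   \<and> (\<exists>n. card I = 2 * n \<and> dimge n U)"

text \<open>Fixing the index type \<open>nat\<close> makes this a property of the multiset alone;
  \<open>metabI\<close> lets constructions use sums and products of index sets.\<close>

definition metab :: "'a multiset \<Rightarrow> bool" where
 "metab M \<longleftrightarrow> (\<exists>(I::nat set) d U. M = image_mset d (mset_set I) \<and> lagr I d U)"

lemma lagrI:
 "finite I ==> rsub U ==> (\<And>u i. u \<in> U ==> i \<notin> I ==> u i = 0) ==>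
  (\<And>u v. u \<in> U ==> v \<in> U ==> hf I d u v = 0) ==> card I = 2 * n ==> dimge n U ==> lagr I d U"
 by (auto simp: lagr_def)

lemma metabI:
 fixes I :: "'i set"
 assumes "lagr I d U" shows "metab (image_mset d (mset_set I))"
proof -
 have fin: "finite I" and sub: "rsub U" and supp: "\<And>u i. u \<in> U ==> i \<notin> I ==> u i = 0"
  and iso: "\<And>u v. u \<in> U ==> v \<in> U ==> hf I d u v = 0"
  using assms by (auto simp: lagr_def)
 obtain n where n: "card I = 2 * n" "dimge n U" using assms by (auto simp: lagr_def)
 obtain h where h: "bij_betw h {..<card I} I"
  using ex_bij_betw_nat_finite[OF fin] by (auto simp: atLeast0LessThan)
 define J where "J = {..<card I}"
 have h: "bij_betw h J I" using h by (simp add: J_def)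
 define f where "f = (\<lambda>u k. if k \<in> J then u (h k) else (0::'a))"
 have rl: "rlin U (\<lambda>u. f u k)" for k
  using sub by (auto simp: rlin_def f_def rsub_def D_zero)
 have inj: "u i = 0" if "u \<in> U" "\<And>k. f u k = 0" for u i
 proof (cases "i \<in> I")
  case True
  then obtain k where "k \<in> J" "h k = i" using h by (auto simp: bij_betw_def)
  then show ?thesis using that(2)[of k] by (auto simp: f_def)
 qed (use that supp in auto)
 have "lagr J (d \<circ> h) (f ` U)"
 proof (rule lagrI)
  show "rsub (f ` U)"
   unfolding rsub_def
  proof (intro conjI ballI allI)
   show "(\<lambda>_. 0) \<in> f ` U" by (rule image_eqI[of _ _ "\<lambda>_. 0"]) (use rsubD[OF sub] in \<open>auto simp: f_def\<close>)
   fix u assume "u \<in> f ` U"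
   then obtain u' where u: "u = f u'" "u' \<in> U" by auto
   show "u k \<in> D" for k using rl[of k] u by (auto simp: rlin_def)
   show "(\<lambda>i. u i * x) \<in> f ` U" if "x \<in> D" for x
    by (rule image_eqI[of _ _ "\<lambda>i. u' i * x"]) (use u rsubD[OF sub] that in \<open>auto simp: f_def\<close>)
   fix v assume "v \<in> f ` U"
   then obtain v' where v: "v = f v'" "v' \<in> U" by auto
   show "(\<lambda>i. u i + v i) \<in> f ` U"
    by (rule image_eqI[of _ _ "\<lambda>i. u' i + v' i"]) (use u v rsubD[OF sub] in \<open>auto simp: f_def\<close>)
  qed
  show "dimge n (f ` U)" by (rule dimge_inj[where f = f, OF sub rl _ n(2)], rule inj)
  show "hf J (d \<circ> h) u v = 0" if uv: "u \<in> f ` U" "v \<in> f ` U" for u v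
  proof -
   obtain u' v' where *: "u = f u'" "u' \<in> U" "v = f v'" "v' \<in> U" using uv by auto
   have "hf J (d \<circ> h) u v = hf I d u' v'"
    unfolding hf_def
    by (subst sum.reindex_bij_betw[OF h, symmetric], rule sum.cong) (auto simp: * f_def)
   then show ?thesis using iso * by auto
  qed
 qed (use n J_def in \<open>auto simp: f_def\<close>)
 moreover have "image_mset (d \<circ> h) (mset_set J) = image_mset d (mset_set I)"
  using h by (metis bij_betw_def image_mset_mset_set multiset.map_comp)
 ultimately show ?thesis unfolding metab_def by metis
qed

lemma metab_empty: "metab {#}"
 using metabI[OF lagrI[of "{}::nat set" "{\<lambda>_. 0}" "\<lambda>_. 0" 0]]
 by (auto simp: rsub_def D_zero hf_def)

lemma metab_add: assumes "metab M" "metab N" shows "metab (M + N)"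
proof -
 obtain I d U where 1: "M = image_mset d (mset_set I)" "lagr (I::nat set) d U"
  using assms by (auto simp: metab_def)
 obtain J d' V where 2: "N = image_mset d' (mset_set J)" "lagr (J::nat set) d' V"
  using assms by (auto simp: metab_def)
 obtain n m where nm: "card I = 2 * n" "dimge n U" "card J = 2 * m" "dimge m V"
  using 1 2 by (auto simp: lagr_def)
 have fin: "finite I" "finite J" and sub: "rsub U" "rsub V" using 1 2 by (auto simp: lagr_def)
 have ms: "mset_set (I <+> J) = image_mset Inl (mset_set I) + image_mset Inr (mset_set J)"
  using fin unfolding Plus_def
  by (subst mset_set_Union) (auto simp: image_mset_mset_set)
 have "lagr (I <+> J) (case_sum d d') (dsum U V)"
 proof (rule lagrI)
  show "dimge (n + m) (dsum U V)" by (rule dimge_dsum) (use nm rsubD[OF sub(1)] rsubD[OF sub(2)] in auto)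
  show "rsub (dsum U V)"
   unfolding rsub_def
  proof (intro conjI ballI allI)
   show "(\<lambda>_. 0) \<in> dsum U V" unfolding dsum_def
    by (rule CollectI, rule exI[of _ "\<lambda>_. 0"], rule exI[of _ "\<lambda>_. 0"])
     (use rsubD[OF sub(1)] rsubD[OF sub(2)] in \<open>auto split: sum.splits\<close>)
   fix u assume "u \<in> dsum U V"
   then obtain u1 u2 where u: "u = case_sum u1 u2" "u1 \<in> U" "u2 \<in> V" by (auto simp: dsum_def)
   show "u k \<in> D" for k using u rsubD[OF sub(1)] rsubD[OF sub(2)] by (auto split: sum.splits)
   show "(\<lambda>i. u i * x) \<in> dsum U V" if "x \<in> D" for x
    unfolding dsum_def
    by (rule CollectI, rule exI[of _ "\<lambda>i. u1 i * x"], rule exI[of _ "\<lambda>i. u2 i * x"])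
     (use that u rsubD[OF sub(1)] rsubD[OF sub(2)] in \<open>auto split: sum.splits\<close>)
   fix v assume "v \<in> dsum U V"
   then obtain v1 v2 where v: "v = case_sum v1 v2" "v1 \<in> U" "v2 \<in> V" by (auto simp: dsum_def)
   show "(\<lambda>i. u i + v i) \<in> dsum U V"
    unfolding dsum_def
    by (rule CollectI, rule exI[of _ "\<lambda>i. u1 i + v1 i"], rule exI[of _ "\<lambda>i. u2 i + v2 i"])
     (use u v rsubD[OF sub(1)] rsubD[OF sub(2)] in \<open>auto split: sum.splits\<close>)
  qed
  show "hf (I <+> J) (case_sum d d') u v = 0" if uv: "u \<in> dsum U V" "v \<in> dsum U V" for u v
  proof -
   obtain u1 u2 v1 v2 where *: "u = case_sum u1 u2" "u1 \<in> U" "u2 \<in> V"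
    "v = case_sum v1 v2" "v1 \<in> U" "v2 \<in> V" using uv by (auto simp: dsum_def)
   have "hf (I <+> J) (case_sum d d') u v = hf I d u1 v1 + hf J d' u2 v2"
    unfolding hf_def * using fin by (simp add: sum.Plus)
   then show ?thesis using * 1 2 by (auto simp: lagr_def)
  qed
  show "u i = 0" if "u \<in> dsum U V" "i \<notin> I <+> J" for u i
   using that 1(2) 2(2) by (cases i) (auto simp: dsum_def lagr_def)
 qed (use fin nm in \<open>auto simp: card_Plus\<close>)
 from metabI[OF this] show ?thesis by (simp add: ms 1 2 image_mset_comp)
qed

lemma mset_set_remove2:
 assumes "finite I" "image_mset d (mset_set I) = M + {#c, c'#}"
 shows "\<exists>i\<in>I. \<exists>j\<in>I. i \<noteq> j \<and> d i = c \<and> d j = c' \<and> image_mset d (mset_set (I - {i, j})) = M"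
proof -
 have "c \<in># image_mset d (mset_set I)" using assms(2) by simp
 then obtain i where i: "i \<in> I" "d i = c" using assms(1) by auto
 have "mset_set I = add_mset i (mset_set (I - {i}))" using assms i by (metis mset_set.remove)
 then have M1: "image_mset d (mset_set (I - {i})) = M + {#c'#}" using assms(2) i by simp
 then have "c' \<in># image_mset d (mset_set (I - {i}))" by simp
 then obtain j where j: "j \<in> I - {i}" "d j = c'" using assms(1) by auto
 have "mset_set (I - {i}) = add_mset j (mset_set (I - {i} - {j}))"
  using assms j by (metis finite_Diff mset_set.remove)
 then have "image_mset d (mset_set (I - {i} - {j})) = M" using M1 j by simp
 moreover have "I - {i} - {j} = I - {i, j}" by auto
 ultimately have "image_mset d (mset_set (I - {i, j})) = M" by metis
 moreover have "i \<in> I" "j \<in> I" "i \<noteq> j" "d i = c" "d j = c'" using i j by auto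
 ultimately show ?thesis by blast
qed

text \<open>The vector \<open>l\<close> with entries \<open>e\<close> at \<open>i\<close> and
  \<open>j\<close> is isotropic, and \<open>u i = u j\<close> says that \<open>u\<close> is
  orthogonal to \<open>l\<close>. The new Lagrangian is the reduction of \<open>U\<close> along
  \<open>l\<close>: intersect with the orthogonal space of \<open>l\<close>, then forget the
  coordinates \<open>i\<close> and \<open>j\<close>.\<close>

lemma metab_cancel_pair:
 assumes "metab (M + {#c, - c#})" "c \<in> D" "c \<noteq> 0" shows "metab M"
proof -
 obtain I d U where 1: "M + {#c, - c#} = image_mset d (mset_set I)" "lagr (I::nat set) d U"
  using assms by (auto simp: metab_def)
 have fin: "finite I" and sub: "rsub U" and supp: "\<And>u i. u \<in> U ==> i \<notin> I ==> u i = 0"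
  and iso: "\<And>u v. u \<in> U ==> v \<in> U ==> hf I d u v = 0"
  using 1 by (auto simp: lagr_def)
 obtain i j where ij: "i \<in> I" "j \<in> I" "i \<noteq> j" "d i = c" "d j = - c"
  and M: "image_mset d (mset_set (I - {i, j})) = M"
  using mset_set_remove2[OF fin 1(1)[symmetric]] by auto
 obtain n where n: "card I = 2 * n" "dimge n U" using 1 by (auto simp: lagr_def)
 have "card {i, j} \<le> card I" by (rule card_mono) (use fin ij in auto)
 then have n0: "n \<noteq> 0" using n ij by auto
 then obtain m where m: "n = Suc m" by (cases n) auto
 define I' where "I' = I - {i, j}"
 have cI': "card I' = 2 * m" using n m ij fin by (simp add: I'_def card_Diff_subset)
 have split: "hf I d u v = hf I' d u v + (\<sigma> (u i) * c * v i - \<sigma> (u j) * c * v j)" for u v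
 proof -
  have "I = insert i (insert j I')" "i \<notin> insert j I'" "j \<notin> I'" "finite I'"
   using ij fin by (auto simp: I'_def)
  then show ?thesis unfolding hf_def using ij by (simp add: algebra_simps)
 qed
 have l1: "rlin U (\<lambda>u. u i - u j)" using sub by (auto simp: rlin_def rsub_def D_diff algebra_simps)
 have l2: "rlin U (\<lambda>u. u i)" by (rule rlin_coord[OF sub])
 \<comment> \<open>If all of \<open>U\<close> is orthogonal to \<open>l\<close>, that condition cuts
   nothing off and \<open>l\<close> may lie in \<open>U\<close>; then \<open>u i = 0\<close> is
   imposed so that the projection stays injective.\<close>
 define V where "V = (if \<exists>u\<in>U. u i \<noteq> u j then {u\<in>U. u i - u j = 0} else {u\<in>U. u i = 0})"
 have V: "rsub V" "dimge m V"
  using rsub_ker[OF sub l1] rsub_ker[OF sub l2] dimge_ker[OF sub l1] dimge_ker[OF sub l2] n m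
  by (auto simp: V_def)
 have Vij: "u \<in> V ==> u i = u j" and VU: "V \<subseteq> U" for u by (auto simp: V_def split: if_splits)
 \<comment> \<open>A vector of \<open>V\<close> supported on \<open>i\<close> and \<open>j\<close>
   is a multiple of \<open>l\<close>; pairing it with a vector of \<open>U\<close> that is not
   orthogonal to \<open>l\<close> shows that the multiple is zero.\<close>
 have Vinj: "u k = 0" if u: "u \<in> V" "\<And>k. k \<in> I' ==> u k = 0" for u k
 proof -
  have "u i = 0"
  proof (cases "\<exists>w\<in>U. w i \<noteq> w j")
   case True
   then obtain w where w: "w \<in> U" "w i \<noteq> w j" by auto
   have "hf I' d u w = 0" unfolding hf_def by (rule sum.neutral) (use u s_zero in auto)
   then have "\<sigma> (u i) * c * w i - \<sigma> (u i) * c * w j = 0"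
    using split[of u w] iso[of u w] u VU w Vij[OF u(1)] by auto
   then have z: "\<sigma> (u i) * (c * (w i - w j)) = 0" by (simp add: algebra_simps mult.assoc)
   have uD: "u i \<in> D" "w i \<in> D" "w j \<in> D" using rsubD[OF sub] u VU w by auto
   have "c * (w i - w j) \<noteq> 0" using mult_nz[of c "w i - w j"] assms w uD D_diff by auto
   then have "\<sigma> (u i) = 0" using z no_zero_div[of "\<sigma> (u i)" "c * (w i - w j)"] uD assms s_in D_diff D_mult by blast
   then show ?thesis using s_nz uD by blast
  next
   case False
   then show ?thesis using u by (auto simp: V_def)
  qed
  then show ?thesis using u Vij[OF u(1)] supp[of u k] VU by (cases "k \<in> I") (auto simp: I'_def)
 qed
 define f where "f = (\<lambda>u k. if k \<in> I' then u k else (0::'a))"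
 have rl: "rlin V (\<lambda>u. f u k)" for k
  using V(1) by (auto simp: rlin_def f_def rsub_def D_zero)
 have "lagr I' d (f ` V)"
 proof (rule lagrI)
  show "rsub (f ` V)"
   unfolding rsub_def
  proof (intro conjI ballI allI)
   show "(\<lambda>_. 0) \<in> f ` V" by (rule image_eqI[of _ _ "\<lambda>_. 0"]) (use rsubD[OF V(1)] in \<open>auto simp: f_def\<close>)
   fix u assume "u \<in> f ` V"
   then obtain u' where u: "u = f u'" "u' \<in> V" by auto
   show "u k \<in> D" for k using rl[of k] u by (auto simp: rlin_def)
   show "(\<lambda>i. u i * x) \<in> f ` V" if "x \<in> D" for x
    by (rule image_eqI[of _ _ "\<lambda>i. u' i * x"]) (use u rsubD[OF V(1)] that in \<open>auto simp: f_def\<close>)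
   fix v assume "v \<in> f ` V"
   then obtain v' where v: "v = f v'" "v' \<in> V" by auto
   show "(\<lambda>i. u i + v i) \<in> f ` V"
    by (rule image_eqI[of _ _ "\<lambda>i. u' i + v' i"]) (use u v rsubD[OF V(1)] in \<open>auto simp: f_def\<close>)
  qed
  show "dimge m (f ` V)"
  proof (rule dimge_inj[where f = f, OF V(1) rl _ V(2)])
   fix u k assume u: "u \<in> V" "\<And>k. f u k = 0"
   have "u k = 0" if "k \<in> I'" for k using u(2)[of k] that by (simp add: f_def)
   from Vinj[OF u(1) this] show "u k = 0" .
  qed
  show "hf I' d u v = 0" if uv: "u \<in> f ` V" "v \<in> f ` V" for u v
  proof -
   obtain u' v' where *: "u = f u'" "u' \<in> V" "v = f v'" "v' \<in> V" using uv by auto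
   have "hf I' d u v = hf I' d u' v'"
    unfolding hf_def by (rule sum.cong) (auto simp: * f_def)
   also have "\<dots> = 0" using split[of u' v'] iso[of u' v'] VU * Vij[of u'] Vij[of v']
    by (auto simp: subset_iff)
   finally show ?thesis .
  qed
 qed (use cI' fin in \<open>auto simp: I'_def f_def\<close>)
 from metabI[OF this] show ?thesis using M by (simp add: I'_def)
qed

lemma metab_scale:
 assumes "metab M" "f \<in> D" "\<And>x. x \<in> D ==> f * x = x * f" "M inside D"
 shows "metab (scl f M)"
proof -
 obtain I d U where 1: "M = image_mset d (mset_set I)" "lagr (I::nat set) d U"
  using assms by (auto simp: metab_def)
 have fin: "finite I" using 1 by (auto simp: lagr_def)
 have dD: "d i \<in> D" if "i \<in> I" for i using assms(4) that fin by (auto simp: 1)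
 have "hf I (\<lambda>i. f * d i) u v = f * hf I d u v" if "u \<in> U" "v \<in> U" for u v
  unfolding hf_def sum_distrib_left
 proof (rule sum.cong)
  fix i assume "i \<in> I"
  have "\<sigma> (u i) \<in> D" using 1(2) that s_in by (auto simp: lagr_def rsub_def)
  then have "\<sigma> (u i) * f = f * \<sigma> (u i)" using assms(3) by metis
  then show "\<sigma> (u i) * (f * d i) * v i = f * (\<sigma> (u i) * d i * v i)" by (metis mult.assoc)
 qed auto
 then have "lagr I (\<lambda>i. f * d i) U" using 1(2) by (auto simp: lagr_def)
 from metabI[OF this] show ?thesis by (simp add: 1 image_mset_comp)
qed

lemma metab_neg: assumes "metab M" "M inside D" shows "metab (neg M)"
proof -
 have "metab (scl (- e) M)"
  by (rule metab_scale) (use assms in \<open>auto simp: D_uminus e_in e_left e_right\<close>)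
 also have "scl (- e) M = neg M"
  by (rule image_mset_cong) (use assms e_left in auto)
 finally show ?thesis .
qed

lemma metab_tens:
 assumes "metab M" "M inside D" "\<And>f x. f \<in># K ==> x \<in> D ==> f * x = x * f" "K inside D"
 shows "metab (tens K M)"
 using assms(3,4) by (induction K) (auto simp: metab_empty intro!: metab_add metab_scale[OF assms(1)] assms(2))

lemma metab_cancel_neg:
 assumes "metab (M + (N + neg N))" "N inside D - {0}" shows "metab M"
 using assms
proof (induction N)
 case (add c N)
 have "(M + (N + neg N)) + {#c, - c#} = M + (add_mset c N + neg (add_mset c N))"
  by (simp add: add_mset_commute)
 then have "metab ((M + (N + neg N)) + {#c, - c#})" using add.prems(1) by metis
 then have "metab (M + (N + neg N))"
  by (rule metab_cancel_pair[where c = c and M = "M + (N + neg N)"]) (use add.prems in auto)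
 then show ?case using add by auto
qed auto

lemma metab_cancel:
 assumes "metab (M + N)" "metab N" "N inside D - {0}" shows "metab M"
proof -
 have "metab (M + N + neg N)" using metab_add[OF assms(1) metab_neg[OF assms(2)]] assms(3) by auto
 then have "metab (M + (N + neg N))" by (simp add: ac_simps)
 then show ?thesis by (rule metab_cancel_neg) (use assms in auto)
qed

text \<open>Equality of classes in the Witt group, stated without forming the group.\<close>

definition witt :: "'a multiset \<Rightarrow> 'a multiset \<Rightarrow> bool" where
 "witt M N \<longleftrightarrow> metab (M + neg N)"

text \<open>The graph of the matrix \<open>Xm\<close> is isotropic for the difference of the two
  forms and projects onto the whole second block; as both blocks have the same size, it is a
  Lagrangian.\<close>

lemma witt_iso:
 fixes I :: "'i set" and J :: "'j set"
 assumes fin: "finite I" "finite J" and card: "card I = card J"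
  and Xm: "\<And>i j. i \<in> I ==> j \<in> J ==> Xm i j \<in> D" and dD: "\<And>i. i \<in> I ==> d i \<in> D"
  and iso: "\<And>j k. j \<in> J ==> k \<in> J ==> (\<Sum>i\<in>I. \<sigma> (Xm i j) * d i * Xm i k) = (if j = k then d' j else 0)"
 shows "witt (image_mset d (mset_set I)) (image_mset d' (mset_set J))"
proof -
 define g where "g = (\<lambda>y. case_sum (\<lambda>i. if i \<in> I then \<Sum>j\<in>J. Xm i j * y j else 0) y)"
 define U where "U = g ` full J"
 have gD: "g y k \<in> D" if "y \<in> full J" for y k
  using that Xm by (auto simp: g_def full_def D_zero intro!: D_sum D_mult split: sum.splits)
 have fullD: "y \<in> full J ==> y j \<in> D" for y :: "'j \<Rightarrow> 'a" and j by (auto simp: full_def)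
 have sub: "rsub U"
  unfolding rsub_def
 proof (intro conjI ballI allI)
  show "(\<lambda>_. 0) \<in> U" unfolding U_def
   by (rule image_eqI[of _ _ "\<lambda>_. 0"]) (auto simp: g_def full_def D_zero split: sum.splits)
  fix u assume "u \<in> U"
  then obtain y where y: "u = g y" "y \<in> full J" by (auto simp: U_def)
  show "u k \<in> D" for k using gD y by auto
  show "(\<lambda>i. u i * x) \<in> U" if "x \<in> D" for x unfolding U_def
   by (rule image_eqI[of _ _ "\<lambda>i. y i * x"])
    (use y that in \<open>auto simp: g_def full_def D_mult sum_distrib_right mult.assoc split: sum.splits\<close>)
  fix v assume "v \<in> U"
  then obtain z where z: "v = g z" "z \<in> full J" by (auto simp: U_def)
  show "(\<lambda>i. u i + v i) \<in> U" unfolding U_def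
   by (rule image_eqI[of _ _ "\<lambda>i. y i + z i"])
    (use y z in \<open>auto simp: g_def full_def D_add sum.distrib distrib_left split: sum.splits\<close>)
 qed
 have iso': "hf (I <+> J) (case_sum d (\<lambda>j. - d' j)) (g y) (g z) = 0" if "y \<in> full J" "z \<in> full J" for y z
 proof -
  have "(\<Sum>i\<in>I. \<sigma> (\<Sum>j\<in>J. Xm i j * y j) * d i * (\<Sum>k\<in>J. Xm i k * z k))
    = (\<Sum>i\<in>I. \<Sum>j\<in>J. \<Sum>k\<in>J. \<sigma> (y j) * (\<sigma> (Xm i j) * d i * Xm i k) * z k)"
  proof (rule sum.cong[OF refl])
   fix i assume i: "i \<in> I"
   have "\<sigma> (\<Sum>j\<in>J. Xm i j * y j) = (\<Sum>j\<in>J. \<sigma> (y j) * \<sigma> (Xm i j))"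
    using that i by (subst s_sum) (auto simp: D_mult Xm fullD s_mult intro!: sum.cong)
   then show "\<sigma> (\<Sum>j\<in>J. Xm i j * y j) * d i * (\<Sum>k\<in>J. Xm i k * z k)
     = (\<Sum>j\<in>J. \<Sum>k\<in>J. \<sigma> (y j) * (\<sigma> (Xm i j) * d i * Xm i k) * z k)"
    by (simp add: sum_distrib_left sum_distrib_right mult.assoc)
     (rule sum.swap[THEN trans], simp)
  qed
  also have "\<dots> = (\<Sum>j\<in>J. \<Sum>k\<in>J. \<Sum>i\<in>I. \<sigma> (y j) * (\<sigma> (Xm i j) * d i * Xm i k) * z k)"
   by (subst sum.swap, rule sum.cong[OF refl], subst sum.swap, rule refl)
  also have "\<dots> = (\<Sum>j\<in>J. \<Sum>k\<in>J. \<sigma> (y j) * (if j = k then d' j else 0) * z k)"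
   by (intro sum.cong refl) (simp add: iso[symmetric] sum_distrib_left sum_distrib_right)
  also have "\<dots> = (\<Sum>j\<in>J. \<Sum>k\<in>J. if j = k then \<sigma> (y j) * d' j * z j else 0)"
   by (intro sum.cong refl) auto
  also have "\<dots> = (\<Sum>j\<in>J. \<sigma> (y j) * d' j * z j)" using fin by simp
  finally show ?thesis unfolding hf_def using fin
   by (simp add: sum.Plus g_def sum_negf cong: sum.cong)
 qed
 have "dimge (card (Inr ` J :: ('i + 'j) set)) U"
 proof (rule dimge_proj0)
  show "finite (Inr ` J :: ('i + 'j) set)" using fin by simp
  fix x :: "'i + 'j \<Rightarrow> 'a" assume x: "\<And>j. j \<in> Inr ` J ==> x j \<in> D"
  define y where "y = (\<lambda>j. if j \<in> J then x (Inr j) else 0)"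
  have "y \<in> full J" using x by (auto simp: y_def full_def D_zero)
  then show "\<exists>u\<in>U. \<forall>j\<in>Inr ` J. u j = x j" unfolding U_def
   by (intro bexI[of _ "g y"]) (auto simp: g_def y_def)
 qed
 moreover have "card (Inr ` J :: ('i + 'j) set) = card J" by (rule card_image) auto
 ultimately have dim: "dimge (card J) U" by metis
 have ms: "mset_set (I <+> J) = image_mset Inl (mset_set I) + image_mset Inr (mset_set J)"
  using fin unfolding Plus_def
  by (subst mset_set_Union) (auto simp: image_mset_mset_set)
 have "lagr (I <+> J) (case_sum d (\<lambda>j. - d' j)) U"
  by (rule lagrI[OF _ sub _ _ _ dim])
   (use fin card iso' in \<open>auto simp: U_def card_Plus g_def full_def split: sum.splits\<close>)
 from metabI[OF this] show ?thesis
  by (simp add: ms witt_def image_mset_comp)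
qed

end

section \<open>Witt equivalence and torsion of diagonal forms\<close>

context divinv
begin

lemma dinv_uminus: "x \<in> D ==> x \<noteq> 0 ==> dinv (- x) = - dinv x"
 by (rule dinv_unique[symmetric]) (use dinv D_uminus in auto)

lemma witt_refl: "M inside D ==> witt M M"
proof (induction M)
 case (add d M)
 have "lagr (UNIV::bool set) (\<lambda>b. if b then d else - d) {\<lambda>_. x | x. x \<in> D}"
 proof (rule lagrI[where n = 1])
  show "rsub {\<lambda>_::bool. x | x. x \<in> D}"
   by (auto simp: rsub_def D_zero fun_eq_iff intro: D_add D_mult)
  have "dimge (card {True}) {\<lambda>_::bool. x | x. x \<in> D}" by (rule dimge_proj0) auto
  then show "dimge 1 {\<lambda>_::bool. x | x. x \<in> D}" by simp
 qed (auto simp: hf_def UNIV_bool)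
 from metabI[OF this] have "metab {#d, - d#}"
  by (simp add: UNIV_bool add_mset_commute)
 from metab_add[OF this, of "M + neg M"] add show ?case by (auto simp: witt_def add_mset_commute)
qed (auto simp: witt_def metab_empty)

lemma witt_sym: assumes "witt M N" "M inside D" "N inside D" shows "witt N M"
proof -
 have "metab (neg (M + neg N))" by (rule metab_neg) (use assms D_uminus in \<open>auto simp: witt_def\<close>)
 then show ?thesis by (simp add: witt_def ac_simps)
qed

lemma witt_trans:
 assumes "witt L M" "witt M N" "M inside D - {0}" shows "witt L N"
proof -
 have "metab ((L + neg M) + (M + neg N))" using metab_add assms by (auto simp: witt_def)
 then have "metab ((L + neg N) + (M + neg M))" by (simp add: ac_simps)
 then show ?thesis unfolding witt_def by (rule metab_cancel_neg) (use assms in auto)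
qed

lemma witt_add: "witt M N ==> witt M' N' ==> witt (M + M') (N + N')"
 unfolding witt_def using metab_add[of "M + neg N" "M' + neg N'"] by (simp add: ac_simps)

lemma witt_image:
 assumes "\<And>m. m \<in># M ==> witt {#f m#} {#g m#}" shows "witt (image_mset f M) (image_mset g M)"
 using assms
proof (induction M)
 case (add m M)
 then show ?case using witt_add[of "{#f m#}" "{#g m#}"] by auto
qed (auto simp: witt_def metab_empty)

lemma witt_conj: assumes "d \<in> D" "x \<in> D" shows "witt {#d#} {#\<sigma> x * d * x#}"
 using witt_iso[of "{0::nat}" "{0::nat}" "\<lambda>_ _. x" "\<lambda>_. d" "\<lambda>_. \<sigma> x * d * x"] assms by auto

lemma witt_conj_comm:
 assumes "d \<in> D" "x \<in> D" "\<sigma> x = x" "d * x = x * d" shows "witt {#d * (x * x)#} {#d#}"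
proof -
 have "\<sigma> x * d * x = d * (x * x)" using assms by (metis mult.assoc)
 then show ?thesis using witt_conj[OF assms(1,2)] witt_sym assms D_mult by auto
qed

text \<open>The noncommutative version of the relation between \<langle>a, b\<rangle> and \<langle>a
  + b, a b / (a + b)\<rangle>: the first column of \<open>Xm\<close> represents
  \<open>d + d'\<close>, the second spans its orthogonal complement.\<close>

lemma witt_binary:
 assumes d: "d \<in> Hs" "d' \<in> Hs" "d + d' \<noteq> 0"
 shows "witt {#d, d'#} {#d + d', d * dinv (d + d') * d'#}"
  "d + d' \<in> Hs" "d * dinv (d + d') * d' \<in> Hs"
proof -
 define s where "s = d + d'"
 define r where "r = dinv s"
 have s: "s \<in> Hs" using d by (auto simp: s_def Hs_def D_add s_add)
 then show "d + d' \<in> Hs" by (simp add: s_def)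
 have r: "r \<in> Hs" unfolding r_def by (rule dinv_Hs[OF s])
 note in' = HsD(1)[OF d(1)] HsD(1)[OF d(2)] HsD(1)[OF s] HsD(1)[OF r]
 have sr: "s * r = e" "r * s = e" using dinv[of s] HsD[OF s] by (auto simp: r_def)
 \<comment> \<open>Both sides equal \<open>d - d * r * d\<close>; hence the second entry is
   symmetric.\<close>
 have z1: "d' * r * d = d * r * d'"
 proof -
  have d': "d' = s - d" by (simp add: s_def)
  have "d' * r * d = (s * r) * d - d * r * d" by (simp add: d' algebra_simps)
  moreover have "d * r * d' = d * (r * s) - d * r * d" by (simp add: d' algebra_simps)
  ultimately show ?thesis using sr e_left e_right in' by simp
 qed
 define z where "z = d * r * d'"
 have zH: "z \<in> Hs" unfolding Hs_def z_def
  using d r in' z1 mult_nz by (auto simp: D_mult s_mult HsD mult.assoc)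
 then show "d * dinv (d + d') * d' \<in> Hs" by (simp add: z_def r_def s_def)
 define Xm where "Xm = (\<lambda>(i::nat) (j::nat). if j = 0 then e else if i = 0 then r * d' else - (r * d))"
 have srd: "\<sigma> (r * d') = d' * r" "\<sigma> (r * d) = d * r" "\<sigma> (- (r * d)) = - (d * r)"
  using d r in' by (auto simp: s_mult HsD s_uminus D_mult)
 have zz: "d' * r * d * (r * d') + d * r * d' * (r * d) = z"
 proof -
  have "d' * r * d * (r * d') + d * r * d' * (r * d) = d' * r * z + d * r * (d' * r * d)"
   by (simp add: z_def mult.assoc)
  also have "\<dots> = s * r * z" unfolding z1 z_def s_def by (simp add: algebra_simps)
  also have "\<dots> = z" using sr zH e_left HsD by simp
  finally show ?thesis .
 qed
 have "witt (image_mset (\<lambda>i. if i = 0 then d else d') (mset_set {0, 1::nat}))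
   (image_mset (\<lambda>i. if i = 0 then s else z) (mset_set {0, 1::nat}))"
 proof (rule witt_iso[where Xm = Xm])
  show "Xm i j \<in> D" for i j using in' e_in by (auto simp: Xm_def D_mult D_uminus)
  show "(\<Sum>i\<in>{0, 1}. \<sigma> (Xm i j) * (if i = 0 then d else d') * Xm i k) =
    (if j = k then if j = 0 then s else z else 0)" if "j \<in> {0,1}" "k \<in> {0,1}" for j k
   using that srd in' zz z1
   by (auto simp: Xm_def s_e e_left e_right s_def D_mult mult.assoc[symmetric])
 qed (use in' in auto)
 then show "witt {#d, d'#} {#d + d', d * dinv (d + d') * d'#}"
  by (simp add: s_def z_def r_def)
qed

text \<open>The multiplier is any nonempty form with entries in \<open>S\<close>. For
  \<open>S = P - {0}\<close> this makes a scalar of \<open>P\<close> as good as a square and lets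
  positive integers be cancelled.\<close>

definition torsion :: "'a set \<Rightarrow> 'a multiset \<Rightarrow> bool" where
 "torsion S M \<longleftrightarrow> (\<exists>K. K \<noteq> {#} \<and> K inside S \<and> metab (tens K M))"

end

section \<open>Orderings of the base field and the local-global principle\<close>

definition fordering :: "'a::ring set \<Rightarrow> 'a set \<Rightarrow> bool" where
 "fordering F P \<longleftrightarrow> (\<forall>x\<in>P. \<forall>y\<in>P. x + y \<in> P) \<and> (\<forall>x\<in>P. \<forall>y\<in>P. x * y \<in> P) \<and>
   P \<union> uminus ` P = F \<and> P \<inter> uminus ` P = {0}"

text \<open>The pair of \<open>D\<close> and \<open>F\<close> is kept general so that
  \<open>F\<close> over itself and \<open>L\<close> over itself are instances; there the theory is
  that of quadratic forms over a commutative field.\<close>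

locale divinv_base = divinv +
 fixes F :: "'a::ring set"
 assumes F_sub: "F \<subseteq> D" and F_e: "e \<in> F" and F_add: "x \<in> F ==> y \<in> F ==> x + y \<in> F"
  and F_uminus: "x \<in> F ==> - x \<in> F" and F_mult: "x \<in> F ==> y \<in> F ==> x * y \<in> F"
  and F_dinv: "x \<in> F ==> x \<noteq> 0 ==> dinv x \<in> F"
  and F_central: "x \<in> F ==> y \<in> D ==> x * y = y * x"
  and F_sym: "x \<in> F ==> \<sigma> x = x"
begin

lemma F_D: "x \<in> F ==> x \<in> D" using F_sub by auto
lemma F_zero: "0 \<in> F" using F_add[OF F_e F_uminus[OF F_e]] by simp
lemma F_Hs: "x \<in> F ==> x \<noteq> 0 ==> x \<in> Hs" by (simp add: Hs_def F_D F_sym)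
lemma F_mult_Hs: "x \<in> F ==> x \<noteq> 0 ==> d \<in> Hs ==> x * d \<in> Hs"
 by (rule comm_Hs) (auto simp: F_Hs F_central HsD)
lemma F_mult_nz: "x \<in> F ==> y \<in> F ==> x \<noteq> 0 ==> y \<noteq> 0 ==> x * y \<noteq> 0"
 using mult_nz F_D by auto

lemma tens_Hs: "K inside F - {0} ==> M inside Hs ==> (tens K M) inside Hs"
 by (auto simp: set_tens intro!: F_mult_Hs)
lemma tens_HsI: "K inside F - {0} ==> M inside Hs ==> x \<in># tens K M ==> x \<in> Hs"
 using tens_Hs by blast

lemma Hs_sub: "M inside Hs ==> M inside D" "M inside Hs ==> M inside D - {0}"
 by (auto simp: Hs_def)

lemma metab_tensF: "metab M ==> M inside Hs ==> K inside F ==> metab (tens K M)"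
 by (rule metab_tens) (use F_central F_D in \<open>auto simp: Hs_def\<close>)

lemma tens_swap: "K inside F ==> K' inside F ==> tens K (tens K' M) = tens K' (tens K M)"
 by (rule tens_comm_out) (use F_central F_D in blast)

lemma neg_Hs: "M inside Hs ==> (neg M) inside Hs" using uminus_Hs by auto

lemma witt_tens:
 assumes "witt M N" "M inside Hs" "N inside Hs" "K inside F"
 shows "witt (tens K M) (tens K N)"
 using metab_tensF[of "M + neg N" K] assms neg_Hs[of N] by (auto simp: witt_def tens_neg_right)

definition mclosed :: "'a set \<Rightarrow> bool" where
 "mclosed S \<longleftrightarrow> S \<subseteq> F - {0} \<and> e \<in> S \<and> (\<forall>x\<in>S. \<forall>y\<in>S. x * y \<in> S)"

lemma mclosed_tens: "mclosed S ==> K inside S ==> K' inside S ==> (tens K K') inside S"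
 by (auto simp: mclosed_def set_tens) (meson subsetD)

lemma tens_nonempty: "K \<noteq> {#} ==> M \<noteq> {#} ==> tens K M \<noteq> {#}"
 by (metis size_tens mult_is_0 size_eq_0_iff_empty)

lemma torsion_metab: "mclosed S ==> metab M ==> M inside Hs ==> torsion S M"
 unfolding torsion_def
 by (rule exI[of _ "{#e#}"])
  (auto simp: mclosed_def F_e F_sub intro!: metab_scale F_central F_D[OF F_e] dest: Hs_sub(1))

lemma torsion_add:
 assumes S: "mclosed S" and t: "torsion S M" "torsion S N" and H: "M inside Hs" "N inside Hs"
 shows "torsion S (M + N)"
proof -
 obtain K K' where K: "K \<noteq> {#}" "K inside S" "metab (tens K M)" "K' \<noteq> {#}" "K' inside S" "metab (tens K' N)"
  using t by (auto simp: torsion_def)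
 have SF: "S \<subseteq> F - {0}" using S by (simp add: mclosed_def)
 have KF: "K inside F - {0}" "K' inside F - {0}" using K SF by auto
 have "metab (tens K' (tens K M))" "metab (tens K (tens K' N))"
  using K KF H by (auto intro!: metab_tensF intro: tens_HsI)
 moreover have "tens K' (tens K M) = tens K (tens K' M)" by (rule tens_swap) (use KF in auto)
 ultimately have "metab (tens (tens K K') (M + N))"
  using metab_add by (simp add: tens_tens)
 then show ?thesis unfolding torsion_def
  using K tens_nonempty mclosed_tens[OF S] by metis
qed

lemma torsion_neg:
 assumes "mclosed S" "torsion S M" "M inside Hs" shows "torsion S (neg M)"
proof -
 obtain K where K: "K \<noteq> {#}" "K inside S" "metab (tens K M)"
  using assms by (auto simp: torsion_def)
 have "metab (neg (tens K M))" by (rule metab_neg[OF K(3)], rule Hs_sub(1), rule tens_Hs)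
   (use K assms in \<open>auto simp: mclosed_def\<close>)
 then show ?thesis using K by (auto simp: torsion_def tens_neg_right)
qed

lemma torsion_cancel:
 assumes S: "mclosed S" and t: "torsion S (M + N)" "torsion S N" and H: "M inside Hs" "N inside Hs"
 shows "torsion S M"
proof -
 obtain K K' where K: "K \<noteq> {#}" "K inside S" "metab (tens K (M + N))" "K' \<noteq> {#}" "K' inside S" "metab (tens K' N)"
  using t by (auto simp: torsion_def)
 have SF: "S \<subseteq> F - {0}" using S by (simp add: mclosed_def)
 have KF: "K inside F - {0}" "K' inside F - {0}" using K SF by auto
 have HMN: "(M + N) inside Hs" using H by auto
 have *: "metab (tens K' (tens K (M + N)))" "metab (tens K (tens K' N))"
  using metab_tensF[OF K(3) tens_Hs[OF KF(1) HMN]] metab_tensF[OF K(6) tens_Hs[OF KF(2) H(2)]] KF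
  by blast+
 have "tens K' (tens K (M + N)) = tens K (tens K' (M + N))" by (rule tens_swap) (use KF in auto)
 then have "metab (tens K (tens K' M) + tens K (tens K' N))" using *(1) by simp
 then have "metab (tens (tens K K') M)" unfolding tens_tens
  by (rule metab_cancel[OF _ *(2)]) (intro Hs_sub(2) tens_Hs KF H)
 then show ?thesis unfolding torsion_def
  using tens_nonempty[OF K(1,4)] mclosed_tens[OF S K(2,5)] by blast
qed

text \<open>Once all squares are present, \<open>S\<close> together with the multiples
  \<open>f * s\<close> is closed under products, because \<open>f * f\<close> falls back into
  \<open>S\<close>.\<close>

definition squares :: "'a set \<Rightarrow> 'a set" where
 "squares S = {s * (x * x) | s x. s \<in> S \<and> x \<in> F - {0}}"

lemma mclosed_squares:
 assumes "mclosed S"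
 shows "mclosed (squares S)" "S \<subseteq> squares S" "x \<in> F ==> x \<noteq> 0 ==> x * x \<in> squares S"
proof -
 have S: "\<And>s. s \<in> S ==> s \<in> F" "\<And>s. s \<in> S ==> s \<noteq> 0" "e \<in> S" "\<And>x y. x \<in> S ==> y \<in> S ==> x * y \<in> S"
  using assms by (auto simp: mclosed_def)
 show "x * x \<in> squares S" if "x \<in> F" "x \<noteq> 0" for x
  unfolding squares_def using S that F_mult e_left F_D
  by (intro CollectI exI[of _ e] exI[of _ x]) auto
 show sub: "S \<subseteq> squares S"
 proof
  fix s assume "s \<in> S"
  then show "s \<in> squares S" unfolding squares_def using S e_right F_D F_e e_nz
   by (intro CollectI exI[of _ s] exI[of _ e]) auto
 qed
 show "mclosed (squares S)"
  unfolding mclosed_def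
 proof (intro conjI ballI subsetI)
  fix k assume "k \<in> squares S"
  then obtain s x where k: "k = s * (x * x)" "s \<in> S" "x \<in> F" "x \<noteq> 0" by (auto simp: squares_def)
  then show "k \<in> F - {0}" using F_mult F_mult_nz S by simp
  fix l assume "l \<in> squares S"
  then obtain t y where l: "l = t * (y * y)" "t \<in> S" "y \<in> F" "y \<noteq> 0" by (auto simp: squares_def)
  have c: "a * b = b * a" if "a \<in> F" "b \<in> F" for a b using F_central[OF that(1) F_D[OF that(2)]] .
  have "(x * x) * (t * (y * y)) = t * ((x * y) * (x * y))"
   using c[of x t] c[of x y] c[of "x * x" t] c[of x "y * x"] k l S F_mult by (metis mult.assoc)
  then have "k * l = (s * t) * ((x * y) * (x * y))" using k l by (simp add: mult.assoc)
  then show "k * l \<in> squares S" unfolding squares_def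
   by (intro CollectI exI[of _ "s * t"] exI[of _ "x * y"] conjI) (use k l S F_mult F_mult_nz in auto)
 qed (use sub S in auto)
qed

lemma split_extension:
 assumes "K inside S \<union> (*) f ` S"
 shows "\<exists>K0 K1. K0 inside S \<and> K1 inside S \<and> K = K0 + scl f K1"
 using assms
proof (induction K)
 case (add k K)
 then obtain K0 K1 where K: "K0 inside S" "K1 inside S" "K = K0 + scl f K1" by auto
 show ?case
 proof (cases "k \<in> S")
  case True
  then show ?thesis using K by (intro exI[of _ "add_mset k K0"] exI[of _ K1]) auto
 next
  case False
  then obtain s where "s \<in> S" "k = f * s" using add.prems by auto
  then show ?thesis using K by (intro exI[of _ K0] exI[of _ "add_mset s K1"]) auto
 qed
qed auto

text \<open>
 A maximal multiplicative set \<open>S \<supseteq> S0\<close> over which \<open>N\<close> never holds is the set of nonzero elements of an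
 ordering: from \<open>N (K0 + f K1)\<close> and \<open>N (L0 - f L1)\<close> one gets \<open>N (L1 K0 + K1 L0)\<close>.
\<close>

lemma ordering_avoiding:
 fixes N :: "'a multiset \<Rightarrow> bool"
 assumes S0: "mclosed S0" and nt: "\<And>K. K \<noteq> {#} ==> K inside S0 ==> \<not> N K"
  and N_add: "\<And>K K'. N K ==> N K' ==> N (K + K')"
  and N_cancel: "\<And>K x. K inside F - {0} ==> x \<in> F ==> x \<noteq> 0 ==> N (K + {#x, - x#}) ==> N K"
  and N_pair: "\<And>x. x \<in> F ==> x \<noteq> 0 ==> N {#x, - x#}"
  and N_scale: "\<And>K x. K inside F - {0} ==> x \<in> F ==> x \<noteq> 0 ==> N K ==> N (scl x K)"
  and N_sq: "\<And>x z. x \<in> F ==> x \<noteq> 0 ==> z \<in> F ==> z \<noteq> 0 ==> N {#x * (z * z), - x#}"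
  and N_binary: "\<And>x y. x \<in> F ==> x \<noteq> 0 ==> y \<in> F ==> y \<noteq> 0 ==> x + y \<noteq> 0 ==>
    N {#x, y, - (x + y), - (x * dinv (x + y) * y)#}"
 shows "\<exists>P. fordering F P \<and> S0 \<subseteq> P \<and> (\<forall>K. K \<noteq> {#} \<longrightarrow> K inside P - {0} \<longrightarrow> \<not> N K)"
proof -
 define bad where "bad = (\<lambda>S. \<exists>K. K \<noteq> {#} \<and> K inside S \<and> N K)"
 define A where "A = {S. mclosed S \<and> squares S0 \<subseteq> S \<and> \<not> bad S}"
 have c: "a * b = b * a" if "a \<in> F" "b \<in> F" for a b using F_central[OF that(1) F_D[OF that(2)]] .
 have S0F: "S0 \<subseteq> F - {0}" using S0 by (simp add: mclosed_def)
 have m1: "scl (- e) K = neg K" if "K inside F - {0}" for K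
  by (rule image_mset_cong) (use that e_left F_D in auto)
 have N_neg: "N (neg K)" if "N K" "K inside F - {0}" for K
  using N_scale[OF that(2) F_uminus[OF F_e] _ that(1)] e_nz m1[OF that(2)] by simp
 have nbad: "\<not> bad (squares S0)"
 proof
  assume "bad (squares S0)"
  then obtain K where K: "K \<noteq> {#}" "K inside squares S0" "N K" by (auto simp: bad_def)
  \<comment> \<open>The square factors are stripped off one entry at a time, by adding the relation
    between \<open>s\<close> and \<open>s * (x * x)\<close> and cancelling. Keeping the size ensures
    that the resulting multiset is nonempty.\<close>
  have "\<exists>K'. size K' = size K \<and> K' inside S0 \<and> N (K' + M)"
   if "K inside squares S0" "N (K + M)" "M inside S0" for K M
   using that
  proof (induction K arbitrary: M)
   case (add k K)
   obtain s x where sx: "k = s * (x * x)" "s \<in> S0" "x \<in> F" "x \<noteq> 0" using add.prems by (auto simp: squares_def)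
   have sF: "s \<in> F" "s \<noteq> 0" using S0F sx by auto
   have kF: "k \<in> F" "k \<noteq> 0" using sx sF F_mult F_mult_nz by auto
   have KF: "K inside F - {0}"
   proof
    fix k assume "k \<in># K"
    then have "k \<in> squares S0" using add.prems by auto
    then show "k \<in> F - {0}" using mclosed_squares(1)[OF S0] by (auto simp: mclosed_def)
   qed
   have "N (neg {#s * (x * x), - s#})"
    by (rule N_neg[OF N_sq[OF sF sx(3,4)]]) (use kF sF sx F_uminus in auto)
   moreover have "neg {#s * (x * x), - s#} = {#s, - k#}" using sx by (simp add: add_mset_commute)
   ultimately have "N ((add_mset k K + M) + {#s, - k#})" using N_add[OF add.prems(2)] by metis
   moreover have "(add_mset k K + M) + {#s, - k#} = (K + add_mset s M) + {#k, - k#}"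
    by (simp add: add_mset_commute)
   ultimately have N': "N ((K + add_mset s M) + {#k, - k#})" by metis
   have "(K + add_mset s M) inside F - {0}" using KF sF add.prems(3) S0F by auto
   from N_cancel[OF this kF N'] have "N (K + add_mset s M)" .
   then obtain K' where "size K' = size K" "K' inside S0" "N (K' + add_mset s M)"
    using add.IH[of "add_mset s M"] add.prems sx by auto
   then show ?case using sx by (intro exI[of _ "add_mset s K'"]) auto
  qed (auto intro!: exI[of _ "{#}"])
  from this[OF K(2), of "{#}"] K obtain K' where "size K' = size K" "K' inside S0" "N K'" by auto
  then show False using nt[of K'] K(1) by (metis size_eq_0_iff_empty)
 qed
 have A0: "squares S0 \<in> A" using mclosed_squares[OF S0] nbad by (auto simp: A_def)
 have "\<exists>S\<in>A. \<forall>Xm\<in>A. S \<subseteq> Xm \<longrightarrow> Xm = S"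
 proof (rule subset_Zorn_nonempty)
  show "A \<noteq> {}" using A0 by auto
  fix C assume C: "C \<noteq> {}" "subset.chain A C"
  have CA: "S \<in> A" if "S \<in> C" for S using C that by (auto simp: subset.chain_def)
  have pair: "\<exists>S\<in>C. x \<in> S \<and> y \<in> S" if xy: "x \<in> \<Union>C" "y \<in> \<Union>C" for x y
  proof -
   obtain Xm Y where "Xm \<in> C" "x \<in> Xm" "Y \<in> C" "y \<in> Y" using xy by auto
   moreover have "Xm \<subseteq> Y \<or> Y \<subseteq> Xm" using C(2) calculation by (auto simp: subset_chain_def)
   ultimately show ?thesis by blast
  qed
  have "mclosed (\<Union>C)"
   unfolding mclosed_def
  proof (intro conjI ballI)
   show "\<Union>C \<subseteq> F - {0}" using CA unfolding A_def mclosed_def by blast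
   show "e \<in> \<Union>C" using CA C(1) by (auto simp: A_def mclosed_def)
   fix x y assume "x \<in> \<Union>C" "y \<in> \<Union>C"
   then obtain S where "S \<in> C" "x \<in> S" "y \<in> S" using pair by blast
   then show "x * y \<in> \<Union>C" using CA unfolding A_def mclosed_def by blast
  qed
  moreover have "squares S0 \<subseteq> \<Union>C" using CA C(1) by (auto simp: A_def)
  moreover have "\<not> bad (\<Union>C)"
  proof
   assume "bad (\<Union>C)"
   then obtain K where K: "K \<noteq> {#}" "K inside \<Union>C" "N K" by (auto simp: bad_def)
   obtain S where "S \<in> C" "K inside S"
    using finite_subset_Union_chain[OF _ K(2) C] by auto
   then have "bad S" using K by (auto simp: bad_def)
   then show False using CA \<open>S \<in> C\<close> by (auto simp: A_def)
  qed
  ultimately show "\<Union>C \<in> A" by (simp add: A_def)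
 qed
 then obtain S where S: "mclosed S" "squares S0 \<subseteq> S" "\<not> bad S"
  and max: "\<And>Xm. Xm \<in> A ==> S \<subseteq> Xm ==> Xm = S" by (auto simp: A_def)
 have SF: "\<And>s. s \<in> S ==> s \<in> F" "\<And>s. s \<in> S ==> s \<noteq> 0" and Se: "e \<in> S"
  and Sm: "\<And>x y. x \<in> S ==> y \<in> S ==> x * y \<in> S" using S(1) by (auto simp: mclosed_def)
 have sq: "x * x \<in> S" if "x \<in> F" "x \<noteq> 0" for x using mclosed_squares(3)[OF S0 that] S(2) by auto
 have S0S: "S0 \<subseteq> S" using mclosed_squares(2)[OF S0] S(2) by auto
 \<comment> \<open>Adjoining \<open>f\<close> to the maximal \<open>S\<close> must produce a
   multiset on which \<open>N\<close> holds; it uses \<open>f\<close> because \<open>S\<close> alone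
   admits none.\<close>
 have ext: "\<exists>K0 K1. K0 inside S \<and> K1 inside S \<and> K1 \<noteq> {#} \<and> N (K0 + scl f K1)"
  if f: "f \<in> F" "f \<noteq> 0" "f \<notin> S" for f
 proof -
  define S' where "S' = S \<union> (*) f ` S"
  have "mclosed S'"
   unfolding mclosed_def
  proof (intro conjI ballI)
   show "S' \<subseteq> F - {0}" using SF f F_mult F_mult_nz by (auto simp: S'_def)
   show "e \<in> S'" using Se by (simp add: S'_def)
   fix x y assume "x \<in> S'" "y \<in> S'"
   then consider "x \<in> S" "y \<in> S" | s where "x \<in> S" "s \<in> S" "y = f * s"
    | s where "y \<in> S" "s \<in> S" "x = f * s" | s t where "s \<in> S" "t \<in> S" "x = f * s" "y = f * t"
    unfolding S'_def by blast
   then show "x * y \<in> S'"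
   proof cases
    case 1 then show ?thesis by (simp add: S'_def Sm)
   next
    case 2
    then have "x * y = f * (x * s)" using c[of x f] SF f by (metis mult.assoc)
    then show ?thesis using 2 Sm by (simp add: S'_def)
   next
    case 3
    then show ?thesis using Sm by (simp add: S'_def mult.assoc)
   next
    case 4
    then have "x * y = (f * f) * (s * t)" using c[of s f] SF f by (metis mult.assoc)
    then show ?thesis using 4 Sm sq f by (simp add: S'_def)
   qed
  qed
  moreover have "f \<in> S'" using Se e_right f F_D by (auto simp: S'_def image_iff intro!: bexI[of _ e])
  moreover have "S \<subseteq> S'" by (auto simp: S'_def)
  ultimately have "bad S'" using max[of S'] f S(2) by (auto simp: A_def)
  then obtain K where K: "K \<noteq> {#}" "K inside S'" "N K" by (auto simp: bad_def)
  then obtain K0 K1 where K01: "K0 inside S" "K1 inside S" "K = K0 + scl f K1"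
   using split_extension[of K S f] by (auto simp: S'_def)
  have "K1 \<noteq> {#}"
  proof
   assume "K1 = {#}"
   then have "bad S" using K01 K by (auto simp: bad_def)
   then show False using S by simp
  qed
  then show ?thesis using K01 K by blast
 qed
 have SF0: "S \<subseteq> F - {0}" using SF by auto
 have N_empty: "N {#}" using N_cancel[of "{#}" e] N_pair[OF F_e e_nz] F_e e_nz by auto
 have N_tens: "N (tens K M)" if "N M" "K inside S" "M inside F - {0}" for K M
  using that(2)
 proof (induction K)
  case (add k K)
  then have "N (scl k M)" using N_scale[OF that(3) _ _ that(1)] SF by auto
  then show ?case using add N_add by auto
 qed (use N_empty in simp)
 have N_cancel': "N K" if "N (K + (Xm + neg Xm))" "K inside F - {0}" "Xm inside F - {0}" for K Xm
  using that
 proof (induction Xm)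
  case (add x Xm)
  have "K + (add_mset x Xm + neg (add_mset x Xm)) = (K + (Xm + neg Xm)) + {#x, - x#}"
   by (simp add: add_mset_commute)
  then have N: "N ((K + (Xm + neg Xm)) + {#x, - x#})" using add.prems(1) by metis
  have "(K + (Xm + neg Xm)) inside F - {0}" using add.prems F_uminus by auto
  from N_cancel[OF this _ _ N] show ?case using add by auto
 qed simp
 have dich: "f \<in> S \<or> - f \<in> S" if f: "f \<in> F" "f \<noteq> 0" for f
 proof (rule ccontr)
  assume "\<not> (f \<in> S \<or> - f \<in> S)"
  then have nf: "f \<notin> S" "- f \<notin> S" by auto
  obtain K0 K1 where K: "K0 inside S" "K1 inside S" "K1 \<noteq> {#}"
   "N (K0 + tens {#f#} K1)" using ext[OF f nf(1)] by auto
  obtain L0 L1 where L: "L0 inside S" "L1 inside S" "L1 \<noteq> {#}"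
   "N (L0 + scl (- f) L1)"
   using ext[of "- f"] nf f F_uminus by auto
  have KLF: "K0 inside F - {0}" "K1 inside F - {0}" "L0 inside F - {0}" "L1 inside F - {0}"
   using K L SF0 by auto
  have KLF': "K1 inside F" "L1 inside F" using KLF by auto
  have fF: "(tens {#f#} Xm) inside F - {0}" if "Xm inside F - {0}" for Xm
  proof
   fix x assume "x \<in># tens {#f#} Xm"
   then obtain y where y: "x = f * y" "y \<in># Xm" by auto
   then have "y \<in> F" "y \<noteq> 0" using that by auto
   then show "x \<in> F - {0}" using y f F_mult F_mult_nz by auto
  qed
  have negF: "(neg Xm) inside F - {0}" if "Xm inside F - {0}" for Xm
   using that F_uminus by auto
  have "scl (- f) L1 = neg (tens {#f#} L1)"
   by (simp add: multiset.map_comp comp_def mult_minus_left[abs_def])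
  then have L4: "N (L0 + neg (tens {#f#} L1))" using L(4) by simp
  have m1: "N (tens L1 (K0 + tens {#f#} K1))"
   by (rule N_tens[OF K(4) L(2)]) (use KLF(1) fF[OF KLF(2)] in \<open>simp only: set_mset_union Un_subset_iff\<close>)
  have m2: "N (tens K1 (L0 + neg (tens {#f#} L1)))"
   by (rule N_tens[OF L4 K(2)]) (use KLF(3) negF[OF fF[OF KLF(4)]] in \<open>simp only: set_mset_union Un_subset_iff\<close>)
  have t1: "tens Xm {#e#} = Xm" if "Xm inside F" for Xm
   using that by (induction Xm) (auto simp: e_right F_D)
  have c2: "tens L1 K1 = tens K1 L1"
   using tens_swap[OF KLF'(2,1), of "{#e#}"] t1 KLF' by simp
  have sw: "tens L1 (tens {#f#} K1) = tens K1 (tens {#f#} L1)"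
   using tens_swap[of L1 "{#f#}" K1] tens_swap[of K1 "{#f#}" L1] KLF' f c2 by simp
  have FK: "(tens Xm Y) inside F - {0}" if "Xm inside F - {0}" "Y inside F - {0}" for Xm Y
  proof
   fix x assume "x \<in># tens Xm Y"
   then obtain a b where y: "x = a * b" "a \<in># Xm" "b \<in># Y" by (auto simp: set_tens)
   then have "a \<in> F" "a \<noteq> 0" "b \<in> F" "b \<noteq> 0" using that by auto
   then show "x \<in> F - {0}" using y F_mult F_mult_nz by auto
  qed
  have "N ((tens L1 K0 + tens K1 L0) +
    (tens L1 (tens {#f#} K1) + neg (tens L1 (tens {#f#} K1))))"
   using N_add[OF m1 m2] sw by (simp only: tens_add_right tens_neg_right) (simp add: ac_simps)
  then have m: "N (tens L1 K0 + tens K1 L0)"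
   by (rule N_cancel') (use FK[OF KLF(4,1)] FK[OF KLF(2,3)] FK[OF KLF(4) fF[OF KLF(2)]]
     in \<open>simp_all only: set_mset_union Un_subset_iff\<close>)
  show False
  proof (cases "tens L1 K0 + tens K1 L0 = {#}")
   case False
   have "(tens L1 K0 + tens K1 L0) inside S"
    using mclosed_tens[OF S(1)] K L by auto
   then have "bad S" using False m unfolding bad_def by blast
   then show False using S by simp
  next
   \<comment> \<open>This forces \<open>K0 = {#}\<close>, so the relation for \<open>f\<close>
     consists of multiples of \<open>f\<close> only; division by \<open>f\<close> moves it into
     \<open>S\<close>.\<close>
   case True
   then have "K0 = {#}" using L(3) tens_nonempty by auto
   then have "N (tens {#f#} K1)" using K(4) by simp
   then have "N (scl (dinv f) (tens {#f#} K1))"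
    by (rule N_scale[OF fF[OF KLF(2)], rotated 2]) (use F_dinv dinv_nz f F_D in auto)
   moreover have "scl (dinv f) (tens {#f#} K1) = K1"
   proof -
    have "image_mset (\<lambda>x. dinv f * (f * x)) K1 = image_mset id K1"
     by (rule image_mset_cong) (use KLF(2) cancel2[of f] f F_D in auto)
    then show ?thesis by (simp add: image_mset_comp)
   qed
   ultimately have "bad S" using K by (auto simp: bad_def)
   then show False using S by simp
  qed
 qed
 have ne: "- e \<notin> S"
 proof
  assume "- e \<in> S"
  then have "bad S" using Se N_pair[OF F_e e_nz] unfolding bad_def by (intro exI[of _ "{#e, - e#}"]) auto
  then show False using S by simp
 qed
 \<comment> \<open>An inverse is \<open>x\<close> times the square of the inverse.\<close>
 have Sinv: "dinv x \<in> S" if "x \<in> S" for x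
 proof -
  have x: "x \<in> D" "x \<noteq> 0" using that SF F_D by auto
  have "dinv x = x * (dinv x * dinv x)" using cancel1[OF x dinv(1)[OF x]] by simp
  then show ?thesis using Sm[OF that sq[of "dinv x"]] F_dinv dinv_nz x that SF by auto
 qed
 have nn: "- x \<notin> S" if "x \<in> S" for x
 proof
  assume "- x \<in> S"
  then have "(- x) * dinv x \<in> S" using Sm Sinv that by blast
  then show False using ne dinv that SF F_D by auto
 qed
 \<comment> \<open>If \<open>- (x + y)\<close> were in \<open>S\<close>, all four entries of the
   binary relation would lie in \<open>S\<close>.\<close>
 have Sadd: "x + y \<in> S" if xy: "x \<in> S" "y \<in> S" for x y
 proof (rule ccontr)
  assume n: "x + y \<notin> S"
  have xyF: "x \<in> F" "y \<in> F" "x \<noteq> 0" "y \<noteq> 0" using xy SF by auto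
  have "x + y \<noteq> 0" using nn[OF xy(1)] xy(2) by (metis add_eq_0_iff)
  then have s: "x + y \<in> F" "x + y \<noteq> 0" "- (x + y) \<in> S" using F_add xyF dich[of "x + y"] n by auto
  define z where "z = x * dinv (x + y) * y"
  have dF: "dinv (x + y) \<in> F" using F_dinv s by auto
  have "- z = x * y * dinv (- (x + y))"
  proof -
   have "dinv (- (x + y)) = - dinv (x + y)" by (rule dinv_uminus) (use s F_D in auto)
   then show ?thesis using c[OF dF xyF(2)] by (simp add: z_def mult.assoc)
  qed
  then have zS: "- z \<in> S" using Sm[OF Sm[OF xy] Sinv[OF s(3)]] by simp
  have zF: "z \<in> F" using xyF dF F_mult by (simp add: z_def)
  have "N {#x, y, - (x + y), - z#}"
   using N_binary[OF xyF(1,3,2,4) s(2)] by (simp only: z_def)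
  moreover have "{#x, y, - (x + y), - z#} inside S" using xy s zS by auto
  ultimately have "bad S" unfolding bad_def by (metis multi_self_add_other_not_self empty_not_add_mset)
  then show False using S by simp
 qed
 have "fordering F (insert 0 S)"
  unfolding fordering_def
 proof (intro conjI ballI)
  show "insert 0 S \<union> uminus ` insert 0 S = F"
  proof
   show "insert 0 S \<union> uminus ` insert 0 S \<subseteq> F" using SF F_zero F_uminus by auto
   show "F \<subseteq> insert 0 S \<union> uminus ` insert 0 S"
   proof
    fix f assume "f \<in> F"
    then show "f \<in> insert 0 S \<union> uminus ` insert 0 S"
     using dich[of f] by (auto simp: image_iff) (metis minus_minus)
   qed
  qed
  show "insert 0 S \<inter> uminus ` insert 0 S = {0}" using nn by auto
 qed (use Sadd Sm in auto)
 moreover have "insert 0 S - {0} = S" using SF by auto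
 ultimately show ?thesis using S(3) S0S unfolding bad_def by (intro exI[of _ "insert 0 S"]) auto
qed

lemma scale_binary:
 assumes xy: "x \<in> F" "y \<in> F" "x \<noteq> 0" "y \<noteq> 0" "x + y \<noteq> 0" and m: "m \<in> Hs"
 shows "witt {#x * m, y * m#} {#(x + y) * m, x * dinv (x + y) * y * m#}"
proof -
 have c: "a * b = b * a" if "a \<in> F" "b \<in> F" for a b using F_central[OF that(1) F_D[OF that(2)]] .
 have s: "x + y \<in> F" using F_add xy by auto
 have dF: "dinv (x + y) \<in> F" using F_dinv s xy by auto
 have mD: "m \<in> D" "m \<noteq> 0" using m by (auto simp: Hs_def)
 have H: "x * m \<in> Hs" "y * m \<in> Hs" using F_mult_Hs m xy by auto
 have sm: "x * m + y * m = (x + y) * m" by (simp add: algebra_simps)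
 have smD: "(x + y) * m \<in> D" "(x + y) * m \<noteq> 0" using s xy F_D D_mult mD mult_nz by auto
 have "dinv ((x + y) * m) = dinv m * dinv (x + y)"
 proof (rule dinv_unique[symmetric])
  have "(x + y) * m * (dinv m * dinv (x + y)) = (x + y) * (m * (dinv m * dinv (x + y)))"
   by (simp add: mult.assoc)
  also have "\<dots> = e" using cancel1[OF mD, of "dinv (x + y)"] dF F_D dinv s xy by simp
  finally show "(x + y) * m * (dinv m * dinv (x + y)) = e" .
 qed (use smD D_mult dinv mD dF F_D in auto)
 then have "(x * m) * dinv (x * m + y * m) * (y * m) = x * (m * (dinv m * (dinv (x + y) * (y * m))))"
  by (simp add: sm mult.assoc)
 also have "\<dots> = x * dinv (x + y) * y * m" using cancel1[OF mD, of "dinv (x + y) * (y * m)"] D_mult dF xy F_D mD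
  by (simp add: mult.assoc)
 finally show ?thesis using witt_binary(1)[OF H] smD sm by simp
qed

text \<open>\<open>ordering_avoiding\<close> is applied to the property that \<open>tens K M\<close>
  is metabolic. The conditions required there follow from the relations of the Witt ring of
  \<open>F\<close>: hyperbolic pairs, square classes and the binary relation.\<close>

lemma plgp:
 assumes S0: "mclosed S0" and M: "M inside Hs" and nt: "\<not> torsion S0 M"
 shows "\<exists>P. fordering F P \<and> S0 \<subseteq> P \<and> \<not> torsion (P - {0}) M"
proof -
 have negt: "scl (- w) M = neg (scl w M)" for w
  by (simp add: multiset.map_comp comp_def mult_minus_left[abs_def])
 have xM: "set_mset (scl x M) \<subseteq> Hs" if "x \<in> F" "x \<noteq> 0" for x
  using F_mult_Hs M that by auto
 have "\<exists>P. fordering F P \<and> S0 \<subseteq> P \<and> (\<forall>K. K \<noteq> {#} \<longrightarrow> K inside P - {0} \<longrightarrow> \<not> metab (tens K M))"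
 proof (rule ordering_avoiding[OF S0])
  show "\<not> metab (tens K M)" if "K \<noteq> {#}" "K inside S0" for K using nt that by (auto simp: torsion_def)
  show "metab (tens (K + K') M)" if "metab (tens K M)" "metab (tens K' M)" for K K'
   using metab_add[OF that] by simp
  show "metab (tens {#x, - x#} M)" if "x \<in> F" "x \<noteq> 0" for x
   using witt_refl[OF Hs_sub(1)[OF xM[OF that]]] by (simp add: witt_def negt ac_simps)
  show "metab (tens K M)" if "K inside F - {0}" "x \<in> F" "x \<noteq> 0" "metab (tens (K + {#x, - x#}) M)" for K x
  proof (rule metab_cancel_neg)
   show "metab (tens K M + (scl x M + neg (scl x M)))"
    using that(4) by (simp add: negt ac_simps)
  qed (rule Hs_sub(2)[OF xM[OF that(2,3)]])
  show "metab (tens (scl x K) M)" if "K inside F - {0}" "x \<in> F" "x \<noteq> 0" "metab (tens K M)" for K x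
   using metab_tensF[OF that(4) tens_Hs[OF that(1) M], of "{#x#}"] that by (simp add: tens_image)
  show "metab (tens {#x * (z * z), - x#} M)" if "x \<in> F" "x \<noteq> 0" "z \<in> F" "z \<noteq> 0" for x z
  proof -
   have "witt (image_mset ((*) (x * (z * z))) M) (scl x M)"
   proof (rule witt_image)
    fix m assume "m \<in># M"
    then have m: "m \<in> D" using M HsD by auto
    have sm: "x * m \<in> D" "z \<in> D" using m that F_D D_mult by auto
    have "(x * m) * z = z * (x * m)" using F_central[OF that(3) sm(1)] by simp
    moreover have "x * (z * z) * m = x * m * (z * z)"
     using F_central[of "z * z" m] F_mult that m by (simp add: mult.assoc)
    ultimately show "witt {#x * (z * z) * m#} {#x * m#}"
     using witt_conj_comm[OF sm F_sym[OF that(3)]] by simp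
   qed
   then show ?thesis by (simp add: witt_def negt ac_simps)
  qed
  show "metab (tens {#x, y, - (x + y), - (x * dinv (x + y) * y)#} M)"
   if "x \<in> F" "x \<noteq> 0" "y \<in> F" "y \<noteq> 0" "x + y \<noteq> 0" for x y
  proof -
   have "witt (scl x M + scl y M)
    (scl (x + y) M + image_mset ((*) (x * dinv (x + y) * y)) M)"
    using M
   proof (induction M)
    case (add m M)
    then show ?case using witt_add[OF scale_binary[of x y m]] that by (simp add: add_mset_commute)
   qed (simp add: witt_def metab_empty)
   then show ?thesis
    unfolding witt_def tens_simps negt image_mset_union by (simp only: ac_simps empty_neutral)
  qed
 qed
 then show ?thesis unfolding torsion_def by blast
qed

end

section \<open>Orthogonal bases and the law of inertia\<close>

context divinv
begin

text \<open>A longest orthogonal list of anisotropic vectors spans, since a nonzero complement would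
  contain one more. \<open>V\<close> sits inside the ambient ring because the lemma is applied to
  \<open>L\<close> over \<open>F\<close>, and to \<open>D\<close> over the centraliser of
  \<open>L\<close>.\<close>

lemma orth_basis_exists:
 fixes V :: "'a set" and b :: "'a \<Rightarrow> 'a \<Rightarrow> 'a"
 defines "orth ys \<equiv> set ys \<subseteq> V \<and> (\<forall>i<length ys. \<forall>j<length ys. i \<noteq> j \<longrightarrow> b (ys!i) (ys!j) = 0)
  \<and> (\<forall>i<length ys. b (ys!i) (ys!i) \<noteq> 0)"
 assumes Vadd: "\<And>x y. x \<in> V ==> y \<in> V ==> x + y \<in> V"
  and Vm: "\<And>x c. x \<in> V ==> c \<in> D ==> x * c \<in> V" and V0: "0 \<in> V"
  and Ve: "\<And>x. x \<in> V ==> x * e = x"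
  and bD: "\<And>x y. x \<in> V ==> y \<in> V ==> b x y \<in> D"
  and badd: "\<And>x y z. x \<in> V ==> y \<in> V ==> z \<in> V ==> b x (y + z) = b x y + b x z"
  and bm: "\<And>x y c. x \<in> V ==> y \<in> V ==> c \<in> D ==> b x (y * c) = b x y * c"
  and bs: "\<And>x y. x \<in> V ==> y \<in> V ==> \<sigma> (b x y) = b y x"
  and nondeg: "\<And>x. x \<in> V ==> x \<noteq> 0 ==> \<exists>y\<in>V. b x y \<noteq> 0"
  and two: "e + e \<noteq> 0"
  and bound: "\<And>ys. orth ys ==> length ys \<le> N"
 shows "\<exists>ys. orth ys \<and> (\<forall>x\<in>V. x = (\<Sum>i<length ys. ys!i * (dinv (b (ys!i) (ys!i)) * b (ys!i) x)))"
proof -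
 have "orth []" by (simp add: orth_def)
 then have "\<exists>ys. orth ys \<and> (\<forall>zs. orth zs \<longrightarrow> length zs \<le> length ys)"
  using bound by (intro ex_has_greatest_nat[of orth "[]" length "Suc N"]) (auto simp: less_Suc_eq_le)
 then obtain ys where ys: "orth ys" and max: "\<And>zs. orth zs ==> length zs \<le> length ys" by auto
 define n where "n = length ys"
 have yV: "ys ! i \<in> V" if "i < n" for i using ys that by (auto simp: orth_def n_def)
 have yo: "b (ys!i) (ys!j) = 0" if "i < n" "j < n" "i \<noteq> j" for i j using ys that by (auto simp: orth_def n_def)
 have yn: "b (ys!i) (ys!i) \<noteq> 0" if "i < n" for i using ys that by (auto simp: orth_def n_def)
 define c where "c = (\<lambda>x i. dinv (b (ys!i) (ys!i)) * b (ys!i) x)"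
 have cD: "c x i \<in> D" if "x \<in> V" "i < n" for x i
  using that yV bD yn dinv D_mult by (auto simp: c_def)
 have Vsum: "(\<Sum>i\<in>I. f i) \<in> V" if "\<And>i. i \<in> I ==> f i \<in> V" for I :: "nat set" and f
  using that by (induction I rule: infinite_finite_induct) (auto simp: V0 Vadd)
 have b0: "b x 0 = 0" if "x \<in> V" for x using badd[OF that V0 V0] by simp
 have bsum: "b x (\<Sum>i\<in>I. f i) = (\<Sum>i\<in>I. b x (f i))" if "x \<in> V" "\<And>i. i \<in> I ==> f i \<in> V"
  for x and I :: "nat set" and f
  using that(2) by (induction I rule: infinite_finite_induct) (auto simp: b0 badd Vsum that(1))
 have Vminus: "- x \<in> V" if "x \<in> V" for x
  using Vm[OF that D_uminus[OF e_in]] Ve[OF that] by simp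
 have bminus: "b x (- y) = - b x y" if "x \<in> V" "y \<in> V" for x y
  using bm[OF that D_uminus[OF e_in]] Ve[OF that(2)] e_right[OF bD[OF that]] by simp
 define p where "p = (\<lambda>x. \<Sum>i<n. ys!i * c x i)"
 have pV: "p x \<in> V" if "x \<in> V" for x unfolding p_def by (rule Vsum) (use that yV cD Vm in auto)
 have bp: "b (ys!j) (p x) = b (ys!j) x" if x: "x \<in> V" and j: "j < n" for x j
 proof -
  have "b (ys!j) (p x) = (\<Sum>i<n. b (ys!j) (ys!i) * c x i)"
   unfolding p_def using x j by (subst bsum) (auto simp: yV Vm cD bm)
  also have "\<dots> = (\<Sum>i<n. if i = j then b (ys!j) (ys!j) * c x j else 0)"
   by (rule sum.cong) (use yo j in auto)
  also have "\<dots> = b (ys!j) (ys!j) * c x j" using j by simp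
  also have "\<dots> = b (ys!j) x" unfolding c_def by (rule cancel1) (use x j yV bD yn in auto)
  finally show ?thesis .
 qed
 define W where "W = {x\<in>V. \<forall>i<n. b (ys!i) x = 0}"
 have rW: "x - p x \<in> W" if x: "x \<in> V" for x
  using Vadd[OF x Vminus[OF pV[OF x]]] badd[OF yV x Vminus[OF pV[OF x]]] bminus[OF yV pV[OF x]] bp[OF x]
  by (auto simp: W_def)
 have "W = {0}"
 proof (rule ccontr)
  assume "W \<noteq> {0}"
  moreover have "0 \<in> W" using V0 b0 yV by (auto simp: W_def)
  ultimately obtain x where x: "x \<in> W" "x \<noteq> 0" by auto
  have "\<exists>w\<in>W. b w w \<noteq> 0"
  proof (rule ccontr)
   assume "\<not> ?thesis"
   then have all0: "b w w = 0" if "w \<in> W" for w using that by auto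
   have xV: "x \<in> V" using x by (simp add: W_def)
   have xy0: "b x (ys!i) = 0" if "i < n" for i
    using bs[OF yV[OF that] xV] x that s_zero by (auto simp: W_def)
   obtain y where y: "y \<in> V" "b x y \<noteq> 0" using nondeg xV x by blast
   define y' where "y' = y - p y"
   have y'W: "y' \<in> W" unfolding y'_def by (rule rW[OF y(1)])
   then have y'V: "y' \<in> V" by (simp add: W_def)
   have "b x (p y) = (\<Sum>i<n. b x (ys!i) * c y i)"
    unfolding p_def using xV y by (subst bsum) (auto simp: yV Vm cD bm)
   then have "b x (p y) = 0" using xy0 by simp
   then have r: "b x y' = b x y"
    using badd[OF xV y(1) Vminus[OF pV[OF y(1)]]] bminus[OF xV pV[OF y(1)]] by (simp add: y'_def)
   define q where "q = dinv (b x y)"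
   have q: "q \<in> D" "b x y * q = e" using dinv[OF bD[OF xV y(1)] y(2)] by (auto simp: q_def)
   \<comment> \<open>If all values on the complement were zero, \<open>x\<close> and
     \<open>z\<close> would be a hyperbolic pair, and \<open>x + z\<close> would have the value
     \<open>e + e\<close>.\<close>
   define z where "z = y' * q"
   have zV: "z \<in> V" using Vm y'V q by (simp add: z_def)
   have zW: "z \<in> W" using y'W bm[OF yV y'V q(1)] zV by (auto simp: W_def z_def)
   have bxz: "b x z = e" using bm[OF xV y'V q(1)] r q by (simp add: z_def)
   then have bzx: "b z x = e" using bs[OF xV zV] s_e by simp
   have xzV: "x + z \<in> V" using Vadd xV zV by auto
   have xzW: "x + z \<in> W" using x zW xzV badd[OF yV xV zV] by (auto simp: W_def)
   have 1: "b (x + z) x = e"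
    using bs[OF xV xzV] badd[OF xV xV zV] all0[OF x(1)] bxz s_e by simp
   have 2: "b (x + z) z = e"
    using bs[OF zV xzV] badd[OF zV xV zV] all0[OF zW] bzx s_e by simp
   have "b (x + z) (x + z) = e + e" using badd[OF xzV xV zV] 1 2 by simp
   then show False using all0[OF xzW] two by simp
  qed
  then obtain w where w: "w \<in> W" "b w w \<noteq> 0" by auto
  have wV: "w \<in> V" and wy: "b (ys!i) w = 0" if "i < n" for i using w that by (auto simp: W_def)
  have wV: "w \<in> V" using w by (auto simp: W_def)
  have wy': "b w (ys!i) = 0" if "i < n" for i using bs[OF yV[OF that] wV] wy[OF that] s_zero by simp
  have "orth (ys @ [w])"
   unfolding orth_def
   using wV yV yo yn w wy wy' ys
   by (auto simp: orth_def nth_append n_def less_Suc_eq)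
  then show False using max[of "ys @ [w]"] by simp
 qed
 then have "x = p x" if "x \<in> V" for x using rW[OF that] by simp
 then show ?thesis using ys by (intro exI[of _ ys]) (auto simp: p_def c_def n_def)
qed

lemma dim_le:
 fixes f :: "(nat \<Rightarrow> 'a) \<Rightarrow> nat \<Rightarrow> 'a"
 assumes "\<And>j. j < m ==> rlin (full {..<n}) (\<lambda>u. f u j)"
  "\<And>u i. u \<in> full {..<n} ==> (\<And>j. j < m ==> f u j = 0) ==> u i = 0"
 shows "n \<le> m"
proof (rule ccontr)
 assume "\<not> n \<le> m"
 then have "\<exists>u\<in>full {..<n}. (\<exists>i. u i \<noteq> 0) \<and> (\<forall>j\<in>{..<m}. f u j = 0)"
  by (intro dimge_exists[OF _ rsub_full _ dimge_full[of "{..<n}", simplified]]) (use assms in auto)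
 then show False using assms(2) by fastforce
qed

end

lemma fordering_sum:
 assumes "fordering F P" "\<And>i. i \<in> I ==> f i \<in> P" shows "sum f I \<in> P"
 using assms(2)
proof (induction I rule: infinite_finite_induct)
 case (insert i I)
 then show ?case using assms(1) by (auto simp: fordering_def)
qed (use assms(1) in \<open>auto simp: fordering_def\<close>)

lemma fordering_zero: assumes "fordering F P" "x \<in> P" "- x \<in> P" shows "x = 0"
proof -
 have "x \<in> P \<inter> uminus ` P" using assms(2,3) by (metis IntI imageI minus_minus)
 then show ?thesis using assms(1) by (auto simp: fordering_def)
qed

lemma fordering_sum_zero:
 assumes "fordering F P" "finite I" "\<And>i. i \<in> I ==> f i \<in> P" "sum f I = 0" "i \<in> I"
 shows "f i = 0"
proof -
 have "sum f I = f i + sum f (I - {i})" using assms by (simp add: sum.remove)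
 moreover have "sum f (I - {i}) \<in> P" by (rule fordering_sum[OF assms(1)]) (use assms in auto)
 ultimately have "- f i \<in> P" using assms(4) by (metis add.inverse_unique)
 then show ?thesis using fordering_zero[OF assms(1)] assms(3,5) by blast
qed

text \<open>The value at zero is a convention; signatures are taken of nonzero entries.\<close>

definition sgnP :: "'a::ring set \<Rightarrow> 'a \<Rightarrow> int" where
 "sgnP P c = (if c \<in> P then 1 else -1)"

context divinv_base
begin

text \<open>On \<open>F\<close> the involution is trivial, so this instance is the theory of
  quadratic forms over \<open>F\<close>.\<close>

lemma F_base: "divinv_base F e \<sigma> F"
proof -
 interpret A: divring F e
 proof
  fix x assume x: "x \<in> F" "x \<noteq> 0"
  then show "\<exists>y\<in>F. x * y = e \<and> y * x = e" using F_dinv dinv F_D by blast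
 qed (use F_add F_uminus F_mult F_e e_nz e_left e_right F_D in auto)
 have "A.dinv x = dinv x" if "x \<in> F" "x \<noteq> 0" for x
  using dinv_unique[of x "A.dinv x"] A.dinv[OF that] F_D that by metis
 then show ?thesis
  by unfold_locales (use F_add F_uminus F_mult F_e F_dinv F_D F_sym F_central in auto)
qed

interpretation FF: divinv_base F e \<sigma> F by (rule F_base)

lemma FF_dinv: "x \<in> F ==> x \<noteq> 0 ==> FF.dinv x = dinv x"
 using dinv_unique[of x "FF.dinv x"] FF.dinv[of x] F_D by metis

context
 fixes P assumes P: "fordering F P"
begin

lemma P_props:
 shows "P \<subseteq> F" "\<And>x y. x \<in> P ==> y \<in> P ==> x + y \<in> P" "\<And>x y. x \<in> P ==> y \<in> P ==> x * y \<in> P"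
  "0 \<in> P" "\<And>x. x \<in> F ==> x \<in> P \<or> - x \<in> P"
proof -
 have "x \<in> P \<or> x \<in> uminus ` P" if "x \<in> F" for x using P that by (auto simp: fordering_def)
 then show "\<And>x. x \<in> F ==> x \<in> P \<or> - x \<in> P" by (metis (no_types) image_iff minus_minus)
qed (use P in \<open>auto simp: fordering_def\<close>)

lemma P_sq: assumes "x \<in> F" shows "x * x \<in> P"
 using P_props(3)[of x x] P_props(3)[of "-x" "-x"] P_props(5)[OF assms] by auto

lemma P_e: "e \<in> P" using P_sq[OF F_e] e_left[OF e_in] by simp

lemma P_mclosed: "mclosed (P - {0})"
 unfolding mclosed_def
proof (intro conjI ballI)
 show "P - {0} \<subseteq> F - {0}" using P_props(1) by auto
 show "e \<in> P - {0}" using P_e e_nz by simp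
 fix x y assume "x \<in> P - {0}" "y \<in> P - {0}"
 then show "x * y \<in> P - {0}" using P_props(3) F_mult_nz[of x y] P_props(1) by auto
qed

lemma sgnP_uminus: "c \<in> F ==> c \<noteq> 0 ==> sgnP P (- c) = - sgnP P c"
 using P_props(5)[of c] fordering_zero[OF P, of c] by (auto simp: sgnP_def)

lemma sgnP_mult:
 assumes "c \<in> F" "c \<noteq> 0" "p \<in> P" "p \<noteq> 0" shows "sgnP P (p * c) = sgnP P c"
proof (cases "c \<in> P")
 case True
 then show ?thesis using P_props(3) assms by (auto simp: sgnP_def)
next
 case False
 then have "p * (- c) \<in> P" using P_props(3,5) assms by blast
 moreover have "p * c \<noteq> 0" using F_mult_nz assms P_props by auto
 ultimately show ?thesis using False fordering_zero[OF P, of "p * c"] by (auto simp: sgnP_def)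
qed

text \<open>The form is anisotropic on the span of the coordinates with positive entries, and
  likewise for the negative ones. A Lagrangian meets each span only in zero, so neither sign occurs
  at more than half of the indices.\<close>

lemma inertia:
 assumes "FF.metab M" "M inside F - {0}"
 shows "(\<Sum>c\<in>#M. sgnP P c) = 0"
proof -
 obtain I d U where M: "M = image_mset d (mset_set I)" "FF.lagr (I::nat set) d U"
  using assms by (auto simp: FF.metab_def)
 have fin: "finite I" and sub: "FF.rsub U" and supp: "\<And>u i. u \<in> U ==> i \<notin> I ==> u i = 0"
  and iso: "\<And>u v. u \<in> U ==> v \<in> U ==> FF.hf I d u v = 0"
  using M by (auto simp: FF.lagr_def)
 obtain n where n: "card I = 2 * n" "dimge n U" using M by (auto simp: FF.lagr_def)
 have dF: "d i \<in> F" "d i \<noteq> 0" if "i \<in> I" for i using assms(2) that fin by (auto simp: M)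
 \<comment> \<open>\<open>g = e\<close> bounds the number of negative entries from below,
   \<open>g = - e\<close> the number of positive ones.\<close>
 have key: "n \<le> card {i\<in>I. g * d i \<notin> P}" if g: "g = e \<or> g = - e" for g
 proof (rule ccontr)
  assume "\<not> ?thesis"
  then have "\<exists>u\<in>U. (\<exists>i. u i \<noteq> 0) \<and> (\<forall>j\<in>{i\<in>I. g * d i \<notin> P}. u j = 0)"
   by (intro FF.dimge_exists[OF _ sub _ n(2)]) (use fin FF.rlin_coord[OF sub] in auto)
  then obtain u i where u: "u \<in> U" "u i \<noteq> 0" "\<And>j. j \<in> I ==> g * d j \<notin> P ==> u j = 0" by auto
  have gF: "g \<in> F" "g \<noteq> 0" using g F_e F_uminus e_nz by auto
  have uF: "u j \<in> F" for j using FF.rsubD[OF sub] u by auto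
  have i: "i \<in> I" using supp u by blast
  have tP: "(u j * u j) * (g * d j) \<in> P" if "j \<in> I" for j
   using P_props(3)[OF P_sq[OF uF], of "g * d j"] u(3)[OF that] P_props(4) by (cases "g * d j \<in> P") auto
  have c: "a * b = b * a" if "a \<in> F" "b \<in> F" for a b using F_central[OF that(1) F_D[OF that(2)]] .
  have eq: "(u j * u j) * (g * d j) = g * (\<sigma> (u j) * d j * u j)" if "j \<in> I" for j
  proof -
   have "u j * u j * g = g * (u j * u j)" "u j * d j = d j * u j"
    using c uF gF dF[OF that] F_mult by auto
   then show ?thesis using F_sym[OF uF] by (metis mult.assoc)
  qed
  have "(\<Sum>j\<in>I. (u j * u j) * (g * d j)) = g * FF.hf I d u u"
   unfolding FF.hf_def by (simp add: eq sum_distrib_left)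
  then have "(\<Sum>j\<in>I. (u j * u j) * (g * d j)) = 0" using iso[OF u(1) u(1)] by simp
  from fordering_sum_zero[where f = "\<lambda>j. (u j * u j) * (g * d j)", OF P fin _ this i] tP
  have "(u i * u i) * (g * d i) = 0" by blast
  then show False using F_mult_nz[of "u i" "u i"] F_mult_nz[of g "d i"] F_mult_nz[of "u i * u i" "g * d i"]
   uF u(2) gF dF[OF i] F_mult by auto
 qed
 define Ip where "Ip = {i\<in>I. d i \<in> P}"
 define In where "In = {i\<in>I. d i \<notin> P}"
 have "{i\<in>I. e * d i \<notin> P} = In" using dF e_left F_D by (auto simp: In_def)
 then have 1: "n \<le> card In" using key[of e] by simp
 have "(- e) * d i \<notin> P \<longleftrightarrow> d i \<in> P" if "i \<in> I" for i
  using dF[OF that] e_left F_D P_props(5)[of "d i"] fordering_zero[OF P, of "d i"] by auto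
 then have "{i\<in>I. (- e) * d i \<notin> P} = Ip" by (auto simp: Ip_def)
 then have 2: "n \<le> card Ip" using key[of "- e"] by simp
 have I: "I = Ip \<union> In" "Ip \<inter> In = {}" "finite Ip" "finite In" using fin by (auto simp: Ip_def In_def)
 have "card I = card Ip + card In" using I card_Un_disjoint by metis
 then have eq: "card Ip = card In" using 1 2 n by linarith
 have "(\<Sum>c\<in>#M. sgnP P c) = (\<Sum>i\<in>I. sgnP P (d i))" using fin
  by (simp add: M image_mset_comp sum_unfold_sum_mset)
 also have "\<dots> = (\<Sum>i\<in>Ip. sgnP P (d i)) + (\<Sum>i\<in>In. sgnP P (d i))"
  unfolding I(1) by (rule sum.union_disjoint) (use I in auto)
 also have "\<dots> = int (card Ip) - int (card In)"
  by (simp add: sgnP_def Ip_def In_def)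
 finally show ?thesis using eq by simp
qed

end

definition Findep :: "'a list \<Rightarrow> bool" where
 "Findep xs \<longleftrightarrow> (\<forall>c. (\<forall>i<length xs. c i \<in> F) \<longrightarrow> (\<Sum>i<length xs. xs!i * c i) = 0 \<longrightarrow> (\<forall>i<length xs. c i = 0))"

end

locale divinv_fd = divinv_base +
 assumes fd: "\<exists>N. \<forall>xs. set xs \<subseteq> D \<longrightarrow> Findep xs \<longrightarrow> length xs \<le> N"
  and two: "e + e \<noteq> 0"

section \<open>Transfer from a subfield of symmetric elements\<close>

text \<open>\<open>t\<close> is a nonzero linear functional, so that \<open>tf v\<close> is the
  Scharlau transfer of \<langle>v\<rangle> and is regular for \<open>v \<noteq> 0\<close>. Besides
  subfields of a division ring the instances include field extensions with the identity as
  involution.\<close>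

locale sym_ext = divinv_fd +
 fixes L :: "'a::ring set" and t :: "'a \<Rightarrow> 'a"
 assumes L_D: "x \<in> L ==> x \<in> D" and F_L: "x \<in> F ==> x \<in> L"
  and L_add: "x \<in> L ==> y \<in> L ==> x + y \<in> L" and L_uminus: "x \<in> L ==> - x \<in> L"
  and L_mult: "x \<in> L ==> y \<in> L ==> x * y \<in> L" and L_dinv: "x \<in> L ==> x \<noteq> 0 ==> dinv x \<in> L"
  and L_comm: "x \<in> L ==> y \<in> L ==> x * y = y * x" and L_sym: "x \<in> L ==> \<sigma> x = x"
  and t_in: "x \<in> L ==> t x \<in> F" and t_add: "x \<in> L ==> y \<in> L ==> t (x + y) = t x + t y"
  and t_lin: "x \<in> L ==> c \<in> F ==> t (x * c) = t x * c"
  and t_nz: "\<exists>x\<in>L. t x \<noteq> 0"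
begin

lemma L_base: "divinv_base L e \<sigma> L"
proof -
 interpret A: divring L e
 proof
  fix x assume x: "x \<in> L" "x \<noteq> 0"
  then show "\<exists>y\<in>L. x * y = e \<and> y * x = e" using L_dinv dinv L_D by blast
 qed (use L_add L_uminus L_mult F_L F_e e_nz e_left e_right L_D in auto)
 have "A.dinv x = dinv x" if "x \<in> L" "x \<noteq> 0" for x
  using dinv_unique[of x "A.dinv x"] A.dinv[OF that] L_D that by metis
 then show ?thesis
  by unfold_locales (use L_add L_uminus L_mult F_L F_e L_dinv L_D L_sym L_comm in auto)
qed

sublocale FF: divinv_base F e \<sigma> F by (rule F_base)
sublocale LL: divinv_base L e \<sigma> L by (rule L_base)

lemma L_zero: "0 \<in> L" using F_L F_zero by auto
lemma L_nz: "x \<in> L ==> y \<in> L ==> x \<noteq> 0 ==> y \<noteq> 0 ==> x * y \<noteq> 0" using mult_nz L_D by auto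
lemma L_sum: "(\<And>i. i \<in> I ==> f i \<in> L) ==> sum f I \<in> L" by (rule LL.D_sum)
lemma t_zero: "t 0 = 0" using t_add[OF L_zero L_zero] by simp
lemma t_sum: "(\<And>i. i \<in> I ==> f i \<in> L) ==> t (sum f I) = (\<Sum>i\<in>I. t (f i))"
 by (induction I rule: infinite_finite_induct) (auto simp: t_zero t_add L_sum)

definition tf :: "'a \<Rightarrow> 'a \<Rightarrow> 'a \<Rightarrow> 'a" where "tf v x y = t (v * x * y)"

lemma tf_in: "v \<in> L ==> x \<in> L ==> y \<in> L ==> tf v x y \<in> F" by (simp add: tf_def t_in L_mult)
lemma tf_add: "v \<in> L ==> x \<in> L ==> y \<in> L ==> z \<in> L ==> tf v x (y + z) = tf v x y + tf v x z"
 by (simp add: tf_def distrib_left t_add L_mult)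
lemma tf_mult: "v \<in> L ==> x \<in> L ==> y \<in> L ==> c \<in> F ==> tf v x (y * c) = tf v x y * c"
 by (simp add: tf_def mult.assoc[symmetric] t_lin L_mult)
lemma tf_sym: "v \<in> L ==> x \<in> L ==> y \<in> L ==> tf v x y = tf v y x"
 by (metis tf_def L_comm mult.assoc)
lemma tf_zero: "v \<in> L ==> x \<in> L ==> tf v x 0 = 0" by (simp add: tf_def t_zero)
lemma tf_sum: "v \<in> L ==> x \<in> L ==> (\<And>i. i \<in> I ==> f i \<in> L) ==> tf v x (sum f I) = (\<Sum>i\<in>I. tf v x (f i))"
 by (simp add: tf_def sum_distrib_left t_sum L_mult)

lemma tf_scale: assumes "v \<in> L" "c \<in> F" "x \<in> L" "y \<in> L" shows "tf (c * v) x y = c * tf v x y"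
proof -
 have "c * v * x * y = v * x * y * c" using assms L_comm L_mult F_L by (metis mult.assoc)
 then have "tf (c * v) x y = tf v x y * c" using assms L_mult t_lin by (simp add: tf_def)
 then show ?thesis using assms tf_in F_D F_central by metis
qed

text \<open>Spanning is expressed by the Fourier expansion, which fixes the coordinates at the same
  time; see \<open>cf\<close>.\<close>

definition orthb :: "'a \<Rightarrow> 'a list \<Rightarrow> bool" where
 "orthb v fs \<longleftrightarrow> set fs \<subseteq> L \<and> (\<forall>i<length fs. \<forall>j<length fs. i \<noteq> j \<longrightarrow> tf v (fs!i) (fs!j) = 0)
  \<and> (\<forall>i<length fs. tf v (fs!i) (fs!i) \<noteq> 0)
  \<and> (\<forall>x\<in>L. x = (\<Sum>i<length fs. fs!i * (dinv (tf v (fs!i) (fs!i)) * tf v (fs!i) x)))"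

lemma orthb_exists: assumes v: "v \<in> L" "v \<noteq> 0" shows "\<exists>fs. orthb v fs"
proof -
 obtain N where N: "\<And>xs. set xs \<subseteq> D ==> Findep xs ==> length xs \<le> N" using fd by auto
 have "\<exists>ys. (set ys \<subseteq> L \<and> (\<forall>i<length ys. \<forall>j<length ys. i \<noteq> j \<longrightarrow> tf v (ys!i) (ys!j) = 0)
  \<and> (\<forall>i<length ys. tf v (ys!i) (ys!i) \<noteq> 0)) \<and>
  (\<forall>x\<in>L. x = (\<Sum>i<length ys. ys!i * (FF.dinv (tf v (ys!i) (ys!i)) * tf v (ys!i) x)))"
 proof (rule FF.orth_basis_exists)
  show "\<exists>y\<in>L. tf v x y \<noteq> 0" if x: "x \<in> L" "x \<noteq> 0" for x
  proof -
   obtain z where z: "z \<in> L" "t z \<noteq> 0" using t_nz by auto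
   define y where "y = dinv (v * x) * z"
   have vx: "v * x \<in> L" "v * x \<noteq> 0" using L_mult L_nz v x by auto
   have "v * x * y = z" unfolding y_def using cancel1[OF L_D[OF vx(1)] vx(2) L_D[OF z(1)]] .
   moreover have "y \<in> L" unfolding y_def using vx z L_dinv L_mult by auto
   ultimately show ?thesis using z by (auto simp: tf_def)
  qed
  fix ys assume ys: "set ys \<subseteq> L \<and> (\<forall>i<length ys. \<forall>j<length ys. i \<noteq> j \<longrightarrow> tf v (ys!i) (ys!j) = 0)
    \<and> (\<forall>i<length ys. tf v (ys!i) (ys!i) \<noteq> 0)"
  have "Findep ys"
   unfolding Findep_def
  proof (intro allI impI)
   fix c j assume c: "\<forall>i<length ys. c i \<in> F" "(\<Sum>i<length ys. ys!i * c i) = 0" and j: "j < length ys"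
   have yL: "ys!i \<in> L" if "i < length ys" for i using ys that by auto
   have "0 = tf v (ys!j) (\<Sum>i<length ys. ys!i * c i)" using c tf_zero[OF v(1) yL[OF j]] by simp
   also have "\<dots> = (\<Sum>i<length ys. tf v (ys!j) (ys!i) * c i)"
    using c j yL by (subst tf_sum) (auto simp: v tf_mult L_mult F_L)
   also have "\<dots> = (\<Sum>i<length ys. if i = j then tf v (ys!j) (ys!j) * c j else 0)"
    by (rule sum.cong) (use ys j in auto)
   also have "\<dots> = tf v (ys!j) (ys!j) * c j" using j by simp
   finally show "c j = 0"
    using no_zero_div[of "tf v (ys!j) (ys!j)" "c j"] F_D tf_in[OF v(1) yL[OF j] yL[OF j]] c j ys by auto
  qed
  then show "length ys \<le> N" using N ys L_D by blast
 qed (use v two L_add L_mult F_L L_zero L_D e_right tf_in tf_add tf_mult tf_sym F_sym in auto)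
 then obtain ys where ys: "set ys \<subseteq> L" "\<forall>i<length ys. \<forall>j<length ys. i \<noteq> j \<longrightarrow> tf v (ys!i) (ys!j) = 0"
  "\<forall>i<length ys. tf v (ys!i) (ys!i) \<noteq> 0"
  "\<forall>x\<in>L. x = (\<Sum>i<length ys. ys!i * (FF.dinv (tf v (ys!i) (ys!i)) * tf v (ys!i) x))" by blast
 have "FF.dinv (tf v (ys!i) (ys!i)) = dinv (tf v (ys!i) (ys!i))" if "i < length ys" for i
  by (rule FF_dinv) (use ys v nth_mem[OF that] that tf_in in blast)+
 then have eq: "(\<Sum>i<length ys. ys!i * (FF.dinv (tf v (ys!i) (ys!i)) * tf v (ys!i) x))
   = (\<Sum>i<length ys. ys!i * (dinv (tf v (ys!i) (ys!i)) * tf v (ys!i) x))" for x by simp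
 have "\<forall>x\<in>L. x = (\<Sum>i<length ys. ys!i * (dinv (tf v (ys!i) (ys!i)) * tf v (ys!i) x))"
  by (rule ballI, rule trans[OF bspec[OF ys(4)] eq])
 with ys(1,2,3) have "orthb v ys" unfolding orthb_def by (intro conjI)
 then show ?thesis ..
qed

definition cf :: "'a \<Rightarrow> 'a list \<Rightarrow> nat \<Rightarrow> 'a \<Rightarrow> 'a" where
 "cf v fs i x = dinv (tf v (fs!i) (fs!i)) * tf v (fs!i) x"

lemma orthbD:
 assumes "orthb v fs" "v \<in> L"
 shows "i < length fs ==> fs!i \<in> L" "i < length fs ==> j < length fs ==> i \<noteq> j ==> tf v (fs!i) (fs!j) = 0"
  "i < length fs ==> tf v (fs!i) (fs!i) \<noteq> 0" "i < length fs ==> tf v (fs!i) (fs!i) \<in> F"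
  "x \<in> L ==> x = (\<Sum>i<length fs. fs!i * cf v fs i x)"
  "i < length fs ==> x \<in> L ==> cf v fs i x \<in> F"
proof -
 have fL: "fs!i \<in> L" if "i < length fs" for i using assms(1) that unfolding orthb_def by (meson nth_mem subsetD)
 then have tF: "tf v (fs!i) x \<in> F" if "i < length fs" "x \<in> L" for i x using tf_in assms(2) that by blast
 show "i < length fs ==> fs!i \<in> L" "i < length fs ==> tf v (fs!i) (fs!i) \<in> F" using fL tF by blast+
 show n0: "tf v (fs!i) (fs!i) \<noteq> 0" if "i < length fs" for i using assms(1) that unfolding orthb_def by blast
 show "i < length fs ==> x \<in> L ==> cf v fs i x \<in> F"
  unfolding cf_def using fL tF n0 F_dinv F_mult by blast
 show "i < length fs ==> j < length fs ==> i \<noteq> j ==> tf v (fs!i) (fs!j) = 0"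
  using assms(1) unfolding orthb_def by blast
 show "x \<in> L ==> x = (\<Sum>i<length fs. fs!i * cf v fs i x)"
  using assms(1) unfolding orthb_def cf_def by blast
qed

lemma tf_comb:
 assumes o: "orthb v fs" "v \<in> L" and c: "\<And>i. i < length fs ==> c i \<in> F" and j: "j < length fs"
 shows "tf v (fs!j) (\<Sum>i<length fs. fs!i * c i) = tf v (fs!j) (fs!j) * c j"
proof -
 note D = orthbD[OF o]
 have "tf v (fs!j) (\<Sum>i<length fs. fs!i * c i) = (\<Sum>i<length fs. tf v (fs!j) (fs!i) * c i)"
  using c j D(1) by (subst tf_sum) (auto simp: o tf_mult L_mult F_L)
 also have "\<dots> = (\<Sum>i<length fs. if i = j then tf v (fs!j) (fs!j) * c j else 0)"
  by (rule sum.cong) (use D(2) j in auto)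
 also have "\<dots> = tf v (fs!j) (fs!j) * c j" using j by simp
 finally show ?thesis .
qed

lemma cf_comb:
 assumes o: "orthb v fs" "v \<in> L" and c: "\<And>i. i < length fs ==> c i \<in> F" and j: "j < length fs"
 shows "cf v fs j (\<Sum>i<length fs. fs!i * c i) = c j"
 unfolding cf_def using tf_comb[OF o c j] cancel2 orthbD[OF o] F_D c j by simp

text \<open>Coordinates with respect to \<open>gs\<close> separate the coefficient vectors of
  \<open>fs\<close>. Thus all entries of a form over \<open>L\<close> have transfers of the same
  size, which the dimension count for transferred Lagrangians needs.\<close>

lemma orthb_length:
 assumes o: "orthb v fs" "v \<in> L" and o': "orthb w gs" "w \<in> L"
 shows "length fs \<le> length gs"
proof -
 define x where "x = (\<lambda>u. \<Sum>i<length fs. fs!i * u i)"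
 have uF: "u i \<in> F" if "u \<in> FF.full {..<length fs}" for u and i :: nat using that by (auto simp: FF.full_def)
 have xL: "x u \<in> L" if "u \<in> FF.full {..<length fs}" for u
  unfolding x_def by (rule L_sum) (use orthbD[OF o] F_L uF[OF that] L_mult in auto)
 show ?thesis
 proof (rule FF.dim_le[where f = "\<lambda>u j. cf w gs j (x u)"])
  fix j assume j: "j < length gs"
  have cfa: "cf w gs j (y + z) = cf w gs j y + cf w gs j z" if "y \<in> L" "z \<in> L" for y z
   using that orthbD[OF o'] j by (simp add: cf_def tf_add o' distrib_left)
  have cfm: "cf w gs j (y * c) = cf w gs j y * c" if "y \<in> L" "c \<in> F" for y c
   using that orthbD[OF o'] j by (simp add: cf_def tf_mult o' mult.assoc)
  have "x (\<lambda>i. u i + v i) = x u + x v" for u v by (simp add: x_def distrib_left sum.distrib)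
  moreover have "x (\<lambda>i. u i * c) = x u * c" for u c by (simp add: x_def sum_distrib_right mult.assoc)
  ultimately show "FF.rlin (FF.full {..<length fs}) (\<lambda>u. cf w gs j (x u))"
   using xL cfa cfm orthbD(6)[OF o' j] by (auto simp: FF.rlin_def)
 next
  fix u i assume u: "u \<in> FF.full {..<length fs}" and z: "\<And>j. j < length gs ==> cf w gs j (x u) = 0"
  have "x u = (\<Sum>j<length gs. gs!j * cf w gs j (x u))" by (rule orthbD(5)[OF o' xL[OF u]])
  also have "\<dots> = 0" using z by simp
  finally have x0: "x u = 0" .
  show "u i = 0"
  proof (cases "i < length fs")
   case True
   have "u i = cf v fs i (x u)" unfolding x_def using cf_comb[OF o _ True, of u] uF[OF u] by simp
   also have "\<dots> = 0" using x0 tf_zero orthbD[OF o] True o by (simp add: cf_def)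
   finally show ?thesis .
  qed (use u in \<open>auto simp: FF.full_def\<close>)
 qed
qed

definition vals :: "'a \<Rightarrow> 'a list \<Rightarrow> 'a multiset" where
 "vals v fs = mset (map (\<lambda>f. tf v f f) fs)"

text \<open>One diagonalisation of the transfer of \<langle>v\<rangle>; signatures do not depend on
  the choice, by \<open>sg_any\<close>.\<close>

definition dg :: "'a \<Rightarrow> 'a multiset" where "dg v = vals v (SOME fs. orthb v fs)"

lemma mset_set_Sigma:
 assumes "finite I" "\<And>i. i \<in> I ==> finite (J i)"
 shows "image_mset (\<lambda>(i, j). d i j) (mset_set (Sigma I J)) = (\<Sum>i\<in>#mset_set I. image_mset (d i) (mset_set (J i)))"
 using assms
proof (induction I)
 case (insert i I)
 have "Sigma (insert i I) J = Pair i ` J i \<union> Sigma I J" by auto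
 moreover have "Pair i ` J i \<inter> Sigma I J = {}" using insert by auto
 ultimately have "mset_set (Sigma (insert i I) J) = image_mset (Pair i) (mset_set (J i)) + mset_set (Sigma I J)"
  using insert by (subst image_mset_mset_set) (auto simp: mset_set_Union inj_on_def)
 then show ?case using insert by (simp add: image_mset_comp)
qed auto

text \<open>Restriction of scalars multiplies both the size of the form and the dimension of the
  Lagrangian by \<open>k\<close>, and applying \<open>t\<close> to a vanishing form gives zero. The
  basis \<open>fs i\<close> may vary with the entry.\<close>

lemma transfer_lagr:
 fixes I :: "nat set"
 assumes lag: "LL.lagr I d U" and dL: "\<And>i. i \<in> I ==> d i \<in> L"
  and o: "\<And>i. i \<in> I ==> orthb (d i) (fs i)"
 shows "FF.metab (\<Sum>i\<in>#mset_set I. vals (d i) (fs i))"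
proof -
 have fin: "finite I" and sub: "LL.rsub U" and supp: "\<And>u i. u \<in> U ==> i \<notin> I ==> u i = 0"
  and iso: "\<And>u v. u \<in> U ==> v \<in> U ==> LL.hf I d u v = 0"
  using lag by (auto simp: LL.lagr_def)
 obtain n where n: "card I = 2 * n" "dimge n U" using lag by (auto simp: LL.lagr_def)
 obtain k where k: "\<And>i. i \<in> I ==> length (fs i) = k"
 proof (cases "I = {}")
  case False
  then obtain i where i: "i \<in> I" by auto
  show ?thesis
  proof (rule that)
   fix j assume j: "j \<in> I"
   show "length (fs j) = length (fs i)"
    using orthb_length[OF o[OF i] dL[OF i] o[OF j] dL[OF j]] orthb_length[OF o[OF j] dL[OF j] o[OF i] dL[OF i]]
    by simp
  qed
 qed (use that in auto)
 define S where "S = I \<times> {..<k}"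
 define g where "g = (\<lambda>(a::nat \<times> nat \<Rightarrow> 'a) i. if i \<in> I then \<Sum>j<k. fs i ! j * a (i, j) else 0)"
 define T where "T = (\<lambda>U. {a \<in> FF.full S. g a \<in> U})"
 have fsL: "fs i ! j \<in> L" if "i \<in> I" "j < k" for i j using orthbD(1)[OF o[OF that(1)] dL[OF that(1)]] that k by auto
 have aF: "a p \<in> F" if "a \<in> FF.full S" for a p using that unfolding FF.full_def by blast
 have gL: "g a i \<in> L" if "a \<in> FF.full S" for a i
  using fsL F_L[OF aF[OF that]] by (auto simp: g_def L_zero intro!: L_sum L_mult)
 have gadd: "g (\<lambda>p. a p + b p) = (\<lambda>i. g a i + g b i)" for a b
  by (auto simp: g_def fun_eq_iff distrib_left sum.distrib)
 have gmult: "g (\<lambda>p. a p * c) = (\<lambda>i. g a i * c)" for a c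
  by (auto simp: g_def fun_eq_iff sum_distrib_right mult.assoc)
 have g0: "g (\<lambda>_. 0) = (\<lambda>_. 0)" by (auto simp: g_def fun_eq_iff)
 have Tsub: "FF.rsub (T U)" if "LL.rsub U" for U
  using LL.rsubD[OF that] FF.rsubD[OF FF.rsub_full[of S]] F_L
  by (auto simp: FF.rsub_def T_def gadd gmult g0)
 \<comment> \<open>One pivot over \<open>L\<close> yields \<open>k\<close> pivots over
   \<open>F\<close>: on the multiples of the pivot vector \<open>w\<close> the pivot coordinate
   takes every value in \<open>L\<close>.\<close>
 have Tdim: "dimge (n * k) (T U)" if "dimge n U" "LL.rsub U" "\<And>u i. u \<in> U ==> i \<notin> I ==> u i = 0" for n U
  using that
 proof (induction n arbitrary: U)
  case (Suc n)
  obtain i w where i: "w \<in> U" "w i \<noteq> 0" "dimge n {u\<in>U. u i = 0}" using Suc.prems by auto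
  have iI: "i \<in> I" using Suc.prems(3) i by blast
  have wL: "w i \<in> L" using LL.rsubD[OF Suc.prems(2)] i by auto
  note oi = o[OF iI] dL[OF iI]
  have IH: "dimge (n * k) (T {u\<in>U. u i = 0})"
   by (rule Suc.IH[OF i(3) LL.rsub_ker[OF Suc.prems(2) LL.rlin_coord[OF Suc.prems(2)]]])
    (use Suc.prems in auto)
  have "dimge (card ({i} \<times> {..<k}) + n * k) (T U)"
  proof (rule FF.dimge_proj)
   fix x :: "nat \<times> nat \<Rightarrow> 'a" assume x: "\<And>j. j \<in> {i} \<times> {..<k} ==> x j \<in> F"
   define l where "l = (\<Sum>j<k. fs i ! j * x (i, j))"
   have lL: "l \<in> L" unfolding l_def using F_L[OF x] fsL[OF iI] by (auto intro!: L_sum L_mult)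
   define u where "u = (\<lambda>k. w k * (dinv (w i) * l))"
   have uU: "u \<in> U" unfolding u_def using LL.rsubD(4)[OF Suc.prems(2) i(1)] L_mult L_dinv wL i lL by auto
   have ui: "u i = l" unfolding u_def using cancel1[OF L_D[OF wL] i(2) L_D[OF lL]] .
   have uL: "u m \<in> L" for m using LL.rsubD[OF Suc.prems(2)] uU by auto
   define a where "a = (\<lambda>(m, j). if m \<in> I \<and> j < k then cf (d m) (fs m) j (u m) else 0)"
   have "a \<in> FF.full S"
    using orthbD(6)[OF o dL] k uL by (auto simp: FF.full_def a_def S_def F_zero)
   moreover have "g a = u"
   proof
    fix m show "g a m = u m"
     using orthbD(5)[OF o dL uL, of m m] k[of m] Suc.prems(3)[OF uU, of m] by (auto simp: g_def a_def)
   qed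
   ultimately have "a \<in> T U" using uU by (simp add: T_def)
   moreover have "a (i, j) = x (i, j)" if "j < k" for j
    unfolding a_def using cf_comb[OF oi, of "\<lambda>j. x (i, j)" j] x k[OF iI] that iI by (simp add: ui l_def)
   ultimately show "\<exists>u\<in>T U. \<forall>j\<in>{i} \<times> {..<k}. u j = x j" by (intro bexI[of _ a]) auto
  next
   have "T {u\<in>U. u i = 0} \<subseteq> {u \<in> T U. \<forall>j\<in>{i} \<times> {..<k}. u j = 0}"
   proof
    fix a assume "a \<in> T {u\<in>U. u i = 0}"
    then have a: "a \<in> FF.full S" "g a \<in> U" "g a i = 0" by (auto simp: T_def)
    have "a (i, j) = 0" if j: "j < k" for j
    proof -
     have "a (i, j) = cf (d i) (fs i) j (\<Sum>j<length (fs i). fs i ! j * a (i, j))"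
      by (rule cf_comb[OF oi, symmetric]) (use j k[OF iI] aF[OF a(1)] in auto)
     also have "(\<Sum>j<length (fs i). fs i ! j * a (i, j)) = 0" using a(3) iI k[OF iI] by (simp add: g_def)
     also have "cf (d i) (fs i) j 0 = 0" using tf_zero fsL[OF iI j] oi by (simp add: cf_def)
     finally show ?thesis .
    qed
    then show "a \<in> {u \<in> T U. \<forall>j\<in>{i} \<times> {..<k}. u j = 0}" using a by (auto simp: T_def)
   qed
   then show "dimge (n * k) {u \<in> T U. \<forall>j\<in>{i} \<times> {..<k}. u j = 0}" using IH dimge_mono by blast
  qed auto
  then show ?case by simp
 qed simp
 define c where "c = (\<lambda>i j. tf (d i) (fs i ! j) (fs i ! j))"
 have cF: "c i j \<in> F" if "i \<in> I" "j < k" for i j using orthbD(4)[OF o[OF that(1)] dL[OF that(1)]] that k by (auto simp: c_def)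
 have form: "FF.hf S (\<lambda>(i, j). c i j) a b = t (LL.hf I d (g a) (g b))" if a: "a \<in> FF.full S" and b: "b \<in> FF.full S" for a b
 proof -
  have "t (LL.hf I d (g a) (g b)) = (\<Sum>i\<in>I. t (\<sigma> (g a i) * d i * g b i))"
   unfolding LL.hf_def using gL[OF a] gL[OF b] dL L_sym by (subst t_sum) (auto intro!: L_mult)
  also have "\<dots> = (\<Sum>i\<in>I. \<Sum>j<k. \<sigma> (a (i, j)) * c i j * b (i, j))"
  proof (rule sum.cong[OF refl])
   fix i assume i: "i \<in> I"
   note oi = o[OF i] dL[OF i]
   have "t (\<sigma> (g a i) * d i * g b i) = tf (d i) (g a i) (g b i)"
    using gL[OF a] dL[OF i] L_comm L_sym by (simp add: tf_def)
   also have "\<dots> = tf (d i) (\<Sum>j<k. fs i ! j * a (i, j)) (g b i)" using i by (simp add: g_def)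
   also have "\<dots> = tf (d i) (g b i) (\<Sum>j<k. fs i ! j * a (i, j))"
    by (rule tf_sym) (use gL[OF b] dL[OF i] fsL[OF i] F_L[OF aF[OF a]] in \<open>auto intro!: L_sum L_mult\<close>)
   also have "\<dots> = (\<Sum>j<k. tf (d i) (g b i) (fs i ! j) * a (i, j))"
    using gL[OF b] dL[OF i] fsL[OF i] aF[OF a] by (subst tf_sum) (auto simp: tf_mult F_L L_mult)
   also have "\<dots> = (\<Sum>j<k. \<sigma> (a (i, j)) * c i j * b (i, j))"
   proof (rule sum.cong[OF refl])
    fix j assume "j \<in> {..<k}"
    then have j: "j < k" by simp
    have "tf (d i) (g b i) (fs i ! j) = tf (d i) (fs i ! j) (g b i)"
     by (rule tf_sym) (use gL[OF b] dL[OF i] fsL[OF i j] in auto)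
    also have "\<dots> = tf (d i) (fs i ! j) (\<Sum>j<length (fs i). fs i ! j * b (i, j))"
     using i k[OF i] by (simp add: g_def)
    also have "\<dots> = c i j * b (i, j)"
     unfolding c_def by (rule tf_comb[OF oi]) (use j k[OF i] aF[OF b] in auto)
    finally have "tf (d i) (g b i) (fs i ! j) = c i j * b (i, j)" .
    then show "tf (d i) (g b i) (fs i ! j) * a (i, j) = \<sigma> (a (i, j)) * c i j * b (i, j)"
     using F_sym[OF aF[OF a]] F_central[OF aF[OF a] F_D[OF F_mult[OF cF[OF i j] aF[OF b]]]]
     by (simp add: mult.assoc)
   qed
   finally show "t (\<sigma> (g a i) * d i * g b i) = (\<Sum>j<k. \<sigma> (a (i, j)) * c i j * b (i, j))" .
  qed
  also have "\<dots> = FF.hf S (\<lambda>(i, j). c i j) a b"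
   unfolding FF.hf_def S_def using fin by (simp add: sum.cartesian_product split_def)
  finally show ?thesis by simp
 qed
 have "FF.lagr S (\<lambda>(i, j). c i j) (T U)"
 proof (rule FF.lagrI)
  show "dimge (n * k) (T U)" by (rule Tdim[OF n(2) sub]) (rule supp)
  show "card S = 2 * (n * k)" using n by (simp add: S_def card_cartesian_product)
 qed (use fin Tsub[OF sub] form iso t_zero in \<open>auto simp: S_def T_def FF.full_def\<close>)
 from FF.metabI[OF this] have "FF.metab (\<Sum>i\<in>#mset_set I. image_mset (c i) (mset_set {..<k}))"
  unfolding S_def using fin by (simp add: mset_set_Sigma)
 moreover have "image_mset (c i) (mset_set {..<k}) = vals (d i) (fs i)" if "i \<in> I" for i
 proof -
  have "mset (map (\<lambda>f. tf (d i) f f) (fs i)) = image_mset (\<lambda>f. tf (d i) f f) (mset (fs i))" by simp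
  also have "mset (fs i) = image_mset ((!) (fs i)) (mset_set {..<k})"
   using k[OF that] by (metis atLeast0LessThan map_nth mset_map mset_upt)
  finally show ?thesis by (simp add: vals_def c_def image_mset_comp)
 qed
 ultimately show ?thesis using fin by (metis (mono_tags, lifting) finite_set_mset_mset_set image_mset_cong)
qed

end

section \<open>Transferred signatures and orderings of the subfield\<close>

context sym_ext
begin

lemma dg_orth: assumes "v \<in> L" "v \<noteq> 0" shows "\<exists>fs. orthb v fs \<and> dg v = vals v fs"
 using someI_ex[OF orthb_exists[OF assms]] unfolding dg_def by blast

lemma vals_F: assumes "orthb v fs" "v \<in> L" shows "(vals v fs) inside F - {0}"
 using orthbD(3,4)[OF assms] by (auto simp: vals_def in_set_conv_nth)

lemma dg_F: assumes "v \<in> L" "v \<noteq> 0" shows "(dg v) inside F - {0}"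
 using dg_orth[OF assms] vals_F assms by metis

lemma transfer_metab:
 assumes "LL.metab K" "K inside L" "\<And>x. x \<in># K ==> orthb x (f x)"
 shows "FF.metab (\<Sum>x\<in>#K. vals x (f x))"
proof -
 obtain I d U where K: "K = image_mset d (mset_set I)" "LL.lagr (I::nat set) d U"
  using assms by (auto simp: LL.metab_def)
 have fin: "finite I" using K by (auto simp: LL.lagr_def)
 have "FF.metab (\<Sum>i\<in>#mset_set I. vals (d i) (f (d i)))"
  by (rule transfer_lagr[OF K(2)]) (use assms K fin in auto)
 then show ?thesis by (simp add: K image_mset_comp)
qed

lemma orthb_scale:
 assumes o: "orthb v fs" "v \<in> L" and c: "c \<in> F" "c \<noteq> 0"
 shows "orthb (c * v) fs" "vals (c * v) fs = scl c (vals v fs)"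
proof -
 note D = orthbD[OF o]
 have tfc: "tf (c * v) x y = c * tf v x y" if "x \<in> L" "y \<in> L" for x y
  using tf_scale[OF o(2) c(1) that] .
 have cfc: "dinv (c * tf v (fs!i) (fs!i)) * (c * tf v (fs!i) x) = cf v fs i x" if "i < length fs" "x \<in> L" for i x
 proof -
  define a where "a = tf v (fs!i) (fs!i)"
  define b where "b = tf v (fs!i) x"
  have ab: "a \<in> F" "a \<noteq> 0" "b \<in> F" using D that tf_in o by (auto simp: a_def b_def)
  have ca: "c * a \<in> D" "c * a \<noteq> 0" using c ab F_D F_mult F_mult_nz by auto
  have "dinv (c * a) * (c * b) = dinv (c * a) * (c * a * (dinv a * b))"
   using cancel1[of a b] ab F_D by (simp add: mult.assoc)
  also have "\<dots> = dinv a * b" by (rule cancel2[OF ca]) (use ab F_D D_mult dinv in auto)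
  finally show ?thesis by (simp add: a_def b_def cf_def)
 qed
 have "x = (\<Sum>i<length fs. fs!i * (dinv (tf (c * v) (fs!i) (fs!i)) * tf (c * v) (fs!i) x))" if "x \<in> L" for x
  using D(5)[OF that] cfc tfc D(1) that by simp
 moreover have "tf (c * v) (fs!i) (fs!j) = 0" if "i < length fs" "j < length fs" "i \<noteq> j" for i j
  using D that tfc by auto
 moreover have "tf (c * v) (fs!i) (fs!i) \<noteq> 0" if "i < length fs" for i
  using D that tfc F_mult_nz c by auto
 ultimately show "orthb (c * v) fs" using o(1) unfolding orthb_def by blast
 have fsL: "f \<in> L" if "f \<in> set fs" for f using D(1) that by (metis in_set_conv_nth)
 show "vals (c * v) fs = scl c (vals v fs)"
  unfolding vals_def using tfc fsL by (auto simp: image_mset_comp intro!: image_mset_cong)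
qed

definition sg :: "'a set \<Rightarrow> 'a \<Rightarrow> int" where "sg P v = (\<Sum>c\<in>#dg v. sgnP P c)"

lemma sum_mset_sum_mset: "(\<Sum>c\<in>#(\<Sum>x\<in>#K. g x). h c) = (\<Sum>x\<in>#K. \<Sum>c\<in>#g x. h c)"
 for g :: "'b \<Rightarrow> 'c multiset" and h :: "'c \<Rightarrow> int"
 by (induction K) auto

text \<open>The Pfister form over \<open>L\<close> with slots \<open>gs\<close>.\<close>

primrec pf :: "'a list \<Rightarrow> 'a multiset" where
 "pf [] = {#e#}"
| "pf (g # gs) = pf gs + scl g (pf gs)"

lemma pf_in: assumes "LL.mclosed S" "set gs \<subseteq> S" shows "(pf gs) inside S"
 using assms(2) assms(1) by (induction gs) (auto simp: LL.mclosed_def)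

lemma pf_nonempty: "pf gs \<noteq> {#}" by (induction gs) auto

lemma LHs: "v \<in> L ==> v \<noteq> 0 ==> v \<in> LL.Hs" by (rule LL.F_Hs)

context
 fixes P assumes P: "fordering F P"
begin

lemma sum_vals_metab:
 assumes "LL.metab K" "K inside L - {0}" "\<And>x. x \<in># K ==> orthb x (f x)"
 shows "(\<Sum>x\<in>#K. \<Sum>c\<in>#vals x (f x). sgnP P c) = 0"
proof -
 have "(\<Sum>c\<in>#(\<Sum>x\<in>#K. vals x (f x)). sgnP P c) = 0"
 proof (rule inertia[OF P])
  show "FF.metab (\<Sum>x\<in>#K. vals x (f x))" by (rule transfer_metab) (use assms in auto)
  show "(\<Sum>x\<in>#K. vals x (f x)) inside F - {0}"
   using assms(2,3)
  proof (induction K)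
   case (add k K)
   then have "(vals k (f k)) inside F - {0}" using vals_F[of k "f k"] by auto
   then show ?case using add by auto
  qed auto
 qed
 then show ?thesis by (simp add: sum_mset_sum_mset)
qed

lemma sg_metab: assumes "LL.metab K" "K inside L - {0}" shows "(\<Sum>x\<in>#K. sg P x) = 0"
proof -
 define f where "f = (\<lambda>x. SOME fs. orthb x fs)"
 have "orthb x (f x)" if "x \<in># K" for x unfolding f_def using someI_ex[OF orthb_exists[of x]] assms(2) that by auto
 from sum_vals_metab[OF assms this] show ?thesis by (simp add: sg_def dg_def f_def)
qed

lemma L_neg_nz: "v \<in> L ==> v \<noteq> 0 ==> v \<noteq> - v"
proof
 assume v: "v \<in> L" "v \<noteq> 0" "v = - v"
 then have "v + v = 0" by (metis add.right_inverse)
 then have "(e + e) * v = 0" using e_left L_D v by (simp add: distrib_right)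
 then show False using no_zero_div[of "e + e" v] two D_add e_in L_D v by auto
qed

lemma sgn_neg_sum: "M inside F - {0} ==> (\<Sum>c\<in>#neg M. sgnP P c) = - (\<Sum>c\<in>#M. sgnP P c)"
 using sgnP_uminus[OF P] by (induction M) auto

text \<open>In the metabolic form \<open>{#v, - v#}\<close> the two entries may be given unrelated
  bases: \<open>fs\<close> for \<open>v\<close> and the chosen one for \<open>- v\<close>. The
  vanishing of the total signature compares the two.\<close>

lemma sg_any: assumes o: "orthb v fs" and v: "v \<in> L" "v \<noteq> 0" shows "(\<Sum>c\<in>#vals v fs. sgnP P c) = sg P v"
proof -
 obtain gs where gs: "orthb v gs" "dg v = vals v gs" using dg_orth[OF v] by auto
 have mv: "- e * v = - v" using e_left L_D v by simp
 have gs': "orthb (- v) gs" "vals (- v) gs = neg (vals v gs)"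
 proof -
  have eF: "- e \<in> F" "- e \<noteq> 0" using F_uminus F_e e_nz by auto
  have "scl (- e) (vals v gs) = neg (vals v gs)"
   by (rule image_mset_cong) (use vals_F[OF gs(1) v(1)] e_left F_D in auto)
  then show "orthb (- v) gs" "vals (- v) gs = neg (vals v gs)"
   using orthb_scale[OF gs(1) v(1) eF] mv by auto
 qed
 have m: "LL.metab {#v, - v#}" using LL.witt_refl[of "{#v#}"] v by (simp add: LL.witt_def add_mset_commute)
 have "(\<Sum>x\<in>#{#v, - v#}. \<Sum>c\<in>#vals x ((\<lambda>x. if x = v then fs else gs) x). sgnP P c) = 0"
  by (rule sum_vals_metab[OF m]) (use v o gs' L_uminus L_neg_nz[OF v] in auto)
 then have "(\<Sum>c\<in>#vals v fs. sgnP P c) + (\<Sum>c\<in>#vals (- v) gs. sgnP P c) = 0"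
  using L_neg_nz[OF v] by auto
 then show ?thesis using sgn_neg_sum[OF vals_F[OF gs(1) v(1)]] gs gs'(2) by (simp add: sg_def)
qed

lemma sg_scale: assumes p: "p \<in> P" "p \<noteq> 0" and v: "v \<in> L" "v \<noteq> 0" shows "sg P (p * v) = sg P v"
proof -
 have pF: "p \<in> F" using p P_props[OF P] by auto
 obtain gs where gs: "orthb v gs" "dg v = vals v gs" using dg_orth[OF v] by auto
 have pv: "p * v \<in> L" "p * v \<noteq> 0" using pF F_L L_mult L_nz p v by auto
 have "sg P (p * v) = (\<Sum>c\<in>#scl p (vals v gs). sgnP P c)"
  using sg_any[OF orthb_scale(1)[OF gs(1) v(1) pF p(2)] pv] orthb_scale(2)[OF gs(1) v(1) pF p(2)] by simp
 also have "\<dots> = (\<Sum>c\<in>#vals v gs. sgnP P c)"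
  using sgnP_mult[OF P _ _ p] vals_F[OF gs(1) v(1)]
  by (auto simp: image_mset_comp intro!: arg_cong[of _ _ sum_mset] image_mset_cong)
 finally show ?thesis by (simp add: sg_def gs)
qed

lemma sg_uminus: assumes v: "v \<in> L" "v \<noteq> 0" shows "sg P (- v) = - sg P v"
 using sg_metab[of "{#v, - v#}"] LL.witt_refl[of "{#v#}"] v L_uminus
 by (auto simp: LL.witt_def add_mset_commute)

text \<open>\<open>ordering_avoiding\<close> over \<open>L\<close>, for the property that every
  multiple of \<open>K\<close> by a nonzero \<open>l\<close> has transferred signature zero.
  Quantifying over \<open>l\<close> makes the property stable under scaling; the price is that an
  offending \<open>l\<close> must later be turned into a slot of the Pfister form.\<close>

lemma visible_ordering:
 assumes v0: "v0 \<in> L" "v0 \<noteq> 0" "sg P v0 \<noteq> 0"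
 shows "\<exists>Q. fordering L Q \<and> P \<subseteq> Q \<and> (\<forall>G. finite G \<longrightarrow> G \<subseteq> Q - {0} \<longrightarrow>
   (\<exists>gs. set gs \<subseteq> Q - {0} \<and> G \<subseteq> set gs \<and> (\<Sum>v\<in>#pf gs. sg P v) \<noteq> 0))"
proof -
 define N where "N = (\<lambda>K. \<forall>l\<in>L-{0}. (\<Sum>k\<in>#K. sg P (l * k)) = 0)"
 have LL0: "l * k \<in> L - {0}" if "l \<in> L - {0}" "k \<in> L - {0}" for l k using that L_mult L_nz by auto
 have PL: "P - {0} \<subseteq> L - {0}" using P_props[OF P] F_L by auto
 have "\<exists>Q. fordering L Q \<and> P - {0} \<subseteq> Q \<and> (\<forall>K. K \<noteq> {#} \<longrightarrow> K inside Q - {0} \<longrightarrow> \<not> N K)"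
 proof (rule LL.ordering_avoiding)
  show "LL.mclosed (P - {0})" using P_mclosed[OF P] PL by (auto simp: mclosed_def LL.mclosed_def)
  show "\<not> N K" if K: "K \<noteq> {#}" "K inside P - {0}" for K
  proof -
   have "(\<Sum>k\<in>#K. sg P (v0 * k)) = int (size K) * sg P v0"
    using K(2)
   proof (induction K)
    case (add k K)
    then have k: "k \<in> P" "k \<noteq> 0" by auto
    then have "v0 * k = k * v0" using L_comm v0 PL by auto
    then show ?case using add sg_scale[OF k v0(1,2)] by (simp add: algebra_simps)
   qed auto
   then show ?thesis using v0 K e_in unfolding N_def by (metis DiffI mult_eq_0_iff of_nat_eq_0_iff singletonD size_eq_0_iff_empty)
  qed
  show "N (K + K')" if "N K" "N K'" for K K' using that by (auto simp: N_def)
  have pair: "sg P (l * x) + sg P (l * - x) = 0" if "l \<in> L - {0}" "x \<in> L" "x \<noteq> 0" for l x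
   using sg_uminus[of "l * x"] LL0[of l x] that by auto
  show "N K" if "N (K + {#x, - x#})" "x \<in> L" "x \<noteq> 0" for K x
   unfolding N_def
  proof
   fix l assume l: "l \<in> L - {0}"
   have "(\<Sum>k\<in>#K + {#x, - x#}. sg P (l * k)) = 0" using that(1) l unfolding N_def by blast
   then show "(\<Sum>k\<in>#K. sg P (l * k)) = 0" using pair[OF l that(2,3)] by simp
  qed
  show "N {#x, - x#}" if "x \<in> L" "x \<noteq> 0" for x
   using that pair by (auto simp: N_def)
  show "N (scl x K)" if "x \<in> L" "x \<noteq> 0" "N K" for K x
   using that LL0[of _ x] by (auto simp: N_def image_mset_comp mult.assoc[symmetric])
  show "N {#x * (z * z), - x#}" if x: "x \<in> L" "x \<noteq> 0" "z \<in> L" "z \<noteq> 0" for x z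
   unfolding N_def
  proof
   fix l assume l: "l \<in> L - {0}"
   have lx: "l * x \<in> L" "l * x \<noteq> 0" using LL0[OF l, of x] x by auto
   have zz: "l * x * (z * z) \<in> L - {0}" using LL0 lx x by auto
   have "LL.witt {#l * x * (z * z)#} {#l * x#}"
    by (rule LL.witt_conj_comm) (use lx x L_sym L_comm in auto)
   then have "LL.metab {#l * x * (z * z), - (l * x)#}" by (simp add: LL.witt_def add_mset_commute)
   from sg_metab[OF this] show "(\<Sum>k\<in>#{#x * (z * z), - x#}. sg P (l * k)) = 0"
    using lx L_uminus zz by (simp add: mult.assoc)
  qed
  show "N {#x, y, - (x + y), - (x * LL.dinv (x + y) * y)#}"
   if x: "x \<in> L" "x \<noteq> 0" "y \<in> L" "y \<noteq> 0" "x + y \<noteq> 0" for x y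
   unfolding N_def
  proof
   fix l assume l: "l \<in> L - {0}"
   define z where "z = x * LL.dinv (x + y) * y"
   have xy: "x + y \<in> L" using L_add x by auto
   have z: "z \<in> L" "z \<noteq> 0"
    using x xy LL.dinv[OF xy x(5)] LL.dinv_nz[OF xy x(5)] L_mult L_nz by (auto simp: z_def)
   have c: "l * a = a * l" if "a \<in> L" for a using L_comm l that by auto
   have "LL.witt {#l * x, l * y#} {#l * (x + y), l * z#}"
    using LL.scale_binary[OF x(1,3,2,4,5) LHs[of l]] l c[OF x(1)] c[OF x(3)] c[OF xy] c[OF z(1)]
    by (simp add: z_def)
   moreover have "{#l * x, l * y#} + neg {#l * (x + y), l * z#} = {#l * x, l * y, - (l * (x + y)), - (l * z)#}"
    by (simp add: add_mset_commute)
   ultimately have m: "LL.metab {#l * x, l * y, - (l * (x + y)), - (l * z)#}"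
    unfolding LL.witt_def by metis
   have "{#l * x, l * y, - (l * (x + y)), - (l * z)#} inside L - {0}"
    using LL0[OF l] x xy z L_uminus by auto
   from sg_metab[OF m this]
   show "(\<Sum>k\<in>#{#x, y, - (x + y), - (x * LL.dinv (x + y) * y)#}. sg P (l * k)) = 0"
    by (simp add: z_def[symmetric] mult_minus_right del: minus_add_distrib mult_minus_right) (simp only: mult_minus_right)
  qed
 qed
 then obtain Q where Q: "fordering L Q" "P - {0} \<subseteq> Q" and nN: "\<And>K. K \<noteq> {#} ==> K inside Q - {0} ==> \<not> N K" by blast
 have QL: "Q \<subseteq> L" using LL.P_props[OF Q(1)] by auto
 have "\<exists>gs. set gs \<subseteq> Q - {0} \<and> G \<subseteq> set gs \<and> (\<Sum>v\<in>#pf gs. sg P v) \<noteq> 0"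
  if G: "finite G" "G \<subseteq> Q - {0}" for G
 proof -
  obtain gs where gs: "set gs = G" using finite_list[OF G(1)] by auto
  have pfQ: "(pf gs) inside Q - {0}" by (rule pf_in[OF LL.P_mclosed[OF Q(1)]]) (use gs G in auto)
  obtain l where l: "l \<in> L" "l \<noteq> 0" "(\<Sum>k\<in>#pf gs. sg P (l * k)) \<noteq> 0"
   using nN[OF pf_nonempty pfQ] by (auto simp: N_def)
  have "\<exists>m. m \<in> Q \<and> m \<noteq> 0 \<and> (\<Sum>k\<in>#pf gs. sg P (m * k)) \<noteq> 0"
  proof (cases "l \<in> Q")
   case False
   have "(\<Sum>k\<in>#pf gs. sg P ((- l) * k)) = - (\<Sum>k\<in>#pf gs. sg P (l * k))"
    using pfQ
   proof (induction "pf gs")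
    case empty
    then show ?case by simp
   next
    case (add x Xm)
    have "(\<Sum>k\<in>#Xm. sg P ((- l) * k)) = - (\<Sum>k\<in>#Xm. sg P (l * k))" if "Xm inside Q - {0}" for Xm
     using that
    proof (induction Xm)
     case (add k K)
     then have "k \<in> L" "k \<noteq> 0" using QL by auto
     then show ?case using add sg_uminus[of "l * k"] LL0[of l k] l by auto
    qed simp
    then show ?case using add.prems by blast
   qed
   then show ?thesis using LL.P_props(5)[OF Q(1), of l] l False by (intro exI[of _ "- l"]) auto
  qed (use l in auto)
  then obtain m where m: "m \<in> Q" "m \<noteq> 0" "(\<Sum>k\<in>#pf gs. sg P (m * k)) \<noteq> 0" by auto
  show ?thesis
  \<comment> \<open>If the form of \<open>gs\<close> has signature zero, the extra slot
    \<open>m\<close> adds exactly the nonzero sum over \<open>m * k\<close>.\<close>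
  proof (cases "(\<Sum>v\<in>#pf gs. sg P v) = 0")
   case True
   then show ?thesis using m gs G
    by (intro exI[of _ "m # gs"]) (auto simp: image_mset_comp)
  next
   case False
   then show ?thesis using gs G by auto
  qed
 qed
 moreover have "P \<subseteq> Q" using Q(2) LL.P_props(4)[OF Q(1)] by auto
 ultimately show ?thesis using Q(1) by blast
qed

end

end

section \<open>The centraliser of a maximal subfield of symmetric elements\<close>

locale sym_ext_max = sym_ext +
 assumes cen: "z \<in> D ==> (\<And>x. x \<in> D ==> z * x = x * z) ==> \<sigma> z = z ==> z \<in> F"
  and L_max: "z \<in> D ==> \<sigma> z = z ==> (\<And>l. l \<in> L ==> z * l = l * z) ==> z \<in> L"
begin

definition C :: "'a set" where "C = {x\<in>D. \<forall>l\<in>L. x * l = l * x}"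

lemma C_D: "x \<in> C ==> x \<in> D" by (simp add: C_def)
lemma C_L: "x \<in> C ==> l \<in> L ==> x * l = l * x" by (simp add: C_def)
lemma F_comm: "a \<in> F ==> x \<in> D ==> x * a = a * x" by (metis F_central)

lemma C_inv: "divinv C e \<sigma>"
proof
 fix x y assume x: "x \<in> C" and y: "y \<in> C"
 have "x * y * l = l * (x * y)" if "l \<in> L" for l
  using C_L[OF x that] C_L[OF y that] by (metis mult.assoc)
 then show "x * y \<in> C" using x y D_mult by (auto simp: C_def)
next
 fix x assume x: "x \<in> C" "x \<noteq> 0"
 have xD: "x \<in> D" using x C_D by auto
 have "dinv x * l = l * dinv x" if l: "l \<in> L" for l
 proof -
  have "dinv x * l = dinv x * (l * (x * dinv x))" using dinv[OF xD x(2)] e_right L_D[OF l] by simp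
  also have "\<dots> = dinv x * (x * (l * dinv x))" using C_L[OF x(1) l] by (metis mult.assoc)
  also have "\<dots> = l * dinv x" by (rule cancel2[OF xD x(2)]) (use D_mult dinv xD x L_D l in auto)
  finally show ?thesis .
 qed
 then have "dinv x \<in> C" using dinv[OF xD x(2)] by (auto simp: C_def)
 then show "\<exists>y\<in>C. x * y = e \<and> y * x = e" using dinv[OF xD x(2)] by auto
next
 fix x assume x: "x \<in> C"
 have "\<sigma> x * l = l * \<sigma> x" if l: "l \<in> L" for l
  using s_mult[of l x] s_mult[of x l] C_L[OF x l] L_sym[OF l] L_D[OF l] C_D[OF x] by simp
 then show "\<sigma> x \<in> C" using x s_in by (auto simp: C_def)
qed (auto simp: C_def D_add D_uminus e_in e_nz e_left e_right L_D distrib_left distrib_right s_add s_mult s_invol)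

sublocale CC: divinv C e \<sigma> by (rule C_inv)

lemma rlin_sum:
 assumes "\<And>i. i < (k::nat) ==> g i \<in> D" shows "rlin (full {..<n}) (\<lambda>u. \<Sum>i<k. g i * u i)"
 using assms by (auto simp: rlin_def full_def distrib_left sum.distrib sum_distrib_right mult.assoc intro!: D_sum D_mult)

text \<open>A shortest relation can be normalised so that its coefficients are central.\<close>

lemma faithful:
 fixes k :: nat
 assumes ind: "\<And>a. (\<And>i. i < k ==> a i \<in> F) ==> (\<Sum>i<k. f i * a i) = 0 ==> (\<And>i. i < k ==> a i = 0)"
  and fL: "\<And>i. i < k ==> f i \<in> L"
  and z: "\<And>i. i < k ==> z i \<in> D" "\<And>y. y \<in> D ==> (\<Sum>i<k. f i * y * z i) = 0"
 shows "\<forall>i<k. z i = 0"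
 using z
proof (induction "card {i. i < k \<and> z i \<noteq> 0}" arbitrary: z rule: less_induct)
 case less
 show ?case
 proof (rule ccontr)
  assume "\<not> ?thesis"
  then obtain p where p: "p < k" "z p \<noteq> 0" by auto
  define q where "q = dinv (z p)"
  have q: "q \<in> D" "q \<noteq> 0" "z p * q = e" using dinv[of "z p"] dinv_nz[of "z p"] less.prems(1) p by (auto simp: q_def)
  define z' where "z' = (\<lambda>i. z i * q)"
  have z'D: "z' i \<in> D" if "i < k" for i using less.prems(1)[OF that] q D_mult by (auto simp: z'_def)
  have rel: "(\<Sum>i<k. f i * y * z' i) = 0" if "y \<in> D" for y
   using less.prems(2)[OF that] by (simp add: z'_def mult.assoc[symmetric] sum_distrib_right[symmetric])
  have comm: "c * z' i = z' i * c" if c: "c \<in> D" and i: "i < k" for c i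
  proof -
   \<comment> \<open>The commutators with \<open>c\<close> satisfy the same kind of relation, but
     with smaller support, because \<open>z' p = e\<close> commutes with everything in
     \<open>D\<close>.\<close>
   define w where "w = (\<lambda>i. c * z' i - z' i * c)"
   have "{i. i < k \<and> w i \<noteq> 0} \<subseteq> {i. i < k \<and> z i \<noteq> 0} - {p}"
    using q e_left e_right c by (auto simp: w_def z'_def)
   moreover have "p \<in> {i. i < k \<and> z i \<noteq> 0}" using p by simp
   ultimately have "{i. i < k \<and> w i \<noteq> 0} \<subset> {i. i < k \<and> z i \<noteq> 0}" by blast
   then have "card {i. i < k \<and> w i \<noteq> 0} < card {i. i < k \<and> z i \<noteq> 0}"
    by (rule psubset_card_mono[rotated]) (rule finite_subset[of _ "{..<k}"], auto)
   moreover have "w i \<in> D" if "i < k" for i using z'D[OF that] c D_mult D_diff by (auto simp: w_def)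
   moreover have "(\<Sum>i<k. f i * y * w i) = 0" if "y \<in> D" for y
   proof -
    have "(\<Sum>i<k. f i * y * w i) = (\<Sum>i<k. f i * (y * c) * z' i) - (\<Sum>i<k. f i * y * z' i) * c"
     by (simp add: w_def right_diff_distrib sum_subtractf sum_distrib_right mult.assoc)
    then show ?thesis using rel[of "y * c"] rel[of y] that c D_mult by simp
   qed
   ultimately have "\<forall>i<k. w i = 0" by (rule less.hyps)
   then show ?thesis using i by (simp add: w_def)
  qed
  have scomm: "\<sigma> (z' i) * x = x * \<sigma> (z' i)" if x: "x \<in> D" and i: "i < k" for x i
  proof -
   have "\<sigma> (z' i) * x = \<sigma> (\<sigma> x * z' i)" using s_mult s_in s_invol x z'D[OF i] by simp
   also have "\<dots> = \<sigma> (z' i * \<sigma> x)" using comm[OF s_in[OF x] i] by simp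
   also have "\<dots> = x * \<sigma> (z' i)" using s_mult s_in s_invol x z'D[OF i] by simp
   finally show ?thesis .
  qed
  have r1: "(\<Sum>i<k. f i * z' i) = 0" using rel[OF e_in] e_right fL L_D by simp
  have "0 = \<sigma> (\<Sum>i<k. f i * z' i)" using r1 s_zero by simp
  also have "\<dots> = (\<Sum>i<k. \<sigma> (f i * z' i))" by (rule s_sum) (use fL L_D z'D D_mult in auto)
  also have "\<dots> = (\<Sum>i<k. f i * \<sigma> (z' i))"
   by (rule sum.cong) (use s_mult L_D fL z'D L_sym scomm in auto)
  finally have r2: "(\<Sum>i<k. f i * \<sigma> (z' i)) = 0" by simp
  \<comment> \<open>A central element need not be symmetric, so the relation is added to its image
    under \<sigma> before independence over \<open>F\<close> applies. At \<open>p\<close> the result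
    would be \<open>e + e = 0\<close>.\<close>
  have "z' i + \<sigma> (z' i) \<in> F" if i: "i < k" for i
  proof (rule cen)
   show "z' i + \<sigma> (z' i) \<in> D" using z'D[OF i] s_in D_add by auto
   show "(z' i + \<sigma> (z' i)) * x = x * (z' i + \<sigma> (z' i))" if "x \<in> D" for x
    using comm[OF that i] scomm[OF that i] by (simp add: distrib_left distrib_right)
   show "\<sigma> (z' i + \<sigma> (z' i)) = z' i + \<sigma> (z' i)"
    using z'D[OF i] s_in s_add s_invol by (simp add: add.commute)
  qed
  moreover have "(\<Sum>i<k. f i * (z' i + \<sigma> (z' i))) = 0" using r1 r2 by (simp add: distrib_left sum.distrib)
  ultimately have "z' p + \<sigma> (z' p) = 0" using ind[of "\<lambda>i. z' i + \<sigma> (z' i)" p] p by auto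
  then show False using q two s_e by (simp add: z'_def)
 qed
qed

text \<open>
 For the trace form of an extension, \<open>Ev v fs\<close> is up to a factor \<open>v\<close> the projection onto the centraliser of \<open>L\<close>.
\<close>

definition Ev :: "'a \<Rightarrow> 'a list \<Rightarrow> 'a \<Rightarrow> 'a" where
 "Ev v fs x = (\<Sum>i<length fs. fs!i * x * (dinv (tf v (fs!i) (fs!i)) * fs!i))"

lemma Ev_D: assumes "orthb v fs" "v \<in> L" "x \<in> D" shows "Ev v fs x \<in> D"
 unfolding Ev_def
proof (rule D_sum)
 fix i assume "i \<in> {..<length fs}"
 then have "fs!i \<in> D" "dinv (tf v (fs!i) (fs!i)) \<in> D" using orthbD[OF assms(1,2)] L_D F_D dinv by auto
 then show "fs!i * x * (dinv (tf v (fs!i) (fs!i)) * fs!i) \<in> D" using D_mult assms(3) by simp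
qed

text \<open>The element behind \<open>Ev\<close>, the sum of \<open>fs!i\<close> tensored with its
  dual, does not depend on the basis, and \<open>v\<close> times a dual basis for
  \<open>tf v\<close> is a dual basis for \<open>tf e\<close>. The factor \<open>v\<close> can be
  put on either tensor factor, which gives the two formulas.\<close>

lemma Ev_change:
 assumes o: "orthb v fs" "v \<in> L" and o': "orthb e gs" and x: "x \<in> D"
 shows "v * Ev v fs x = Ev e gs x" "Ev v fs x * v = Ev e gs x"
proof -
 have eL: "e \<in> L" using F_L F_e by auto
 note A = orthbD[OF o] note B = orthbD[OF o' eL]
 define c where "c = (\<lambda>i. dinv (tf v (fs!i) (fs!i)))"
 define d where "d = (\<lambda>j. dinv (tf e (gs!j) (gs!j)))"
 define m where "m = (\<lambda>i j. t (v * fs!i * gs!j))"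
 define n k where "n = length fs" "k = length gs"
 have cF: "c i \<in> F" if "i < n" for i using A that F_dinv by (auto simp: c_def n_k_def)
 have dF: "d j \<in> F" if "j < k" for j using B that F_dinv by (auto simp: d_def n_k_def)
 have mF: "m i j \<in> F" if "i < n" "j < k" for i j using A B that L_mult t_in o by (auto simp: m_def n_k_def)
 have fD: "fs!i \<in> L" "fs!i \<in> D" if "i < n" for i using A that L_D by (auto simp: n_k_def)
 have gD: "gs!j \<in> L" "gs!j \<in> D" if "j < k" for j using B that L_D by (auto simp: n_k_def)
 have g: "gs!j = (\<Sum>i<n. fs!i * (c i * m i j))" if "j < k" for j
  using A(5)[OF gD(1)[OF that]] by (simp add: cf_def c_def m_def tf_def n_k_def)
 have vf: "v * fs!i = (\<Sum>j<k. gs!j * (d j * m i j))" if i: "i < n" for i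
 proof -
  have "e * gs!j * (v * fs!i) = v * fs!i * gs!j" if "j < k" for j
   using L_comm[of "gs!j" "v * fs!i"] gD[OF that] fD[OF i] L_mult o e_left by simp
  then show ?thesis using B(5)[of "v * fs!i"] L_mult o fD[OF i]
   by (simp add: cf_def d_def m_def tf_def n_k_def)
 qed
 have vfc: "fs!i * v = v * fs!i" if "i < n" for i using L_comm fD[OF that] o by simp
 have E1: "Ev e gs x = (\<Sum>j<k. \<Sum>i<n. gs!j * x * (d j * (c i * m i j * fs!i)))"
 proof -
  have "gs!j * x * (d j * gs!j) = (\<Sum>i<n. gs!j * x * (d j * (c i * m i j * fs!i)))" if "j < k" for j
  proof -
   have "gs!j * x * (d j * gs!j) = gs!j * x * (d j * (\<Sum>i<n. fs!i * (c i * m i j)))" using g[OF that] by simp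
   also have "\<dots> = (\<Sum>i<n. gs!j * x * (d j * (c i * m i j * fs!i)))"
    unfolding sum_distrib_left by (rule sum.cong) (use F_comm[OF F_mult[OF cF mF]] fD that in auto)
   finally show ?thesis .
  qed
  then show ?thesis by (simp add: Ev_def d_def n_k_def)
 qed
 have E1': "Ev e gs x = (\<Sum>j<k. \<Sum>i<n. fs!i * x * (c i * (d j * m i j * gs!j)))"
 proof -
  have "gs!j * x * (d j * gs!j) = (\<Sum>i<n. fs!i * x * (c i * (d j * m i j * gs!j)))" if j: "j < k" for j
  proof -
   have "gs!j * x * (d j * gs!j) = (\<Sum>i<n. fs!i * (c i * m i j)) * x * (d j * gs!j)" using g[OF j] by metis
   also have "\<dots> = (\<Sum>i<n. fs!i * x * (c i * (d j * m i j * gs!j)))"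
    unfolding sum_distrib_right
   proof (rule sum.cong[OF refl])
    fix i assume "i \<in> {..<n}"
    then have i: "i < n" by simp
    have 1: "c i * m i j * x = x * (c i * m i j)" using F_comm[OF F_mult[OF cF mF], of i i j x] i j x by simp
    have 2: "m i j * d j = d j * m i j" using F_comm[OF dF[OF j] F_D[OF mF]] i j by simp
    show "fs!i * (c i * m i j) * x * (d j * gs!j) = fs!i * x * (c i * (d j * m i j * gs!j))"
     using 1 2 by (metis mult.assoc)
   qed
   finally show ?thesis .
  qed
  then show ?thesis by (simp add: Ev_def d_def n_k_def)
 qed
 have "v * Ev v fs x = (\<Sum>i<n. v * fs!i * x * (c i * fs!i))"
  by (simp add: Ev_def c_def n_k_def sum_distrib_left mult.assoc)
 also have "\<dots> = (\<Sum>i<n. \<Sum>j<k. gs!j * x * (d j * (c i * m i j * fs!i)))"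
 proof (rule sum.cong[OF refl])
  fix i assume "i \<in> {..<n}"
  then have i: "i < n" by simp
  have "v * fs!i * x * (c i * fs!i) = (\<Sum>j<k. gs!j * (d j * m i j)) * x * (c i * fs!i)" using vf[OF i] by simp
  also have "\<dots> = (\<Sum>j<k. gs!j * x * (d j * (c i * m i j * fs!i)))"
   unfolding sum_distrib_right
  proof (rule sum.cong[OF refl])
   fix j assume "j \<in> {..<k}"
   then have j: "j < k" by simp
   have 1: "d j * m i j * x = x * (d j * m i j)" using F_comm[OF F_mult[OF dF mF], of j i j x] i j x by simp
   have 2: "m i j * c i = c i * m i j" using F_comm[OF cF[OF i] F_D[OF mF]] i j by simp
   show "gs!j * (d j * m i j) * x * (c i * fs!i) = gs!j * x * (d j * (c i * m i j * fs!i))"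
    using 1 2 by (metis mult.assoc)
  qed
  finally show "v * fs!i * x * (c i * fs!i) = (\<Sum>j<k. gs!j * x * (d j * (c i * m i j * fs!i)))" .
 qed
 also have "\<dots> = Ev e gs x" unfolding E1 by (rule sum.swap)
 finally show "v * Ev v fs x = Ev e gs x" .
 have "Ev v fs x * v = (\<Sum>i<n. fs!i * x * (c i * (v * fs!i)))"
  by (simp add: Ev_def c_def n_k_def sum_distrib_right mult.assoc vfc[unfolded n_k_def])
 also have "\<dots> = (\<Sum>i<n. \<Sum>j<k. fs!i * x * (c i * (d j * m i j * gs!j)))"
 proof (rule sum.cong[OF refl])
  fix i assume "i \<in> {..<n}"
  then have i: "i < n" by simp
  have "fs!i * x * (c i * (v * fs!i)) = fs!i * x * (c i * (\<Sum>j<k. gs!j * (d j * m i j)))" using vf[OF i] by simp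
  also have "\<dots> = (\<Sum>j<k. fs!i * x * (c i * (d j * m i j * gs!j)))"
   unfolding sum_distrib_left
   by (rule sum.cong) (use F_comm[OF F_mult[OF dF mF]] gD i in auto)
  finally show "fs!i * x * (c i * (v * fs!i)) = (\<Sum>j<k. fs!i * x * (c i * (d j * m i j * gs!j)))" .
 qed
 also have "\<dots> = Ev e gs x" unfolding E1' by (rule sum.swap)
 finally show "Ev v fs x * v = Ev e gs x" .
qed

lemma orthb_indep:
 assumes o: "orthb v fs" "v \<in> L" and a: "\<And>i. i < length fs ==> a i \<in> F" "(\<Sum>i<length fs. fs!i * a i) = 0"
  and i: "i < length fs"
 shows "a i = 0"
 using cf_comb[OF o, of a i] a i tf_zero orthbD(1)[OF o i] o by (simp add: cf_def)

text \<open>\<Lambda> consists of the diagonal entries of the form \<open>b\<close> of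
  \<open>D\<close> over the centraliser \<open>C\<close>. It does not depend on \<open>v\<close>;
  only the basis of the transfer of \<langle>v\<rangle> does, and \<open>Ev_change\<close> accounts
  for this by the scalar \<open>v\<close>.\<close>

lemma pairing_form:
 assumes w: "w \<in> Hs"
 shows "\<exists>\<Lambda>. \<Lambda> inside L - {0} \<and> size \<Lambda> = size (dg e) \<and>
   (\<forall>v\<in>L-{0}. witt (tens (dg v) {#w#}) (scl v \<Lambda>))"
proof -
 have eL: "e \<in> L" "e \<noteq> 0" using F_L F_e e_nz by auto
 obtain gs where gs: "orthb e gs" "dg e = vals e gs" using dg_orth[OF eL] by auto
 note G = orthbD[OF gs(1) eL(1)]
 have wD: "w \<in> D" "\<sigma> w = w" "w \<noteq> 0" using w by (auto simp: Hs_def)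
 define E where "E = Ev e gs"
 define c where "c = (\<lambda>i. dinv (tf e (gs!i) (gs!i)))"
 have cF: "c i \<in> F" "c i \<noteq> 0" if "i < length gs" for i using G that F_dinv dinv_nz F_D by (auto simp: c_def)
 have gD: "gs!i \<in> L" "gs!i \<in> D" if "i < length gs" for i using G that L_D by auto
 have E_def': "E x = (\<Sum>i<length gs. gs!i * x * (c i * gs!i))" for x by (simp add: E_def Ev_def c_def)
 have ED: "E x \<in> D" if "x \<in> D" for x unfolding E_def by (rule Ev_D[OF gs(1) eL(1) that])
 \<comment> \<open>For a basis \<open>hs\<close> with respect to \<open>tf l\<close>, both
   \<open>l * Ev l hs x\<close> and \<open>Ev l hs x * l\<close> equal \<open>E x\<close>, so
   \<open>E x\<close> commutes with \<open>l\<close>.\<close>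
 have EC: "E x \<in> C" if x: "x \<in> D" for x
 proof -
  have "E x * l = l * E x" if l: "l \<in> L" for l
  proof (cases "l = 0")
   case False
   obtain hs where hs: "orthb l hs" using orthb_exists[OF l False] by auto
   show ?thesis using Ev_change[OF hs l gs(1) x] unfolding E_def by (metis mult.assoc)
  qed simp
  then show ?thesis using ED[OF x] by (auto simp: C_def)
 qed
 have Eadd: "E (x + y) = E x + E y" for x y by (simp add: E_def' distrib_left distrib_right sum.distrib)
 have Emul: "E (x * a) = E x * a" if "x \<in> D" "a \<in> C" for x a
  unfolding E_def' sum_distrib_right
 proof (rule sum.cong[OF refl])
  fix i assume "i \<in> {..<length gs}"
  then have i: "i < length gs" by simp
  have "a * (c i * gs!i) = c i * gs!i * a"
   using C_L[OF that(2) gD(1)[OF i]] F_central[OF cF(1)[OF i] C_D[OF that(2)]] by (metis mult.assoc)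
  then show "gs!i * (x * a) * (c i * gs!i) = gs!i * x * (c i * gs!i) * a" by (metis mult.assoc)
 qed
 have Es: "\<sigma> (E x) = E (\<sigma> x)" if x: "x \<in> D" for x
 proof -
  have "\<sigma> (E x) = (\<Sum>i<length gs. \<sigma> (gs!i * x * (c i * gs!i)))"
   unfolding E_def' by (rule s_sum) (use gD F_D[OF cF(1)] x in \<open>auto intro!: D_mult\<close>)
  also have "\<dots> = E (\<sigma> x)"
   unfolding E_def'
  proof (rule sum.cong[OF refl])
   fix i assume "i \<in> {..<length gs}"
   then have i: "i < length gs" by simp
   have "\<sigma> (gs!i * x * (c i * gs!i)) = (gs!i * c i) * (\<sigma> x * gs!i)"
    using gD[OF i] cF[OF i] F_D F_sym L_sym x by (simp add: s_mult D_mult)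
   also have "\<dots> = gs!i * \<sigma> x * (c i * gs!i)"
    using F_comm[OF cF(1)[OF i] s_in[OF x]] by (metis mult.assoc)
   finally show "\<sigma> (gs!i * x * (c i * gs!i)) = gs!i * \<sigma> x * (c i * gs!i)" .
  qed
  finally show ?thesis .
 qed
 have gs0: "gs \<noteq> []" using G(5)[OF eL(1)] e_nz by auto
 \<comment> \<open>This nonvanishing is what makes \<open>b\<close> nondegenerate.\<close>
 have "\<exists>y\<in>D. E y \<noteq> 0"
 proof (rule ccontr)
  assume "\<not> ?thesis"
  then have "\<forall>i<length gs. c i * gs!i = 0"
   by (intro faithful[where f = "(!) gs"]) (use orthb_indep[OF gs(1) eL(1)] gD cF F_D D_mult E_def' in auto)
  then have "c 0 * gs!0 = 0" using gs0 by auto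
  moreover have "gs!0 \<noteq> 0" using G(3)[of 0] gs0 tf_zero[OF eL(1) L_zero] by auto
  ultimately show False using no_zero_div[of "c 0" "gs!0"] cF[of 0] gD[of 0] F_D gs0 by auto
 qed
 then obtain y0 where y0: "y0 \<in> D" "E y0 \<noteq> 0" by auto
 define b where "b = (\<lambda>x y. E (\<sigma> x * w * y))"
 have bC: "b x y \<in> C" if "x \<in> D" "y \<in> D" for x y unfolding b_def by (rule EC) (use that wD s_in D_mult in auto)
 have badd: "b x (y + z) = b x y + b x z" for x y z by (simp add: b_def distrib_left Eadd)
 have bmul: "b x (y * a) = b x y * a" if "x \<in> D" "y \<in> D" "a \<in> C" for x y a
  using that wD s_in D_mult Emul[of "\<sigma> x * w * y" a] by (simp add: b_def mult.assoc)
 have bs: "\<sigma> (b x y) = b y x" if "x \<in> D" "y \<in> D" for x y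
  using that wD s_in D_mult Es[of "\<sigma> x * w * y"] by (simp add: b_def s_mult s_invol mult.assoc)
 have bsum: "b x (\<Sum>i<n. h i) = (\<Sum>i<n. b x (h i))" for x h and n :: nat
 proof (induction n)
  case 0
  show ?case by (simp add: b_def E_def')
 qed (simp add: badd)
 have FC: "a \<in> C" if "a \<in> F" for a using that F_D F_central L_D by (auto simp: C_def)
 obtain N where N: "\<And>xs. set xs \<subseteq> D ==> Findep xs ==> length xs \<le> N" using fd by auto
 have "\<exists>ys. (set ys \<subseteq> D \<and> (\<forall>i<length ys. \<forall>j<length ys. i \<noteq> j \<longrightarrow> b (ys!i) (ys!j) = 0)
  \<and> (\<forall>i<length ys. b (ys!i) (ys!i) \<noteq> 0)) \<and>
  (\<forall>x\<in>D. x = (\<Sum>i<length ys. ys!i * (CC.dinv (b (ys!i) (ys!i)) * b (ys!i) x)))"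
 proof (rule CC.orth_basis_exists)
  show "\<exists>y\<in>D. b x y \<noteq> 0" if x: "x \<in> D" "x \<noteq> 0" for x
  proof -
   have sxw: "\<sigma> x * w \<in> D" "\<sigma> x * w \<noteq> 0" using x wD s_in s_nz D_mult mult_nz by auto
   have "b x (dinv (\<sigma> x * w) * y0) = E y0" unfolding b_def using cancel1[OF sxw y0(1)] by simp
   then show ?thesis using y0 D_mult dinv sxw by metis
  qed
  fix ys assume ys: "set ys \<subseteq> D \<and> (\<forall>i<length ys. \<forall>j<length ys. i \<noteq> j \<longrightarrow> b (ys!i) (ys!j) = 0)
    \<and> (\<forall>i<length ys. b (ys!i) (ys!i) \<noteq> 0)"
  have yD: "ys!i \<in> D" if "i < length ys" for i using ys that by auto
  have "Findep ys"
   unfolding Findep_def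
  proof (intro allI impI)
   fix a j assume a: "\<forall>i<length ys. a i \<in> F" "(\<Sum>i<length ys. ys!i * a i) = 0" and j: "j < length ys"
   have "0 = b (ys!j) (\<Sum>i<length ys. ys!i * a i)" using a by (simp add: b_def E_def')
   also have "\<dots> = (\<Sum>i<length ys. b (ys!j) (ys!i) * a i)"
    unfolding bsum by (rule sum.cong) (use bmul yD j a FC in auto)
   also have "\<dots> = (\<Sum>i<length ys. if i = j then b (ys!j) (ys!j) * a j else 0)"
    by (rule sum.cong) (use ys j in auto)
   also have "\<dots> = b (ys!j) (ys!j) * a j" using j by simp
   finally show "a j = 0"
    using no_zero_div[of "b (ys!j) (ys!j)" "a j"] bC yD j C_D F_D a ys by auto
  qed
  then show "length ys \<le> N" using N ys by blast
 qed (use two D_add D_mult D_zero C_D e_right bC badd bmul bs in auto)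
 then obtain ys where ys: "set ys \<subseteq> D" "\<And>i j. i < length ys ==> j < length ys ==> i \<noteq> j ==> b (ys!i) (ys!j) = 0"
  "\<And>i. i < length ys ==> b (ys!i) (ys!i) \<noteq> 0"
  "\<And>x. x \<in> D ==> x = (\<Sum>i<length ys. ys!i * (CC.dinv (b (ys!i) (ys!i)) * b (ys!i) x))" by blast
 define m where "m = length ys"
 have yD: "ys!i \<in> D" if "i < m" for i using ys(1) that nth_mem by (auto simp: m_def)
 define l where "l = (\<lambda>a. b (ys!a) (ys!a))"
 \<comment> \<open>A diagonal value of a hermitian form over \<open>C\<close> is symmetric and
   commutes with \<open>L\<close>; here the maximality of \<open>L\<close> is used.\<close>
 have lL: "l a \<in> L" "l a \<noteq> 0" if "a < m" for a
 proof -
  show "l a \<noteq> 0" using ys(3) that by (simp add: l_def m_def)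
  show "l a \<in> L" unfolding l_def
   by (rule L_max) (use bC yD that C_D bs C_L in auto)
 qed
 have main: "length fs = m \<and> witt (image_mset (\<lambda>i. dinv (tf v (fs!i) (fs!i)) * w) (mset_set {..<length fs}))
   (image_mset (\<lambda>a. dinv v * l a) (mset_set {..<m}))"
  if v: "v \<in> L" "v \<noteq> 0" and fs: "orthb v fs" for v fs
 proof -
  note A = orthbD[OF fs v(1)]
  define k where "k = length fs"
  define d where "d = (\<lambda>i. dinv (tf v (fs!i) (fs!i)))"
  have dF: "d i \<in> F" "d i \<noteq> 0" if "i < k" for i using A that F_dinv dinv_nz F_D by (auto simp: d_def k_def)
  have fD: "fs!i \<in> L" "fs!i \<in> D" if "i < k" for i using A that L_D by (auto simp: k_def)
  \<comment> \<open>Products of a \<open>C\<close>-basis of \<open>D\<close> with an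
    \<open>F\<close>-basis of \<open>L\<close>. Summation over \<open>i\<close> produces
    \<open>Ev\<close>, and so reduces the orthogonality of the columns to that of
    \<open>ys\<close>.\<close>
  define Xm where "Xm = (\<lambda>i a. ys!a * fs!i)"
  have XD: "Xm i a \<in> D" if "i < k" "a < m" for i a using yD fD that D_mult by (auto simp: Xm_def)
  have vD: "v \<in> D" using v L_D by auto
  have sX: "\<sigma> (Xm i a) * (d i * w) = fs!i * \<sigma> (ys!a) * (d i * w)" if "i < k" "a < m" for i a
   using s_mult yD fD that L_sym by (simp add: Xm_def)
  have iso: "(\<Sum>i<k. \<sigma> (Xm i a) * (d i * w) * Xm i a') = (if a = a' then dinv v * l a else 0)"
   if a: "a < m" "a' < m" for a a'
  proof -
   have zD: "\<sigma> (ys!a) * w * ys!a' \<in> D" using yD a wD s_in D_mult by auto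
   have "(\<Sum>i<k. \<sigma> (Xm i a) * (d i * w) * Xm i a') = Ev v fs (\<sigma> (ys!a) * w * ys!a')"
    unfolding Ev_def k_def[symmetric]
   proof (rule sum.cong[OF refl])
    fix i assume "i \<in> {..<k}"
    then have i: "i < k" by simp
    have "d i * w * (ys!a' * fs!i) = w * ys!a' * (d i * fs!i)"
     using F_central[OF dF(1)[OF i], of "w * ys!a'"] wD yD[OF a(2)] D_mult by (metis mult.assoc)
    then show "\<sigma> (Xm i a) * (d i * w) * Xm i a' =
      fs!i * (\<sigma> (ys!a) * w * ys!a') * (dinv (tf v (fs!i) (fs!i)) * fs!i)"
     unfolding sX[OF i a(1)] by (simp add: Xm_def d_def mult.assoc)
   qed
   also have "\<dots> = dinv v * (v * Ev v fs (\<sigma> (ys!a) * w * ys!a'))"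
    by (rule cancel2[symmetric, OF vD v(2) Ev_D[OF fs v(1) zD]])
   also have "v * Ev v fs (\<sigma> (ys!a) * w * ys!a') = b (ys!a) (ys!a')"
    unfolding Ev_change(1)[OF fs v(1) gs(1) zD] b_def E_def ..
   finally show ?thesis using ys(2)[of a a'] a by (auto simp: l_def m_def)
  qed
  have dl: "dinv v * l a \<in> D" "dinv v * l a \<noteq> 0" if "a < m" for a
   using lL[OF that] L_D vD v dinv[OF vD v(2)] dinv_nz[OF vD v(2)] D_mult mult_nz by auto
  have dw: "d i * w \<in> D" if "i < k" for i using dF[OF that] F_D wD D_mult by auto
  have "m \<le> k"
  proof (rule dim_le[where f = "\<lambda>u i. \<Sum>a<m. Xm i a * u a"])
   show "rlin (full {..<m}) (\<lambda>u. \<Sum>a<m. Xm i a * u a)" if "i < k" for i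
    by (rule rlin_sum) (use XD[OF that] in auto)
   fix u a assume u: "u \<in> full {..<m}" and z: "\<And>i. i < k ==> (\<Sum>a<m. Xm i a * u a) = 0"
   show "u a = 0"
   proof (cases "a < m")
    case True
    have uD: "u a \<in> D" for a using u by (auto simp: full_def)
    have "0 = (\<Sum>i<k. \<sigma> (Xm i a) * (d i * w) * (\<Sum>a'<m. Xm i a' * u a'))" using z by simp
    also have "\<dots> = (\<Sum>a'<m. (\<Sum>i<k. \<sigma> (Xm i a) * (d i * w) * Xm i a') * u a')"
     by (simp add: sum_distrib_left sum_distrib_right mult.assoc) (rule sum.swap)
    also have "\<dots> = (\<Sum>a'<m. if a' = a then dinv v * l a * u a else 0)"
     by (rule sum.cong) (use iso[OF True] in auto)
    also have "\<dots> = dinv v * l a * u a" using True by simp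
    finally show ?thesis using no_zero_div[OF dl(1)[OF True] uD] dl(2)[OF True] by metis
   qed (use u in \<open>auto simp: full_def\<close>)
  qed
  \<comment> \<open>Expanding an arbitrary \<open>y\<close> of \<open>D\<close> in the basis
    \<open>ys\<close> turns the \<open>m\<close> orthogonality conditions into the relation required
    by \<open>faithful\<close>.\<close>
  moreover have "k \<le> m"
  proof (rule dim_le[where f = "\<lambda>u a. \<Sum>i<k. \<sigma> (Xm i a) * (d i * w) * u i"])
   show "rlin (full {..<k}) (\<lambda>u. \<Sum>i<k. \<sigma> (Xm i a) * (d i * w) * u i)" if "a < m" for a
    by (rule rlin_sum) (use XD[OF _ that] s_in dw D_mult in blast)
   fix u i assume u: "u \<in> full {..<k}" and z: "\<And>a. a < m ==> (\<Sum>i<k. \<sigma> (Xm i a) * (d i * w) * u i) = 0"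
   have uD: "u i \<in> D" for i using u by (auto simp: full_def)
   have "\<forall>i<k. d i * w * u i = 0"
   proof (rule faithful[where f = "(!) fs"])
    show "d i * w * u i \<in> D" if "i < k" for i using dw[OF that] uD D_mult by auto
    fix y assume y: "y \<in> D"
    define g where "g = (\<lambda>a. CC.dinv (b (ys!a) (ys!a)) * b (ys!a) (\<sigma> y))"
    have gC: "g a \<in> C" if "a < m" for a
     using CC.D_mult CC.dinv(1)[OF bC ys(3)] bC yD[OF that] s_in[OF y] that by (auto simp: g_def m_def)
    have "\<sigma> y = (\<Sum>a<m. ys!a * g a)" using ys(4)[OF s_in[OF y]] by (simp add: g_def m_def)
    then have "y = \<sigma> (\<Sum>a<m. ys!a * g a)" using s_invol[OF y] by metis
    also have "\<dots> = (\<Sum>a<m. \<sigma> (g a) * \<sigma> (ys!a))"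
     using yD gC C_D by (subst s_sum) (auto simp: D_mult s_mult)
    finally have y': "y = (\<Sum>a<m. \<sigma> (g a) * \<sigma> (ys!a))" .
    have "(\<Sum>i<k. fs!i * y * (d i * w * u i)) = (\<Sum>i<k. \<Sum>a<m. \<sigma> (g a) * (\<sigma> (Xm i a) * (d i * w) * u i))"
    proof (rule sum.cong[OF refl])
     fix i assume "i \<in> {..<k}"
     then have i: "i < k" by simp
     have "fs!i * y * (d i * w * u i) = (\<Sum>a<m. fs!i * (\<sigma> (g a) * \<sigma> (ys!a)) * (d i * w * u i))"
      unfolding sum_distrib_left[symmetric] sum_distrib_right[symmetric] using y' by simp
     also have "\<dots> = (\<Sum>a<m. \<sigma> (g a) * (\<sigma> (Xm i a) * (d i * w) * u i))"
     proof (rule sum.cong[OF refl])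
      fix a assume "a \<in> {..<m}"
      then have a: "a < m" by simp
      have "fs!i * \<sigma> (g a) = \<sigma> (g a) * fs!i" using C_L[OF CC.s_in[OF gC[OF a]] fD(1)[OF i]] by simp
      then show "fs!i * (\<sigma> (g a) * \<sigma> (ys!a)) * (d i * w * u i) = \<sigma> (g a) * (\<sigma> (Xm i a) * (d i * w) * u i)"
       unfolding sX[OF i a] by (metis mult.assoc)
     qed
     finally show "fs!i * y * (d i * w * u i) = (\<Sum>a<m. \<sigma> (g a) * (\<sigma> (Xm i a) * (d i * w) * u i))" .
    qed
    also have "\<dots> = (\<Sum>a<m. \<sigma> (g a) * (\<Sum>i<k. \<sigma> (Xm i a) * (d i * w) * u i))"
     unfolding sum_distrib_left by (rule sum.swap)
    also have "\<dots> = 0" using z by simp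
    finally show "(\<Sum>i<k. fs!i * y * (d i * w * u i)) = 0" .
   qed (use orthb_indep[OF fs v(1)] fD k_def in auto)
   then have "d i * w * u i = 0" if "i < k" for i using that by auto
   then have "u i = 0" if "i < k" for i
    using no_zero_div[OF dw[OF that] uD] no_zero_div[OF F_D[OF dF(1)[OF that]] wD(1)] dF(2)[OF that] wD(3) that by metis
   then show "u i = 0" using u by (cases "i < k") (auto simp: full_def)
  qed
  ultimately have km: "k = m" by simp
  have "witt (image_mset (\<lambda>i. d i * w) (mset_set {..<k})) (image_mset (\<lambda>a. dinv v * l a) (mset_set {..<m}))"
   by (rule witt_iso[where Xm = Xm]) (use km XD dw iso in auto)
  then show ?thesis using km by (simp add: k_def d_def)
 qed
 define \<Lambda> where "\<Lambda> = image_mset l (mset_set {..<m})"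
 \<comment> \<open>\<open>a\<close> and its inverse differ by a square; this removes the inverses on
   both sides of \<open>main\<close>.\<close>
 have sq_wit: "witt {#dinv a * x#} {#a * x#}" if "a \<in> D" "a \<noteq> 0" "\<sigma> a = a" "x \<in> D" "a * x = x * a" for a x
 proof -
  have "\<sigma> a * (dinv a * x) * a = a * x" using that cancel1[OF that(1,2,4)] by simp
  then show ?thesis using witt_conj[of "dinv a * x" a] that dinv D_mult by auto
 qed
 show ?thesis
 proof (intro exI[of _ \<Lambda>] conjI ballI)
  show "\<Lambda> inside L - {0}" using lL by (auto simp: \<Lambda>_def)
  show "size \<Lambda> = size (dg e)" using main[OF eL gs(1)] by (simp add: \<Lambda>_def gs(2) vals_def)
  fix v assume "v \<in> L - {0}"
  then have v: "v \<in> L" "v \<noteq> 0" by auto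
  obtain fs where fs: "orthb v fs" "dg v = vals v fs" using dg_orth[OF v] by auto
  note A = orthbD[OF fs(1) v(1)]
  define k where "k = length fs"
  define d where "d = (\<lambda>i. tf v (fs!i) (fs!i))"
  have dF: "d i \<in> F" "d i \<noteq> 0" if "i < k" for i using A that by (auto simp: d_def k_def)
  have "witt (image_mset (\<lambda>i. dinv (d i) * w) (mset_set {..<k})) (image_mset (\<lambda>a. dinv v * l a) (mset_set {..<m}))"
   using main[OF v fs(1)] unfolding d_def k_def by blast
  moreover have "witt (image_mset (\<lambda>i. dinv (d i) * w) (mset_set {..<k})) (image_mset (\<lambda>i. d i * w) (mset_set {..<k}))"
  proof (rule witt_image)
   fix i assume "i \<in># mset_set {..<k}"
   then have "d i \<in> F" "d i \<noteq> 0" using dF by auto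
   then show "witt {#dinv (d i) * w#} {#d i * w#}" using F_D F_sym F_central wD by (intro sq_wit) blast+
  qed
  then have "witt (image_mset (\<lambda>i. d i * w) (mset_set {..<k})) (image_mset (\<lambda>i. dinv (d i) * w) (mset_set {..<k}))"
   by (rule witt_sym) (use dF F_D wD dinv D_mult in auto)
  moreover have "witt (image_mset (\<lambda>a. dinv v * l a) (mset_set {..<m})) (image_mset (\<lambda>a. v * l a) (mset_set {..<m}))"
  proof (rule witt_image)
   fix a assume "a \<in># mset_set {..<m}"
   then have "l a \<in> L" using lL by auto
   then show "witt {#dinv v * l a#} {#v * l a#}" using L_D L_sym L_comm v by (intro sq_wit) blast+
  qed
  moreover have "set_mset (image_mset (\<lambda>i. dinv (d i) * w) (mset_set {..<k})) \<subseteq> D - {0}"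
   using dF F_D wD dinv dinv_nz D_mult mult_nz by auto
  moreover have "(image_mset (\<lambda>a. dinv v * l a) (mset_set {..<m})) inside D - {0}"
   using lL L_D v dinv dinv_nz D_mult mult_nz by auto
  ultimately have "witt (image_mset (\<lambda>i. d i * w) (mset_set {..<k})) (image_mset (\<lambda>a. v * l a) (mset_set {..<m}))"
   using witt_trans by blast
  moreover have "tens (dg v) {#w#} = image_mset (\<lambda>i. d i * w) (mset_set {..<k})"
  proof -
   have "tens K {#w#} = image_mset (\<lambda>x. x * w) K" for K by (induction K) auto
   moreover have "dg v = image_mset d (mset_set {..<k})"
   proof -
    have "mset fs = image_mset ((!) fs) (mset_set {..<k})"
     unfolding k_def by (metis atLeast0LessThan map_nth mset_map mset_upt)
    then show ?thesis unfolding fs(2) vals_def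
     by (simp add: image_mset_comp d_def)
   qed
   ultimately show ?thesis by (simp add: image_mset_comp)
  qed
  ultimately show "witt (tens (dg v) {#w#}) (scl v \<Lambda>)"
   by (simp add: \<Lambda>_def image_mset_comp)
 qed
qed

end

section \<open>Signatures of hermitian forms\<close>

text \<open>The multiple of a class by an integer in the Witt group.\<close>

definition repm :: "int \<Rightarrow> 'a::ring multiset \<Rightarrow> 'a multiset" where
 "repm n M = (if n \<ge> 0 then repeat_mset (nat n) M else repeat_mset (nat (- n)) (neg M))"

lemma repm_0 [simp]: "repm 0 M = {#}" by (simp add: repm_def)
lemma repm_1 [simp]: "repm 1 M = M" by (simp add: repm_def)

lemma neg_repeat: "neg (repeat_mset n M) = repeat_mset n (neg (M::'a::ring multiset))"
 by (induction n) auto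

lemma neg_repm: "neg (repm n M) = repm (- n) M"
 by (auto simp: repm_def neg_repeat)

lemma repm_neg: "repm n (neg M) = neg (repm n M)"
 by (auto simp: repm_def neg_repeat)

lemma tens_repeat: "tens K (repeat_mset n M) = tens (repeat_mset n K) M"
 by (induction n) auto

lemma repm_add_distrib: "repm n (M + N) = repm n M + repm n N"
 by (auto simp: repm_def)

context divinv_base
begin

text \<open>Extension of scalars: the span over \<open>D\<close> of a Lagrangian over
  \<open>L\<close> is still isotropic, and it contains \<open>U\<close> with all its pivots.\<close>

lemma subring_metab:
 assumes L: "divinv L e \<sigma>" "L \<subseteq> D" and m: "divinv.metab L \<sigma> K" and KD: "K inside D"
 shows "metab K"
proof -
 interpret LL: divinv L e \<sigma> by (rule L)
 obtain I d U where K: "K = image_mset d (mset_set I)" "LL.lagr (I::nat set) d U"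
  using m by (auto simp: LL.metab_def)
 have fin: "finite I" and sub: "LL.rsub U" and supp: "\<And>u i. u \<in> U ==> i \<notin> I ==> u i = 0"
  and iso: "\<And>u v. u \<in> U ==> v \<in> U ==> LL.hf I d u v = 0"
  using K by (auto simp: LL.lagr_def)
 obtain n where n: "card I = 2 * n" "dimge n U" using K by (auto simp: LL.lagr_def)
 have dD: "d i \<in> D" if "i \<in> I" for i using KD K fin that by auto
 have UD: "u i \<in> D" if "u \<in> U" for u i using LL.rsubD(1)[OF sub that] L(2) by auto
 define comb where "comb = (\<lambda>(ps :: ((nat \<Rightarrow> 'a) \<times> 'a) list) i. \<Sum>(u, x)\<leftarrow>ps. u i * x)"
 define V where "V = {comb ps | ps. set ps \<subseteq> U \<times> D}"
 have combD: "comb ps i \<in> D" if "set ps \<subseteq> U \<times> D" for ps i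
  using that
 proof (induction ps)
  case (Cons p ps)
  then have "fst p i * snd p \<in> D" using UD[of "fst p" i] D_mult by (cases p) auto
  then show ?case using Cons D_add by (auto simp: comb_def split_def)
 qed (simp add: comb_def D_zero)
 have "lagr I d V"
 proof (rule lagrI)
  show "rsub V"
   unfolding rsub_def
  proof (intro conjI ballI allI)
   show "(\<lambda>_. 0) \<in> V" unfolding V_def by (rule CollectI, rule exI[of _ "[]"]) (auto simp: comb_def)
   fix u assume "u \<in> V"
   then obtain ps where ps: "u = comb ps" "set ps \<subseteq> U \<times> D" by (auto simp: V_def)
   show "u i \<in> D" for i using ps combD by auto
   show "(\<lambda>i. u i * x) \<in> V" if "x \<in> D" for x
   proof -
    have "(\<lambda>i. u i * x) = comb (map (\<lambda>(a, b). (a, b * x)) ps)"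
     unfolding ps(1) comb_def by (induction ps) (auto simp: fun_eq_iff distrib_right mult.assoc)
    moreover have "set (map (\<lambda>(a, b). (a, b * x)) ps) \<subseteq> U \<times> D" using ps that D_mult by auto
    ultimately show ?thesis unfolding V_def by blast
   qed
   fix v assume "v \<in> V"
   then obtain qs where qs: "v = comb qs" "set qs \<subseteq> U \<times> D" by (auto simp: V_def)
   have "(\<lambda>i. u i + v i) = comb (ps @ qs)" unfolding ps qs comb_def by auto
   then show "(\<lambda>i. u i + v i) \<in> V" unfolding V_def using ps qs by (intro CollectI exI[of _ "ps @ qs"]) auto
  qed
  have iso1: "hf I d u (comb qs) = 0" if "u \<in> U" "set qs \<subseteq> U \<times> D" for u qs
   using that(2)
  proof (induction qs)
   case (Cons q qs)
   obtain v x where q: "q = (v, x)" by force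
   have "hf I d u (comb (q # qs)) = hf I d u v * x + hf I d u (comb qs)"
    by (simp add: hf_def comb_def q distrib_left sum.distrib sum_distrib_right mult.assoc)
   moreover have "hf I d u v = 0" using iso[of u v] that(1) Cons.prems q by (simp add: hf_def LL.hf_def)
   ultimately show ?case using Cons by auto
  qed (simp add: hf_def comb_def)
  have iso2: "hf I d (comb ps) v = 0" if "set ps \<subseteq> U \<times> D" "set qs \<subseteq> U \<times> D" "v = comb qs" for ps qs v
   using that(1)
  proof (induction ps)
   case (Cons p ps)
   obtain u x where p: "p = (u, x)" by force
   have u: "u \<in> U" "x \<in> D" using Cons.prems p by auto
   have "\<sigma> (comb (p # ps) i) = \<sigma> x * \<sigma> (u i) + \<sigma> (comb ps i)" for i
    using u UD[OF u(1)] combD[of ps i] Cons.prems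
    by (simp add: comb_def p s_add s_mult D_mult)
   then have "hf I d (comb (p # ps)) v = \<sigma> x * hf I d u v + hf I d (comb ps) v"
    by (simp add: hf_def distrib_right sum.distrib sum_distrib_left mult.assoc)
   then show ?case using iso1[OF u(1) that(2)] that(3) Cons by auto
  qed (simp add: hf_def comb_def s_zero)
  show "hf I d u v = 0" if "u \<in> V" "v \<in> V" for u v using that iso2 by (auto simp: V_def)
  have "u = comb [(u, e)]" if "u \<in> U" for u using UD[OF that] e_right by (auto simp: comb_def)
  then have "U \<subseteq> V" unfolding V_def using e_in by fastforce
  then show "dimge n V" using n dimge_mono by blast
  show "u i = 0" if uV: "u \<in> V" "i \<notin> I" for u i
  proof -
   obtain ps where ps: "u = comb ps" "set ps \<subseteq> U \<times> D" using uV by (auto simp: V_def)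
   show ?thesis unfolding ps(1) using ps(2)
   proof (induction ps)
    case (Cons p ps)
    then have "fst p i = 0" using supp[of "fst p" i] uV(2) by (cases p) auto
    then show ?case using Cons by (auto simp: comb_def split_def)
   qed (simp add: comb_def)
  qed
 qed (use n fin in auto)
 from metabI[OF this] show ?thesis by (simp add: K)
qed

context
 fixes P assumes P: "fordering F P"
begin

abbreviation "P0 \<equiv> P - {0}"

definition teq :: "'a multiset \<Rightarrow> 'a multiset \<Rightarrow> bool" where "teq M N \<longleftrightarrow> torsion (P - {0}) (M + neg N)"

lemmas mcP = P_mclosed[OF P]

lemma witt_teq: assumes "witt M N" "M inside Hs" "N inside Hs" shows "teq M N"
 unfolding teq_def by (rule torsion_metab[OF mcP]) (use assms uminus_Hs in \<open>auto simp: witt_def\<close>)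

lemma teq_sym: assumes "teq M N" "M inside Hs" "N inside Hs" shows "teq N M"
proof -
 have "torsion P0 (neg (M + neg N))"
  by (rule torsion_neg[OF mcP]) (use assms uminus_Hs in \<open>auto simp: teq_def\<close>)
 then show ?thesis by (simp add: teq_def ac_simps)
qed

lemma teq_refl: "M inside Hs ==> teq M M" by (rule witt_teq) (auto simp: witt_refl Hs_sub)

lemma teq_trans: assumes "teq L M" "teq M N" "L inside Hs" "M inside Hs" "N inside Hs" shows "teq L N"
proof -
 have "torsion P0 ((L + neg M) + (M + neg N))"
  by (rule torsion_add[OF mcP]) (use assms uminus_Hs in \<open>auto simp: teq_def\<close>)
 then have "torsion P0 ((L + neg N) + (M + neg M))" by (simp add: ac_simps)
 moreover have "torsion P0 (M + neg M)" using teq_refl[OF assms(4)] by (simp add: teq_def)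
 ultimately show ?thesis unfolding teq_def
  by (rule torsion_cancel[OF mcP]) (use assms uminus_Hs in auto)
qed

lemma teq_add:
 assumes "teq M N" "teq M' N'" "M inside Hs" "N inside Hs" "M' inside Hs" "N' inside Hs"
 shows "teq (M + M') (N + N')"
proof -
 have "torsion P0 ((M + neg N) + (M' + neg N'))"
  by (rule torsion_add[OF mcP]) (use assms uminus_Hs in \<open>auto simp: teq_def\<close>)
 then show ?thesis by (simp add: teq_def ac_simps)
qed

lemma teq_neg: assumes "teq M N" "M inside Hs" "N inside Hs" shows "teq (neg M) (neg N)"
proof -
 have "torsion P0 (neg (M + neg N))"
  by (rule torsion_neg[OF mcP]) (use assms uminus_Hs in \<open>auto simp: teq_def\<close>)
 then show ?thesis by (simp add: teq_def)
qed

lemma teq_empty: "teq M {#} \<longleftrightarrow> torsion P0 M" by (simp add: teq_def)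

lemma set_repeat: "(repeat_mset n M) inside set_mset M" by (induction n) auto

lemma repm_Hs: "M inside Hs ==> (repm n M) inside Hs"
 using set_repeat[of "nat n" M] set_repeat[of "nat (- n)" "neg M"] neg_Hs[of M] by (auto simp: repm_def)

text \<open>The integer is absorbed into the multiplier, whose entries may be repeated.\<close>

lemma torsion_repm: assumes "torsion P0 (repm n M)" "n \<noteq> 0" "M inside Hs" shows "torsion P0 M"
proof -
 have pos: "torsion P0 M" if t: "torsion P0 (repeat_mset k M)" "k > 0" for k M
 proof -
  obtain K where "K \<noteq> {#}" "K inside P0" "metab (tens K (repeat_mset k M))" using t by (auto simp: torsion_def)
  moreover have "repeat_mset k K \<noteq> {#}" using t(2) \<open>K \<noteq> {#}\<close> by (cases k) auto
  ultimately show ?thesis unfolding torsion_def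
   using set_repeat[of k K] by (intro exI[of _ "repeat_mset k K"]) (auto simp: tens_repeat)
 qed
 show ?thesis
 proof (cases "n \<ge> 0")
  case True
  then show ?thesis using pos[of "nat n" M] assms by (auto simp: repm_def)
 next
  case False
  then have "torsion P0 (neg M)" using pos[of "nat (- n)" "neg M"] assms by (auto simp: repm_def)
  from torsion_neg[OF mcP this neg_Hs[OF assms(3)]] show ?thesis by simp
 qed
qed

lemma teq_pair: assumes "M inside Hs" shows "teq (M + neg M) {#}"
 using teq_refl[OF assms] by (simp add: teq_def)

lemma repm_Suc: assumes M: "M inside Hs" shows "teq (repm (n + 1) M) (M + repm n M)"
proof (cases "n \<ge> 0")
 case True
 then have "repm (n + 1) M = M + repm n M" by (simp add: repm_def nat_add_distrib)
 then show ?thesis using teq_refl[OF repm_Hs[OF M]] by metis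
next
 case False
 define k where "k = nat (- n - 1)"
 have n: "n = - int k - 1" using False by (simp add: k_def)
 have 1: "repm (n + 1) M = repeat_mset k (neg M)" by (cases "k = 0") (auto simp: n repm_def)
 have 2: "repm n M = neg M + repeat_mset k (neg M)"
  by (simp add: n repm_def nat_add_distrib)
 have H: "(repeat_mset k (neg M)) inside Hs" using set_repeat[of k "neg M"] neg_Hs[OF M] by blast
 have "teq ((M + neg M) + repeat_mset k (neg M)) ({#} + repeat_mset k (neg M))"
  by (rule teq_add[OF teq_pair[OF M] teq_refl[OF H]]) (use M neg_Hs[OF M] H in auto)
 then have "teq (M + repm n M) (repm (n + 1) M)" unfolding 1 2 by (simp add: ac_simps)
 then show ?thesis by (rule teq_sym) (use M repm_Hs[OF M] in auto)
qed

lemma repm_plus: assumes M: "M inside Hs" shows "teq (repm (m + n) M) (repm m M + repm n M)"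
proof -
 have pos: "teq (repm (int m + n) M) (repm (int m) M + repm n M)" for m n
 proof (induction m)
  case 0
  then show ?case using teq_refl[OF repm_Hs[OF M]] by simp
 next
  case (Suc m)
  have "teq (M + repm (int m + n) M) (M + (repm (int m) M + repm n M))"
   by (rule teq_add[OF teq_refl[OF M] Suc]) (use M repm_Hs[OF M] in auto)
  moreover have "repm (int (Suc m)) M = M + repm (int m) M" by (simp add: repm_def nat_add_distrib)
  ultimately have "teq (M + repm (int m + n) M) (repm (int (Suc m)) M + repm n M)" by (simp add: ac_simps)
  moreover have "teq (repm (int (Suc m) + n) M) (M + repm (int m + n) M)"
   using repm_Suc[OF M, of "int m + n"] by (simp add: ac_simps)
  moreover have "(M + repm (int m + n) M) inside Hs" "set_mset (repm (int (Suc m)) M + repm n M) \<subseteq> Hs"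
   using M repm_Hs[OF M] by auto
  ultimately show ?case
   using teq_trans[of "repm (int (Suc m) + n) M" "M + repm (int m + n) M"] repm_Hs[OF M] by blast
 qed
 show ?thesis
 proof (cases "m \<ge> 0")
  case True
  then show ?thesis using pos[of "nat m" n] by simp
 next
  case False
  then have "teq (repm (- m + - n) M) (repm (- m) M + repm (- n) M)" using pos[of "nat (- m)" "- n"] by simp
  then have "teq (neg (repm (- m + - n) M)) (neg (repm (- m) M + repm (- n) M))"
   by (rule teq_neg) (use repm_Hs[OF M] in auto)
  then show ?thesis by (simp add: neg_repm add.commute)
 qed
qed

lemma teq_repm: assumes t: "teq M N" and H: "M inside Hs" "N inside Hs" shows "teq (repm n M) (repm n N)"
proof -
 have pos: "teq (repeat_mset k M) (repeat_mset k N)" if "teq M N" "M inside Hs" "N inside Hs" for k M N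
 proof (induction k)
  case 0
  then show ?case using teq_refl[of "{#}"] by simp
 next
  case (Suc k)
  have "teq (M + repeat_mset k M) (N + repeat_mset k N)"
   by (rule teq_add[OF that(1) Suc]) (use that set_repeat[of k M] set_repeat[of k N] in auto)
  then show ?case by simp
 qed
 show ?thesis
  using pos[OF t H, of "nat n"] pos[OF teq_neg[OF t H] neg_Hs[OF H(1)] neg_Hs[OF H(2)], of "nat (- n)"]
  by (auto simp: repm_def)
qed

lemma repm_repm: assumes M: "M inside Hs" shows "teq (repm m (repm n M)) (repm (m * n) M)"
proof -
 have pos: "teq (repm (int k) (repm n M)) (repm (int k * n) M)" for k n
 proof (induction k)
  case 0
  then show ?case using teq_refl[of "{#}"] by simp
 next
  case (Suc k)
  have "repm (int (Suc k)) (repm n M) = repm n M + repm (int k) (repm n M)"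
   by (simp add: repm_def[of "1 + int k"] repm_def[of "int k"] nat_add_distrib)
  moreover have "teq (repm n M + repm (int k) (repm n M)) (repm n M + repm (int k * n) M)"
   by (rule teq_add[OF teq_refl Suc]) (use repm_Hs repm_Hs[OF M] in auto)
  moreover have "teq (repm n M + repm (int k * n) M) (repm (int (Suc k) * n) M)"
   using teq_sym[OF repm_plus[OF M, of n "int k * n"]] repm_Hs[OF M] by (simp add: distrib_right)
  moreover have "(repm n M + repm (int k) (repm n M)) inside Hs" "(repm n M + repm (int k * n) M) inside Hs"
   using repm_Hs[OF M] repm_Hs[OF repm_Hs[OF M]] by auto
  ultimately show ?case
   using teq_trans[of "repm n M + repm (int k) (repm n M)" "repm n M + repm (int k * n) M"] repm_Hs[OF M] by metis
 qed
 show ?thesis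
 proof (cases "m \<ge> 0")
  case True
  then show ?thesis using pos[of "nat m" n] by simp
 next
  case False
  then have "teq (repm (- m) (repm (- n) M)) (repm (m * n) M)" using pos[of "nat (- m)" "- n"] by simp
  moreover have "repm (- m) (repm (- n) M) = repm m (repm n M)"
   unfolding neg_repm[symmetric] repm_neg by simp
  ultimately show ?thesis by simp
 qed
qed

text \<open>The multiplier \<open>{#e, p#}\<close> is a Pfister form and absorbs its slot
  \<open>p\<close>.\<close>

lemma teq_scale: assumes p: "p \<in> P" "p \<noteq> 0" and w: "w \<in> Hs" shows "teq {#p * w#} {#w#}"
proof -
 have pF: "p \<in> F" using p P_props[OF P] by auto
 have pw: "p * w \<in> Hs" using F_mult_Hs[OF pF p(2) w] .
 have ppw: "p * (p * w) \<in> Hs" using F_mult_Hs[OF pF p(2) pw] .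
 have "w * p = p * w" using F_central[OF pF HsD(1)[OF w]] by simp
 then have "w * (p * p) = p * (p * w)" using F_central[OF pF HsD(1)[OF pw]] by (metis mult.assoc)
 then have "witt {#p * (p * w)#} {#w#}"
  using witt_conj_comm[OF HsD(1)[OF w] F_D[OF pF] F_sym[OF pF]] \<open>w * p = p * w\<close> by simp
 moreover have "witt {#p * w#} {#p * w#}" using pw HsD by (intro witt_refl) auto
 ultimately have "metab (({#p * (p * w)#} + {#p * w#}) + neg ({#w#} + {#p * w#}))"
  using witt_add unfolding witt_def by blast
 moreover have "tens {#e, p#} ({#p * w#} + neg {#w#}) = ({#p * (p * w)#} + {#p * w#}) + neg ({#w#} + {#p * w#})"
  using e_left HsD(1)[OF pw] HsD(1)[OF w] by (simp add: add_mset_commute)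
 ultimately show ?thesis unfolding teq_def torsion_def using P_e[OF P] e_nz p
  by (intro exI[of _ "{#e, p#}"]) (simp del: tens_simps tens_add_right)
qed

lemma teq_tens:
 assumes K: "K inside F - {0}" and w: "w \<in> Hs"
 shows "teq (tens K {#w#}) (repm (\<Sum>c\<in>#K. sgnP P c) {#w#})"
 using K
proof (induction K)
 case empty
 then show ?case using teq_refl[of "{#}"] by simp
next
 case (add c K)
 have c: "c \<in> F" "c \<noteq> 0" using add.prems by auto
 have wH: "{#w#} inside Hs" using w by simp
 have 1: "teq {#c * w#} (repm (sgnP P c) {#w#})"
 proof (cases "c \<in> P")
  case True
  then show ?thesis using teq_scale[of c w] c w by (simp add: sgnP_def)
 next
  case False
  then have "- c \<in> P" using P_props(5)[OF P c(1)] by auto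
  then have "teq {#- c * w#} {#w#}" using teq_scale[of "- c" w] c w by simp
  then have "teq (neg {#- c * w#}) (neg {#w#})"
   by (rule teq_neg) (use w F_mult_Hs[OF F_uminus[OF c(1)] _ w] c in auto)
  then show ?thesis using False by (simp add: sgnP_def repm_def)
 qed
 have H: "{#c * w#} inside Hs" "(tens K {#w#}) inside Hs"
  using F_mult_Hs[OF c w] tens_Hs[of K "{#w#}"] add.prems w by auto
 have 2: "teq ({#c * w#} + tens K {#w#}) (repm (sgnP P c) {#w#} + repm (\<Sum>c\<in>#K. sgnP P c) {#w#})"
  by (rule teq_add[OF 1 add.IH]) (use add.prems H repm_Hs[OF wH] in auto)
 have "teq (repm (sgnP P c) {#w#} + repm (\<Sum>c\<in>#K. sgnP P c) {#w#}) (repm (sgnP P c + (\<Sum>c\<in>#K. sgnP P c)) {#w#})"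
  by (rule teq_sym[OF repm_plus[OF wH]]) (use repm_Hs[OF wH] in auto)
 from teq_trans[OF 2 this] show ?case using H repm_Hs[OF wH] by auto
qed

end

end

context sym_ext_max
begin

lemma L_divinv: "divinv L e \<sigma>" by (rule LL.divinv_axioms)

lemma LL_witt: assumes "LL.witt M N" "M inside L" "N inside L" shows "witt M N"
 unfolding witt_def
 by (rule subring_metab[OF L_divinv]) (use assms L_D L_uminus in \<open>auto simp: LL.witt_def\<close>)

lemma LHs': "v \<in> L ==> v \<noteq> 0 ==> v \<in> Hs" by (simp add: Hs_def L_D L_sym)

lemma L_scale: assumes "M inside L - {0}" "x \<in> L" "x \<noteq> 0" shows "set_mset (scl x M) \<subseteq> L - {0}"
proof
 fix y assume "y \<in># scl x M"
 then obtain m where "y = x * m" "m \<in># M" by auto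
 moreover from this have "m \<in> L" "m \<noteq> 0" using assms(1) by auto
 ultimately show "y \<in> L - {0}" using L_mult L_nz assms(2,3) by auto
qed

lemma L_sub_Hs: "M inside L - {0} ==> M inside Hs" using LHs' by auto

text \<open>For the first slot, multiplication exchanges the two halves of the form up to squares;
  for a later slot it is absorbed by both halves.\<close>

lemma pf_absorb: "set gs \<subseteq> L - {0} ==> g \<in> set gs ==> LL.witt (scl g (pf gs)) (pf gs)"
proof (induction gs)
 case (Cons h gs)
 have mc: "LL.mclosed (L - {0})" using L_nz L_mult F_L F_e e_nz by (auto simp: LL.mclosed_def)
 have pfL: "(pf gs) inside L - {0}" by (rule pf_in[OF mc]) (use Cons in auto)
 have imL: "set_mset (scl x (pf gs)) \<subseteq> L - {0}" if "x \<in> L" "x \<noteq> 0" for x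
  by (rule L_scale[OF pfL that])
 have hL: "h \<in> L" "h \<noteq> 0" using Cons.prems by auto
 show ?case
 proof (cases "g = h")
  case True
  have "LL.witt (image_mset (\<lambda>x. h * (h * x)) (pf gs)) (image_mset (\<lambda>x. x) (pf gs))"
  proof (rule LL.witt_image)
   fix m assume "m \<in># pf gs"
   then have m: "m \<in> L" using pfL by auto
   have "h * (h * m) = m * (h * h)" using L_comm hL m L_mult by (metis mult.assoc)
   then show "LL.witt {#h * (h * m)#} {#m#}" using LL.witt_conj_comm[of m h] m hL L_sym L_comm by simp
  qed
  then have "LL.witt (scl h (pf gs) + image_mset (\<lambda>x. h * (h * x)) (pf gs)) (scl h (pf gs) + pf gs)"
   by (intro LL.witt_add LL.witt_refl) (use imL[OF hL] in auto)
  then show ?thesis using True by (simp add: image_mset_comp ac_simps)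
 next
  case False
  then have IH: "LL.witt (scl g (pf gs)) (pf gs)" and gL: "g \<in> L" "g \<noteq> 0" using Cons by auto
  have "LL.witt (tens {#h#} (scl g (pf gs))) (tens {#h#} (pf gs))"
   by (rule LL.witt_tens[OF IH]) (use imL[OF gL] pfL hL LHs in auto)
  moreover have "tens {#h#} (scl g (pf gs)) = scl g (scl h (pf gs))"
  proof -
   have "h * (g * x) = g * (h * x)" for x using L_comm[OF hL(1) gL(1)] by (metis mult.assoc)
   then show ?thesis by (simp add: image_mset_comp)
  qed
  ultimately show ?thesis using LL.witt_add[OF IH] by simp
 qed
qed simp

text \<open>
 \<open>S w\<close> is the signature at \<open>Q\<close> of the form \<open>\<Lambda>\<close> of \<open>pairing_form\<close>; multiplying with a Pfister form that
 absorbs all entries of \<open>\<Lambda>\<close> replaces \<open>\<Lambda>\<close> by this integer.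
\<close>

lemma theta_exists:
 assumes P: "fordering F P" and v0: "v0 \<in> L" "v0 \<noteq> 0" "sg P v0 \<noteq> 0"
 shows "\<exists>S B. (\<forall>w\<in>Hs. \<bar>S w\<bar> \<le> (B::int)) \<and> (\<forall>u\<in>Hs. \<forall>w\<in>Hs. teq P (repm (S w) {#u#}) (repm (S u) {#w#}))
   \<and> (\<forall>w\<in>Hs. S w = 0 \<longrightarrow> torsion (P - {0}) {#w#})"
proof -
 from visible_ordering[OF P v0] obtain Q where Q: "fordering L Q" "P \<subseteq> Q" and vis0: "\<forall>G. finite G \<longrightarrow> G \<subseteq> Q - {0} \<longrightarrow>
   (\<exists>gs. set gs \<subseteq> Q - {0} \<and> G \<subseteq> set gs \<and> (\<Sum>v\<in>#pf gs. sg P v) \<noteq> 0)" by (elim exE conjE)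
 have vis: "\<And>G. finite G ==> G \<subseteq> Q - {0} ==>
   \<exists>gs. set gs \<subseteq> Q - {0} \<and> G \<subseteq> set gs \<and> (\<Sum>v\<in>#pf gs. sg P v) \<noteq> 0"
  using vis0 by (elim allE impE)
 have QL: "Q \<subseteq> L" using LL.P_props[OF Q(1)] by auto
 define \<Lambda> where "\<Lambda> = (\<lambda>w. SOME \<Lambda>. \<Lambda> inside L - {0} \<and> size \<Lambda> = size (dg e) \<and>
   (\<forall>v\<in>L-{0}. witt (tens (dg v) {#w#}) (scl v \<Lambda>)))"
 have \<Lambda>0: "(\<Lambda> w) inside L - {0} \<and> size (\<Lambda> w) = size (dg e) \<and>
   (\<forall>v\<in>L-{0}. witt (tens (dg v) {#w#}) (scl v (\<Lambda> w)))" if "w \<in> Hs" for w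
  unfolding \<Lambda>_def by (rule someI_ex) (rule pairing_form[OF that])
 have \<Lambda>: "(\<Lambda> w) inside L - {0}" "size (\<Lambda> w) = size (dg e)" if "w \<in> Hs" for w
  by (rule conjunct1[OF \<Lambda>0[OF that]], rule conjunct1[OF conjunct2[OF \<Lambda>0[OF that]]])
 have \<Lambda>3: "witt (tens (dg v) {#w#}) (scl v (\<Lambda> w))" if "w \<in> Hs" "v \<in> L" "v \<noteq> 0" for w v
  by (rule bspec[OF conjunct2[OF conjunct2[OF \<Lambda>0[OF that(1)]]]]) (simp add: that)
 define S where "S = (\<lambda>w. \<Sum>l\<in>#\<Lambda> w. sgnP Q l)"
 have bound: "\<bar>S w\<bar> \<le> int (size (dg e))" if "w \<in> Hs" for w
 proof -
  have "\<bar>\<Sum>l\<in>#M. sgnP Q l\<bar> \<le> int (size M)" for M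
   by (induction M) (auto simp: sgnP_def)
  then show ?thesis using \<Lambda>(2)[OF that] unfolding S_def by metis
 qed
 \<comment> \<open>The product of \<psi> and \<open>\<Lambda> w\<close> is evaluated twice: along
   the entries of \<psi> it gives \<open>T\<close> copies of \<open>w\<close>, along those of
   \<open>\<Lambda> w\<close>, whose absolute values are absorbed, it gives \<open>S w\<close>
   copies of \<psi>.\<close>
 have main: "teq P (repm T {#w#}) (repm (S w) \<psi>)"
  if w: "w \<in> Hs" and gs: "set gs \<subseteq> Q - {0}" "(\<lambda>l. if l \<in> Q then l else - l) ` set_mset (\<Lambda> w) \<subseteq> set gs"
   and T: "T = (\<Sum>v\<in>#pf gs. sg P v)" and psi: "\<psi> = pf gs" for w gs T \<psi>
 proof -
  have gsL: "set gs \<subseteq> L - {0}" using gs QL by auto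
  have mc: "LL.mclosed (L - {0})" using L_nz L_mult F_L F_e e_nz by (auto simp: LL.mclosed_def)
  have pL: "\<psi> inside L - {0}" unfolding psi by (rule pf_in[OF mc gsL])
  have pH: "\<psi> inside Hs" using pL LHs' by auto
  have wH: "{#w#} inside Hs" using w by simp
  have 1: "teq P (tens Xm (\<Lambda> w)) (repm (\<Sum>v\<in>#Xm. sg P v) {#w#}) \<and> (tens Xm (\<Lambda> w)) inside Hs" if "Xm inside L - {0}" for Xm
   using that
  proof (induction Xm)
   case empty
   then show ?case using teq_refl[OF P, of "{#}"] by simp
  next
   case (add v Xm)
   have v: "v \<in> L" "v \<noteq> 0" using add.prems by auto
   have vH: "set_mset (scl v (\<Lambda> w)) \<subseteq> Hs"
    by (rule L_sub_Hs[OF L_scale[OF \<Lambda>(1)[OF w] v]])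
   have dH: "(tens (dg v) {#w#}) inside Hs" by (rule tens_Hs[OF dg_F[OF v] wH])
   have "teq P (tens (dg v) {#w#}) (scl v (\<Lambda> w))"
    by (rule witt_teq[OF P \<Lambda>3[OF w v] dH vH])
   then have "teq P (scl v (\<Lambda> w)) (tens (dg v) {#w#})"
    by (rule teq_sym[OF P _ dH vH])
   moreover have "teq P (tens (dg v) {#w#}) (repm (sg P v) {#w#})"
    unfolding sg_def by (rule teq_tens[OF P dg_F[OF v] w])
   ultimately have a: "teq P (scl v (\<Lambda> w)) (repm (sg P v) {#w#})"
    by (rule teq_trans[OF P _ _ vH dH]) (rule repm_Hs[OF P wH])
   have IH: "teq P (tens Xm (\<Lambda> w)) (repm (\<Sum>v\<in>#Xm. sg P v) {#w#})" "(tens Xm (\<Lambda> w)) inside Hs"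
    using add by auto
   have b: "teq P (scl v (\<Lambda> w) + tens Xm (\<Lambda> w)) (repm (sg P v) {#w#} + repm (\<Sum>v\<in>#Xm. sg P v) {#w#})"
    by (rule teq_add[OF P a IH(1) vH repm_Hs[OF P wH] IH(2) repm_Hs[OF P wH]])
   have c: "teq P (repm (sg P v) {#w#} + repm (\<Sum>v\<in>#Xm. sg P v) {#w#}) (repm (sg P v + (\<Sum>v\<in>#Xm. sg P v)) {#w#})"
    by (rule teq_sym[OF P repm_plus[OF P wH]]) (use repm_Hs[OF P wH] in auto)
   show ?case using teq_trans[OF P b c] vH IH(2) repm_Hs[OF P wH] by auto
  qed
  have "teq P (repm T {#w#}) (tens \<psi> (\<Lambda> w))" and tH: "(tens \<psi> (\<Lambda> w)) inside Hs"
   using teq_sym[OF P conjunct1[OF 1[OF pL]]] conjunct2[OF 1[OF pL]] repm_Hs[OF P wH] by (auto simp: T psi)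
  moreover have "teq P (tens \<psi> (\<Lambda> w)) (repm (S w) \<psi>)"
  proof -
   have "tens \<psi> (\<Lambda> w) = tens (\<Lambda> w) \<psi>"
   proof -
    have t1: "tens Xm {#e#} = Xm" if "Xm inside L" for Xm
     using that by (induction Xm) (auto simp: e_right L_D)
    have "tens \<psi> (tens (\<Lambda> w) {#e#}) = tens (\<Lambda> w) (tens \<psi> {#e#})"
     by (rule tens_comm_out) (use pL \<Lambda>(1)[OF w] L_comm in blast)
    then show ?thesis using t1 pL \<Lambda>(1)[OF w] by (metis Diff_subset subset_trans)
   qed
   moreover have "teq P (tens Xm \<psi>) (repm (\<Sum>l\<in>#Xm. sgnP Q l) \<psi>) \<and> (tens Xm \<psi>) inside Hs"
    if "Xm inside set_mset (\<Lambda> w)" for Xm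
    using that
   proof (induction Xm)
    case empty
    then show ?case using teq_refl[OF P, of "{#}"] by simp
   next
    case (add l Xm)
    have lL: "l \<in> L" "l \<noteq> 0" and l\<Lambda>: "l \<in># \<Lambda> w" using add.prems \<Lambda>(1)[OF w] by auto
    have lH: "set_mset (scl l \<psi>) \<subseteq> Hs"
     by (rule L_sub_Hs[OF L_scale[OF pL lL]])
    have a: "teq P (scl l \<psi>) (repm (sgnP Q l) \<psi>)"
    proof (cases "l \<in> Q")
     case True
     then have "l \<in> set gs" using gs(2) l\<Lambda> by auto
     then have "witt (scl l \<psi>) \<psi>" unfolding psi
      by (intro LL_witt pf_absorb gsL) (use pL lL L_mult psi in auto)
     then show ?thesis using witt_teq[OF P _ lH pH] True by (simp add: sgnP_def)
    next
     case False
     have mlH: "set_mset (scl (- l) \<psi>) \<subseteq> Hs"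
      by (rule L_sub_Hs[OF L_scale[OF pL]]) (use lL L_uminus in auto)
     have "- l \<in> set gs" using gs(2) l\<Lambda> False by (auto simp: image_subset_iff)
     then have "witt (scl (- l) \<psi>) \<psi>" unfolding psi
      by (intro LL_witt pf_absorb gsL) (use pL lL L_mult L_uminus psi in auto)
     then have "teq P (scl (- l) \<psi>) \<psi>" by (rule witt_teq[OF P _ mlH pH])
     then have "teq P (neg (scl (- l) \<psi>)) (neg \<psi>)" by (rule teq_neg[OF P _ mlH pH])
     moreover have "neg (scl (- l) \<psi>) = scl l \<psi>"
      by (simp add: image_mset_comp)
     ultimately show ?thesis using False by (simp add: sgnP_def repm_def)
    qed
    have IH: "teq P (tens Xm \<psi>) (repm (\<Sum>l\<in>#Xm. sgnP Q l) \<psi>)" "(tens Xm \<psi>) inside Hs"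
     using add by auto
    have b: "teq P (scl l \<psi> + tens Xm \<psi>) (repm (sgnP Q l) \<psi> + repm (\<Sum>l\<in>#Xm. sgnP Q l) \<psi>)"
     by (rule teq_add[OF P a IH(1) lH repm_Hs[OF P pH] IH(2) repm_Hs[OF P pH]])
    have c: "teq P (repm (sgnP Q l) \<psi> + repm (\<Sum>l\<in>#Xm. sgnP Q l) \<psi>) (repm (sgnP Q l + (\<Sum>l\<in>#Xm. sgnP Q l)) \<psi>)"
     by (rule teq_sym[OF P repm_plus[OF P pH]]) (use repm_Hs[OF P pH] in auto)
    show ?case using teq_trans[OF P b c] lH IH(2) repm_Hs[OF P pH] by auto
   qed
   ultimately show ?thesis by (simp add: S_def)
  qed
  ultimately show ?thesis
   by (rule_tac teq_trans[OF P _ _ repm_Hs[OF P wH] tH repm_Hs[OF P pH]])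
 qed
 \<comment> \<open>A single Pfister form absorbs the entries belonging to \<open>w\<close> and to
   \<open>u\<close>. Eliminating \<psi> leaves the relation multiplied by \<open>T\<close>, which is
   nonzero and therefore cancels modulo torsion.\<close>
 have cross: "teq P (repm (S u) {#w#}) (repm (S w) {#u#}) \<and> (S w = 0 \<longrightarrow> torsion (P - {0}) {#w#})"
  if w: "w \<in> Hs" and u: "u \<in> Hs" for w u
 proof -
  define G where "G = (\<lambda>l. if l \<in> Q then l else - l) ` (set_mset (\<Lambda> w) \<union> set_mset (\<Lambda> u))"
  have "G \<subseteq> Q - {0}"
  proof
   fix g assume "g \<in> G"
   then obtain l where l: "l \<in># \<Lambda> w \<or> l \<in># \<Lambda> u" "g = (if l \<in> Q then l else - l)" unfolding G_def by blast
   have "l \<in> L" "l \<noteq> 0" using l(1) subsetD[OF \<Lambda>(1)[OF w]] subsetD[OF \<Lambda>(1)[OF u]] by blast+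
   then show "g \<in> Q - {0}" using LL.P_props(5)[OF Q(1)] l(2) by auto
  qed
  moreover have "finite G" by (simp add: G_def)
  ultimately have "\<exists>gs. set gs \<subseteq> Q - {0} \<and> G \<subseteq> set gs \<and> (\<Sum>v\<in>#pf gs. sg P v) \<noteq> 0" by (rule vis[rotated])
  then obtain gs where gs: "set gs \<subseteq> Q - {0}" "G \<subseteq> set gs" "(\<Sum>v\<in>#pf gs. sg P v) \<noteq> 0" by (elim exE conjE)
  define T where "T = (\<Sum>v\<in>#pf gs. sg P v)"
  define \<psi> where "\<psi> = pf gs"
  have mc: "LL.mclosed (L - {0})" using L_nz L_mult F_L F_e e_nz by (auto simp: LL.mclosed_def)
  have pH: "\<psi> inside Hs" unfolding \<psi>_def using pf_in[OF mc, of gs] gs(1) QL LHs' by blast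
  have wH: "{#w#} inside Hs" "{#u#} inside Hs" using w u by auto
  note RH = repm_Hs[OF P pH] repm_Hs[OF P wH(1)] repm_Hs[OF P wH(2)]
  have mw: "teq P (repm T {#w#}) (repm (S w) \<psi>)" and mu: "teq P (repm T {#u#}) (repm (S u) \<psi>)"
   using main[OF w gs(1) _ T_def \<psi>_def] main[OF u gs(1) _ T_def \<psi>_def] gs(2) by (auto simp: G_def)
  have A: "teq P (repm (T * m) {#w#}) (repm (m * S w) \<psi>)" if "teq P (repm T {#w#}) (repm (S w) \<psi>)" "{#w#} inside Hs" for w m
  proof -
   note RH = repm_Hs[OF P pH] repm_Hs[OF P that(2)]
   note RR = repm_Hs[OF P RH(1)] repm_Hs[OF P RH(2)]
   have 1: "teq P (repm m (repm T {#w#})) (repm m (repm (S w) \<psi>))"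
    by (rule teq_repm[OF P that(1)]) (use RH in auto)
   have 2: "teq P (repm (m * T) {#w#}) (repm m (repm T {#w#}))"
    by (rule teq_sym[OF P repm_repm[OF P that(2)] RR(2) RH(2)])
   have 3: "teq P (repm m (repm (S w) \<psi>)) (repm (m * S w) \<psi>)" by (rule repm_repm[OF P pH])
   have "teq P (repm (m * T) {#w#}) (repm m (repm (S w) \<psi>))" by (rule teq_trans[OF P 2 1 RH(2) RR(2) RR(1)])
   from teq_trans[OF P this 3 RH(2) RR(1) RH(1)] show ?thesis by (simp add: mult.commute)
  qed
  have B1: "teq P (repm (T * S u) {#w#}) (repm (S u * S w) \<psi>)" using A[OF mw wH(1)] .
  have B2: "teq P (repm (S u * S w) \<psi>) (repm (T * S w) {#u#})"
   using teq_sym[OF P A[OF mu wH(2), of "S w"] RH(3) RH(1)] by (simp add: mult.commute)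
  have B: "teq P (repm (T * S u) {#w#}) (repm (T * S w) {#u#})"
   by (rule teq_trans[OF P B1 B2 RH(2) RH(1) RH(3)])
  define M where "M = repm (S u) {#w#} + neg (repm (S w) {#u#})"
  have MH: "M inside Hs" unfolding M_def using RH neg_Hs by auto
  have C1: "teq P (repm T (repm (S u) {#w#})) (repm (T * S u) {#w#})" by (rule repm_repm[OF P wH(1)])
  have C2: "teq P (repm (T * S w) {#u#}) (repm T (repm (S w) {#u#}))"
   by (rule teq_sym[OF P repm_repm[OF P wH(2)] repm_Hs[OF P RH(3)] RH(3)])
  have "teq P (repm T (repm (S u) {#w#})) (repm T (repm (S w) {#u#}))"
   by (rule teq_trans[OF P C1 teq_trans[OF P B C2 RH(2) RH(3) repm_Hs[OF P RH(3)]] repm_Hs[OF P RH(2)] RH(2) repm_Hs[OF P RH(3)]])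
  then have "torsion (P - {0}) (repm T M)"
   by (simp add: teq_def[OF P] M_def repm_add_distrib repm_neg)
  then have "torsion (P - {0}) M" by (rule torsion_repm[OF P _ _ MH]) (use gs T_def in auto)
  moreover have "torsion (P - {0}) {#w#}" if "S w = 0"
  proof -
   have "torsion (P - {0}) (repm T {#w#})" using mw that teq_empty[OF P] by simp
   then show ?thesis by (rule torsion_repm[OF P _ _ wH(1)]) (use gs T_def in auto)
  qed
  ultimately show ?thesis by (simp add: teq_def[OF P] M_def)
 qed
 show ?thesis
  by (rule exI[of _ S], rule exI[of _ "int (size (dg e))"]) (use bound cross in blast)
qed

end

section \<open>Anisotropic cones in the division ring and the proportionality integers\<close>

context divinv_base
begin

definition coneset :: "'a set \<Rightarrow> 'a set \<Rightarrow> 'a set" where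
 "coneset P W = {p * (\<sigma> x * w * x) | p w x. p \<in> P \<and> p \<noteq> 0 \<and> w \<in> W \<and> x \<in> D \<and> x \<noteq> 0}"

text \<open>Joint anisotropy over the ordering: no diagonal form whose entries are positive
  multiples of elements of \<open>W\<close> has a nontrivial zero. Since \<open>coneset\<close>
  excludes zero, multisets can record the nonzero coordinates.\<close>

definition aniso :: "'a set \<Rightarrow> 'a set \<Rightarrow> bool" where
 "aniso P W \<longleftrightarrow> (\<forall>M. M inside coneset P W \<longrightarrow> sum_mset M = 0 \<longrightarrow> M = {#})"

text \<open>\<open>witt_binary\<close> merges two entries into their sum and sets a third entry
  aside. The entries still to be merged keep the sum zero, so an opposite pair appears and splits
  off.\<close>

lemma isotropic_reduce:
 "M inside Hs ==> M \<noteq> {#} ==> sum_mset M = 0 ==>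
   \<exists>M'. M' inside Hs \<and> size M' + 2 = size M \<and> witt M M'"
proof (induction "size M" arbitrary: M rule: less_induct)
 case less
 obtain a M1 where M1: "M = add_mset a M1" using less.prems(2) by (cases M) auto
 have "M1 \<noteq> {#}" using M1 less.prems HsD(3)[of a] by auto
 then obtain b N where N: "M1 = add_mset b N" by (cases M1) auto
 have ab: "a \<in> Hs" "b \<in> Hs" and NH: "N inside Hs" using less.prems(1) M1 N by auto
 show ?case
 proof (cases "a + b = 0")
  case True
  then have b: "b = - a" by (simp add: add_eq_0_iff)
  have "witt {#a#} {#a#}" by (rule witt_refl) (use HsD ab in auto)
  then have "metab ({#a, b#} + {#})" using b by (simp add: witt_def add_mset_commute)
  then have "witt ({#a, b#} + N) ({#} + N)"
   by (intro witt_add witt_refl) (use Hs_sub(1)[OF NH] in \<open>auto simp: witt_def\<close>)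
  then show ?thesis using NH by (intro exI[of _ N]) (simp add: M1 N)
 next
  case False
  note wb = witt_binary[OF ab False]
  define s where "s = a * dinv (a + b) * b"
  have "\<exists>M'. M' inside Hs \<and> size M' + 2 = size (add_mset (a + b) N) \<and> witt (add_mset (a + b) N) M'"
   by (rule less.hyps) (use less.prems M1 N wb(2) NH in \<open>auto simp: add.assoc\<close>)
  then obtain M' where M': "M' inside Hs" "size M' + 2 = size (add_mset (a + b) N)" "witt (add_mset (a + b) N) M'"
   by blast
  have sH: "s \<in> Hs" using wb(3) by (simp add: s_def)
  have w1: "witt ({#a, b#} + N) ({#a + b, s#} + N)"
   by (intro witt_add witt_refl) (use Hs_sub(1)[OF NH] wb(1) s_def in auto)
  have w2: "witt (add_mset (a + b) N + {#s#}) (M' + {#s#})"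
   by (intro witt_add witt_refl M'(3)) (use HsD sH in auto)
  have "witt ({#a + b, s#} + N) (M' + {#s#})" using w2 by (simp add: add_mset_commute)
  moreover have "({#a + b, s#} + N) inside D - {0}"
   using Hs_sub(2)[OF NH] HsD[OF sH] HsD[OF wb(2)] by simp
  ultimately have "witt ({#a, b#} + N) (M' + {#s#})" by (intro witt_trans[OF w1])
  moreover have "M = {#a, b#} + N" using M1 N by simp
  ultimately have "witt M (M' + {#s#})" by simp
  then show ?thesis using M'(1,2) sH M1 N by (intro exI[of _ "M' + {#s#}"]) auto
 qed
qed

lemma sum_mset_sum_in: "finite I ==> (\<Sum>x\<in>#mset_set I. f x) = sum f I" by (simp add: sum_unfold_sum_mset)

context
 fixes P assumes P: "fordering F P"
begin

lemma coneset_Hs: "W \<subseteq> Hs ==> coneset P W \<subseteq> Hs"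
 using P_props(1)[OF P] F_mult_Hs conj_Hs by (auto simp: coneset_def subset_iff)

lemma coneset_scale: assumes "p \<in> P" "p \<noteq> 0" "m \<in> coneset P W" shows "p * m \<in> coneset P W"
proof -
 obtain q w x where q: "m = q * (\<sigma> x * w * x)" "q \<in> P" "q \<noteq> 0" "w \<in> W" "x \<in> D" "x \<noteq> 0"
  using assms by (auto simp: coneset_def)
 have "p * m = (p * q) * (\<sigma> x * w * x)" "p * q \<in> P" "p * q \<noteq> 0"
  using q assms P_props[OF P] F_mult_nz[of p q] by (auto simp: mult.assoc)
 then show ?thesis using q by (auto simp: coneset_def)
qed

lemma coneset_conj:
 assumes "m \<in> coneset P W" "y \<in> D" "y \<noteq> 0" "W \<subseteq> D" shows "\<sigma> y * m * y \<in> coneset P W"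
proof -
 obtain q w x where q: "m = q * (\<sigma> x * w * x)" "q \<in> P" "q \<noteq> 0" "w \<in> W" "x \<in> D" "x \<noteq> 0"
  using assms by (auto simp: coneset_def)
 have qD: "q \<in> F" using q P_props(1)[OF P] by auto
 have "\<sigma> y * (q * (\<sigma> x * w * x)) * y = q * (\<sigma> (x * y) * w * (x * y))"
  using F_central[OF qD s_in[OF assms(2)]] assms q s_mult[of x y] by (metis mult.assoc)
 moreover have "x * y \<in> D" "x * y \<noteq> 0" using q assms D_mult mult_nz by auto
 ultimately show ?thesis using q(1-4) unfolding coneset_def by blast
qed

lemma coneset_base: assumes "w \<in> W" "W \<subseteq> D" shows "w \<in> coneset P W"
proof -
 have "w \<in> D" using assms by auto
 then have "w = e * (\<sigma> e * w * e)" using e_left e_right s_e D_mult e_in by simp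
 then show ?thesis using assms(1) e_in e_nz P_e[OF P] unfolding coneset_def by blast
qed

lemma coneset_teq: assumes "m \<in> coneset P {w}" "w \<in> Hs" shows "teq P {#m#} {#w#}"
proof -
 obtain q x where q: "m = q * (\<sigma> x * w * x)" "q \<in> P" "q \<noteq> 0" "x \<in> D" "x \<noteq> 0"
  using assms by (auto simp: coneset_def)
 have cH: "\<sigma> x * w * x \<in> Hs" using conj_Hs[OF assms(2) q(4,5)] .
 have "witt {#\<sigma> x * w * x#} {#w#}"
  by (rule witt_sym[OF witt_conj]) (use HsD[OF assms(2)] HsD[OF cH] q in auto)
 then have "teq P {#\<sigma> x * w * x#} {#w#}" by (rule witt_teq[OF P]) (use cH assms in auto)
 moreover have "teq P {#m#} {#\<sigma> x * w * x#}" unfolding q(1) by (rule teq_scale[OF P q(2,3) cH])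
 moreover have "m \<in> Hs" using coneset_Hs[of "{w}"] assms by auto
 ultimately show ?thesis using teq_trans[OF P] cH assms(2) by (metis empty_subsetI insert_subset set_mset_add_mset_insert set_mset_empty)
qed

text \<open>A space of dimension \<open>n\<close> meets the span of more than \<open>n\<close> of
  the \<open>2 * n\<close> coordinates; on coordinates with entries in the cone, isotropy is a
  vanishing sum of cone elements.\<close>

lemma aniso_half:
 assumes an: "aniso P W" and I: "finite (I::nat set)" "J \<subseteq> I" "card I < 2 * card J" and n: "card I = 2 * n"
  and U: "rsub U" "\<And>u i. u \<in> U ==> i \<notin> I ==> u i = 0" "\<And>u. u \<in> U ==> hf I d u u = 0" "dimge n U"
  and d: "\<And>i. i \<in> J ==> d i \<in> coneset P W" and W: "W \<subseteq> D"
 shows False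
proof -
 have "card (I - J) = card I - card J" using I by (simp add: card_Diff_subset finite_subset)
 moreover have "card J \<le> card I" using I by (simp add: card_mono)
 ultimately have "card (I - J) < n" using I(3) n by linarith
 then obtain u where u: "u \<in> U" "\<exists>i. u i \<noteq> 0" "\<forall>j\<in>I-J. u j = 0"
  using dimge_exists[of "I - J" U "\<lambda>j u. u j" n] I U rlin_coord[OF U(1)] by auto
 define J' where "J' = {j\<in>J. u j \<noteq> 0}"
 have J': "J' \<subseteq> I" using I by (auto simp: J'_def)
 then have J'f: "finite J'" using I(1) finite_subset by blast
 note J' = J'f J'
 have uD: "u j \<in> D" for j using rsubD(1)[OF U(1) u(1)] .
 have "0 = (\<Sum>i\<in>I. \<sigma> (u i) * d i * u i)" using U(3)[OF u(1)] by (simp add: hf_def)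
 also have "\<dots> = (\<Sum>i\<in>J'. \<sigma> (u i) * d i * u i)"
  by (rule sum.mono_neutral_right) (use I J' u J'_def s_zero in auto)
 finally have s: "sum_mset (image_mset (\<lambda>i. \<sigma> (u i) * d i * u i) (mset_set J')) = 0"
  by (simp add: sum_mset_sum_in J')
 have "image_mset (\<lambda>i. \<sigma> (u i) * d i * u i) (mset_set J') = {#}"
 proof -
  have "set_mset (image_mset (\<lambda>i. \<sigma> (u i) * d i * u i) (mset_set J')) \<subseteq> coneset P W"
   using J' d uD coneset_conj W by (auto simp: J'_def)
  then show ?thesis using an s unfolding aniso_def by blast
 qed
 then have "J' = {}" using J' by (simp add: mset_set_empty_iff)
 then have "u i = 0" for i using u(3) U(2)[OF u(1)] I(2) by (cases "i \<in> I"; cases "i \<in> J") (auto simp: J'_def)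
 then show False using u(2) by auto
qed

text \<open>The law of inertia with the cone in the role of the positive elements:
  \<open>aniso_half\<close> applied to the form and to its negative.\<close>

lemma aniso_count:
 assumes an: "aniso P W" and W: "W \<subseteq> D" and m: "metab M"
  and M: "\<And>m. m \<in># M ==> m \<in> coneset P W \<or> - m \<in> coneset P W"
 shows "(\<Sum>m\<in>#M. if m \<in> coneset P W then 1 else - 1 :: int) = 0"
proof -
 obtain I :: "nat set" and d U where I: "M = image_mset d (mset_set I)" "lagr I d U" using m by (auto simp: metab_def)
 obtain n where n: "card I = 2 * n" "dimge n U" using I(2) by (auto simp: lagr_def)
 have U: "finite I" "rsub U" "\<And>u i. u \<in> U ==> i \<notin> I ==> u i = 0" "\<And>u. u \<in> U ==> hf I d u u = 0"
  using I(2) by (auto simp: lagr_def)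
 define J where "J = {i\<in>I. d i \<in> coneset P W}"
 have J: "J \<subseteq> I" "finite J" using U(1) by (auto simp: J_def)
 have 1: "\<not> card I < 2 * card J"
 proof
  assume a: "card I < 2 * card J"
  show False by (rule aniso_half[where d=d and U=U and I=I and J=J and n=n and W=W]) (use an U J a n W in \<open>auto simp: J_def\<close>)
 qed
 have 2: "\<not> card I < 2 * card (I - J)"
 proof
  assume a: "card I < 2 * card (I - J)"
  have "hf I (\<lambda>i. - d i) u u = 0" if "u \<in> U" for u
   using U(4)[OF that] by (simp add: hf_def sum_negf)
  moreover have "- d i \<in> coneset P W" if "i \<in> I - J" for i
   using that M[of "d i"] I(1) U(1) by (auto simp: J_def)
  ultimately show False
   by (intro aniso_half[where d="\<lambda>i. - d i" and U=U and I=I and J="I-J" and n=n and W=W]) (use an U a n W in auto)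
 qed
 have "card (I - J) = card I - card J" "card J \<le> card I" using J U(1) by (auto simp: card_Diff_subset card_mono)
 then have c: "card J = card (I - J)" using 1 2 by auto
 have "(\<Sum>m\<in>#M. if m \<in> coneset P W then 1 else - 1 :: int) = (\<Sum>i\<in>I. if d i \<in> coneset P W then 1 else - 1)"
  by (simp add: I(1) image_mset_comp sum_mset_sum_in U(1))
 also have "\<dots> = (\<Sum>i\<in>J. 1) + (\<Sum>i\<in>I-J. - 1)"
  by (subst sum.subset_diff[OF J(1) U(1)]) (simp add: J_def)
 also have "\<dots> = 0" using c by simp
 finally show ?thesis .
qed

lemma aniso_disjoint: assumes "aniso P W" "m \<in> coneset P W" "- m \<in> coneset P W" shows False
 using assms(1)[unfolded aniso_def, rule_format, of "{#m, - m#}"] assms(2,3) by auto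

text \<open>Modulo torsion all one-dimensional forms are proportional, with integer coefficients \<open>S w\<close>.\<close>

definition theta :: "('a \<Rightarrow> int) \<Rightarrow> int \<Rightarrow> bool" where
 "theta S B \<longleftrightarrow> (\<forall>w\<in>Hs. \<bar>S w\<bar> \<le> B) \<and> (\<forall>u\<in>Hs. \<forall>w\<in>Hs. teq P (repm (S w) {#u#}) (repm (S u) {#w#}))
   \<and> (\<forall>w\<in>Hs. S w = 0 \<longrightarrow> torsion (P - {0}) {#w#})"

lemma repm_single_count:
 assumes an: "aniso P W" and w: "w \<in> coneset P W" and K: "K inside P - {0}"
 shows "(\<Sum>m\<in>#tens K (repm n {#w#}). if m \<in> coneset P W then 1 else - 1 :: int) = int (size K) * n"
  "m \<in># tens K (repm n {#w#}) ==> m \<in> coneset P W \<or> - m \<in> coneset P W"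
proof -
 have kw: "k * w \<in> coneset P W" "\<not> - (k * w) \<in> coneset P W" if "k \<in># K" for k
 proof -
  have "k \<in> P" "k \<noteq> 0" using K that by auto
  then show "k * w \<in> coneset P W" using coneset_scale w by auto
  then show "\<not> - (k * w) \<in> coneset P W" using aniso_disjoint[OF an] by blast
 qed
 have rep: "(\<Sum>m\<in>#scl k (repeat_mset j N). g m) = int j * (\<Sum>m\<in>#scl k N. g m)" for g :: "'a \<Rightarrow> int" and k j N
  by (induction j) (auto simp: algebra_simps)
 have "(\<Sum>m\<in>#tens K (repm n {#w#}). if m \<in> coneset P W then 1 else - 1 :: int) = int (size K) * n"
  if "\<And>k. k \<in># K ==> k * w \<in> coneset P W \<and> \<not> - (k * w) \<in> coneset P W" for K
  using that
 proof (induction K)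
  case (add k K)
  then show ?case by (cases "n \<ge> 0") (auto simp: repm_def algebra_simps rep)
 qed simp
 then show "(\<Sum>m\<in>#tens K (repm n {#w#}). if m \<in> coneset P W then 1 else - 1 :: int) = int (size K) * n"
  using kw by blast
 show "m \<in> coneset P W \<or> - m \<in> coneset P W" if "m \<in># tens K (repm n {#w#})"
  using that kw(1) by (auto simp: set_tens repm_def split: if_splits)
qed

text \<open>Since \<open>e\<close> and \<open>d\<close> lie in a common anisotropic cone, a
  metabolic multiple of the proportionality relation between them can be counted by
  \<open>aniso_count\<close>. This forces \<open>S d = S e\<close>, and the common integer is
  cancelled.\<close>

lemma theta_aniso_torsion:
 assumes th: "theta S B" and d: "d \<in> Hs" and an: "aniso P {e, d}"
 shows "torsion (P - {0}) {#e, - d#}"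
proof -
 note mc = P_mclosed[OF P]
 define W where "W = {e, d}"
 have WD: "W \<subseteq> D" using e_in HsD d by (auto simp: W_def)
 have eW: "e \<in> coneset P W" "d \<in> coneset P W" using coneset_base WD by (auto simp: W_def)
 have anW: "aniso P W" using an by (simp add: W_def)
 have t: "torsion (P - {0}) (repm (S d) {#e#} + repm (- S e) {#d#})"
  using th d e_Hs by (auto simp: theta_def teq_def[OF P] neg_repm)
 then obtain K where K: "K \<noteq> {#}" "K inside P - {0}" "metab (tens K (repm (S d) {#e#}) + tens K (repm (- S e) {#d#}))"
  by (auto simp: torsion_def)
 have "int (size K) * S d + int (size K) * (- S e) = 0"
 proof -
  have "m \<in> coneset P W \<or> - m \<in> coneset P W" if "m \<in># tens K (repm (S d) {#e#}) + tens K (repm (- S e) {#d#})" for m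
   using that repm_single_count(2)[OF anW _ K(2)] eW by (metis union_iff)
  from aniso_count[OF anW WD K(3) this] show ?thesis
   using repm_single_count(1)[OF anW eW(1) K(2)] repm_single_count(1)[OF anW eW(2) K(2)] by simp
 qed
 then have "int (size K) * (S d - S e) = 0" by (simp add: algebra_simps)
 then have eq: "S d = S e" using K(1) by simp
 have dH: "{#e#} inside Hs" "{#- d#} inside Hs" using e_Hs d uminus_Hs by auto
 show ?thesis
 proof (cases "S e = 0")
  case True
  then have "torsion (P - {0}) {#e#}" "torsion (P - {0}) {#d#}" using th d e_Hs eq by (auto simp: theta_def)
  then have "torsion (P - {0}) ({#e#} + {#- d#})"
   using torsion_add[OF mc _ _ dH] torsion_neg[OF mc, of "{#d#}"] d by auto
  then show ?thesis by (simp add: add_mset_commute)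
 next
  case False
  have "repm (- S e) {#d#} = repm (S e) {#- d#}" using repm_neg[of "S e" "{#d#}"] neg_repm[of "S e" "{#d#}"] by simp
  then have "torsion (P - {0}) (repm (S e) ({#e#} + {#- d#}))"
   using t eq by (simp only: repm_add_distrib)
  then have "torsion (P - {0}) ({#e#} + {#- d#})" using torsion_repm[OF P _ False] dH by simp
  then show ?thesis by (simp add: add_mset_commute)
 qed
qed

text \<open>An element \<open>w\<close> with \<open>\<bar>S w\<bar>\<close> maximal works: an isotropic sum of \<open>n\<close> copies would have only \<open>n - 2\<close> summands.\<close>

lemma theta_aniso_exists:
 assumes th: "theta S B" and u: "u \<in> Hs" "\<not> torsion (P - {0}) {#u#}"
 shows "\<exists>w\<in>Hs. aniso P {w}"
proof -
 have bd: "nat \<bar>S x\<bar> < Suc (nat B)" if "x \<in> Hs" for x using th that by (auto simp: theta_def nat_le_iff)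
 obtain w where w: "w \<in> Hs" "\<And>x. x \<in> Hs ==> nat \<bar>S x\<bar> \<le> nat \<bar>S w\<bar>"
  using ex_has_greatest_nat[of "\<lambda>x. x \<in> Hs" u "\<lambda>x. nat \<bar>S x\<bar>" "Suc (nat B)"] u(1) bd by (metis less_imp_le)
 have mx: "\<bar>S x\<bar> \<le> \<bar>S w\<bar>" if "x \<in> Hs" for x using w(2)[OF that] by simp
 have "S u \<noteq> 0" using th u by (auto simp: theta_def)
 then have Sw: "S w \<noteq> 0" using mx[OF u(1)] by auto
 have wH: "{#w#} inside Hs" and uH: "{#u#} inside Hs" using w u by auto
 note RH = repm_Hs[OF P]
 have cross: "teq P (repm (S w) {#m#}) (repm (S m) {#w#})" if "m \<in> Hs" for m using th w that by (auto simp: theta_def)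
 have nt: "\<not> torsion (P - {0}) {#w#}"
 proof
  assume "torsion (P - {0}) {#w#}"
  then have a: "teq P {#w#} {#}" using teq_empty[OF P] by simp
  have "teq P (repm (S u) {#w#}) {#}" using teq_repm[OF P a wH, of "S u"] by (simp add: repm_def split: if_splits)
  then have "teq P (repm (S w) {#u#}) {#}" by (rule teq_trans[OF P cross[OF u(1)] _ RH[OF uH] RH[OF wH]]) simp
  then have "torsion (P - {0}) {#u#}" using teq_empty[OF P] torsion_repm[OF P _ Sw uH] by simp
  then show False using u by simp
 qed
 have "aniso P {w}" unfolding aniso_def
 proof (intro allI impI, rule ccontr)
  fix M assume M: "M inside coneset P {w}" "sum_mset M = 0" "M \<noteq> {#}"
  have MH: "M inside Hs" using M(1) coneset_Hs[of "{w}"] w by auto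
  obtain M' where M': "M' inside Hs" "size M' + 2 = size M" "witt M M'"
   using isotropic_reduce[OF MH M(3,2)] by blast
  have a: "teq P N (repm (int (size N)) {#w#}) \<and> N inside Hs" if "N inside coneset P {w}" for N using that
  proof (induction N)
   case empty
   then show ?case using teq_refl[OF P, of "{#}"] by simp
  next
   case (add m N)
   have mH: "{#m#} inside Hs" using add.prems coneset_Hs[of "{w}"] w by auto
   have IH: "teq P N (repm (int (size N)) {#w#})" "N inside Hs" using add by auto
   have 1: "teq P ({#m#} + N) ({#w#} + repm (int (size N)) {#w#})"
    by (rule teq_add[OF P coneset_teq IH(1) mH wH IH(2) RH[OF wH]]) (use add.prems w in auto)
   have 2: "teq P ({#w#} + repm (int (size N)) {#w#}) (repm (int (size N) + 1) {#w#})"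
    by (rule teq_sym[OF P repm_Suc[OF P wH]]) (use RH[OF wH] wH in auto)
   have "teq P ({#m#} + N) (repm (int (size N) + 1) {#w#})"
    by (rule teq_trans[OF P 1 2]) (use RH[OF wH] wH mH IH(2) in auto)
   then show ?case using mH IH(2) by (simp add: add.commute)
  qed
  have b: "teq P (repm (S w) N) (repm (\<Sum>m\<in>#N. S m) {#w#})" if "N inside Hs" for N using that
  proof (induction N)
   case empty
   then show ?case using teq_refl[OF P, of "{#}"] by (simp add: repm_def)
  next
   case (add m N)
   have mH: "m \<in> Hs" "{#m#} inside Hs" "N inside Hs" using add.prems by auto
   have 1: "teq P (repm (S w) {#m#} + repm (S w) N) (repm (S m) {#w#} + repm (\<Sum>m\<in>#N. S m) {#w#})"
    by (rule teq_add[OF P cross[OF mH(1)] add.IH[OF mH(3)] RH[OF mH(2)] RH[OF wH] RH[OF mH(3)] RH[OF wH]])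
   have 2: "teq P (repm (S m) {#w#} + repm (\<Sum>m\<in>#N. S m) {#w#}) (repm (S m + (\<Sum>m\<in>#N. S m)) {#w#})"
    by (rule teq_sym[OF P repm_plus[OF P wH]]) (use RH[OF wH] in auto)
   have 3: "teq P (repm (S w) {#m#} + repm (S w) N) (repm (S m + (\<Sum>m\<in>#N. S m)) {#w#})"
    by (rule teq_trans[OF P 1 2]) (use RH[OF wH] RH[OF mH(2)] RH[OF mH(3)] in auto)
   have "repm (S w) {#m#} + repm (S w) N = repm (S w) (add_mset m N)"
    using repm_add_distrib[of "S w" "{#m#}" N] by simp
   then show ?case using 3 by simp
  qed
  \<comment> \<open>The class of \<open>S w\<close> copies of \<open>M\<close> is computed from the
    cone, each entry counting as one copy of \<open>w\<close>, and from the shorter multiset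
    \<open>M'\<close> through \<open>S\<close>. As \<open>w\<close> is not torsion, the two integers
    agree.\<close>
  define n1 where "n1 = S w * int (size M)"
  define n2 where "n2 = (\<Sum>m\<in>#M'. S m)"
  have 1: "teq P (repm (S w) M) (repm n1 {#w#})"
   unfolding n1_def
   by (rule teq_trans[OF P teq_repm[OF P conjunct1[OF a[OF M(1)]] MH RH[OF wH]] repm_repm[OF P wH] RH[OF MH] RH[OF RH[OF wH]] RH[OF wH]])
  have 2: "teq P (repm (S w) M) (repm (S w) M')"
   by (rule teq_repm[OF P witt_teq[OF P M'(3) MH M'(1)] MH M'(1)])
  have 3: "teq P (repm (S w) M) (repm n2 {#w#})"
   unfolding n2_def by (rule teq_trans[OF P 2 b[OF M'(1)] RH[OF MH] RH[OF M'(1)] RH[OF wH]])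
  have 4: "teq P (repm n1 {#w#}) (repm n2 {#w#})"
   by (rule teq_trans[OF P teq_sym[OF P 1 RH[OF MH] RH[OF wH]] 3 RH[OF wH] RH[OF MH] RH[OF wH]])
  then have "teq P (repm n1 {#w#} + repm (- n2) {#w#}) {#}"
   using teq_empty[OF P] by (simp add: teq_def[OF P] neg_repm)
  from teq_trans[OF P repm_plus[OF P wH] this RH[OF wH]] have "teq P (repm (n1 + - n2) {#w#}) {#}" using RH[OF wH] by auto
  then have "n1 + - n2 = 0" using teq_empty[OF P] torsion_repm[OF P _ _ wH] nt by blast
  then have eq: "S w * int (size M) = n2" by (simp add: n1_def)
  have "\<bar>\<Sum>m\<in>#N. S m\<bar> \<le> \<bar>S w\<bar> * int (size N)" if "N inside Hs" for N using that
  proof (induction N)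
   case (add m N)
   then have "\<bar>S m\<bar> \<le> \<bar>S w\<bar>" "\<bar>\<Sum>m\<in>#N. S m\<bar> \<le> \<bar>S w\<bar> * int (size N)" using mx by auto
   then show ?case by (simp add: algebra_simps)
  qed simp
  from this[OF M'(1)] have "\<bar>S w\<bar> * int (size M) \<le> \<bar>S w\<bar> * int (size M')"
   using eq by (simp add: n2_def[symmetric] abs_mult[symmetric])
  then have "size M \<le> size M'" using Sw by simp
  then show False using M'(2) by simp
 qed
 then show ?thesis using w(1) by blast
qed

end

end

section \<open>Signatures of trace forms over ordered fields\<close>

definition pE :: "'w::field set \<Rightarrow> 'w poly set" where "pE E = {p. \<forall>i. coeff p i \<in> E}"

text \<open>The trace of the class of \<open>h\<close> modulo \<open>rootpoly Z\<close>, computed as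
  a sum over the roots in the large field; no quotient ring has to be formed.\<close>

definition tr :: "'w::field set \<Rightarrow> 'w poly \<Rightarrow> 'w" where "tr Z h = (\<Sum>z\<in>Z. poly h z)"

definition dvals :: "'w::field set \<Rightarrow> 'w poly list \<Rightarrow> 'w multiset" where
 "dvals Z hs = mset (map (\<lambda>h. tr Z (h * h)) hs)"

definition rootpoly :: "'w::field set \<Rightarrow> 'w poly" where "rootpoly Z = (\<Prod>z\<in>Z. [:- z, 1:])"

lemma tr_simps: "tr Z 0 = 0" "tr Z (p + q) = tr Z p + tr Z q" "tr Z (p * [:c:]) = tr Z p * c" "tr Z (smult c p) = c * tr Z p"
 by (simp_all add: tr_def sum.distrib sum_distrib_right sum_distrib_left mult.commute)

lemma smult_sum_right: "smult c (sum f I) = (\<Sum>i\<in>I. smult c (f i))"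
 by (induction I rule: infinite_finite_induct) (auto simp: smult_add_right)

lemma rootpoly_poly: "finite Z ==> poly (rootpoly Z) x = 0 \<longleftrightarrow> x \<in> Z"
 by (auto simp: rootpoly_def poly_prod prod_zero_iff)

lemma rootpoly_monic: "lead_coeff (rootpoly Z) = 1" "rootpoly Z \<noteq> 0"
proof -
 show "lead_coeff (rootpoly Z) = 1" unfolding rootpoly_def by (induction Z rule: infinite_finite_induct) (auto simp: lead_coeff_mult simp del: mult_pCons_left)
 then show "rootpoly Z \<noteq> 0" by auto
qed

lemma rootpoly_degree: "finite Z ==> degree (rootpoly Z) = card Z"
 unfolding rootpoly_def by (subst degree_prod_eq_sum_degree) auto

lemma zero_on_roots:
 fixes p :: "'w::field poly"
 assumes "finite Z" "\<And>z. z \<in> Z ==> poly p z = 0" "p \<noteq> 0" shows "card Z \<le> degree p"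
proof -
 have "card Z \<le> card {x. poly p x = 0}" by (rule card_mono) (use assms poly_roots_finite[OF assms(3)] in auto)
 also have "\<dots> \<le> degree p" by (rule card_poly_roots_bound[OF assms(3)])
 finally show ?thesis .
qed

lemma poly_mod_root:
 assumes "finite Z" "z \<in> Z" shows "poly (p mod rootpoly Z) z = poly p z"
proof -
 have "poly p z = poly (p div rootpoly Z * rootpoly Z + p mod rootpoly Z) z" by simp
 also have "\<dots> = poly (p mod rootpoly Z) z" using rootpoly_poly[OF assms(1), of z] assms(2) by (simp only: poly_add poly_mult) simp
 finally show ?thesis by simp
qed

lemma degree_mod_rootpoly: "finite Z ==> Z \<noteq> {} ==> degree (p mod rootpoly Z) < card Z"
 using degree_mod_less'[of "rootpoly Z" p] rootpoly_monic[of Z] rootpoly_degree[of Z]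
 by (cases "p mod rootpoly Z = 0") (auto simp: card_gt_0_iff)

text \<open>Every element of \<open>Z\<close> is a root of the divisor or of the cofactor. Comparing
  degrees, the divisor has as many roots in \<open>Z\<close> as its degree allows.\<close>

lemma dvd_rootpoly:
 assumes Z: "finite Z" and m: "lead_coeff m = 1" "m dvd rootpoly Z"
 shows "m = rootpoly {z\<in>Z. poly m z = 0}"
proof -
 define A where "A = {z\<in>Z. poly m z = 0}"
 obtain k where k: "rootpoly Z = m * k" using m(2) by auto
 have nz: "m \<noteq> 0" "k \<noteq> 0" using k rootpoly_monic[of Z] by auto
 define B where "B = {z\<in>Z. poly k z = 0}"
 have "Z \<subseteq> A \<union> B" using rootpoly_poly[OF Z] by (auto simp: A_def B_def k)
 then have "card Z \<le> card (A \<union> B)" using Z by (intro card_mono) (auto simp: A_def B_def)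
 also have "\<dots> \<le> card A + card B" by (rule card_Un_le)
 finally have 1: "card Z \<le> card A + card B" .
 have "card A \<le> degree m" by (rule zero_on_roots) (use Z nz in \<open>auto simp: A_def\<close>)
 moreover have "card B \<le> degree k" by (rule zero_on_roots) (use Z nz in \<open>auto simp: B_def\<close>)
 moreover have "card Z = degree m + degree k" using rootpoly_degree[OF Z] k nz by (simp add: degree_mult_eq)
 ultimately have dm: "degree m = card A" using 1 by linarith
 have fA: "finite A" using Z by (simp add: A_def)
 show ?thesis
 proof (rule ccontr)
  assume "m \<noteq> rootpoly {z\<in>Z. poly m z = 0}"
  then have ne: "m - rootpoly A \<noteq> 0" by (simp add: A_def)
  have "card A \<le> degree (m - rootpoly A)"
   by (rule zero_on_roots[OF fA _ ne]) (use rootpoly_poly[OF fA] in \<open>auto simp: A_def\<close>)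
  moreover have "coeff (m - rootpoly A) (card A) = 0"
   using m(1) rootpoly_monic(1)[of A] rootpoly_degree[OF fA] dm by simp
  moreover have "degree (m - rootpoly A) \<le> card A"
   using degree_diff_le_max[of m "rootpoly A"] dm rootpoly_degree[OF fA] by simp
  ultimately show False using ne by (metis le_antisym leading_coeff_0_iff)
 qed
qed

locale subfield0 = divinv_base E 1 "\<lambda>x. x" E for E :: "'w::field set"
begin

lemma E0: "0 \<in> E" by (rule F_zero)
lemma E1: "1 \<in> E" by (rule F_e)
lemma E_inverse: "x \<in> E ==> inverse x \<in> E"
proof (cases "x = 0")
 case False
 assume "x \<in> E"
 then have "x * dinv x = 1" "dinv x \<in> E" using dinv[of x] False by auto
 then show ?thesis using False by (metis inverse_unique)
qed (simp add: E0)
lemma E_diff: "x \<in> E ==> y \<in> E ==> x - y \<in> E" by (rule D_diff)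
lemma E_div: "x \<in> E ==> y \<in> E ==> x / y \<in> E" using E_inverse F_mult by (simp add: divide_inverse)
lemma E_power: "x \<in> E ==> x ^ n \<in> E" by (induction n) (auto simp: E1 F_mult)

lemma pE_simps: "0 \<in> pE E" "1 \<in> pE E" "p \<in> pE E ==> q \<in> pE E ==> p + q \<in> pE E" "p \<in> pE E ==> q \<in> pE E ==> p - q \<in> pE E"
 "p \<in> pE E ==> - p \<in> pE E" "c \<in> E ==> p \<in> pE E ==> smult c p \<in> pE E" "c \<in> E ==> p \<in> pE E ==> pCons c p \<in> pE E"
 "c \<in> E ==> [:c:] \<in> pE E" "c \<in> E ==> monom c n \<in> pE E"
 by (auto simp: pE_def E0 E1 F_add E_diff F_uminus F_mult coeff_pCons one_pCons split: nat.splits)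

lemma pE_mult: "p \<in> pE E ==> q \<in> pE E ==> p * q \<in> pE E"
 by (auto simp: pE_def coeff_mult intro!: D_sum F_mult)

lemma pE_sum: "(\<And>i. i \<in> I ==> f i \<in> pE E) ==> sum f I \<in> pE E"
 by (induction I rule: infinite_finite_induct) (auto intro: pE_simps)

lemma of_nat_E: "of_nat n \<in> E" by (induction n) (auto simp: E0 E1 F_add)

lemma pE_pderiv: "p \<in> pE E ==> pderiv p \<in> pE E"
 by (simp add: pE_def coeff_pderiv F_mult F_add E1 of_nat_E)

lemma pE_coeff: "p \<in> pE E ==> coeff p i \<in> E" by (simp add: pE_def)

text \<open>\<open>div\<close> and \<open>mod\<close> refer to the large field. Long division is
  carried out inside \<open>E\<close>, and uniqueness identifies the results.\<close>

lemma pE_divmod: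
 assumes b: "b \<in> pE E" "b \<noteq> 0" and a: "a \<in> pE E"
 shows "a div b \<in> pE E \<and> a mod b \<in> pE E"
proof -
 have "\<exists>s r. s \<in> pE E \<and> r \<in> pE E \<and> a = s * b + r \<and> (r = 0 \<or> degree r < degree b)" using a
 proof (induction a)
  case 0
  then show ?case using pE_simps(1) by (intro exI[of _ 0]) auto
 next
  case (pCons c a)
  have c: "c \<in> E" "a \<in> pE E" using pCons.prems by (auto simp: pE_def coeff_pCons split: nat.splits)
  then obtain s r where sr: "s \<in> pE E" "r \<in> pE E" "a = s * b + r" "r = 0 \<or> degree r < degree b" using pCons.IH by blast
  define r1 where "r1 = pCons c r"
  have r1: "r1 \<in> pE E" "pCons c a = pCons 0 s * b + r1" using pE_simps(7) c sr by (auto simp: r1_def)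
  define k where "k = coeff r1 (degree b) / lead_coeff b"
  have k: "k \<in> E" using r1(1) b(1) E_div by (simp add: k_def pE_coeff)
  have "pCons c a = (pCons 0 s + [:k:]) * b + (r1 - smult k b)" using r1(2) by (simp add: algebra_simps)
  moreover have "degree r1 \<le> degree b" using sr(4) by (auto simp: r1_def)
  then have "r1 - smult k b = 0 \<or> degree (r1 - smult k b) < degree b"
  proof (cases "degree b = 0")
   case True
   then have "degree r1 = 0" using \<open>degree r1 \<le> degree b\<close> by simp
   then have "r1 - smult k b = 0" using True b(2) by (auto simp: k_def elim!: degree_eq_zeroE)
   then show ?thesis by simp
  next
   case False
   have "coeff (r1 - smult k b) (degree b) = 0" using b(2) by (simp add: k_def)
   moreover have "degree (r1 - smult k b) \<le> degree b"
    using \<open>degree r1 \<le> degree b\<close> by (intro degree_diff_le) (auto intro: order_trans[OF degree_smult_le])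
   ultimately show ?thesis by (metis le_neq_implies_less leading_coeff_0_iff)
  qed
  moreover have "pCons 0 s + [:k:] \<in> pE E" "r1 - smult k b \<in> pE E"
   using pE_simps(3,4,6,7,8) sr r1 k b E0 by auto
  ultimately show ?case by blast
 qed
 then obtain s r where sr: "s \<in> pE E" "r \<in> pE E" "a = s * b + r" "r = 0 \<or> degree r < degree b" by blast
 have "r div b = 0" "r mod b = r" using sr(4) by (auto simp: div_poly_less mod_poly_less)
 then have "a div b = s" "a mod b = r" using sr(3) b(2) by auto
 then show ?thesis using sr by simp
qed

text \<open>By Lagrange interpolation the sum is a coefficient of the remainder of \<open>h\<close> times the derivative.\<close>

lemma sum_roots_in:
 assumes Z: "finite Z" and g: "rootpoly Z \<in> pE E" and h: "h \<in> pE E"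
 shows "tr Z h \<in> E"
proof (cases "Z = {}")
 case False
 define g where "g = rootpoly Z"
 define n where "n = card Z"
 define p where "p = (pderiv g * h) mod g"
 have n: "n > 0" using Z False by (simp add: n_def card_gt_0_iff)
 define B where "B = (\<lambda>z. rootpoly (Z - {z}))"
 have gB: "g = [:- z, 1:] * B z" if "z \<in> Z" for z
  unfolding g_def B_def rootpoly_def using prod.remove[OF Z that, of "\<lambda>z. [:- z, 1:]"] by simp
 have dg: "poly (pderiv g) z = poly (B z) z" if "z \<in> Z" for z
  by (subst gB[OF that], subst pderiv_mult) (simp add: pderiv_pCons)
 define q where "q = (\<Sum>z\<in>Z. smult (poly h z) (B z))"
 have qz: "poly q z = poly p z" if z: "z \<in> Z" for z
 proof -
  have "poly q z = (\<Sum>z'\<in>Z. poly h z' * poly (B z') z)" by (simp add: q_def poly_sum)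
  also have "\<dots> = (\<Sum>z'\<in>Z. if z' = z then poly h z * poly (B z) z else 0)"
   by (rule sum.cong) (use z Z rootpoly_poly[of "Z - {_}" z] in \<open>auto simp: B_def\<close>)
  also have "\<dots> = poly h z * poly (B z) z" using Z z by simp
  also have "\<dots> = poly p z" using poly_mod_root[OF Z z, of "pderiv g * h"] dg[OF z] by (simp add: p_def g_def)
  finally show ?thesis .
 qed
 have dB: "degree (B z) = n - 1" "lead_coeff (B z) = 1" if "z \<in> Z" for z
  using rootpoly_degree[of "Z - {z}"] rootpoly_monic[of "Z - {z}"] Z that by (auto simp: B_def n_def)
 have dq: "degree q < n"
 proof -
  have "degree q \<le> n - 1" unfolding q_def
   by (rule degree_sum_le[OF Z]) (use dB in \<open>auto intro: order_trans[OF degree_smult_le]\<close>)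
  then show ?thesis using n by simp
 qed
 have dp: "degree p < n" using degree_mod_rootpoly[OF Z False] by (simp add: p_def g_def n_def)
 have "p = q"
 proof (rule ccontr)
  assume "p \<noteq> q"
  then have "card Z \<le> degree (p - q)" by (intro zero_on_roots Z) (use qz in auto)
  then show False using degree_diff_le_max[of p q] dp dq by (simp add: n_def)
 qed
 moreover have "coeff q (n - 1) = tr Z h"
  using dB by (simp add: q_def coeff_sum tr_def)
 moreover have "p \<in> pE E" using pE_divmod[of g "pderiv g * h"] pE_mult pE_pderiv g h rootpoly_monic(2)[of Z] by (auto simp: p_def g_def)
 ultimately show ?thesis using pE_coeff by metis
qed (simp add: tr_def E0)

text \<open>An orthogonal basis for the trace form on polynomials over \<open>E\<close> modulo
  \<open>rootpoly Z\<close>; congruence is expressed by equality of values on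
  \<open>Z\<close>.\<close>

definition odiag :: "'w set \<Rightarrow> 'w poly list \<Rightarrow> bool" where
 "odiag Z hs \<longleftrightarrow> set hs \<subseteq> pE E \<and> (\<forall>i<length hs. \<forall>j<length hs. i \<noteq> j \<longrightarrow> tr Z (hs!i * hs!j) = 0)
  \<and> (\<forall>i<length hs. tr Z (hs!i * hs!i) \<noteq> 0)
  \<and> (\<forall>h\<in>pE E. \<exists>c. (\<forall>i<length hs. c i \<in> E) \<and> (\<forall>z\<in>Z. poly h z = (\<Sum>i<length hs. poly (hs!i) z * c i)))"

lemma odiagD:
 assumes "odiag Z hs"
 shows "i < length hs ==> hs!i \<in> pE E" "i < length hs ==> j < length hs ==> i \<noteq> j ==> tr Z (hs!i * hs!j) = 0"
  "i < length hs ==> tr Z (hs!i * hs!i) \<noteq> 0"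
  "h \<in> pE E ==> \<exists>c. (\<forall>i<length hs. c i \<in> E) \<and> (\<forall>z\<in>Z. poly h z = (\<Sum>i<length hs. poly (hs!i) z * c i))"
 using assms by (auto simp: odiag_def)

lemma tr_comb:
 assumes o: "odiag Z hs" and c: "\<And>z. z \<in> Z ==> poly h z = (\<Sum>i<length hs. poly (hs!i) z * c i)" and j: "j < length hs"
 shows "tr Z (hs!j * h) = tr Z (hs!j * hs!j) * c j"
proof -
 have "tr Z (hs!j * h) = (\<Sum>z\<in>Z. \<Sum>i<length hs. poly (hs!j) z * (poly (hs!i) z * c i))"
  unfolding tr_def by (rule sum.cong) (auto simp: c sum_distrib_left)
 also have "\<dots> = (\<Sum>i<length hs. tr Z (hs!j * hs!i) * c i)"
  by (subst sum.swap) (simp add: tr_def sum_distrib_right mult.assoc)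
 also have "\<dots> = (\<Sum>i<length hs. if i = j then tr Z (hs!j * hs!j) * c j else 0)"
  by (rule sum.cong) (use odiagD(2)[OF o j] in auto)
 finally show ?thesis using j by simp
qed

text \<open>In one direction the coefficients of remainders modulo \<open>rootpoly Z\<close>
  separate combinations of the basis; in the other the traces against the basis separate polynomials
  of degree below \<open>card Z\<close>.\<close>

lemma odiag_length:
 assumes Z: "finite Z" "rootpoly Z \<in> pE E" and o: "odiag Z hs" shows "length hs = card Z"
proof (rule antisym)
 let ?n = "length hs"
 define g where "g = rootpoly Z"
 have g0: "g \<noteq> 0" using rootpoly_monic(2) by (simp add: g_def)
 show "?n \<le> card Z"
 proof (cases "Z = {}")
  case True
  have "?n = 0"
  proof (rule ccontr)
   assume "?n \<noteq> 0"
   then show False using odiagD(3)[OF o, of 0] True by (simp add: tr_def)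
  qed
  then show ?thesis by simp
 next
  case False
  define f where "f = (\<lambda>(u::nat \<Rightarrow> 'w) j::nat. coeff ((\<Sum>i<?n. hs!i * [:u i:]) mod g) j)"
  show ?thesis
  proof (rule dim_le[of "card Z" ?n f])
   fix j
   have "f u j \<in> E" if "u \<in> full {..<?n}" for u
    unfolding f_def
    by (intro pE_coeff conjunct2[OF pE_divmod]) (use that Z(2) g0 odiagD(1)[OF o] in \<open>auto simp: g_def full_def intro!: pE_sum pE_mult pE_simps\<close>)
   moreover have "f (\<lambda>i. u i + v i) j = f u j + f v j" for u v
   proof -
    have "(\<Sum>i<?n. hs!i * [:u i + v i:]) = (\<Sum>i<?n. hs!i * [:u i:]) + (\<Sum>i<?n. hs!i * [:v i:])"
     by (simp add: sum.distrib[symmetric] smult_add_left)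
    then show ?thesis by (simp only: f_def poly_mod_add_left coeff_add)
   qed
   moreover have "f (\<lambda>i. u i * x) j = f u j * x" for u x
   proof -
    have "(\<Sum>i<?n. hs!i * [:u i * x:]) = smult x (\<Sum>i<?n. hs!i * [:u i:])"
     by (simp add: smult_sum_right mult.commute)
    then show ?thesis by (simp only: f_def mod_smult_left coeff_smult mult.commute)
   qed
   ultimately show "rlin (full {..<?n}) (\<lambda>u. f u j)" by (simp add: rlin_def)
  next
   fix u i
   assume u: "u \<in> full {..<?n}" and z: "\<And>j. j < card Z ==> f u j = 0"
   define h where "h = (\<Sum>i<?n. hs!i * [:u i:])"
   have "h mod g = 0"
   proof (rule poly_eqI)
    fix j show "coeff (h mod g) j = coeff 0 j"
     using z[of j] degree_mod_rootpoly[OF Z(1) False, of h]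
     by (cases "j < card Z") (auto simp: f_def h_def g_def coeff_eq_0)
   qed
   then have hz: "poly h z = 0" if "z \<in> Z" for z using poly_mod_root[OF Z(1) that, of h] by (simp add: g_def)
   show "u i = 0"
   proof (cases "i < ?n")
    case True
    have "tr Z (hs!i * h) = tr Z (hs!i * hs!i) * u i"
     by (rule tr_comb[OF o _ True]) (simp add: h_def poly_sum mult.commute)
    moreover have "tr Z (hs!i * h) = 0" using hz by (simp add: tr_def)
    ultimately show ?thesis using odiagD(3)[OF o True] by simp
   qed (use u in \<open>auto simp: full_def\<close>)
  qed
 qed
 show "card Z \<le> ?n"
 proof (rule dim_le[of ?n "card Z" "\<lambda>u i. tr Z (hs!i * (\<Sum>k<card Z. monom (u k) k))"])
  fix j assume j: "j < ?n"
  have 1: "tr Z (hs!j * (\<Sum>k<card Z. monom (u k) k)) \<in> E" if "u \<in> full {..<card Z}" for u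
   by (rule sum_roots_in[OF Z]) (use that odiagD(1)[OF o j] in \<open>auto simp: full_def intro!: pE_mult pE_sum pE_simps\<close>)
  have 2: "tr Z (hs!j * (\<Sum>k<card Z. monom (u k + v k) k)) = tr Z (hs!j * (\<Sum>k<card Z. monom (u k) k)) + tr Z (hs!j * (\<Sum>k<card Z. monom (v k) k))" for u v
   by (simp add: add_monom[symmetric] sum.distrib distrib_left tr_simps)
  have 3: "tr Z (hs!j * (\<Sum>k<card Z. monom (u k * x) k)) = tr Z (hs!j * (\<Sum>k<card Z. monom (u k) k)) * x" for u x
  proof -
   have "(\<Sum>k<card Z. monom (u k * x) k) = smult x (\<Sum>k<card Z. monom (u k) k)"
    by (simp add: smult_sum_right smult_monom mult.commute)
   then show ?thesis by (simp add: tr_simps mult.commute)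
  qed
  show "rlin (full {..<card Z}) (\<lambda>u. tr Z (hs!j * (\<Sum>k<card Z. monom (u k) k)))"
   using 1 2 3 by (simp add: rlin_def)
 next
  fix u i
  assume u: "u \<in> full {..<card Z}" and z: "\<And>j. j < ?n ==> tr Z (hs!j * (\<Sum>k<card Z. monom (u k) k)) = 0"
  define h where "h = (\<Sum>k<card Z. monom (u k) k)"
  have ch: "coeff h i = (if i < card Z then u i else 0)" for i by (simp add: h_def coeff_sum)
  have "h \<in> pE E" using u by (auto simp: h_def full_def intro!: pE_sum pE_simps)
  then obtain c where c: "\<forall>z\<in>Z. poly h z = (\<Sum>i<?n. poly (hs!i) z * c i)" using odiagD(4)[OF o] by blast
  have "c j = 0" if "j < ?n" for j
   using tr_comb[OF o, of h c j] c z[OF that] odiagD(3)[OF o that] that by (simp add: h_def)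
  then have hz: "poly h z = 0" if "z \<in> Z" for z using c that by simp
  have "h = 0"
  proof (rule ccontr)
   assume n: "h \<noteq> 0"
   then have "card Z \<le> degree h" by (intro zero_on_roots Z(1)) (use hz in auto)
   then show False using ch[of "degree h"] n by (metis leD leading_coeff_0_iff)
  qed
  then show "u i = 0" using ch[of i] u by (cases "i < card Z") (auto simp: full_def)
 qed
qed

end

section \<open>Adjoining a root to an ordered subfield\<close>

lemma divinv_base_subfields:
 fixes K E :: "'w::field set"
 assumes K: "1 \<in> K" "\<And>x y. x \<in> K ==> y \<in> K ==> x + y \<in> K" "\<And>x. x \<in> K ==> - x \<in> K"
   "\<And>x y. x \<in> K ==> y \<in> K ==> x * y \<in> K" "\<And>x. x \<in> K ==> inverse x \<in> K"
  and E: "1 \<in> E" "\<And>x y. x \<in> E ==> y \<in> E ==> x + y \<in> E" "\<And>x. x \<in> E ==> - x \<in> E"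
   "\<And>x y. x \<in> E ==> y \<in> E ==> x * y \<in> E" "\<And>x. x \<in> E ==> inverse x \<in> E" and EK: "E \<subseteq> K"
 shows "divinv_base K 1 (\<lambda>x. x) E"
proof -
 have inv: "\<exists>y\<in>K. x * y = 1 \<and> y * x = 1" if "x \<in> K" "x \<noteq> 0" for x
  using K(5)[OF that(1)] that(2) by (intro bexI[of _ "inverse x"]) auto
 have d: "divring K 1" by standard (use K inv in auto)
 interpret divring K 1 by (rule d)
 have di: "dinv x = inverse x" if "x \<in> K" "x \<noteq> 0" for x
  using dinv_unique[of x "inverse x"] K(5)[OF that(1)] that by simp
 show ?thesis by standard (use E EK di in \<open>auto simp: mult.commute\<close>)
qed

lemma fordering_of_nat:
 fixes P :: "'w::field set"
 assumes P: "fordering F P" "1 \<in> P" and n: "n > 0"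
 shows "(of_nat n :: 'w) \<noteq> 0" "(of_nat k :: 'w) \<in> P"
proof -
 have z: "0 \<in> P" "\<And>x y. x \<in> P ==> y \<in> P ==> x + y \<in> P" using P by (auto simp: fordering_def)
 have in_P: "(of_nat k :: 'w) \<in> P" for k by (induction k) (use z P(2) in auto)
 then show "(of_nat k :: 'w) \<in> P" .
 obtain m where m: "n = Suc m" using n by (cases n) auto
 show "(of_nat n :: 'w) \<noteq> 0"
 proof
  assume "(of_nat n :: 'w) = 0"
  then have "(of_nat m :: 'w) = - 1" unfolding m by (simp add: add_eq_0_iff)
  then have "(1::'w) = 0" using fordering_zero[OF P] in_P[of m] by auto
  then show False by simp
 qed
qed

context subfield0
begin

lemma minimal_polynomial:
 assumes f: "f \<in> pE E" "f \<noteq> 0" "poly f z = 0"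
 shows "\<exists>m\<in>pE E. lead_coeff m = 1 \<and> poly m z = 0 \<and> (\<forall>p\<in>pE E. poly p z = 0 \<longrightarrow> m dvd p)"
proof -
 obtain m0 where m0: "m0 \<in> pE E" "m0 \<noteq> 0" "poly m0 z = 0" and
  least: "\<And>p. p \<in> pE E \<and> p \<noteq> 0 \<and> poly p z = 0 ==> degree m0 \<le> degree p"
  using ex_has_least_nat[of "\<lambda>p. p \<in> pE E \<and> p \<noteq> 0 \<and> poly p z = 0" f degree] f by blast
 define m where "m = smult (inverse (lead_coeff m0)) m0"
 have m: "m \<in> pE E" "lead_coeff m = 1" "poly m z = 0" "degree m = degree m0"
  using m0 pE_simps(6)[OF E_inverse[OF pE_coeff[OF m0(1)]] m0(1)] by (auto simp: m_def)
 have "m dvd p" if p: "p \<in> pE E" "poly p z = 0" for p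
 proof -
  have m0': "m \<noteq> 0" using m(2) by auto
  have "poly p z = poly (p div m * m + p mod m) z" by simp
  then have "poly (p mod m) z = 0" using p(2) m(3) by (simp only: poly_add poly_mult)  simp
  moreover have "p mod m \<in> pE E" using pE_divmod[OF m(1) m0' p(1)] by simp
  ultimately have "p mod m \<noteq> 0 ==> False" using least[of "p mod m"] degree_mod_less[OF m0', of p] m(4) by auto
  then have "p mod m = 0" by blast
  then show ?thesis by (simp add: dvd_eq_mod_eq_0)
 qed
 then show ?thesis using m by blast
qed

definition adj :: "'w \<Rightarrow> 'w set" where "adj z = {poly p z | p. p \<in> pE E}"

lemma adjI: "p \<in> pE E ==> poly p z \<in> adj z" by (auto simp: adj_def)

lemma adj_simps: "1 \<in> adj z" "x \<in> adj z ==> y \<in> adj z ==> x + y \<in> adj z" "x \<in> adj z ==> - x \<in> adj z"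
 "x \<in> adj z ==> y \<in> adj z ==> x * y \<in> adj z" "E \<subseteq> adj z" "z \<in> adj z"
proof -
 show "1 \<in> adj z" using adjI[OF pE_simps(2), of z] by simp
 show "z \<in> adj z" using adjI[of "[:0, 1:]" z] pE_simps(7,8) E0 E1 by simp
 show "E \<subseteq> adj z"
 proof
  fix c assume "c \<in> E"
  then show "c \<in> adj z" using adjI[OF pE_simps(8), of c z] by simp
 qed
 show "x \<in> adj z ==> - x \<in> adj z" unfolding adj_def using pE_simps(5) by (auto simp: poly_minus[symmetric] simp del: poly_minus)
 show "x \<in> adj z ==> y \<in> adj z ==> x + y \<in> adj z" unfolding adj_def
  using pE_simps(3) by (auto simp: poly_add[symmetric] simp del: poly_add)
 show "x \<in> adj z ==> y \<in> adj z ==> x * y \<in> adj z" unfolding adj_def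
  using pE_mult by (auto simp: poly_mult[symmetric] simp del: poly_mult)
qed

context
 fixes m z assumes m: "m \<in> pE E" "lead_coeff m = 1" "poly m z = 0" "\<And>p. p \<in> pE E ==> poly p z = 0 ==> m dvd p"
begin

text \<open>Euclidean descent: \<open>p\<close> is replaced by the remainder of \<open>m\<close>
  modulo \<open>p\<close>, which is nonzero at \<open>z\<close> by the minimality of
  \<open>m\<close> and has smaller degree.\<close>

lemma adj_inverse0: "p \<in> pE E ==> poly p z \<noteq> 0 ==> degree p < degree m ==> \<exists>q\<in>pE E. poly p z * poly q z = 1"
proof (induction "degree p" arbitrary: p rule: less_induct)
 case less
 have p0: "p \<noteq> 0" using less.prems by auto
 have mz: "m \<noteq> 0" using m(2) by auto
 show ?case
 proof (cases "degree p = 0")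
  case True
  then obtain c where c: "p = [:c:]" by (rule degree_eq_zeroE)
  have "c \<in> E" "c \<noteq> 0" using less.prems c by (auto simp: pE_def) (metis coeff_pCons_0)
  then show ?thesis using E_inverse pE_simps(8) by (intro bexI[of _ "[:inverse c:]"]) (auto simp: c)
 next
  case False
  define s where "s = m div p"
  define r where "r = m mod p"
  have mz': "m = s * p + r" by (simp add: s_def r_def)
  have srE: "s \<in> pE E" "r \<in> pE E" using pE_divmod[OF less.prems(1) p0 m(1)] by (auto simp: s_def r_def)
  have rd: "r = 0 \<or> degree r < degree p" using degree_mod_less[OF p0, of m] by (auto simp: r_def)
  have ev: "poly s z * poly p z + poly r z = 0" using m(3) arg_cong[OF mz', of "\<lambda>p. poly p z"] by simp
  have rz: "poly r z \<noteq> 0"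
  proof
   assume a: "poly r z = 0"
   have "r = 0"
   proof (rule ccontr)
    assume "r \<noteq> 0"
    then have "degree m \<le> degree r" using m(4)[OF srE(2) a] by (simp add: dvd_imp_degree_le)
    then show False using rd less.prems \<open>r \<noteq> 0\<close> by simp
   qed
   then have ms: "m = s * p" using mz' by simp
   then have s0: "s \<noteq> 0" using mz by auto
   have "poly s z = 0" using ev a less.prems by simp
   then have "degree m \<le> degree s" using m(4)[OF srE(1)] s0 by (simp add: dvd_imp_degree_le)
   moreover have "degree m = degree s + degree p" using ms s0 p0 by (simp add: degree_mult_eq)
   ultimately show False using False by simp
  qed
  then have "degree r < degree p" using rd by auto
  then obtain q where q: "q \<in> pE E" "poly r z * poly q z = 1" using less.hyps[of r] srE rz less.prems by auto
  have "poly p z * poly (- s * q) z = poly r z * poly q z"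
  proof -
   have "poly r z = - (poly s z * poly p z)" using ev by (simp add: eq_neg_iff_add_eq_0 add.commute)
   then show ?thesis by (simp add: algebra_simps)
  qed
  then show ?thesis using q(2) pE_mult[OF pE_simps(5)[OF srE(1)] q(1)] by (intro bexI[of _ "- s * q"]) auto
 qed
qed

lemma poly_mod_min: "poly (p mod m) z = poly p z"
proof -
 have "poly p z = poly (p div m * m + p mod m) z" by simp
 then show ?thesis using m(3) by (simp only: poly_add poly_mult) simp
qed

lemma degree_min: "degree m > 0"
proof (rule ccontr)
 assume "\<not> degree m > 0"
 then obtain c where "m = [:c:]" using degree_eq_zeroE[of m] by auto
 then show False using m(2,3) by simp
qed

lemma adj_inverse: assumes "x \<in> adj z" shows "inverse x \<in> adj z"
proof (cases "x = 0")
 case False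
 obtain p where p: "p \<in> pE E" "x = poly p z" using assms by (auto simp: adj_def)
 have m0: "m \<noteq> 0" using m(2) by auto
 have "degree (p mod m) < degree m" using degree_mod_less[OF m0, of p] degree_min by auto
 then obtain q where "q \<in> pE E" "x * poly q z = 1"
  using adj_inverse0[of "p mod m"] pE_divmod[OF m(1) m0 p(1)] False p(2) by (auto simp: poly_mod_min)
 then show ?thesis using adjI by (metis inverse_unique)
qed (use adj_simps(5) E0 in auto)

lemma adj_base: "divinv_base (adj z) 1 (\<lambda>x. x) E" "divinv_base (adj z) 1 (\<lambda>x. x) (adj z)"
 by (rule divinv_base_subfields; fact adj_simps adj_inverse F_add F_mult F_uminus E_inverse E1 subset_refl)+

lemma adj_fd: assumes "set xs \<subseteq> adj z" "divinv_base.Findep E xs" shows "length xs \<le> degree m"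
proof -
 interpret A: divinv_base "adj z" 1 "\<lambda>x. x" E by (rule adj_base)
 have m0: "m \<noteq> 0" using m(2) by auto
 have "\<exists>p. p \<in> pE E \<and> xs ! i = poly p z" if "i < length xs" for i
  using subsetD[OF assms(1) nth_mem[OF that]] by (auto simp: adj_def)
 then obtain ps where ps: "\<And>i. i < length xs ==> ps i \<in> pE E" "\<And>i. i < length xs ==> xs ! i = poly (ps i) z" by metis
 define g where "g = (\<lambda>(u::nat\<Rightarrow>'w). (\<Sum>i<length xs. ps i * [:u i:]))"
 show ?thesis
 proof (rule dim_le[of "degree m" "length xs" "\<lambda>u j. coeff (g u mod m) j"])
  fix j
  have 1: "coeff (g u mod m) j \<in> E" if "u \<in> full {..<length xs}" for u
   unfolding g_def by (intro pE_coeff conjunct2[OF pE_divmod] m0 m(1) pE_sum pE_mult ps pE_simps) (use that in \<open>auto simp: full_def\<close>)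
  have 2: "coeff (g (\<lambda>i. u i + v i) mod m) j = coeff (g u mod m) j + coeff (g v mod m) j" for u v
  proof -
   have "g (\<lambda>i. u i + v i) = g u + g v" by (simp add: g_def sum.distrib[symmetric] smult_add_left)
   then show ?thesis by (simp only: poly_mod_add_left coeff_add)
  qed
  have 3: "coeff (g (\<lambda>i. u i * x) mod m) j = coeff (g u mod m) j * x" for u x
  proof -
   have "g (\<lambda>i. u i * x) = smult x (g u)" by (simp add: g_def smult_sum_right mult.commute)
   then show ?thesis by (simp only: mod_smult_left coeff_smult mult.commute)
  qed
  show "rlin (full {..<length xs}) (\<lambda>u. coeff (g u mod m) j)" using 1 2 3 by (simp add: rlin_def)
 next
  fix u i assume u: "u \<in> full {..<length xs}" and z: "\<And>j. j < degree m ==> coeff (g u mod m) j = 0"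
  have "g u mod m = 0"
  proof (rule poly_eqI)
   fix j show "coeff (g u mod m) j = coeff 0 j"
    using z[of j] degree_mod_less[OF m0, of "g u"] by (cases "j < degree m") (auto simp: coeff_eq_0)
  qed
  then have "poly (g u) z = 0" using poly_mod_min[of "g u"] by simp
  then have "(\<Sum>i<length xs. xs ! i * u i) = 0" by (simp add: g_def poly_sum ps(2) mult.commute)
  then show "u i = 0" using assms(2) u by (cases "i < length xs") (auto simp: A.Findep_def Findep_def full_def)
 qed
qed

text \<open>Polynomials with equal values at \<open>z\<close> differ by a multiple of
  \<open>rootpoly Z\<close>, so the trace descends to values at \<open>z\<close>. It is not the zero
  functional, since \<open>1\<close> has trace \<open>card Z\<close> and the characteristic is
  zero.\<close>

lemma trace_ext:
 assumes Z: "finite Z" "m = rootpoly Z" "z \<in> Z" and ch: "\<And>n. n > 0 ==> (of_nat n :: 'w) \<noteq> 0"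
 shows "\<exists>t. (\<forall>p\<in>pE E. t (poly p z) = tr Z p) \<and> sym_ext (adj z) 1 (\<lambda>x. x) E (adj z) t"
proof -
 define t where "t = (\<lambda>x. tr Z (SOME p. p \<in> pE E \<and> poly p z = x))"
 have t: "t (poly p z) = tr Z p" if p: "p \<in> pE E" for p
 proof -
  define p' where "p' = (SOME p'. p' \<in> pE E \<and> poly p' z = poly p z)"
  have "p' \<in> pE E \<and> poly p' z = poly p z" unfolding p'_def by (rule someI[of _ p]) (simp add: p)
  then have "m dvd p - p'" using m(4)[OF pE_simps(4)[OF p]] by auto
  then obtain k where "p - p' = rootpoly Z * k" by (auto simp: Z(2) elim!: dvdE)
  then have "poly (p - p') y = 0" if "y \<in> Z" for y
   using rootpoly_poly[OF Z(1), of y] that by simp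
  then have "tr Z p = tr Z p'" by (auto simp: tr_def)
  then show ?thesis by (simp add: t_def p'_def)
 qed
 interpret A: divinv_base "adj z" 1 "\<lambda>x. x" E by (rule adj_base)
 interpret B: divinv_base "adj z" 1 "\<lambda>x. x" "adj z" by (rule adj_base)
 have "sym_ext (adj z) 1 (\<lambda>x. x) E (adj z) t"
 proof
  show "\<exists>N. \<forall>xs. set xs \<subseteq> adj z \<longrightarrow> A.Findep xs \<longrightarrow> length xs \<le> N"
   using adj_fd by (auto simp: A.Findep_def Findep_def)
  show "(1::'w) + 1 \<noteq> 0" using ch[of 2] by simp
  show "\<exists>x\<in>adj z. t x \<noteq> 0"
  proof
   have "t 1 = of_nat (card Z)" using t[OF pE_simps(2)] by (simp add: tr_def)
   then show "t 1 \<noteq> 0" using ch[of "card Z"] Z by (auto simp: card_gt_0_iff)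
   show "1 \<in> adj z" by (rule adj_simps)
  qed
  show "t x \<in> E" if "x \<in> adj z" for x
   using that t sum_roots_in[OF Z(1)] m(1) Z(2) by (auto simp: adj_def)
  show "t (x + y) = t x + t y" if xy: "x \<in> adj z" "y \<in> adj z" for x y
  proof -
   obtain p q where "p \<in> pE E" "q \<in> pE E" "x = poly p z" "y = poly q z" using xy unfolding adj_def by blast
   then show ?thesis using t pE_simps(3)[of p q] t[of "p + q"] by (simp add: tr_simps)
  qed
  show "t (x * c) = t x * c" if xc: "x \<in> adj z" "c \<in> E" for x c
  proof -
   obtain p where "p \<in> pE E" "x = poly p z" using xc by (auto simp: adj_def)
   then show ?thesis using t pE_simps(6)[of c p] t[of "smult c p"] xc by (simp add: tr_simps mult.commute)
  qed
 qed (use adj_simps B.F_dinv subsetD[OF adj_simps(5)] in \<open>auto simp: mult.commute\<close>)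
 then show ?thesis using t by blast
qed

text \<open>Without an extension of \<open>Q\<close> to the field generated by \<open>z\<close>, the
  local-global principle makes \<langle>1\<rangle> torsion there, with a multiplier \<open>K\<close>
  from \<open>Q\<close>. Transferring, \<open>size K\<close> times the signature of the trace form
  is zero.\<close>

lemma piece_nonreal:
 assumes Z: "finite Z" "m = rootpoly Z" "z \<in> Z" and Q: "fordering E Q"
  and no: "\<not> (\<exists>Q'. fordering (adj z) Q' \<and> Q \<subseteq> Q')"
 shows "\<exists>hs. odiag Z hs \<and> (\<Sum>c\<in>#dvals Z hs. sgnP Q c) = 0"
proof -
 have one: "1 \<in> Q" by (rule P_e[OF Q])
 have ch: "\<And>n. n > 0 ==> (of_nat n :: 'w) \<noteq> 0" using fordering_of_nat(1)[OF Q one] .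
 obtain t where t: "\<And>p. p \<in> pE E ==> t (poly p z) = tr Z p" and se: "sym_ext (adj z) 1 (\<lambda>x. x) E (adj z) t"
  using trace_ext[OF Z ch] by blast
 interpret A: sym_ext "adj z" 1 "\<lambda>x. x" E "adj z" t by (rule se)
 have QE: "Q \<subseteq> E" using P_props(1)[OF Q] .
 have QA: "Q - {0} \<subseteq> adj z - {0}" using QE adj_simps(5) by auto
 have tors: "A.torsion (Q - {0}) {#1#}"
 proof (rule ccontr)
  assume a: "\<not> A.torsion (Q - {0}) {#1#}"
  have "A.LL.mclosed (Q - {0})" using P_mclosed[OF Q] QA by (auto simp: mclosed_def A.LL.mclosed_def)
  then obtain Q' where "fordering (adj z) Q'" "Q - {0} \<subseteq> Q'"
   using A.LL.plgp[OF _ _ a] A.e_Hs by auto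
  moreover from this have "0 \<in> Q'" by (auto simp: fordering_def)
  ultimately show False using no by blast
 qed
 then obtain K where K: "K \<noteq> {#}" "K inside Q - {0}" "A.metab (tens K {#1#})" by (auto simp: A.torsion_def)
 have t1: "tens K {#1#} = K" for K :: "'w multiset" by (induction K) auto
 have "(\<Sum>x\<in>#K. A.sg Q x) = 0"
  by (rule A.sg_metab[OF Q]) (use K(2,3) QA t1 in auto)
 moreover have "(\<Sum>x\<in>#K. A.sg Q x) = int (size K) * A.sg Q 1"
  using K(2)
 proof (induction K)
  case (add k K)
  then have "A.sg Q (k * 1) = A.sg Q 1" by (intro A.sg_scale[OF Q]) (use adj_simps in auto)
  then show ?case using add by (simp add: algebra_simps)
 qed simp
 ultimately have s0: "A.sg Q 1 = 0" using K(1) by simp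
 obtain fs where fs: "A.orthb 1 fs" "A.dg 1 = A.vals 1 fs" using A.dg_orth[of 1] adj_simps by auto
 have one_in: "1 \<in> adj z" by (rule adj_simps)
 note oD = A.orthbD[OF fs(1) one_in]
 have "\<exists>h. h \<in> pE E \<and> fs ! i = poly h z" if "i < length fs" for i
  using oD(1)[OF that] by (auto simp: adj_def)
 then obtain h where h: "\<And>i. i < length fs ==> h i \<in> pE E" "\<And>i. i < length fs ==> fs ! i = poly (h i) z" by metis
 define hs where "hs = map h [0..<length fs]"
 have tf: "A.tf 1 (fs ! i) (fs ! j) = tr Z (hs ! i * hs ! j)" if "i < length fs" "j < length fs" for i j
  using t[OF pE_mult[OF h(1) h(1)], of i j] that by (simp add: A.tf_def h hs_def)
 have "odiag Z hs" unfolding odiag_def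
 proof (intro conjI ballI)
  show "set hs \<subseteq> pE E" using h by (auto simp: hs_def)
  show "\<forall>i<length hs. \<forall>j<length hs. i \<noteq> j \<longrightarrow> tr Z (hs ! i * hs ! j) = 0" using tf oD(2) by (simp add: hs_def)
  show "\<forall>i<length hs. tr Z (hs ! i * hs ! i) \<noteq> 0" using tf oD(3) by (simp add: hs_def)
  fix g assume g: "g \<in> pE E"
  define c where "c = (\<lambda>i. A.cf 1 fs i (poly g z))"
  have c: "c i \<in> E" if "i < length fs" for i using oD(6)[OF that adjI[OF g]] by (simp add: c_def)
  have e: "poly g z = (\<Sum>i<length fs. fs ! i * c i)" using oD(5)[OF adjI[OF g]] by (simp add: c_def)
  define d where "d = g - (\<Sum>i<length fs. h i * [:c i:])"
  have dE: "d \<in> pE E" unfolding d_def by (intro pE_simps(4) g pE_sum pE_mult h pE_simps(8) c) auto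
  have "poly d z = 0" using e by (simp add: d_def poly_sum h(2) mult.commute)
  then have "m dvd d" using m(4) dE by blast
  then obtain k where "d = rootpoly Z * k" by (auto simp: Z(2) elim!: dvdE)
  then have "poly d y = 0" if "y \<in> Z" for y
   using rootpoly_poly[OF Z(1), of y] that by simp
  then have "\<forall>y\<in>Z. poly g y = (\<Sum>i<length hs. poly (hs ! i) y * c i)"
   by (simp add: d_def poly_sum hs_def mult.commute)
  then show "\<exists>c. (\<forall>i<length hs. c i \<in> E) \<and> (\<forall>z\<in>Z. poly g z = (\<Sum>i<length hs. poly (hs ! i) z * c i))"
   using c by (intro exI[of _ c]) (simp add: hs_def)
 qed
 moreover have "dvals Z hs = A.vals 1 fs"
 proof -
  have "map (\<lambda>h. tr Z (h * h)) hs = map (\<lambda>f. A.tf 1 f f) fs"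
   by (rule nth_equalityI) (use tf in \<open>auto simp: hs_def\<close>)
  then show ?thesis by (simp add: dvals_def A.vals_def)
 qed
 ultimately show ?thesis using s0 fs(2) by (auto simp: A.sg_def)
qed

end

lemma piece_one: assumes "z \<in> E" shows "odiag {z} [1]" "dvals {z} [1] = {#1#}"
proof -
 have "\<exists>c. c 0 \<in> E \<and> poly h z = c 0" if "h \<in> pE E" for h
 proof -
  have "poly h z \<in> E" unfolding poly_altdef by (rule D_sum) (use that assms in \<open>auto intro!: F_mult E_power pE_coeff\<close>)
  then show ?thesis by (intro exI[of _ "\<lambda>_. poly h z"]) auto
 qed
 then show "odiag {z} [1]" by (auto simp: odiag_def tr_def pE_simps)
 show "dvals {z} [1] = {#1#}" by (simp add: dvals_def tr_def)
qed

text \<open>The Chinese remainder theorem as an isometry: restricting the basis \<open>us\<close> to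
  each member of \<open>J\<close> and expanding it in \<open>hs Z\<close> gives a matrix between the
  two trace forms, and inertia compares signatures.\<close>

lemma odiag_combine:
 assumes J: "finite J" "disjoint J" and Z: "\<And>Z. Z \<in> J ==> finite Z" "\<And>Z. Z \<in> J ==> rootpoly Z \<in> pE E"
  and o: "\<And>Z. Z \<in> J ==> odiag Z (hs Z)" and UE: "rootpoly (\<Union>J) \<in> pE E" and ou: "odiag (\<Union>J) us"
  and Q: "fordering E Q"
 shows "(\<Sum>c\<in>#dvals (\<Union>J) us. sgnP Q c) = (\<Sum>Z\<in>J. \<Sum>c\<in>#dvals Z (hs Z). sgnP Q c)"
proof -
 define I where "I = Sigma J (\<lambda>Z. {..<length (hs Z)})"
 define d where "d = (\<lambda>(Z, i). tr Z (hs Z ! i * hs Z ! i))"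
 define d' where "d' = (\<lambda>j. tr (\<Union>J) (us ! j * us ! j))"
 have fin: "finite (\<Union>J)" using J Z by auto
 have fI: "finite I" using J by (auto simp: I_def)
 have cU: "length us = card (\<Union>J)" by (rule odiag_length[OF fin UE ou])
 have cI: "card I = card (\<Union>J)"
 proof -
  have "card I = (\<Sum>Z\<in>J. card Z)" using J odiag_length[OF Z o] by (simp add: I_def)
  also have "\<dots> = card (\<Union>J)" using J Z by (subst card_Union_disjoint) (auto simp: disjoint_def pairwise_def disjnt_def)
  finally show ?thesis .
 qed
 have "\<exists>c. (\<forall>i<length (hs Z). c i \<in> E) \<and> (\<forall>z\<in>Z. poly (us ! j) z = (\<Sum>i<length (hs Z). poly (hs Z!i) z * c i))"
  if "Z \<in> J" "j < length us" for Z j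
  using odiagD(4)[OF o[OF that(1)] odiagD(1)[OF ou that(2)]] .
 then obtain c where c: "\<And>Z j i. Z \<in> J ==> j < length us ==> i < length (hs Z) ==> c Z j i \<in> E"
   "\<And>Z j z. Z \<in> J ==> j < length us ==> z \<in> Z ==> poly (us ! j) z = (\<Sum>i<length (hs Z). poly (hs Z!i) z * c Z j i)"
  by metis
 have trE: "tr Z (h * h') \<in> E" if "finite Z" "rootpoly Z \<in> pE E" "h \<in> pE E" "h' \<in> pE E" for Z h h'
  by (rule sum_roots_in[OF that(1,2) pE_mult[OF that(3,4)]])
 have dI: "d i \<in> E - {0}" if "i \<in> I" for i
  using that trE Z odiagD(1,3)[OF o] by (auto simp: I_def d_def)
 have dJ: "d' j \<in> E - {0}" if "j < length us" for j
  using that trE[OF fin UE] odiagD(1,3)[OF ou] by (auto simp: d'_def)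
 have "witt (image_mset d (mset_set I)) (image_mset d' (mset_set {..<length us}))"
 proof (rule witt_iso[where Xm = "\<lambda>(Z, i) j. c Z j i"])
  fix j k assume jk: "j \<in> {..<length us}" "k \<in> {..<length us}"
  have "(\<Sum>i\<in>I. (case i of (Z, i) \<Rightarrow> \<lambda>j. c Z j i) j * d i * (case i of (Z, i) \<Rightarrow> \<lambda>j. c Z j i) k)
    = (\<Sum>Z\<in>J. \<Sum>i<length (hs Z). c Z j i * tr Z (hs Z ! i * hs Z ! i) * c Z k i)"
   unfolding I_def by (subst sum.Sigma[OF J(1)]) (auto simp: d_def intro!: sum.cong)
  also have "\<dots> = (\<Sum>Z\<in>J. tr Z (us ! j * us ! k))"
  proof (rule sum.cong)
   fix Z assume ZJ: "Z \<in> J"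
   have "tr Z (us ! j * us ! k) = (\<Sum>z\<in>Z. \<Sum>i<length (hs Z). c Z j i * (poly (hs Z ! i) z * poly (us ! k) z))"
    unfolding tr_def by (rule sum.cong) (use c(2)[OF ZJ] jk in \<open>auto simp: sum_distrib_right mult_ac\<close>)
   also have "\<dots> = (\<Sum>i<length (hs Z). c Z j i * tr Z (hs Z ! i * us ! k))"
    by (subst sum.swap) (simp add: tr_def sum_distrib_left)
   also have "\<dots> = (\<Sum>i<length (hs Z). c Z j i * tr Z (hs Z ! i * hs Z ! i) * c Z k i)"
    by (rule sum.cong) (use tr_comb[OF o[OF ZJ], of "us ! k" "c Z k"] c(2)[OF ZJ, of k] jk in \<open>auto simp: mult.assoc\<close>)
   finally show "(\<Sum>i<length (hs Z). c Z j i * tr Z (hs Z ! i * hs Z ! i) * c Z k i) = tr Z (us ! j * us ! k)" by simp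
  qed simp
  also have "\<dots> = tr (\<Union>J) (us ! j * us ! k)"
   unfolding tr_def by (subst sum.Union_disjoint) (use J Z in \<open>auto simp: disjoint_def pairwise_def disjnt_def\<close>)
  also have "\<dots> = (if j = k then d' j else 0)" using odiagD(2)[OF ou] jk by (auto simp: d'_def)
  finally show "(\<Sum>i\<in>I. (case i of (Z, i) \<Rightarrow> \<lambda>j. c Z j i) j * d i * (case i of (Z, i) \<Rightarrow> \<lambda>j. c Z j i) k) = (if j = k then d' j else 0)" .
 qed (use fI cI cU c dI in \<open>auto simp: I_def\<close>)
 then have "metab (image_mset d (mset_set I) + neg (image_mset d' (mset_set {..<length us})))" by (simp add: witt_def)
 then have "(\<Sum>c\<in>#image_mset d (mset_set I) + neg (image_mset d' (mset_set {..<length us})). sgnP Q c) = 0"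
  by (rule inertia[OF Q]) (use dI dJ fI F_uminus in auto)
 moreover have "sgnP Q (- d' j) = - sgnP Q (d' j)" if "j < length us" for j
  using sgnP_uminus[OF Q] dJ[OF that] by auto
 ultimately have eq: "(\<Sum>i\<in>I. sgnP Q (d i)) = (\<Sum>j<length us. sgnP Q (d' j))"
  by (simp add: image_mset_comp sum_mset_sum_in fI sum_negf)
 have dv: "(\<Sum>c\<in>#dvals Z hs. sgnP Q c) = (\<Sum>i<length hs. sgnP Q (tr Z (hs ! i * hs ! i)))" for Z hs
  unfolding dvals_def by (subst mset_map[symmetric], subst sum_mset_sum_list) (simp add: comp_def sum_list_sum_nth atLeast0LessThan)
 have "(\<Sum>i\<in>I. sgnP Q (d i)) = (\<Sum>Z\<in>J. \<Sum>c\<in>#dvals Z (hs Z). sgnP Q c)"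
  unfolding I_def by (simp add: dv sum.Sigma[OF J(1)] d_def case_prod_beta')
 then show ?thesis using eq by (simp add: dv d'_def)
qed

end

text \<open>
 Take an ordered field \<open>E\<close> that contains as many roots as possible. A root \<open>z \<in> E\<close> contributes \<open>1\<close>; the
 other roots generate extensions of \<open>E\<close> without compatible ordering, in which \<open>1\<close> is torsion, and contribute \<open>0\<close>.
\<close>

lemma trace_signature_pos:
 fixes F :: "'w::field set"
 assumes F: "subfield0 F" "fordering F P" and Z: "finite Z" "rootpoly Z \<in> pE F"
  and K: "subfield0 K" "fordering K Q0" "F \<subseteq> K" "P \<subseteq> Q0" and zeta: "\<zeta> \<in> Z" "\<zeta> \<in> K"
  and o: "subfield0.odiag F Z hs"
 shows "(\<Sum>c\<in>#dvals Z hs. sgnP P c) > 0"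
proof -
 interpret F: subfield0 F by (rule F)
 define ok where "ok = (\<lambda>(E, Q). subfield0 E \<and> fordering E Q \<and> F \<subseteq> E \<and> P \<subseteq> Q \<and> \<zeta> \<in> E)"
 have ok0: "ok (K, Q0)" using K zeta by (simp add: ok_def)
 have bd: "card (Z \<inter> fst y) \<le> card Z" for y :: "'w set \<times> 'w set" using Z(1) by (intro card_mono) auto
 have "\<exists>y. ok y \<and> (\<forall>y'. ok y' \<longrightarrow> card (Z \<inter> fst y') \<le> card (Z \<inter> fst y))"
  by (rule ex_has_greatest_nat[where P=ok and k="(K, Q0)" and b="Suc (card Z)"]) (use ok0 bd in \<open>auto simp: less_Suc_eq_le\<close>)
 then obtain E Q where y: "ok (E, Q)" and mx0: "\<forall>y'. ok y' \<longrightarrow> card (Z \<inter> fst y') \<le> card (Z \<inter> E)"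
  by (metis fst_conv surj_pair)
 have mx: "card (Z \<inter> E') \<le> card (Z \<inter> E)" if "ok (E', Q')" for E' Q'
  using mx0[rule_format, OF that] by simp
 have EQ: "subfield0 E" "fordering E Q" "F \<subseteq> E" "P \<subseteq> Q" "\<zeta> \<in> E" using y by (auto simp: ok_def)
 interpret E: subfield0 E by (rule EQ)
 have FE: "p \<in> pE F ==> p \<in> pE E" for p using EQ(3) by (auto simp: pE_def)
 have ex: "\<exists>m\<in>pE E. lead_coeff m = 1 \<and> poly m z = 0 \<and> (\<forall>p\<in>pE E. poly p z = 0 \<longrightarrow> m dvd p)" if "z \<in> Z" for z
  by (rule E.minimal_polynomial[OF FE[OF Z(2)] rootpoly_monic(2)]) (use rootpoly_poly[OF Z(1)] that in auto)
 define M where "M = (\<lambda>z. SOME m. m \<in> pE E \<and> lead_coeff m = 1 \<and> poly m z = 0 \<and> (\<forall>p\<in>pE E. poly p z = 0 \<longrightarrow> m dvd p))"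
 have M0: "M z \<in> pE E \<and> lead_coeff (M z) = 1 \<and> poly (M z) z = 0 \<and> (\<forall>p\<in>pE E. poly p z = 0 \<longrightarrow> M z dvd p)" if "z \<in> Z" for z
  unfolding M_def by (rule someI_ex) (use ex[OF that] in blast)
 have M: "M z \<in> pE E" "lead_coeff (M z) = 1" "poly (M z) z = 0" "\<And>p. p \<in> pE E ==> poly p z = 0 ==> M z dvd p" if "z \<in> Z" for z
  using M0[OF that] by auto
 define cl where "cl = (\<lambda>z. {y\<in>Z. poly (M z) y = 0})"
 have Mr: "M z = rootpoly (cl z)" if "z \<in> Z" for z
  unfolding cl_def using rootpoly_poly[OF Z(1)] that FE[OF Z(2)]
  by (intro dvd_rootpoly[OF Z(1) M(2)[OF that] M(4)[OF that]]) auto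
 have clin: "z \<in> cl z" "finite (cl z)" "cl z \<subseteq> Z" if "z \<in> Z" for z using M(3)[OF that] Z(1) that by (auto simp: cl_def)
 \<comment> \<open>Conjugacy is symmetric: if \<open>M y\<close> were nonzero at \<open>z\<close>,
   it would be invertible modulo \<open>M z\<close>, and evaluating at \<open>y\<close>, a zero of
   both polynomials, would give a contradiction.\<close>
 have cleq: "cl y = cl z" if z: "z \<in> Z" and y: "y \<in> cl z" for y z
 proof -
  have yZ: "y \<in> Z" and yz: "poly (M z) y = 0" using y by (auto simp: cl_def)
  have 1: "M y dvd M z" by (rule M(4)[OF yZ M(1)[OF z] yz])
  have "poly (M y) z = 0"
  proof (rule ccontr)
   assume a: "poly (M y) z \<noteq> 0"
   have "inverse (poly (M y) z) \<in> E.adj z"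
    by (rule E.adj_inverse[OF M[OF z] E.adjI[OF M(1)[OF yZ]]])
   then obtain q where q: "q \<in> pE E" "inverse (poly (M y) z) = poly q z" by (auto simp: E.adj_def)
   have "poly (M y * q - 1) z = 0" using a q(2)[symmetric] by simp
   then have "M z dvd M y * q - 1" using M(4)[OF z E.pE_simps(4)[OF E.pE_mult[OF M(1)[OF yZ] q(1)] E.pE_simps(2)]] by blast
   then obtain k where "M y * q - 1 = M z * k" by (elim dvdE)
   then have "poly (M y * q - 1) y = poly (M z * k) y" by simp
   then show False using yz M(3)[OF yZ] by simp
  qed
  then have 2: "M z dvd M y" by (rule M(4)[OF z M(1)[OF yZ]])
  have dv: "poly q x = 0" if "p dvd q" "poly p x = 0" for p q :: "'w poly" and x
   using that by (metis dvd_trans poly_eq_0_iff_dvd)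
  show ?thesis using dv[OF 1] dv[OF 2] by (auto simp: cl_def)
 qed
 define J where "J = cl ` Z"
 have J: "finite J" "disjoint J" "\<Union>J = Z"
 proof -
  show "finite J" using Z by (simp add: J_def)
  show "\<Union>J = Z" using clin by (auto simp: J_def)
  show "disjoint J" unfolding disjoint_def J_def
  proof (intro ballI impI)
   fix A B assume "A \<in> cl ` Z" "B \<in> cl ` Z" "A \<noteq> B"
   then obtain a b where "a \<in> Z" "b \<in> Z" "A = cl a" "B = cl b" by auto
   then show "A \<inter> B = {}" using cleq \<open>A \<noteq> B\<close> by blast
  qed
 qed
 have single: "cl z = {z}" if "z \<in> Z" "z \<in> E" for z
 proof -
  have "M z dvd [:- z, 1:]" by (rule M(4)[OF that(1)]) (use E.pE_simps(7,8) E.F_uminus that E.E1 in auto)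
  then obtain k where "[:- z, 1:] = M z * k" by (elim dvdE)
  then have k: "poly [:- z, 1:] y = poly (M z) y * poly k y" for y by (metis poly_mult)
  have "y = z" if "poly (M z) y = 0" for y using k[of y] that by simp
  then show ?thesis using clin(1)[OF that(1)] by (auto simp: cl_def)
 qed
 have piece: "\<exists>us. E.odiag A us \<and> (\<Sum>c\<in>#dvals A us. sgnP Q c) = (if A \<subseteq> E then 1 else 0)" if A: "A \<in> J" for A
 proof -
  obtain z where z: "z \<in> Z" "A = cl z" using A by (auto simp: J_def)
  show ?thesis
  proof (cases "z \<in> E")
   case True
   then show ?thesis using E.piece_one[OF True] single[OF z(1) True] z E.P_e[OF EQ(2)]
    by (intro exI[of _ "[1]"]) (simp add: sgnP_def)
  next
   case False
   \<comment> \<open>An ordering of the larger field above \<open>Q\<close> would be a competitor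
     containing one more root, namely \<open>z\<close>.\<close>
   have no: "\<not> (\<exists>Q'. fordering (E.adj z) Q' \<and> Q \<subseteq> Q')"
   proof
    assume "\<exists>Q'. fordering (E.adj z) Q' \<and> Q \<subseteq> Q'"
    then obtain Q' where Q': "fordering (E.adj z) Q'" "Q \<subseteq> Q'" by blast
    have sub: "subfield0 (E.adj z)" unfolding subfield0_def by (rule E.adj_base(2)[OF M[OF z(1)]])
    then have "ok (E.adj z, Q')" using Q' EQ E.adj_simps(5)[of z] by (auto simp: ok_def)
    then have "card (Z \<inter> E.adj z) \<le> card (Z \<inter> E)" by (rule mx)
    moreover have "card (Z \<inter> E) < card (Z \<inter> E.adj z)"
     by (rule psubset_card_mono) (use Z z False E.adj_simps(5,6)[of z] in auto)
    ultimately show False by simp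
   qed
   have "\<not> A \<subseteq> E" using clin(1)[OF z(1)] z False by auto
   then show ?thesis using E.piece_nonreal[OF M[OF z(1)] clin(2)[OF z(1)] Mr[OF z(1)] clin(1)[OF z(1)] EQ(2) no] z(2) by auto
  qed
 qed
 define HS where "HS = (\<lambda>A. SOME us. E.odiag A us \<and> (\<Sum>c\<in>#dvals A us. sgnP Q c) = (if A \<subseteq> E then 1 else 0))"
 have HS: "E.odiag A (HS A) \<and> (\<Sum>c\<in>#dvals A (HS A). sgnP Q c) = (if A \<subseteq> E then 1 else 0)" if "A \<in> J" for A
  unfolding HS_def by (rule someI_ex[OF piece[OF that]])
 \<comment> \<open>Extension of scalars from \<open>F\<close> to \<open>E\<close>: only spanning has
   to be checked, and the monomials have coefficients already in \<open>F\<close>.\<close>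
 have oE: "E.odiag Z hs" unfolding E.odiag_def
 proof (intro conjI ballI)
  show "set hs \<subseteq> pE E" "\<forall>i<length hs. \<forall>j<length hs. i \<noteq> j \<longrightarrow> tr Z (hs ! i * hs ! j) = 0" "\<forall>i<length hs. tr Z (hs ! i * hs ! i) \<noteq> 0"
   using o FE by (auto simp: F.odiag_def)
  fix h assume h: "h \<in> pE E"
  have "\<exists>c. (\<forall>i<length hs. c i \<in> F) \<and> (\<forall>z\<in>Z. poly (monom 1 k) z = (\<Sum>i<length hs. poly (hs!i) z * c i))" for k
   by (rule F.odiagD(4)[OF o F.pE_simps(9)[OF F.E1]])
  then obtain c where c: "\<And>k i. i < length hs ==> c k i \<in> F" "\<And>k z. z \<in> Z ==> z ^ k = (\<Sum>i<length hs. poly (hs!i) z * c k i)"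
   by (simp add: poly_monom) metis
  define b where "b = (\<lambda>i. \<Sum>k\<le>degree h. coeff h k * c k i)"
  have "b i \<in> E" if "i < length hs" for i
   unfolding b_def by (rule E.D_sum) (use c(1)[OF that] EQ(3) h E.F_mult E.pE_coeff in blast)
  moreover have "poly h z = (\<Sum>i<length hs. poly (hs!i) z * b i)" if "z \<in> Z" for z
  proof -
   have "poly h z = (\<Sum>k\<le>degree h. \<Sum>i<length hs. coeff h k * (poly (hs!i) z * c k i))"
    by (subst poly_altdef, rule sum.cong) (simp_all add: c(2)[OF that] sum_distrib_left)
   also have "\<dots> = (\<Sum>i<length hs. poly (hs!i) z * b i)"
    by (subst sum.swap) (simp add: b_def sum_distrib_left mult_ac)
   finally show ?thesis .
  qed
  ultimately show "\<exists>c. (\<forall>i<length hs. c i \<in> E) \<and> (\<forall>z\<in>Z. poly h z = (\<Sum>i<length hs. poly (hs!i) z * c i))" by blast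
 qed
 have sg: "sgnP P c = sgnP Q c" if "c \<in># dvals Z hs" for c
 proof -
  obtain h where h: "h \<in> set hs" "c = tr Z (h * h)" using \<open>c \<in># dvals Z hs\<close> by (auto simp: dvals_def)
  obtain i where i: "i < length hs" "h = hs ! i" using h(1) by (auto simp: in_set_conv_nth)
  have "h \<in> pE F" using F.odiagD(1)[OF o i(1)] i by simp
  then have cF: "c \<in> F" using F.sum_roots_in[OF Z F.pE_mult] h(2) by blast
  have "c \<noteq> 0" using F.odiagD(3)[OF o i(1)] i h(2) by simp
  then show ?thesis using F.P_props(5)[OF F(2) cF] EQ(4) fordering_zero[OF EQ(2), of c] by (auto simp: sgnP_def)
 qed
 have "(\<Sum>c\<in>#dvals Z hs. sgnP P c) = (\<Sum>c\<in>#dvals Z hs. sgnP Q c)"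
  by (rule arg_cong[of _ _ sum_mset], rule image_mset_cong) (rule sg)
 also have "\<dots> = (\<Sum>A\<in>J. \<Sum>c\<in>#dvals A (HS A). sgnP Q c)"
 proof -
  have 1: "finite A" "rootpoly A \<in> pE E" if AJ: "A \<in> J" for A
  proof -
   obtain z where "z \<in> Z" "A = cl z" using AJ by (auto simp: J_def)
   then show "finite A" "rootpoly A \<in> pE E" using clin(2) Mr M(1) by metis+
  qed
  show ?thesis
   using E.odiag_combine[OF J(1,2) 1 conjunct1[OF HS] _ _ EQ(2), of hs] J(3) oE FE[OF Z(2)] by auto
 qed
 also have "\<dots> = (\<Sum>A\<in>J. if A \<subseteq> E then 1 else 0)" by (rule sum.cong) (use HS in auto)
 also have "\<dots> > 0"
 proof -
  have "{\<zeta>} \<in> J" using single[OF zeta(1) EQ(5)] zeta(1) by (auto simp: J_def)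
  then have "(\<Sum>A\<in>{{\<zeta>}}. if A \<subseteq> E then 1 else 0 :: int) \<le> (\<Sum>A\<in>J. if A \<subseteq> E then 1 else 0)"
   by (intro sum_mono2 J) auto
  then show ?thesis using EQ(5) by simp
 qed
 finally show ?thesis .
qed

section \<open>Maximal commutative subfields of symmetric elements\<close>

text \<open>Elimination without division, with pivot \<open>M n n\<close>; the product
  \<open>q\<close> of the pivots plays the part of the determinant.\<close>

lemma nonsingular_near:
 fixes M :: "nat \<Rightarrow> nat \<Rightarrow> 'f::field poly"
 assumes "\<And>i j. i < n ==> j < n ==> poly (M i j) 0 = (if i = j then 1 else 0)"
 shows "\<exists>q. poly q 0 \<noteq> 0 \<and> (\<forall>t. poly q t \<noteq> 0 \<longrightarrow>
   (\<forall>v. (\<forall>i<n. (\<Sum>j<n. poly (M i j) t * v j) = 0) \<longrightarrow> (\<forall>j<n. v j = 0)))"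
 using assms
proof (induction n arbitrary: M)
 case 0
 then show ?case by (intro exI[of _ 1]) auto
next
 case (Suc n)
 define M' where "M' = (\<lambda>i j. M n n * M i j - M i n * M n j)"
 have "\<exists>q. poly q 0 \<noteq> 0 \<and> (\<forall>t. poly q t \<noteq> 0 \<longrightarrow>
   (\<forall>v. (\<forall>i<n. (\<Sum>j<n. poly (M' i j) t * v j) = 0) \<longrightarrow> (\<forall>j<n. v j = 0)))"
  by (rule Suc.IH) (use Suc.prems in \<open>auto simp: M'_def\<close>)
 then obtain q where q: "poly q 0 \<noteq> 0" and Q: "\<And>t v. poly q t \<noteq> 0 ==>
   (\<forall>i<n. (\<Sum>j<n. poly (M' i j) t * v j) = 0) ==> (\<forall>j<n. v j = 0)" by blast
 show ?case
 proof (intro exI[of _ "M n n * q"] conjI allI impI)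
  show "poly (M n n * q) 0 \<noteq> 0" using q Suc.prems by simp
  fix t v j
  assume t: "poly (M n n * q) t \<noteq> 0" and v: "\<forall>i<Suc n. (\<Sum>j<Suc n. poly (M i j) t * v j) = 0" and j: "j < Suc n"
  have "(\<Sum>j<n. poly (M' i j) t * v j) = 0" if i: "i < n" for i
  proof -
   have a: "(\<Sum>j<n. poly (M i j) t * v j) = - (poly (M i n) t * v n)" if "i < Suc n" for i
    using v that by (simp add: eq_neg_iff_add_eq_0)
   have "(\<Sum>j<n. poly (M' i j) t * v j)
    = poly (M n n) t * (\<Sum>j<n. poly (M i j) t * v j) - poly (M i n) t * (\<Sum>j<n. poly (M n j) t * v j)"
    by (simp add: M'_def sum_distrib_left algebra_simps sum_subtractf)
   then show ?thesis using a[of i] a[of n] i by (simp add: algebra_simps)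
  qed
  then have vz: "\<forall>j<n. v j = 0" using Q[of t v] t by simp
  then have "(\<Sum>j<Suc n. poly (M n j) t * v j) = poly (M n n) t * v n" by simp
  moreover have "(\<Sum>j<Suc n. poly (M n j) t * v j) = 0" using v by blast
  ultimately have "v n = 0" using t by simp
  then show "v j = 0" using vz j by (auto simp: less_Suc_eq)
 qed
qed

text \<open>The parametrisation \<iota> of \<open>F\<close> by a field type makes polynomials over
  that type available for evaluation in \<open>D\<close>.\<close>

locale fd_alg = divinv_fd +
 fixes \<iota> :: "'f::field \<Rightarrow> 'a::ring"
 assumes i_add: "\<iota> (a + b) = \<iota> a + \<iota> b" and i_mult: "\<iota> (a * b) = \<iota> a * \<iota> b" and i_one: "\<iota> 1 = e"
  and i_range: "F = range \<iota>"
  and cen: "z \<in> D ==> (\<And>x. x \<in> D ==> z * x = x * z) ==> \<sigma> z = z ==> z \<in> F"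
begin

lemma i_F: "\<iota> a \<in> F" "\<iota> a \<in> D" using i_range F_D by auto
lemma i_zero: "\<iota> 0 = 0" using i_add[of 0 0] by simp
lemma i_uminus: "\<iota> (- a) = - \<iota> a" using i_add[of a "- a"] i_zero by (simp add: eq_neg_iff_add_eq_0 add.commute)
lemma i_diff: "\<iota> (a - b) = \<iota> a - \<iota> b" using i_add[of a "- b"] i_uminus by simp
lemma i_nz: "a \<noteq> 0 ==> \<iota> a \<noteq> 0" using i_mult[of a "inverse a"] i_one e_nz by auto
lemma i_eq_0: "\<iota> a = 0 \<longleftrightarrow> a = 0" using i_nz i_zero by auto
lemma i_comm: "x \<in> D ==> \<iota> a * x = x * \<iota> a" using F_central i_F by blast
lemma i_sum: "\<iota> (sum f I) = (\<Sum>i\<in>I. \<iota> (f i))"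
 by (induction I rule: infinite_finite_induct) (auto simp: i_add i_zero)
lemma i_inverse: "a \<noteq> 0 ==> \<iota> a * \<iota> (inverse a) = e" using i_mult[of a "inverse a"] i_one by simp

definition ev :: "'f poly \<Rightarrow> 'a \<Rightarrow> 'a" where
 "ev p x = fold_coeffs (\<lambda>c a. \<iota> c + x * a) p 0"

lemma ev_0 [simp]: "ev 0 x = 0" by (simp add: ev_def)

lemma ev_pCons [simp]: "ev (pCons c p) x = \<iota> c + x * ev p x"
 by (cases "p = 0 \<and> c = 0") (auto simp: ev_def i_zero)

lemma ev_D: "x \<in> D ==> ev p x \<in> D" by (induction p) (auto simp: D_zero D_add D_mult i_F)

lemma ev_comm: assumes "x \<in> D" "y \<in> D" "x * y = y * x" shows "ev p x * y = y * ev p x"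
proof (induction p)
 case (pCons c p)
 have "x * ev p x * y = y * (x * ev p x)" using pCons assms by (metis mult.assoc)
 then show ?case using i_comm assms by (simp add: distrib_left distrib_right)
qed simp

lemma ev_add: "ev (p + q) x = ev p x + ev q x"
 by (induction p q rule: poly_induct2) (auto simp: i_add i_zero distrib_left)

lemma ev_smult: "x \<in> D ==> ev (smult a p) x = \<iota> a * ev p x"
proof (induction p)
 case (pCons c p)
 then have "x * (\<iota> a * ev p x) = \<iota> a * (x * ev p x)" using i_comm by (metis mult.assoc)
 then show ?case using pCons by (simp add: i_mult distrib_left)
qed simp

lemma ev_uminus: "x \<in> D ==> ev (- p) x = - ev p x" using ev_add[of p "- p" x] by (simp add: eq_neg_iff_add_eq_0 add.commute)
lemma ev_diff: "x \<in> D ==> ev (p - q) x = ev p x - ev q x" using ev_add[of p "- q" x] ev_uminus by simp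

lemma ev_mult: "x \<in> D ==> ev (p * q) x = ev p x * ev q x"
 by (induction p) (auto simp: ev_add ev_smult distrib_right mult.assoc i_zero)

lemma ev_one: "x \<in> D ==> ev 1 x = e" by (simp add: one_pCons i_one)

lemma ev_const: "ev [:c:] x = \<iota> c" by simp

lemma ev_x: "x \<in> D ==> ev [:0, 1:] x = x" by (simp add: i_zero i_one e_right)

lemma ev_sum: "x \<in> D ==> ev (sum f I) x = (\<Sum>i\<in>I. ev (f i) x)"
 by (induction I rule: infinite_finite_induct) (auto simp: ev_add)

lemma ev_pcompose: "x \<in> D ==> ev (pcompose p q) x = ev p (ev q x)"
 by (induction p) (auto simp: pcompose_pCons ev_add ev_mult i_zero)

lemma ev_sym: assumes "x \<in> D" "\<sigma> x = x" shows "\<sigma> (ev p x) = ev p x"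
proof (induction p)
 case (pCons c p)
 then show ?case using assms ev_D ev_comm[OF assms(1) assms(1)] i_F F_sym by (simp add: s_add D_mult s_mult)
qed (simp add: s_zero)

definition indf :: "nat \<Rightarrow> (nat \<Rightarrow> 'a) \<Rightarrow> bool" where
 "indf n v \<longleftrightarrow> (\<forall>c. (\<Sum>i<n. v i * \<iota> (c i)) = 0 \<longrightarrow> (\<forall>i<n. c i = 0))"

lemma indf_bound: "\<exists>N. \<forall>n v. indf n v \<longrightarrow> (\<forall>i<n. v i \<in> D) \<longrightarrow> n \<le> N"
proof -
 obtain N where N: "\<And>xs. set xs \<subseteq> D ==> Findep xs ==> length xs \<le> N" using fd by blast
 have "n \<le> N" if "indf n v" "\<forall>i<n. v i \<in> D" for n v
 proof -
  have "Findep (map v [0..<n])" unfolding Findep_def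
  proof (intro allI impI)
   fix c i assume c: "\<forall>i<length (map v [0..<n]). c i \<in> F" "(\<Sum>i<length (map v [0..<n]). map v [0..<n] ! i * c i) = 0"
    "i < length (map v [0..<n])"
   then have "\<forall>i<n. \<exists>a. c i = \<iota> a" using i_range by auto
   then obtain a where a: "\<And>i. i < n ==> c i = \<iota> (a i)" by metis
   then have "(\<Sum>i<n. v i * \<iota> (a i)) = 0" using c by simp
   then have "a i = 0" using that(1) c(3) by (auto simp: indf_def)
   then show "c i = 0" using a c(3) i_zero by simp
  qed
  moreover have "set (map v [0..<n]) \<subseteq> D" using that(2) by auto
  ultimately show ?thesis using N[of "map v [0..<n]"] by simp
 qed
 then show ?thesis by blast
qed

lemma indf_extend: assumes "indf n v" "y \<in> D" "\<And>c. y \<noteq> (\<Sum>i<n. v i * \<iota> (c i))" "\<And>i. i < n ==> v i \<in> D"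
 shows "indf (Suc n) (v(n := y))"
 unfolding indf_def
proof (intro allI impI)
 fix c i assume s: "(\<Sum>i<Suc n. (v(n := y)) i * \<iota> (c i)) = 0" and i: "i < Suc n"
 have s': "(\<Sum>i<n. v i * \<iota> (c i)) + y * \<iota> (c n) = 0" using s by simp
 have "c n = 0"
 proof (rule ccontr)
  assume n: "c n \<noteq> 0"
  define b where "b = - inverse (c n)"
  have 1: "y * \<iota> (c n) = - (\<Sum>i<n. v i * \<iota> (c i))" using s' by (simp add: eq_neg_iff_add_eq_0 add.commute)
  have "y = y * \<iota> (c n) * \<iota> (inverse (c n))" using i_inverse[OF n] assms(2) e_right by (simp add: mult.assoc)
  also have "\<dots> = (\<Sum>i<n. v i * \<iota> (c i * b))"
   unfolding 1 by (simp add: b_def i_mult i_uminus sum_distrib_right sum_negf mult.assoc)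
  finally show False using assms(3)[of "\<lambda>i. c i * b"] by blast
 qed
 moreover from this have "\<forall>i<n. c i = 0" using s' assms(1) i_zero by (auto simp: indf_def)
 ultimately show "c i = 0" using i by (auto simp: less_Suc_eq)
qed

lemma indf_basis:
 assumes v: "indf n v" "\<And>i. i < n ==> v i \<in> D"
 shows "\<exists>m b. n \<le> m \<and> (\<forall>i<n. b i = v i) \<and> indf m b \<and> (\<forall>i<m. b i \<in> D) \<and> (\<forall>y\<in>D. \<exists>c. y = (\<Sum>i<m. b i * \<iota> (c i)))"
proof -
 obtain N where N: "\<And>n v. indf n v ==> (\<forall>i<n. v i \<in> D) ==> n \<le> N" using indf_bound by blast
 define ok where "ok = (\<lambda>m. n \<le> m \<and> (\<exists>b. (\<forall>i<n. b i = v i) \<and> indf m b \<and> (\<forall>i<m. b i \<in> D)))"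
 have "ok n" using v by (auto simp: ok_def)
 moreover have "\<forall>m. ok m \<longrightarrow> m \<le> N" using N by (auto simp: ok_def)
 ultimately obtain m where m: "ok m" and mx: "\<And>m'. ok m' ==> m' \<le> m" using Nat.ex_has_greatest_nat[of ok n N] by auto
 then obtain b where b: "n \<le> m" "\<forall>i<n. b i = v i" "indf m b" "\<forall>i<m. b i \<in> D" by (auto simp: ok_def)
 have "\<exists>c. y = (\<Sum>i<m. b i * \<iota> (c i))" if y: "y \<in> D" for y
 proof (rule ccontr)
  assume "\<nexists>c. y = (\<Sum>i<m. b i * \<iota> (c i))"
  then have "indf (Suc m) (b(m := y))" using indf_extend[OF b(3) y] b(4) by blast
  then have "ok (Suc m)" unfolding ok_def using b y by (intro conjI exI[of _ "b(m := y)"]) (auto simp: less_Suc_eq)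
  then show False using mx by fastforce
 qed
 then show ?thesis using b by blast
qed

text \<open>Complete the vectors at \<open>t = 0\<close> to a basis. The coordinates of the moving
  vectors form a polynomial matrix that is the identity at \<open>0\<close>, so it is nonsingular
  outside finitely many values of \<open>t\<close>.\<close>

lemma indf_near:
 assumes inf: "infinite (UNIV :: 'f set)" and w: "\<And>j k. j < n ==> w j k \<in> D" and ind: "indf n (\<lambda>j. w j 0)"
 shows "\<exists>t. t \<noteq> 0 \<and> indf n (\<lambda>j. \<Sum>k\<le>N. w j k * \<iota> (t ^ k))"
proof -
 obtain m b where b: "n \<le> m" "\<And>i. i < n ==> b i = w i 0" "indf m b" "\<And>i. i < m ==> b i \<in> D"
  "\<And>y. y \<in> D ==> \<exists>c. y = (\<Sum>i<m. b i * \<iota> (c i))" using indf_basis[OF ind] w by blast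
 define l where "l = (\<lambda>y. SOME c. y = (\<Sum>i<m. b i * \<iota> (c i)))"
 have l: "y = (\<Sum>i<m. b i * \<iota> (l y i))" if "y \<in> D" for y unfolding l_def by (rule someI_ex[OF b(5)[OF that]])
 have lb: "l (w j 0) i = (if i = j then 1 else 0)" if ij: "i < n" "j < n" for i j
 proof -
  have wD: "w j 0 \<in> D" using w ij by blast
  have "w j 0 = (\<Sum>i<m. b i * \<iota> (if i = j then 1 else 0))"
  proof -
   have "(\<Sum>i<m. b i * \<iota> (if i = j then 1 else 0)) = (\<Sum>i<m. if i = j then w j 0 else 0)"
    by (rule sum.cong) (use ij b wD in \<open>auto simp: i_one i_zero e_right\<close>)
   then show ?thesis using ij b(1) by simp
  qed
  then have "(\<Sum>i<m. b i * \<iota> (l (w j 0) i)) - (\<Sum>i<m. b i * \<iota> (if i = j then 1 else 0)) = 0" using l[OF wD] by simp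
  then have "(\<Sum>i<m. b i * \<iota> (l (w j 0) i - (if i = j then 1 else 0))) = 0"
   by (simp add: i_diff right_diff_distrib sum_subtractf)
  then have "\<forall>i<m. l (w j 0) i - (if i = j then 1 else 0) = 0"
   using b(3)[unfolded indf_def, rule_format, of "\<lambda>i. l (w j 0) i - (if i = j then 1 else 0)"] by blast
  then show ?thesis using ij b(1) by simp
 qed
 define M where "M = (\<lambda>i j. \<Sum>k\<le>N. monom (l (w j k) i) k)"
 have pM: "poly (M i j) t = (\<Sum>k\<le>N. l (w j k) i * t ^ k)" for i j t by (simp add: M_def poly_sum poly_monom)
 have "poly (M i j) 0 = (if i = j then 1 else 0)" if "i < n" "j < n" for i j
 proof -
  have "poly (M i j) 0 = (\<Sum>k\<le>N. if k = 0 then l (w j 0) i else 0)"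
   unfolding pM by (rule sum.cong) auto
  then show ?thesis using lb[OF that] by simp
 qed
 then obtain q where q: "poly q 0 \<noteq> 0" and Q: "\<And>t v. poly q t \<noteq> 0 ==>
   (\<forall>i<n. (\<Sum>j<n. poly (M i j) t * v j) = 0) ==> (\<forall>j<n. v j = 0)"
  using nonsingular_near[of n M] by blast
 have "q \<noteq> 0" using q by auto
 then have "finite ({t. poly q t = 0} \<union> {0})" using poly_roots_finite by auto
 then obtain t where t: "t \<noteq> 0" "poly q t \<noteq> 0" using ex_new_if_finite[OF inf] by blast
 have "indf n (\<lambda>j. \<Sum>k\<le>N. w j k * \<iota> (t ^ k))" unfolding indf_def
 proof (intro allI impI)
  fix c j assume c: "(\<Sum>j<n. (\<Sum>k\<le>N. w j k * \<iota> (t ^ k)) * \<iota> (c j)) = 0" and j: "j < n"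
  have "(\<Sum>k\<le>N. w j k * \<iota> (t ^ k)) = (\<Sum>i<m. b i * \<iota> (poly (M i j) t))" if "j < n" for j
  proof -
   have "(\<Sum>k\<le>N. w j k * \<iota> (t ^ k)) = (\<Sum>k\<le>N. \<Sum>i<m. b i * \<iota> (l (w j k) i) * \<iota> (t ^ k))"
    by (rule sum.cong[OF refl], subst (1) l[OF w[OF that]], rule sum_distrib_right)
   also have "\<dots> = (\<Sum>i<m. b i * \<iota> (poly (M i j) t))"
    by (subst sum.swap) (simp add: pM i_sum i_mult sum_distrib_left mult.assoc)
   finally show ?thesis .
  qed
  then have "(\<Sum>j<n. (\<Sum>i<m. b i * \<iota> (poly (M i j) t)) * \<iota> (c j)) = 0" using c by simp
  moreover have "(\<Sum>j<n. (\<Sum>i<m. b i * \<iota> (poly (M i j) t)) * \<iota> (c j)) = (\<Sum>i<m. b i * \<iota> (\<Sum>j<n. poly (M i j) t * c j))"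
   by (simp only: sum_distrib_right, subst sum.swap) (simp add: i_sum i_mult sum_distrib_left mult.assoc)
  ultimately have "\<forall>i<m. (\<Sum>j<n. poly (M i j) t * c j) = 0"
   using b(3)[unfolded indf_def, rule_format, of "\<lambda>i. \<Sum>j<n. poly (M i j) t * c j"] by metis
  then show "c j = 0" using Q[OF t(2), of c] b(1) j by auto
 qed
 then show ?thesis using t(1) by blast
qed

text \<open>Taylor expansion of \<open>p\<close> at \<open>x\<close> in the direction
  \<open>z\<close>. Commutation makes the linear coefficient the usual derivative; the higher
  coefficients are left unspecified.\<close>

lemma ev_expand:
 assumes x: "x \<in> D" and z: "z \<in> D"  and xz: "x * z = z * x"
 shows "\<exists>u N. (\<forall>k. u k \<in> D) \<and> (\<forall>k\<ge>N. u k = 0) \<and> u 0 = ev p x \<and> u 1 = z * ev (pderiv p) x \<and>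
   (\<forall>t. ev p (x + z * \<iota> t) = (\<Sum>k<N. u k * \<iota> (t ^ k)))"
proof (induction p)
 case 0
 show ?case by (intro exI[of _ "\<lambda>_. 0"] exI[of _ 0]) (auto simp: D_zero)
next
 case (pCons c p)
 then obtain u N where u: "\<And>k. u k \<in> D" "\<And>k. k \<ge> N ==> u k = 0" "u 0 = ev p x" "u 1 = z * ev (pderiv p) x"
   "\<And>t. ev p (x + z * \<iota> t) = (\<Sum>k<N. u k * \<iota> (t ^ k))" by blast
 define u' where "u' = (\<lambda>k. (if k = 0 then \<iota> c else z * u (k - 1)) + x * u k)"
 have 1: "u' k \<in> D" for k
  unfolding u'_def by (intro D_add D_mult x u(1)) (simp add: i_F D_mult z u(1))
 have 2: "u' k = 0" if "k \<ge> Suc N" for k using that u(2)[of k] u(2)[of "k - 1"] by (auto simp: u'_def)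
 have 3: "u' 1 = z * ev (pderiv (pCons c p)) x"
 proof -
  have "x * (z * ev (pderiv p) x) = z * (x * ev (pderiv p) x)" using xz by (metis mult.assoc)
  then show ?thesis using u by (simp add: u'_def pderiv_pCons ev_add i_zero distrib_left)
 qed
 have 4: "ev (pCons c p) (x + z * \<iota> t) = (\<Sum>k<Suc N. u' k * \<iota> (t ^ k))" for t
 proof -
  have ic: "\<iota> t * u k = u k * \<iota> t" for k using i_comm u(1) by blast
  have a: "x * (\<Sum>k<N. u k * \<iota> (t ^ k)) = (\<Sum>k<Suc N. x * u k * \<iota> (t ^ k))"
   using u(2)[of N] by (simp add: sum_distrib_left mult.assoc)
  have b: "z * \<iota> t * (\<Sum>k<N. u k * \<iota> (t ^ k)) = (\<Sum>k<N. z * u k * \<iota> (t ^ Suc k))"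
   unfolding sum_distrib_left
  proof (rule sum.cong)
   fix k
   have "z * \<iota> t * (u k * \<iota> (t ^ k)) = z * (\<iota> t * u k) * \<iota> (t ^ k)" by (simp only: mult.assoc)
   also have "\<dots> = z * u k * (\<iota> t * \<iota> (t ^ k))" unfolding ic by (simp only: mult.assoc)
   finally show "z * \<iota> t * (u k * \<iota> (t ^ k)) = z * u k * \<iota> (t ^ Suc k)" by (simp add: i_mult)
  qed simp
  have "(\<Sum>k<Suc N. u' k * \<iota> (t ^ k)) = (\<Sum>k<Suc N. (if k = 0 then \<iota> c else z * u (k - 1)) * \<iota> (t ^ k)) + (\<Sum>k<Suc N. x * u k * \<iota> (t ^ k))"
   unfolding u'_def distrib_right sum.distrib ..
  also have "(\<Sum>k<Suc N. (if k = 0 then \<iota> c else z * u (k - 1)) * \<iota> (t ^ k)) = \<iota> c + (\<Sum>k<N. z * u k * \<iota> (t ^ Suc k))"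
   by (subst sum.lessThan_Suc_shift) (simp add: i_one e_right i_F)
  finally show ?thesis using a b u(5) by (simp add: distrib_right add.assoc add.commute)
 qed
 show ?case
  by (rule exI[of _ u'], rule exI[of _ "Suc N"]) (use 1 2 3 4 u(3) in \<open>auto simp: u'_def\<close>)
qed

text \<open>The degree of \<open>x\<close> over \<open>F\<close> is at least
  \<open>n\<close>.\<close>

definition pind :: "'a \<Rightarrow> nat \<Rightarrow> bool" where
 "pind x n \<longleftrightarrow> (\<forall>p. degree p < n \<longrightarrow> ev p x = 0 \<longrightarrow> p = 0)"

lemma ev_Poly: assumes "x \<in> D" shows "ev (\<Sum>i<n. monom (c i) i) x = (\<Sum>i<n. ev (monom 1 i) x * \<iota> (c i))"
proof -
 have "ev (monom (c i) i) x = ev (monom 1 i) x * \<iota> (c i)" for i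
  using ev_smult[OF assms, of "c i" "monom 1 i"] i_comm[OF ev_D[OF assms]] by (simp add: smult_monom)
 then show ?thesis by (simp add: ev_sum[OF assms])
qed

lemma pind_indf: assumes x: "x \<in> D" and n: "pind x n" shows "indf n (\<lambda>i. ev (monom 1 i) x)"
 unfolding indf_def
proof (intro allI impI)
 fix c i assume c: "(\<Sum>i<n. ev (monom 1 i) x * \<iota> (c i)) = 0" and i: "i < n"
 define p where "p = (\<Sum>i<n. monom (c i) i)"
 have cp: "coeff p j = (if j < n then c j else 0)" for j by (simp add: p_def coeff_sum)
 have "degree p \<le> n - 1" by (rule degree_le) (use cp i in auto)
 then have "p = 0" using n c i ev_Poly[OF x, where c=c and n=n] by (auto simp: pind_def p_def[symmetric])
 then show "c i = 0" using cp[of i] i by simp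
qed

lemma pind_bound: "\<exists>N. \<forall>x\<in>D. \<forall>n. pind x n \<longrightarrow> n \<le> N"
proof -
 obtain N where N: "\<And>n v. indf n v ==> (\<forall>i<n. v i \<in> D) ==> n \<le> N" using indf_bound by blast
 show ?thesis using N[OF pind_indf] ev_D by blast
qed

text \<open>An annihilating polynomial of least degree has a nonzero constant term; solving for that
  term gives the inverse.\<close>

lemma ev_inverse: assumes x: "x \<in> D" "x \<noteq> 0" shows "\<exists>q. dinv x = ev q x"
proof -
 obtain N where N: "\<And>n. pind x n ==> n \<le> N" using pind_bound x(1) by blast
 have "\<not> pind x (Suc N)" using N[of "Suc N"] by auto
 then obtain p0 where p0: "p0 \<noteq> 0" "ev p0 x = 0" by (auto simp: pind_def)
 obtain p where p: "p \<noteq> 0" "ev p x = 0" and least: "\<And>q. q \<noteq> 0 \<and> ev q x = 0 ==> degree p \<le> degree q"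
  using ex_has_least_nat[of "\<lambda>p. p \<noteq> 0 \<and> ev p x = 0" p0 degree] p0 by blast
 obtain c p' where pc: "p = pCons c p'" by (cases p)
 have c: "c \<noteq> 0"
 proof
  assume "c = 0"
  then have p': "p' \<noteq> 0" "x * ev p' x = 0" using p pc by (auto simp: i_zero)
  then have "ev p' x = 0" using no_zero_div[OF x(1) ev_D[OF x(1)]] x(2) by blast
  then show False using least[of p'] p' pc by simp
 qed
 define y where "y = ev (smult (- inverse c) p') x"
 have "x * ev p' x = - \<iota> c" using p pc by (simp add: eq_neg_iff_add_eq_0 add.commute)
 then have "x * y = \<iota> (- inverse c) * (- \<iota> c)"
  using i_comm[OF x(1)] unfolding y_def ev_smult[OF x(1)] by (metis mult.assoc)
 also have "\<dots> = \<iota> (inverse c * c)" by (simp add: i_uminus i_mult)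
 also have "\<dots> = e" using c i_one by simp
 finally have "y = dinv x" using dinv_unique[OF x(1) ev_D[OF x(1)]] by (simp add: y_def)
 then show ?thesis unfolding y_def by metis
qed

text \<open>
 If \<open>\<theta>\<close> has maximal degree and \<open>z\<close> times the derivative \<open>f' \<theta>\<close> were not in \<open>F(\<theta>)\<close>, then the powers of \<open>\<theta> + z t\<close> below the degree
 together with \<open>f (\<theta> + z t) / t\<close> would be independent at \<open>t = 0\<close>, hence for some \<open>t \<noteq> 0\<close>.
\<close>

lemma primitive_element:
 assumes inf: "infinite (UNIV :: 'f set)" and ch: "\<And>n. n > 0 ==> (of_nat n :: 'f) \<noteq> 0" and w: "w \<in> D" "\<sigma> w = w"
 shows "\<exists>\<theta> f. \<theta> \<in> D \<and> \<sigma> \<theta> = \<theta> \<and> \<theta> * w = w * \<theta> \<and> lead_coeff f = 1 \<and> degree f > 0 \<and> ev f \<theta> = 0 \<and> pind \<theta> (degree f) \<and> ev (pderiv f) \<theta> \<noteq> 0 \<and>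
  (\<forall>z\<in>D. \<sigma> z = z \<longrightarrow> z * w = w * z \<longrightarrow> \<theta> * z = z * \<theta> \<longrightarrow> (\<exists>p. z = ev p \<theta>))"
proof -
 \<comment> \<open>The degree is maximised only among symmetric elements commuting with
   \<open>w\<close>. In the end \<open>w\<close> itself commutes with \<theta> and is a polynomial
   in it.\<close>
 define T where "T = {x\<in>D. \<sigma> x = x \<and> x * w = w * x}"
 obtain N where N: "\<And>x n. x \<in> D ==> pind x n ==> n \<le> N" using pind_bound by blast
 define ok where "ok = (\<lambda>n. \<exists>x\<in>T. pind x n)"
 have "pind e 1"
  unfolding pind_def
 proof (intro allI impI)
  fix p assume "degree p < 1" "ev p e = 0"
  then show "p = 0" using degree_eq_zeroE[of p] i_eq_0 by (metis ev_const less_one pCons_0_0)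
 qed
 moreover have "e \<in> T" using e_in s_e w e_left e_right by (simp add: T_def)
 ultimately have "ok 1" by (auto simp: ok_def)
 moreover have "\<forall>m. ok m \<longrightarrow> m \<le> N" using N by (auto simp: ok_def T_def)
 ultimately obtain d where d: "ok d" and mx: "\<And>d'. ok d' ==> d' \<le> d" using Nat.ex_has_greatest_nat[of ok 1 N] by auto
 have d1: "d \<ge> 1" using mx[OF \<open>ok 1\<close>] .
 obtain \<theta> where th: "\<theta> \<in> T" "pind \<theta> d" using d by (auto simp: ok_def)
 have thD: "\<theta> \<in> D" "\<sigma> \<theta> = \<theta>" "\<theta> * w = w * \<theta>" using th by (auto simp: T_def)
 have "\<not> pind \<theta> (Suc d)" using mx[of "Suc d"] th by (auto simp: ok_def)
 then obtain f0 where f0: "f0 \<noteq> 0" "degree f0 < Suc d" "ev f0 \<theta> = 0" by (auto simp: pind_def)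
 define f where "f = smult (inverse (lead_coeff f0)) f0"
 have f: "lead_coeff f = 1" "ev f \<theta> = 0" using f0 ev_smult[OF thD(1)] by (auto simp: f_def)
 have "\<not> degree f0 < d" using th(2) f0 by (auto simp: pind_def)
 then have df: "degree f = d" using f0 by (simp add: f_def)
 have f'0: "pderiv f \<noteq> 0"
 proof
  assume "pderiv f = 0"
  then have "coeff (pderiv f) (d - 1) = 0" by simp
  then have "(of_nat d :: 'f) = 0" using d1 f(1) df by (simp add: coeff_pderiv)
  then show False using ch[of d] d1 by simp
 qed
 have "degree (pderiv f) \<le> d - 1" by (rule degree_le) (use df in \<open>auto simp: coeff_pderiv coeff_eq_0\<close>)
 then have "degree (pderiv f) < d" using d1 by linarith
 then have f': "ev (pderiv f) \<theta> \<noteq> 0" using th(2) f'0 by (auto simp: pind_def)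
 have key: "\<exists>p. z = ev p \<theta>" if z: "z \<in> D" "\<sigma> z = z" "z * w = w * z" "\<theta> * z = z * \<theta>" for z
 proof -
  have "\<exists>c. z * ev (pderiv f) \<theta> = (\<Sum>i<d. ev (monom 1 i) \<theta> * \<iota> (c i))"
  proof (rule ccontr)
   assume no: "\<nexists>c. z * ev (pderiv f) \<theta> = (\<Sum>i<d. ev (monom 1 i) \<theta> * \<iota> (c i))"
   define y where "y = z * ev (pderiv f) \<theta>"
   define P where "P = (\<lambda>j. if j < d then monom 1 j else f)"
   define good where "good = (\<lambda>j u N. (\<forall>k. u k \<in> D) \<and> (\<forall>k\<ge>N. u k = 0) \<and> u 0 = ev (P j) \<theta> \<and> u 1 = z * ev (pderiv (P j)) \<theta> \<and>
     (\<forall>t. ev (P j) (\<theta> + z * \<iota> t) = (\<Sum>k<N. u k * \<iota> (t ^ k))))"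
   have "\<forall>j. \<exists>u N. good j u N" unfolding good_def using ev_expand[OF thD(1) z(1) z(4)] by blast
   then obtain u where "\<forall>j. \<exists>N. good j (u j) N" by (rule choice[THEN exE])
   then obtain NN where gd: "\<forall>j. good j (u j) (NN j)" by (rule choice[THEN exE])
   have u: "\<And>j k. u j k \<in> D" "\<And>j k. k \<ge> NN j ==> u j k = 0" "\<And>j. u j 0 = ev (P j) \<theta>"
     "\<And>j. u j 1 = z * ev (pderiv (P j)) \<theta>" "\<And>j t. ev (P j) (\<theta> + z * \<iota> t) = (\<Sum>k<NN j. u j k * \<iota> (t ^ k))"
    using gd unfolding good_def by blast+
   define N where "N = (\<Sum>j\<le>d. NN j)"
   have NN: "NN j \<le> N" if "j \<le> d" for j unfolding N_def by (rule member_le_sum) (use that in auto)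
   have uN: "ev (P j) (\<theta> + z * \<iota> t) = (\<Sum>k\<le>N. u j k * \<iota> (t ^ k))" if "j \<le> d" for j t
    unfolding u(5) by (rule sum.mono_neutral_left) (use NN[OF that] u(2) in auto)
   \<comment> \<open>The shifted index in the last vector is the division of
     \<open>f (\<theta> + z t)\<close> by \<open>t\<close>, possible because the constant
     coefficient \<open>ev f \<theta>\<close> vanishes. Its value at \<open>t = 0\<close> is
     \<open>y\<close>.\<close>
   define v where "v = (\<lambda>j k. if j < d then u j k else u d (Suc k))"
   have "indf (Suc d) ((\<lambda>i. ev (monom 1 i) \<theta>)(d := y))"
    by (rule indf_extend[OF pind_indf[OF thD(1) th(2)]])
     (use no z(1) ev_D[OF thD(1)] D_mult in \<open>auto simp: y_def\<close>)
   moreover have "v j 0 = ((\<lambda>i. ev (monom 1 i) \<theta>)(d := y)) j" if "j < Suc d" for j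
    using that u(3,4) by (auto simp: v_def P_def y_def)
   ultimately have "indf (Suc d) (\<lambda>j. v j 0)" by (simp add: indf_def)
   moreover have "v j k \<in> D" for j k using u(1) by (simp add: v_def)
   ultimately obtain t where t: "t \<noteq> 0" "indf (Suc d) (\<lambda>j. \<Sum>k\<le>N. v j k * \<iota> (t ^ k))"
    using indf_near[OF inf, of "Suc d" v] by blast
   define \<eta> where "\<eta> = \<theta> + z * \<iota> t"
   have eD: "\<eta> \<in> D" using thD z i_F by (auto simp: \<eta>_def intro!: D_add D_mult)
   have zt: "z * \<iota> t * w = w * (z * \<iota> t)" using z(3) i_comm[OF w(1), of t] by (metis mult.assoc)
   have "\<sigma> (z * \<iota> t) = z * \<iota> t" using s_mult[OF z(1) i_F(2), of t] z(2) F_sym[OF i_F(1), of t] i_comm[OF z(1)] by simp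
   then have eT: "\<eta> \<in> T" using eD thD zt z i_F by (simp add: T_def \<eta>_def s_add D_mult distrib_left distrib_right)
   have v1: "(\<Sum>k\<le>N. v j k * \<iota> (t ^ k)) = ev (monom 1 j) \<eta>" if "j < d" for j
    using uN[of j t] that by (simp add: v_def P_def \<eta>_def)
   have v2: "(\<Sum>k\<le>N. v d k * \<iota> (t ^ k)) * \<iota> t = ev f \<eta>"
   proof -
    have "(\<Sum>k\<le>N. v d k * \<iota> (t ^ k)) * \<iota> t = (\<Sum>k\<le>N. u d (Suc k) * \<iota> (t ^ Suc k))"
     unfolding sum_distrib_right by (rule sum.cong) (auto simp: v_def mult.assoc i_mult[symmetric] mult.commute)
    also have "\<dots> = (\<Sum>k\<le>Suc N. u d k * \<iota> (t ^ k))"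
     using u(3)[of d] f(2) by (subst sum.atMost_Suc_shift) (simp add: P_def)
    also have "\<dots> = ev f \<eta>" using uN[of d t] u(2)[of d "Suc N"] NN[of d] by (simp add: P_def \<eta>_def)
    finally show ?thesis .
   qed
   have "pind \<eta> (Suc d)" unfolding pind_def
   proof (intro allI impI)
    fix p assume p: "degree p < Suc d" "ev p \<eta> = 0"
    define a where "a = coeff p d"
    define q where "q = p - smult a f"
    have qc: "coeff q j = 0" if "j \<ge> d" for j
     using that p(1) df f(1) by (cases "j = d") (auto simp: q_def a_def coeff_eq_0)
    \<comment> \<open>The factor \<open>t\<close> in the last coefficient undoes the division by
      \<open>t\<close>, so that the combination equals \<open>ev p \<eta>\<close>.\<close>
    define c where "c = (\<lambda>j. if j < d then coeff q j else t * a)"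
    have q: "q = (\<Sum>i<d. monom (c i) i)" by (rule poly_eqI) (use qc in \<open>auto simp: coeff_sum c_def\<close>)
    have "(\<Sum>j<Suc d. (\<Sum>k\<le>N. v j k * \<iota> (t ^ k)) * \<iota> (c j)) = (\<Sum>j<d. ev (monom 1 j) \<eta> * \<iota> (c j)) + ev f \<eta> * \<iota> a"
     using v1 v2 by (simp add: c_def i_mult mult.assoc[symmetric])
    also have "\<dots> = ev q \<eta> + ev (smult a f) \<eta>" unfolding q ev_Poly[OF eD] ev_smult[OF eD] using i_comm[OF ev_D[OF eD]] by simp
    also have "\<dots> = 0" using p(2) by (simp add: q_def ev_diff[OF eD])
    finally have c0: "c j = 0" if "j < Suc d" for j using t(2)[unfolded indf_def, rule_format, of c] that by blast
    have "a = 0" using c0[of d] t(1) by (simp add: c_def)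
    moreover have "\<forall>j<d. coeff q j = 0"
    proof (intro allI impI)
     fix j assume "j < d"
     then show "coeff q j = 0" using c0[of j] by (simp add: c_def)
    qed
    ultimately have "\<forall>j<d. coeff q j = 0" "a = 0" by blast+
    then have "q = 0" using qc by (intro poly_eqI) (metis coeff_0 not_le)
    then show "p = 0" using \<open>a = 0\<close> by (simp add: q_def)
   qed
   then show False using mx[of "Suc d"] eT by (auto simp: ok_def)
  qed
  then obtain c where c: "z * ev (pderiv f) \<theta> = (\<Sum>i<d. ev (monom 1 i) \<theta> * \<iota> (c i))" by blast
  define p where "p = (\<Sum>i<d. monom (c i) i)"
  define g where "g = ev (pderiv f) \<theta>"
  have gD: "g \<in> D" "g \<noteq> 0" using f' ev_D[OF thD(1)] by (auto simp: g_def)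
  obtain q where q: "dinv g = ev q g" using ev_inverse[OF gD] by blast
  have "z * g = ev p \<theta>" using c ev_Poly[OF thD(1)] by (simp add: g_def p_def)
  moreover have "z = z * g * dinv g" using z(1) gD dinv by (simp add: mult.assoc e_right)
  ultimately have "z = ev p \<theta> * ev (pcompose q (pderiv f)) \<theta>" using q by (simp add: ev_pcompose[OF thD(1)] g_def)
  then show ?thesis using ev_mult[OF thD(1)] by metis
 qed
 show ?thesis
  by (rule exI[of _ \<theta>], rule exI[of _ f]) (use thD f df d1 th(2) f' key in auto)
qed

end

text \<open>Two homomorphisms with the same kernel have isomorphic images, and the isomorphism
  carries the ordering over. This moves orderings between \<iota>, the identity, and evaluations in
  an algebraic closure.\<close>

lemma fordering_transport:
 fixes a :: "'x::comm_ring \<Rightarrow> 'a::ring" and b :: "'x \<Rightarrow> 'b::ring"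
 assumes P: "fordering (range a) P"
  and a: "\<And>x y. a (x + y) = a x + a y" "\<And>x. a (- x) = - a x" "\<And>x y. a (x * y) = a x * a y"
  and b: "\<And>x y. b (x + y) = b x + b y" "\<And>x. b (- x) = - b x" "\<And>x y. b (x * y) = b x * b y"
  and z: "\<And>x. a x = 0 \<longleftrightarrow> b x = 0"
 shows "fordering (range b) (b ` {x. a x \<in> P})" "b x \<in> b ` {x. a x \<in> P} \<longleftrightarrow> a x \<in> P"
proof -
 have eq: "b x = b y ==> a x = a y" for x y
  using z[of "x + - y", unfolded a b] by simp
 show mem: "b x \<in> b ` {x. a x \<in> P} \<longleftrightarrow> a x \<in> P" for x
 proof
  assume "b x \<in> b ` {x. a x \<in> P}"
  then obtain y where y: "b x = b y" "a y \<in> P" by blast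
  show "a x \<in> P" using eq[OF y(1)] y(2) by simp
 qed blast
 have P': "\<And>x y. x \<in> P ==> y \<in> P ==> x + y \<in> P" "\<And>x y. x \<in> P ==> y \<in> P ==> x * y \<in> P"
   "P \<union> uminus ` P = range a" "0 \<in> P" using P by (auto simp: fordering_def)
 show "fordering (range b) (b ` {x. a x \<in> P})" unfolding fordering_def
 proof (intro conjI ballI)
  fix x y assume "x \<in> b ` {x. a x \<in> P}" "y \<in> b ` {x. a x \<in> P}"
  then obtain p q where pq: "x = b p" "y = b q" "a p \<in> P" "a q \<in> P" by auto
  then show "x + y \<in> b ` {x. a x \<in> P}" using P'(1)[OF pq(3,4)] mem[of "p + q"] by (simp add: a b)
  show "x * y \<in> b ` {x. a x \<in> P}" using pq P'(2)[OF pq(3,4)] mem[of "p * q"] by (simp add: a b)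
 next
  show "b ` {x. a x \<in> P} \<union> uminus ` b ` {x. a x \<in> P} = range b"
  proof (intro equalityI subsetI)
   fix y assume "y \<in> range b"
   then obtain x where x: "y = b x" by auto
   have "a x \<in> P \<union> uminus ` P" using P'(3) by auto
   then consider "a x \<in> P" | "a (- x) \<in> P" by (auto simp: a)
   then show "y \<in> b ` {x. a x \<in> P} \<union> uminus ` b ` {x. a x \<in> P}"
   proof cases
    case 2
    then have "b (- x) \<in> b ` {x. a x \<in> P}" by blast
    moreover have "y = - b (- x)" by (simp add: b x)
    ultimately show ?thesis by blast
   qed (use x in blast)
  next
   fix y assume "y \<in> b ` {x. a x \<in> P} \<union> uminus ` b ` {x. a x \<in> P}"
   then show "y \<in> range b" by (auto simp: b(2)[symmetric])
  qed
  have "a 0 = 0" "b 0 = 0" using a(1)[of 0 0] b(1)[of 0 0] by auto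
  then have b0: "0 \<in> b ` {x. a x \<in> P}" using P'(4) mem[of 0] by simp
  show "b ` {x. a x \<in> P} \<inter> uminus ` b ` {x. a x \<in> P} = {0}"
  proof (intro equalityI subsetI)
   fix y assume "y \<in> b ` {x. a x \<in> P} \<inter> uminus ` b ` {x. a x \<in> P}"
   then obtain p q where pq: "y = b p" "a p \<in> P" "y = - b q" "a q \<in> P" by (elim IntE imageE CollectE) auto
   then have "a p = - a q" using eq[of p "- q"] by (simp add: a b)
   then have "a p = 0" using fordering_zero[OF P pq(2)] pq(4) by simp
   then show "y \<in> {0}" using z pq(1) by simp
  qed (use b0 in force)
 qed
qed

section \<open>Comparison with an algebraic closure\<close>

lemma rootpoly_of_separable:
 fixes f :: "'w::alg_closed_field poly"
 assumes f: "lead_coeff f = 1" and sep: "\<And>z. poly f z = 0 ==> poly (pderiv f) z \<noteq> 0"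
 shows "f = rootpoly {z. poly f z = 0}"
proof -
 have f0: "f \<noteq> 0" using f by auto
 obtain A where A: "f = (\<Prod>x\<in>#A. [:- x, 1:])" using alg_closed_imp_factorization[OF f0] f by auto
 have c1: "count A x = 1" if xA: "x \<in># A" for x
 proof (rule ccontr)
  assume n: "count A x \<noteq> 1"
  obtain B where B: "A = add_mset x B" using xA by (metis multi_member_split)
  have "count B x \<noteq> 0" using n B by simp
  then have "x \<in># B" by (simp add: count_inI)
  then obtain C where C: "B = add_mset x C" by (metis multi_member_split)
  have "f = [:- x, 1:] * ([:- x, 1:] * (\<Prod>x\<in>#C. [:- x, 1:]))" unfolding A B C by (simp only: image_mset_add_mset prod_mset.add_mset)
  then obtain g where g: "f = [:- x, 1:] * ([:- x, 1:] * g)" by blast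
  have "poly f x = 0" unfolding g by simp
  moreover have "poly (pderiv f) x = 0" unfolding g by (subst pderiv_mult) (simp add: pderiv_pCons)
  ultimately show False using sep by blast
 qed
 have "A = mset_set (set_mset A)" by (rule multiset_eqI) (use c1 in \<open>auto simp: count_mset_set' not_in_iff\<close>)
 then have "(\<Prod>x\<in>#A. [:- x, 1:]) = rootpoly (set_mset A)" unfolding rootpoly_def prod_unfold_prod_mset by simp
 then have fr: "f = rootpoly (set_mset A)" using A by simp
 have "{z. poly f z = 0} = set_mset A" using rootpoly_poly[of "set_mset A"] fr by auto
 then show ?thesis using fr by simp
qed

abbreviation mp :: "'f::field poly \<Rightarrow> 'f alg_closure poly" where "mp \<equiv> map_poly to_ac"

lemma mp_simps: "mp (p + q) = mp p + mp q" "mp (- p) = - mp p" "mp (p * q) = mp p * mp q" "mp (p - q) = mp p - mp q"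
  "mp (pderiv p) = pderiv (mp p)" "degree (mp p) = degree p" "mp [:c:] = [:to_ac c:]"
proof -
 show "mp (p + q) = mp p + mp q" "mp (- p) = - mp p" "mp (p - q) = mp p - mp q" "mp (pderiv p) = pderiv (mp p)"
  by (rule poly_eqI; simp add: coeff_map_poly coeff_pderiv del: of_nat_Suc)+
 show "mp (p * q) = mp p * mp q"
  by (rule poly_eqI) (simp add: coeff_map_poly coeff_mult to_ac_sum)
 show "degree (mp p) = degree p" by (rule degree_map_poly) simp
 show "mp [:c:] = [:to_ac c:]" by (rule poly_eqI) (simp add: coeff_map_poly coeff_pCons split: nat.splits)
qed

lemma mp_pE: "pE (range (to_ac :: 'f::field \<Rightarrow> _)) = range mp"
proof (intro equalityI subsetI)
 fix p :: "'f alg_closure poly" assume "p \<in> pE (range to_ac)"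
 then have "p = mp (map_poly of_ac p)"
  by (intro poly_eqI) (simp add: coeff_map_poly pE_def to_ac_of_ac)
 then show "p \<in> range mp" by blast
qed (auto simp: pE_def coeff_map_poly)

lemma subfield0_to_ac: "subfield0 (range (to_ac :: 'f::field \<Rightarrow> _))"
proof -
 have r: "1 \<in> range (to_ac :: 'f \<Rightarrow> _)" "\<And>x y :: 'f alg_closure. x \<in> range to_ac ==> y \<in> range to_ac ==> x + y \<in> range to_ac"
  "\<And>x :: 'f alg_closure. x \<in> range to_ac ==> - x \<in> range to_ac" "\<And>x y :: 'f alg_closure. x \<in> range to_ac ==> y \<in> range to_ac ==> x * y \<in> range to_ac"
  "\<And>x :: 'f alg_closure. x \<in> range to_ac ==> inverse x \<in> range to_ac"
  by (auto simp del: to_ac_1 to_ac_add to_ac_minus to_ac_mult to_ac_inverse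
    simp: to_ac_1[symmetric] to_ac_add[symmetric] to_ac_minus[symmetric] to_ac_mult[symmetric] to_ac_inverse[symmetric])
 show ?thesis unfolding subfield0_def by (rule divinv_base_subfields) (use r in auto)
qed

context fd_alg
begin

text \<open>Since \<open>L\<close> is generated by an element \<theta> adapted to \<open>w\<close>,
  it contains \<open>w\<close>, and \<open>w\<close> not being torsion yields an ordering of
  \<open>L\<close> above \<open>P\<close>. A copy of \<open>L\<close> inside the algebraic closure
  then allows \<open>trace_signature_pos\<close> to show that \<open>sg P e\<close> is
  nonzero.\<close>

lemma theta_exists_nontorsion:
 assumes P: "fordering F P" and w: "w \<in> Hs" "\<not> torsion (P - {0}) {#w#}"
 shows "\<exists>S B. theta P S B"
proof -
 define Pf where "Pf = {c. \<iota> c \<in> P}"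
 have P': "fordering (range \<iota>) P" using P i_range by simp
 have "fordering (range (\<lambda>c. c)) ((\<lambda>c. c) ` {c. \<iota> c \<in> P})"
  by (rule fordering_transport[OF P' i_add i_uminus i_mult]) (use i_eq_0 in auto)
 then have Pf: "fordering UNIV Pf" by (simp add: Pf_def)
 have one: "1 \<in> Pf" using P_e[OF P] i_one by (simp add: Pf_def)
 have ch: "\<And>n. n > 0 ==> (of_nat n :: 'f) \<noteq> 0" using fordering_of_nat(1)[OF Pf one] .
 have "inj (of_nat :: nat \<Rightarrow> 'f)"
 proof (rule injI)
  fix m n :: nat assume eq: "(of_nat m :: 'f) = of_nat n"
  have "m = n" if "m \<le> n" "(of_nat m :: 'f) = of_nat n" for m n
   using ch[of "n - m"] that by (cases "m = n") (auto simp: of_nat_diff)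
  then show "m = n" using eq by (metis nle_le)
 qed
 then have inf: "infinite (UNIV :: 'f set)" by (metis finite_imageD finite_subset infinite_UNIV_nat subset_UNIV)
 obtain \<theta> f where th: "\<theta> \<in> D" "\<sigma> \<theta> = \<theta>" "\<theta> * w = w * \<theta>" and f: "lead_coeff f = 1" "degree f > 0" "ev f \<theta> = 0"
   "pind \<theta> (degree f)" "ev (pderiv f) \<theta> \<noteq> 0"
  and pr: "\<And>z. z \<in> D ==> \<sigma> z = z ==> z * w = w * z ==> \<theta> * z = z * \<theta> ==> \<exists>p. z = ev p \<theta>"
  using primitive_element[OF inf ch HsD(1,2)[OF w(1)]] by blast
 note evs = ev_add ev_diff[OF th(1)] ev_mult[OF th(1)] ev_uminus[OF th(1)] ev_one[OF th(1)]
 have dvd: "f dvd p" if "ev p \<theta> = 0" for p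
 proof -
  have f0: "f \<noteq> 0" using f(1) by auto
  have "ev p \<theta> = ev (p div f * f + p mod f) \<theta>" by simp
  then have "ev (p mod f) \<theta> = 0" using f(3) that unfolding evs by simp
  moreover have "degree (p mod f) < degree f" using degree_mod_less[OF f0, of p] f(2) by auto
  ultimately have "p mod f = 0" using f(4) by (auto simp: pind_def)
  then show ?thesis by (simp add: dvd_eq_mod_eq_0)
 qed
 define L where "L = range (\<lambda>p. ev p \<theta>)"
 have L_dinv: "\<exists>q. dinv (ev p \<theta>) = ev q \<theta>" if "ev p \<theta> \<noteq> 0" for p
 proof -
  obtain q where "dinv (ev p \<theta>) = ev q (ev p \<theta>)" using ev_inverse[OF ev_D[OF th(1)] \<open>ev p \<theta> \<noteq> 0\<close>] by blast
  then show ?thesis using ev_pcompose[OF th(1), of q p] by metis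
 qed
 define Z where "Z = {z. poly (mp f) z = 0}"
 have inv: "\<exists>q. \<forall>z\<in>Z. poly (mp p) z * poly (mp q) z = 1" if p: "ev p \<theta> \<noteq> 0" for p
 proof -
  obtain q where q: "dinv (ev p \<theta>) = ev q \<theta>" using L_dinv[OF p] by blast
  have "ev (p * q - 1) \<theta> = 0" using dinv(2)[OF ev_D[OF th(1)] p] q by (simp add: evs)
  then have "f dvd p * q - 1" by (rule dvd)
  then obtain k where k: "p * q - 1 = f * k" by (elim dvdE)
  have "poly (mp p) z * poly (mp q) z = 1" if "z \<in> Z" for z
  proof -
   have "mp (p * q - 1) = mp (f * k)" using k by simp
   then have "poly (mp p * mp q - 1) z = poly (mp f * mp k) z" by (simp add: mp_simps)
   then show ?thesis using that by (simp add: Z_def)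
  qed
  then show ?thesis by blast
 qed
 have mf: "mp f = rootpoly Z" unfolding Z_def
 proof (rule rootpoly_of_separable)
  show "lead_coeff (mp f) = 1" using f(1) by (simp add: mp_simps coeff_map_poly)
  obtain q where q: "\<forall>z\<in>Z. poly (mp (pderiv f)) z * poly (mp q) z = 1" using inv[OF f(5)] by blast
  show "poly (pderiv (mp f)) z \<noteq> 0" if "poly (mp f) z = 0" for z
   using q that by (auto simp: Z_def mp_simps)
 qed
 have "mp f \<noteq> 0" using rootpoly_monic(2) mf by metis
 then have Zf: "finite Z" using poly_roots_finite by (auto simp: Z_def)
 have cZ: "card Z = degree f" using rootpoly_degree[OF Zf] mf by (metis mp_simps(6))
 have zero: "poly (mp p) z = 0" if pz: "ev p \<theta> = 0" "z \<in> Z" for p z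
 proof -
  obtain k where "p = f * k" using dvd[OF pz(1)] by (elim dvdE)
  then show ?thesis using pz(2) by (simp add: mp_simps Z_def)
 qed
 have zero': "ev p \<theta> = 0" if pz: "poly (mp p) z = 0" "z \<in> Z" for p z
 proof (rule ccontr)
  assume "ev p \<theta> \<noteq> 0"
  then obtain q where "\<forall>z\<in>Z. poly (mp p) z * poly (mp q) z = 1" using inv by blast
  then show False using pz by auto
 qed
 interpret E: subfield0 "range to_ac" by (rule subfield0_to_ac)
 have ZE: "rootpoly Z \<in> pE (range to_ac)" unfolding mp_pE mf[symmetric] by blast
 have trE: "to_ac (of_ac (tr Z (mp p))) = tr Z (mp p)" for p
  by (rule to_ac_of_ac, rule E.sum_roots_in[OF Zf ZE]) (simp add: mp_pE)
 \<comment> \<open>The trace of \<open>L\<close> over \<open>F\<close>, read off from the roots in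
   the algebraic closure.\<close>
 define t where "t = (\<lambda>x. \<iota> (of_ac (tr Z (mp (SOME p. ev p \<theta> = x)))))"
 have t: "t (ev p \<theta>) = \<iota> (of_ac (tr Z (mp p)))" for p
 proof -
  define p' where "p' = (SOME p'. ev p' \<theta> = ev p \<theta>)"
  have "ev p' \<theta> = ev p \<theta>" unfolding p'_def by (rule someI[of _ p]) simp
  then have "ev (p' - p) \<theta> = 0" by (simp add: evs)
  then have "poly (mp p') z = poly (mp p) z" if "z \<in> Z" for z using zero[OF _ that, of "p' - p"] by (simp add: mp_simps)
  then have "tr Z (mp p') = tr Z (mp p)" by (simp add: tr_def)
  then show ?thesis by (simp add: t_def p'_def)
 qed
 have tadd: "of_ac (x + y) = of_ac x + of_ac y" if "x \<in> range to_ac" "y \<in> range to_ac" for x y :: "'f alg_closure"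
  using that by (auto simp del: to_ac_add simp: to_ac_add[symmetric])
 have tmul: "of_ac (x * to_ac y) = of_ac x * y" if "x \<in> range to_ac" for x :: "'f alg_closure" and y
  using that by (auto simp del: to_ac_mult simp: to_ac_mult[symmetric])
 have trI: "tr Z (mp p) \<in> range to_ac" for p using trE by (metis rangeI)
 obtain pw where pw: "w = ev pw \<theta>" using pr[OF HsD(1,2)[OF w(1)]] th(3) by blast
 have Lin: "ev p \<theta> \<in> L" for p by (simp add: L_def)
 interpret M: sym_ext_max D e \<sigma> F L t
 proof
  show "x \<in> D" if "x \<in> L" for x using that ev_D[OF th(1)] by (auto simp: L_def)
  show "x \<in> L" if "x \<in> F" for x using that Lin[of "[:_:]"] unfolding i_range ev_const by blast
  show "x + y \<in> L" "x * y \<in> L" "x * y = y * x" if xy: "x \<in> L" "y \<in> L" for x y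
  proof -
   obtain p q where "x = ev p \<theta>" "y = ev q \<theta>" using xy by (auto simp: L_def)
   then show "x + y \<in> L" "x * y \<in> L" "x * y = y * x" using Lin[of "p + q"] Lin[of "p * q"] evs(3)[of q p] by (simp_all only: evs mult.commute[of q p])
  qed
  show "- x \<in> L" "\<sigma> x = x" if xL: "x \<in> L" for x
  proof -
   obtain p where "x = ev p \<theta>" using xL by (auto simp: L_def)
   then show "- x \<in> L" "\<sigma> x = x" using Lin[of "- p"] ev_sym[OF th(1,2)] by (simp_all only: evs)
  qed
  show "dinv x \<in> L" if "x \<in> L" "x \<noteq> 0" for x using that L_dinv by (auto simp: L_def)
  show "t x \<in> F" if "x \<in> L" for x using that t i_F by (auto simp: L_def)
  show "t (x + y) = t x + t y" if xy: "x \<in> L" "y \<in> L" for x y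
  proof -
   obtain p q where pq: "x = ev p \<theta>" "y = ev q \<theta>" using xy by (auto simp: L_def)
   have "t (ev (p + q) \<theta>) = t (ev p \<theta>) + t (ev q \<theta>)"
    unfolding t mp_simps tr_simps tadd[OF trI trI] i_add ..
   then show ?thesis unfolding pq evs(1) .
  qed
  show "t (x * c) = t x * c" if xc: "x \<in> L" "c \<in> F" for x c
  proof -
   obtain p b where pq: "x = ev p \<theta>" "c = \<iota> b" using xc i_range by (auto simp: L_def)
   have "t (ev (p * [:b:]) \<theta>) = t (ev p \<theta>) * \<iota> b"
    unfolding t mp_simps tr_simps tmul[OF trI] i_mult ..
   then show ?thesis unfolding pq evs(3) ev_const .
  qed
  show "\<exists>x\<in>L. t x \<noteq> 0"
  proof
   show "e \<in> L" using Lin[of 1] by (simp only: evs)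
   have "tr Z (mp 1) = to_ac (of_nat (degree f))" by (simp add: tr_def cZ)
   then have "t e = \<iota> (of_nat (degree f))" using t[of 1] by (simp only: evs(5) of_ac_to_ac)
   then show "t e \<noteq> 0" using ch[OF f(2)] i_nz by simp
  qed
  show "z \<in> L" if "z \<in> D" "\<sigma> z = z" "\<And>l. l \<in> L ==> z * l = l * z" for z
  proof -
   have "\<theta> \<in> L" "w \<in> L" using Lin[of "[:0, 1:]"] Lin[of pw] pw by (simp_all only: ev_x[OF th(1)])
   then show ?thesis using pr[OF that(1,2)] that(3) by (auto simp: L_def)
  qed
 qed (fact cen)
 have wL: "w \<in> L" unfolding L_def pw by blast
 have PL: "P - {0} \<subseteq> L - {0}" using P_props(1)[OF P] M.F_L by auto
 \<comment> \<open>A Lagrangian over \<open>L\<close> would extend to one over \<open>D\<close>, so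
   torsion over \<open>L\<close> would contradict the hypothesis on \<open>w\<close>.\<close>
 have "\<not> M.LL.torsion (P - {0}) {#w#}"
 proof
  assume "M.LL.torsion (P - {0}) {#w#}"
  then obtain K where K: "K \<noteq> {#}" "K inside P - {0}" "M.LL.metab (tens K {#w#})" by (auto simp: M.LL.torsion_def)
  have "metab (tens K {#w#})"
   by (rule subring_metab[OF M.L_divinv _ K(3)])
    (use M.L_D K(2) PL HsD[OF w(1)] D_mult in \<open>auto simp: set_tens\<close>)
  then have "torsion (P - {0}) {#w#}" unfolding torsion_def using K by blast
  then show False using w(2) by simp
 qed
 moreover have "M.LL.mclosed (P - {0})" using P_mclosed[OF P] PL by (auto simp: mclosed_def M.LL.mclosed_def)
 moreover have "w \<in> M.LL.Hs" by (rule M.LHs[OF wL HsD(3)[OF w(1)]])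
 ultimately obtain Q0 where Q0: "fordering L Q0" "P - {0} \<subseteq> Q0" using M.LL.plgp[of "P - {0}" "{#w#}"] by auto
 then have PQ: "P \<subseteq> Q0" by (auto simp: fordering_def)
 have eL: "e \<in> L" using Lin[of 1] by (simp only: evs)
 obtain fs where fs: "M.orthb e fs" "M.dg e = M.vals e fs" using M.dg_orth[OF eL e_nz] by auto
 note oD = M.orthbD[OF fs(1) eL]
 have "\<exists>h. fs ! i = ev h \<theta>" if "i < length fs" for i using oD(1)[OF that] by (auto simp: L_def)
 then obtain h where h: "\<And>i. i < length fs ==> fs ! i = ev (h i) \<theta>" by metis
 define hs where "hs = map (\<lambda>i. mp (h i)) [0..<length fs]"
 have tf: "M.tf e (fs ! i) (fs ! j) = \<iota> (of_ac (tr Z (hs ! i * hs ! j)))" if ij: "i < length fs" "j < length fs" for i j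
 proof -
  have "e * ev (h i) \<theta> * ev (h j) \<theta> = ev (h i * h j) \<theta>" using e_left[OF ev_D[OF th(1)]] by (simp add: evs)
  then show ?thesis using t[of "h i * h j"] ij by (simp add: M.tf_def h hs_def mp_simps)
 qed
 have trhs: "to_ac (of_ac (tr Z (hs ! i * hs ! j))) = tr Z (hs ! i * hs ! j)" if "i < length fs" "j < length fs" for i j
  using trE[of "h i * h j"] that by (simp add: hs_def mp_simps)
 have od: "E.odiag Z hs" unfolding E.odiag_def
 proof (intro conjI ballI)
  show "set hs \<subseteq> pE (range to_ac)" unfolding mp_pE by (auto simp: hs_def)
  show "\<forall>i<length hs. \<forall>j<length hs. i \<noteq> j \<longrightarrow> tr Z (hs ! i * hs ! j) = 0"
  proof (intro allI impI)
   fix i j assume ij: "i < length hs" "j < length hs" "i \<noteq> j"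
   then have ij': "i < length fs" "j < length fs" by (auto simp: hs_def)
   have "\<iota> (of_ac (tr Z (hs ! i * hs ! j))) = 0" using tf[OF ij'] oD(2)[OF ij' ij(3)] by simp
   then show "tr Z (hs ! i * hs ! j) = 0" using trhs[OF ij'] i_eq_0 by (metis to_ac_0)
  qed
  show "\<forall>i<length hs. tr Z (hs ! i * hs ! i) \<noteq> 0"
  proof (intro allI impI)
   fix i assume i: "i < length hs"
   then have i': "i < length fs" by (auto simp: hs_def)
   have "\<iota> (of_ac (tr Z (hs ! i * hs ! i))) \<noteq> 0" using tf[OF i' i'] oD(3)[OF i'] by simp
   then show "tr Z (hs ! i * hs ! i) \<noteq> 0" using i_zero by auto
  qed
  fix g :: "'f alg_closure poly" assume "g \<in> pE (range to_ac)"
  then obtain p where p: "g = mp p" unfolding mp_pE by blast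
  have pL: "ev p \<theta> \<in> L" by (auto simp: L_def)
  have "\<exists>c. M.cf e fs i (ev p \<theta>) = \<iota> c" if "i < length fs" for i using oD(6)[OF that pL] i_range by auto
  then obtain c where c: "\<And>i. i < length fs ==> M.cf e fs i (ev p \<theta>) = \<iota> (c i)" by metis
  have "ev p \<theta> = (\<Sum>i<length fs. ev (h i) \<theta> * \<iota> (c i))"
   using oD(5)[OF pL] by (simp add: h c)
  then have "ev (p - (\<Sum>i<length fs. h i * [:c i:])) \<theta> = 0"
   unfolding ev_diff[OF th(1)] ev_sum[OF th(1)] ev_mult[OF th(1)] ev_const by simp
  then have z0: "poly (mp (p - (\<Sum>i<length fs. h i * [:c i:]))) z = 0" if "z \<in> Z" for z by (rule zero[OF _ that])
  have ms: "mp (\<Sum>i<n. h i * [:c i:]) = (\<Sum>i<n. mp (h i) * [:to_ac (c i):])" for n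
   by (induction n) (simp_all only: sum.lessThan_Suc mp_simps, simp_all)
  have "poly g z = (\<Sum>i<length hs. poly (hs ! i) z * to_ac (c i))" if "z \<in> Z" for z
   using z0[OF that] unfolding mp_simps ms p by (simp add: poly_sum hs_def mult.commute)
  then show "\<exists>c. (\<forall>i<length hs. c i \<in> range to_ac) \<and> (\<forall>z\<in>Z. poly g z = (\<Sum>i<length hs. poly (hs ! i) z * c i))"
   by (intro exI[of _ "\<lambda>i. to_ac (c i)"]) auto
 qed
 obtain \<zeta> where zeta: "\<zeta> \<in> Z" using cZ f(2) by (metis card.empty equals0I less_numeral_extra(3))
 \<comment> \<open>A copy of \<open>L\<close>: by \<open>zero\<close> and \<open>zero'\<close> a
   polynomial vanishes at \<theta> exactly if it vanishes at \<zeta>.\<close>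
 define K where "K = range (\<lambda>p. poly (mp p) \<zeta>)"
 obtain m where m: "m \<in> pE (range to_ac)" "lead_coeff m = 1" "poly m \<zeta> = 0" "\<And>p. p \<in> pE (range to_ac) ==> poly p \<zeta> = 0 ==> m dvd p"
  using E.minimal_polynomial[OF ZE rootpoly_monic(2)] rootpoly_poly[OF Zf] zeta by blast
 have Kadj: "K = E.adj \<zeta>" unfolding K_def E.adj_def mp_pE by auto
 have K: "subfield0 K" unfolding Kadj subfield0_def by (rule E.adj_base(2)[OF m])
 have FK: "range to_ac \<subseteq> K" unfolding Kadj by (rule E.adj_simps)
 have zK: "\<zeta> \<in> K" unfolding Kadj by (rule E.adj_simps)
 define QK where "QK = (\<lambda>p. poly (mp p) \<zeta>) ` {p. ev p \<theta> \<in> Q0}"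
 define PK where "PK = to_ac ` {c. \<iota> c \<in> P}"
 have Q0': "fordering (range (\<lambda>p. ev p \<theta>)) Q0" using Q0(1) by (simp add: L_def)
 have QK: "fordering K QK" unfolding K_def QK_def
  by (rule fordering_transport(1)[OF Q0']) (use evs zero[OF _ zeta] zero'[OF _ zeta] in \<open>auto simp: mp_simps\<close>)
 have PK: "fordering (range to_ac) PK" "\<And>c. to_ac c \<in> PK \<longleftrightarrow> \<iota> c \<in> P" unfolding PK_def
  by (rule fordering_transport[OF P' i_add i_uminus i_mult]; simp add: i_eq_0)+
 have PQK: "PK \<subseteq> QK"
 proof
  fix y assume "y \<in> PK"
  then obtain c where c: "y = to_ac c" "\<iota> c \<in> P" by (auto simp: PK_def)
  then have "y = poly (mp [:c:]) \<zeta>" "ev [:c:] \<theta> \<in> Q0" using PQ by (auto simp: mp_simps)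
  then show "y \<in> QK" unfolding QK_def by blast
 qed
 have "(\<Sum>c\<in>#dvals Z hs. sgnP PK c) > 0"
  by (rule trace_signature_pos[OF subfield0_to_ac PK(1) Zf ZE K QK FK PQK zeta zK od])
 also have "(\<Sum>c\<in>#dvals Z hs. sgnP PK c) = M.sg P e"
 proof -
  have "map (\<lambda>f. sgnP P (M.tf e f f)) fs = map (\<lambda>h. sgnP PK (tr Z (h * h))) hs"
  proof (rule nth_equalityI)
   fix i assume "i < length (map (\<lambda>f. sgnP P (M.tf e f f)) fs)"
   then have i: "i < length fs" by simp
   have "tr Z (hs ! i * hs ! i) \<in> PK \<longleftrightarrow> M.tf e (fs ! i) (fs ! i) \<in> P"
    using PK(2)[of "of_ac (tr Z (hs ! i * hs ! i))"] trhs[OF i i] tf[OF i i] by simp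
   then show "map (\<lambda>f. sgnP P (M.tf e f f)) fs ! i = map (\<lambda>h. sgnP PK (tr Z (h * h))) hs ! i"
    using i by (simp add: sgnP_def hs_def)
  qed (simp add: hs_def)
  then show ?thesis unfolding M.sg_def fs(2) M.vals_def dvals_def
   by (simp only: mset_map[symmetric] map_map comp_def sum_mset_sum_list)
 qed
 finally have "M.sg P e \<noteq> 0" by simp
 from M.theta_exists[OF P eL e_nz this] show ?thesis unfolding theta_def[OF P] by blast
qed

end

section \<open>Symmetric primitive idempotents\<close>

locale inv_alg = algebra_with_involution scale \<sigma>
 for scale :: "'f::field \<Rightarrow> 'a::ring_1 \<Rightarrow> 'a" and \<sigma> :: "'a \<Rightarrow> 'a" +
 assumes two_nonzero: "(2 :: 'f) \<noteq> 0"
begin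

lemmas scale_out = scale_mult_left[symmetric] scale_mult_right[symmetric]

lemmas sg_simps = involution_add involution_mult involution_involution

lemma sg_zero [simp]: "\<sigma> 0 = 0" using involution_add[of 0 0] by simp
lemma sg_uminus: "\<sigma> (- x) = - \<sigma> x" using involution_add[of x "- x"] by (simp add: eq_neg_iff_add_eq_0 add.commute)
lemma sg_diff: "\<sigma> (x - y) = \<sigma> x - \<sigma> y" using involution_add[of x "- y"] by (simp add: sg_uminus)
lemma sg_one [simp]: "\<sigma> 1 = 1" using involution_mult[of "\<sigma> 1" 1] by (simp add: involution_involution)

lemma scale_one_central: "scale c 1 * x = x * scale c 1" "\<sigma> (scale c 1) = scale c 1"
proof -
 have "scale c 1 \<in> centre \<inter> Sym \<sigma>" using base_field by blast
 then show "scale c 1 * x = x * scale c 1" "\<sigma> (scale c 1) = scale c 1" by (auto simp: centre_def Sym_def)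
qed

lemma scale_mult: "scale c x = scale c 1 * x" "scale c x = x * scale c 1"
 using scale_mult_left[of c 1 x] scale_one_central(1)[of c x] by auto

lemma sg_scale: "\<sigma> (scale c x) = scale c (\<sigma> x)"
 using scale_mult[of c] by (metis involution_mult scale_one_central(2))

lemma double_nz: "x \<noteq> 0 ==> x + x \<noteq> (0::'a)"
proof
 assume x: "x \<noteq> 0" "x + x = 0"
 have "scale 2 x = scale (1 + 1) x" by simp
 also have "\<dots> = x + x" by (simp only: scale_left_distrib scale_one)
 finally show False using x two_nonzero by simp
qed

lemma half: "scale (inverse 2) (x + x) = x" for x :: 'a
proof -
 have "x + x = scale (1 + 1) x" by (simp only: scale_left_distrib scale_one)
 then show ?thesis using two_nonzero by simp
qed

lemma finite_dim: "\<exists>B. finite_dimensional_vector_space scale B"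
proof -
 obtain B where B: "finite B" "span B = UNIV" using finite_dimensional by blast
 obtain B' where B': "B' \<subseteq> B" "independent B'" "B \<subseteq> span B'" using maximal_independent_subset[of B] by blast
 have "span B' = UNIV" using B(2) B'(3) span_mono[of B "span B'"] by (simp add: span_span top.extremum_unique)
 then have "finite_dimensional_vector_space scale B'"
  by unfold_locales (use B' B finite_subset in auto)
 then show ?thesis by blast
qed

definition right_ideal :: "'a set \<Rightarrow> bool" where
 "right_ideal I \<longleftrightarrow> 0 \<in> I \<and> (\<forall>x\<in>I. \<forall>y\<in>I. x + y \<in> I) \<and> (\<forall>x\<in>I. \<forall>r. x * r \<in> I)"

lemma right_ideal_subspace: "right_ideal I ==> subspace I"
 unfolding subspace_def right_ideal_def using scale_mult(2) by metis

lemma right_ideal_mult: "right_ideal I ==> right_ideal ((*) y ` I)"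
 unfolding right_ideal_def by (auto simp: image_iff distrib_left[symmetric] mult.assoc) (metis mult_zero_right | metis)+

lemma right_ideal_principal: "right_ideal (range ((*) x))"
 unfolding right_ideal_def by (auto simp: mult.assoc distrib_left[symmetric]) (metis mult_zero_right rangeI)

definition min_right_ideal :: "'a set \<Rightarrow> bool" where
 "min_right_ideal I \<longleftrightarrow> right_ideal I \<and> I \<noteq> {0} \<and> (\<forall>J. right_ideal J \<longrightarrow> J \<subseteq> I \<longrightarrow> J = {0} \<or> J = I)"

lemma min_right_idealD: "min_right_ideal I ==> right_ideal J ==> J \<subseteq> I ==> J \<noteq> {0} ==> J = I"
 by (auto simp: min_right_ideal_def)

lemma min_right_ideal_exists: "\<exists>I. min_right_ideal I"
proof -
 obtain B where "finite_dimensional_vector_space scale B" using finite_dim by blast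
 then interpret fv: finite_dimensional_vector_space scale B .
 have "right_ideal (UNIV :: 'a set) \<and> (UNIV :: 'a set) \<noteq> {0}" by (auto simp: right_ideal_def) (metis UNIV_I singletonD zero_neq_one)
 then obtain I where I: "right_ideal I" "I \<noteq> {0}" and least: "\<And>J. right_ideal J \<and> J \<noteq> {0} ==> dim I \<le> dim J"
  using ex_has_least_nat[of "\<lambda>I. right_ideal I \<and> I \<noteq> {0}" UNIV dim] by blast
 have "J = {0} \<or> J = I" if J: "right_ideal J" "J \<subseteq> I" for J
 proof (cases "J = {0}")
  case False
  then have "dim I \<le> dim J" using least J(1) by blast
  then have "J = I" using fv.subspace_dim_equal[OF right_ideal_subspace[OF J(1)] right_ideal_subspace[OF I(1)] J(2)] by simp
  then show ?thesis by simp
 qed simp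
 then show ?thesis using I by (auto simp: min_right_ideal_def)
qed

text \<open>Minimality gives \<open>y I = I\<close>, hence some \<open>p\<close> in \<open>I\<close>
  with \<open>y * p = y\<close>. The elements of \<open>I\<close> annihilated by \<open>y\<close>
  form a proper right ideal, so they are zero, and \<open>p * p - p\<close> is one of them.\<close>

lemma min_right_ideal_left_mult:
 assumes I: "min_right_ideal I" and y: "y \<in> I" "z \<in> I" "y * z \<noteq> 0"
 shows "\<exists>p\<in>I. y * p = y \<and> p * p = p \<and> p \<noteq> 0"
proof -
 have rI: "right_ideal I" using I by (simp add: min_right_ideal_def)
 have sub: "(*) y ` I \<subseteq> I" using rI y(1) by (auto simp: right_ideal_def)
 have "(*) y ` I \<noteq> {0}" using y(2,3) by blast
 then have "(*) y ` I = I" by (rule min_right_idealD[OF I right_ideal_mult[OF rI] sub])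
 then obtain p where p: "p \<in> I" "y * p = y" using y(1) by (metis imageE)
 define K where "K = {r\<in>I. y * r = 0}"
 have rK: "right_ideal K" using rI by (auto simp: right_ideal_def K_def distrib_left mult.assoc[symmetric])
 have "z \<notin> K" using y by (simp add: K_def)
 then have "K \<noteq> I" using y by blast
 then have K0: "K = {0}" using I rK by (auto simp: min_right_ideal_def K_def)
 have pI: "p * p \<in> I" "- p \<in> I" using rI p(1) mult_minus_right[of p 1] unfolding right_ideal_def by (blast, metis mult.right_neutral)
 have "p * p + - p \<in> K" using rI pI p by (auto simp: K_def right_ideal_def right_diff_distrib mult.assoc[symmetric])
 then have "p * p = p" using K0 by simp
 moreover have "p \<noteq> 0" using p(2) y(3) by auto
 ultimately show ?thesis using p by blast
qed

lemma min_right_ideal_idempotent: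
 assumes I: "min_right_ideal I" shows "\<exists>q\<in>I. q * q = q \<and> q \<noteq> 0"
proof -
 have rI: "right_ideal I" using I by (simp add: min_right_ideal_def)
 have "0 \<in> I" using rI by (simp add: right_ideal_def)
 then obtain x where x: "x \<in> I" "x \<noteq> 0" using I by (auto simp: min_right_ideal_def)
 define J where "J = {r. \<forall>y\<in>I. y * r = 0}"
 have "two_sided_ideal J" using rI by (auto simp: two_sided_ideal_def J_def right_ideal_def distrib_left mult.assoc[symmetric])
 then have "J = {0} \<or> J = UNIV" by (rule simple)
 moreover have "1 \<notin> J" using x by (auto simp: J_def)
 ultimately have "x \<notin> J" using x by auto
 then obtain y where "y \<in> I" "y * x \<noteq> 0" by (auto simp: J_def)
 then show ?thesis using min_right_ideal_left_mult[OF I _ x(1)] by blast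
qed

text \<open>For an idempotent \<open>q\<close> of a minimal right ideal,
  \<open>q * \<sigma> q\<close> is a symmetric generator by anisotropy, and the idempotent it
  determines is symmetric. Minimality makes every nonzero element of the corner a generator too,
  which yields right inverses.\<close>

lemma symmetric_idempotent_exists:
 assumes an: "\<And>q. q * q = q ==> q \<noteq> 0 ==> \<sigma> q * q \<noteq> 0"
 shows "\<exists>e. e * e = e \<and> \<sigma> e = e \<and> e \<noteq> 0 \<and> (\<forall>d. e * d = d \<longrightarrow> d * e = d \<longrightarrow> d \<noteq> 0 \<longrightarrow> (\<exists>d'. e * d' = d' \<and> d' * e = d' \<and> d * d' = e))"
proof -
 obtain I where I: "min_right_ideal I" using min_right_ideal_exists by blast
 have rI: "right_ideal I" using I by (simp add: min_right_ideal_def)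
 have gen: "range ((*) x) = I" if x: "x \<in> I" "x \<noteq> 0" for x
 proof -
  have "range ((*) x) \<subseteq> I" using rI x by (auto simp: right_ideal_def)
  moreover have "range ((*) x) \<noteq> {0}" using x by (metis mult.right_neutral rangeI singletonD)
  ultimately show ?thesis by (rule min_right_idealD[OF I right_ideal_principal])
 qed
 obtain q where q: "q \<in> I" "q * q = q" "q \<noteq> 0" using min_right_ideal_idempotent[OF I] by blast
 have sq: "\<sigma> q * \<sigma> q = \<sigma> q" "\<sigma> q \<noteq> 0" using q involution_mult[of q q] involution_involution[of q] by auto
 define x where "x = q * \<sigma> q"
 have x: "x \<in> I" "x \<noteq> 0" "\<sigma> x = x"
  using rI q(1) an[OF sq] by (auto simp: x_def right_ideal_def sg_simps)
 have "x * x \<noteq> 0"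
 proof
  assume xx: "x * x = 0"
  obtain k where "q = x * k" using gen[OF x(1,2)] q(1) by blast
  then have "\<sigma> q * q = \<sigma> k * (x * x) * k" using x(3) by (simp add: sg_simps mult.assoc)
  then show False using xx an[OF q(2,3)] by simp
 qed
 then obtain p where p: "p \<in> I" "x * p = x" "p * p = p" "p \<noteq> 0" using min_right_ideal_left_mult[OF I x(1) x(1)] by blast
 have spx: "\<sigma> p * x = x" using arg_cong[OF p(2), of \<sigma>] x(3) by (simp add: sg_simps)
 obtain k where k: "p = x * k" using gen[OF x(1,2)] p(1) by blast
 \<comment> \<open>\<open>\<sigma> p\<close> fixes \<open>x\<close> on the left, hence everything in
   the right ideal generated by \<open>x\<close>; the left side is symmetric, so \<open>p\<close>
   is.\<close>
 have "\<sigma> p * p = p" using spx by (metis k mult.assoc)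
 then have sp: "\<sigma> p = p" by (metis involution_involution involution_mult)
 have "\<exists>d'. p * d' = d' \<and> d' * p = d' \<and> d * d' = p" if d: "p * d = d" "d * p = d" "d \<noteq> 0" for d
 proof -
  have "d \<in> I" using d(1) p(1) rI by (metis right_ideal_def)
  then obtain k where k: "p = d * k" using gen[OF _ d(3)] p(1) by blast
  have "d * (p * k * p) = p" using d(2) k p(3) by (metis mult.assoc)
  moreover have "p * (p * k * p) = p * k * p" "p * k * p * p = p * k * p" using p(3) by (metis mult.assoc)+
  ultimately show ?thesis by blast
 qed
 then show ?thesis using p sp by blast
qed

end

section \<open>Two-sided ideals and the corner ring of the idempotent\<close>

context inv_alg
begin

text \<open>Membership in the two-sided ideal generated by \<open>u\<close>, as explicit
  sums.\<close>

definition spn :: "'a \<Rightarrow> 'a \<Rightarrow> bool" where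
 "spn u x \<longleftrightarrow> (\<exists>M :: ('a \<times> 'a) multiset. x = (\<Sum>(y, w)\<in>#M. y * u * w))"

lemma spn_all: assumes "u \<noteq> 0" shows "spn u x"
proof -
 define J where "J = {x. spn u x}"
 have "two_sided_ideal J" unfolding two_sided_ideal_def
 proof (intro conjI ballI allI)
  show "0 \<in> J" unfolding J_def spn_def by (auto intro!: exI[of _ "{#}"])
 next
  fix x y assume "x \<in> J" "y \<in> J"
  then obtain M N where "x = (\<Sum>(y, w)\<in>#M. y * u * w)" "y = (\<Sum>(y, w)\<in>#N. y * u * w)" unfolding J_def spn_def by blast
  then show "x + y \<in> J" unfolding J_def spn_def by (auto intro!: exI[of _ "M + N"])
 next
  fix x r assume "x \<in> J"
  then obtain M :: "('a \<times> 'a) multiset" where M: "x = (\<Sum>(y, w)\<in>#M. y * u * w)" unfolding J_def spn_def by blast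
  have "r * x = (\<Sum>(y, w)\<in>#image_mset (\<lambda>(y, w). (r * y, w)) M. y * u * w)"
   unfolding M by (induction M) (auto simp: distrib_left mult.assoc)
  then show "r * x \<in> J" unfolding J_def spn_def by blast
  have "x * r = (\<Sum>(y, w)\<in>#image_mset (\<lambda>(y, w). (y, w * r)) M. y * u * w)"
   unfolding M by (induction M) (auto simp: distrib_right mult.assoc)
  then show "x * r \<in> J" unfolding J_def spn_def by blast
 qed
 then have "J = {0} \<or> J = UNIV" by (rule simple)
 moreover have "u \<in> J" unfolding J_def spn_def by (auto intro!: exI[of _ "{#(1, 1)#}"])
 ultimately show ?thesis using assms by (auto simp: J_def)
qed

lemma sandwich_zero: fixes u v :: 'a assumes "u \<noteq> 0" "\<And>a. v * a * u = 0" shows "v = 0"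
proof -
 obtain M :: "('a \<times> 'a) multiset" where M: "1 = (\<Sum>(y, w)\<in>#M. y * u * w)" using spn_all[OF assms(1)] unfolding spn_def by blast
 have "v * (\<Sum>(y, w)\<in>#M. y * u * w) = 0" by (induction M) (auto simp: distrib_left mult.assoc[symmetric] assms(2))
 then show ?thesis using M by (metis mult.right_neutral)
qed

lemma sg_eq_0: "\<sigma> x = 0 ==> x = 0"
 by (metis involution_involution sg_zero)

lemma sandwich_zero2: fixes u v :: 'a assumes "u \<noteq> 0" "\<And>a b. u * a * v * b * u = 0" shows "v = 0"
proof -
 have "u * a * v = 0" for a by (rule sandwich_zero[OF assms(1)]) (use assms(2) in simp)
 then have "\<sigma> (u * a * v) = 0" for a by simp
 then have "\<sigma> v * \<sigma> a * \<sigma> u = 0" for a by (simp only: sg_simps mult.assoc)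
 from this[of "\<sigma> _", unfolded involution_involution] have "\<And>a. \<sigma> v * a * \<sigma> u = 0" .
 moreover have "\<sigma> u \<noteq> 0" using assms(1) sg_eq_0 by blast
 ultimately have "\<sigma> v = 0" using sandwich_zero[of "\<sigma> u" "\<sigma> v"] by blast
 then show ?thesis by (rule sg_eq_0)
qed

lemma finite_dim_bound: "\<exists>N. \<forall>S. independent S \<longrightarrow> finite S \<and> card S \<le> N"
proof -
 obtain B where B: "finite B" "span B = UNIV" using finite_dimensional by blast
 have "independent S ==> finite S \<and> card S \<le> card B" for S
  by (rule independent_span_bound[OF B(1)]) (use B in auto)
 then show ?thesis by blast
qed

end

locale sym_idem = inv_alg scale \<sigma> for scale :: "'f::field \<Rightarrow> 'a::ring_1 \<Rightarrow> 'a" and \<sigma> :: "'a \<Rightarrow> 'a" +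
 fixes e :: 'a
 assumes ee: "e * e = e" and se: "\<sigma> e = e" and e0: "e \<noteq> 0"
  and e_div: "e * d = d ==> d * e = d ==> d \<noteq> 0 ==> \<exists>d'. e * d' = d' \<and> d' * e = d' \<and> d * d' = e"
begin

definition D :: "'a set" where "D = {x. e * x = x \<and> x * e = x}"

definition emb :: "'f \<Rightarrow> 'a" where "emb c = scale c e"

lemma D_I: "e * x * e \<in> D" unfolding D_def using ee by (metis (mono_tags, lifting) mem_Collect_eq mult.assoc)

lemma emb_mult: "emb c * x = scale c (e * x)" "x * emb c = scale c (x * e)"
 by (simp_all add: emb_def scale_out)

lemma D_base: "divinv_base D e \<sigma> (range emb)"
proof -
 have inv: "\<exists>y\<in>D. x * y = e \<and> y * x = e" if x: "x \<in> D" "x \<noteq> 0" for x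
 proof -
  obtain y where y: "e * y = y" "y * e = y" "x * y = e" using e_div[of x] x by (auto simp: D_def)
  have "y \<noteq> 0" using y e0 by auto
  \<comment> \<open>A right inverse that has a right inverse itself is two-sided.\<close>
  then obtain z where z: "e * z = z" "z * e = z" "y * z = e" using e_div[of y] y by auto
  have "x = x * (y * z)" using x z(3) by (simp add: D_def)
  also have "\<dots> = z" using y(3) z(1) by (simp add: mult.assoc[symmetric])
  finally show ?thesis using y z by (auto simp: D_def)
 qed
 have d: "divring D e"
  by standard (use ee e0 inv in \<open>auto simp: D_def distrib_left distrib_right mult.assoc mult.assoc[symmetric, of e]\<close>)
 interpret divring D e by (rule d)
 have di: "dinv (emb c) = emb (inverse c)" if "c \<noteq> 0" for c
 proof -
  have "emb c \<in> D" "emb (inverse c) \<in> D" using ee emb_mult by (auto simp: D_def emb_def scale_out)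
  moreover have "emb c * emb (inverse c) = e" unfolding emb_mult(1) using that ee by (simp add: emb_def scale_mult_right[symmetric])
  ultimately show ?thesis using dinv_unique by metis
 qed
 show ?thesis
 proof
  show "\<sigma> x \<in> D" if "x \<in> D" for x
  proof -
   have "\<sigma> (e * x) = \<sigma> x" "\<sigma> (x * e) = \<sigma> x" using that by (auto simp: D_def)
   then show ?thesis by (simp add: D_def sg_simps se)
  qed
  show "range emb \<subseteq> D" using ee by (auto simp: D_def emb_def scale_out)
  show "e \<in> range emb" unfolding emb_def by (metis rangeI scale_one)
  show "x + y \<in> range emb" "x * y \<in> range emb" if xy: "x \<in> range emb" "y \<in> range emb" for x y
  proof -
   obtain c d where cd: "x = emb c" "y = emb d" using xy by auto
   have "x + y = emb (c + d)" "x * y = emb (c * d)" unfolding cd emb_mult using ee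
    by (auto simp: emb_def scale_left_distrib scale_mult_right[symmetric])
   then show "x + y \<in> range emb" "x * y \<in> range emb" by auto
  qed
  show "- x \<in> range emb" if "x \<in> range emb" for x using that by (auto simp: emb_def scale_minus_left[symmetric] simp del: scale_minus_left)
  show "dinv x \<in> range emb" if "x \<in> range emb" "x \<noteq> 0" for x using that di by (auto simp: emb_def)
  show "x * y = y * x" if "x \<in> range emb" "y \<in> D" for x y using that emb_mult by (auto simp: D_def)
  show "\<sigma> x = x" if "x \<in> range emb" for x using that by (auto simp: emb_def sg_scale se)
 qed (simp_all add: sg_simps)
qed

sublocale DD: divinv_base D e \<sigma> "range emb" by (rule D_base)

text \<open>Writing \<open>1\<close> as a sum of elements \<open>y * e * w\<close>, the sum of the
  \<open>y * z * w\<close> is a central lift of \<open>z\<close>. Its skew part is central and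
  killed by \<open>e\<close>, hence zero because the centre is a field; so the lift is a scalar of
  the base field.\<close>

lemma D_cen:
 assumes z: "z \<in> D" "\<And>x. x \<in> D ==> z * x = x * z" "\<sigma> z = z" shows "z \<in> range emb"
proof -
 obtain M :: "('a \<times> 'a) multiset" where M: "1 = (\<Sum>(y, w)\<in>#M. y * e * w)" using spn_all[OF e0] unfolding spn_def by blast
 define z' where "z' = (\<Sum>(y, w)\<in>#M. y * z * w)"
 have ze: "z * e = z" "e * z = z" using z by (auto simp: D_def)
 have step: "z * w * a * y * e = e * w * a * y * z" for a y w
 proof -
  have "z * (e * (w * a * y) * e) = e * (w * a * y) * e * z" using z(2)[OF D_I] .
  then show ?thesis using ze by (metis mult.assoc)
 qed
 have l: "(\<Sum>(y, w)\<in>#N. y * z * w) * a = (\<Sum>(y, w)\<in>#N. y * z * w * a)" for N a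
  by (induction N) (auto simp: distrib_right)
 have r: "a * (\<Sum>(y, w)\<in>#N. y * z * w) = (\<Sum>(y, w)\<in>#N. a * y * z * w)" for N a
  by (induction N) (auto simp: distrib_left mult.assoc)
 have key: "y * z * w * a * (\<Sum>(y, w)\<in>#N. y * e * w) = y * e * w * a * (\<Sum>(y, w)\<in>#N. y * z * w)" for y w a N
 proof (induction N)
  case (add p N)
  obtain y' w' where p: "p = (y', w')" by (cases p)
  have "y * z * w * a * (y' * e * w') = y * e * w * a * (y' * z * w')"
   using step[of w a y'] by (metis mult.assoc)
  then show ?case using add by (simp add: p distrib_left)
 qed simp
 have comm: "z' * a = a * z'" for a
 proof -
  have "(\<Sum>(y, w)\<in>#N. y * z * w) * a = (\<Sum>(y, w)\<in>#N. y * e * w) * a * z'" for N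
  proof (induction N)
   case (add p N)
   obtain y w where p: "p = (y, w)" by (cases p)
   have "y * z * w * a = y * e * w * a * z'" using key[of y w a M] M by (simp add: z'_def)
   then show ?case using add by (simp add: p distrib_right)
  qed simp
  from this[of M] show ?thesis using M by (simp add: z'_def)
 qed
 have ez: "e * z' * e = z"
 proof -
  have "e * (\<Sum>(y, w)\<in>#N. y * z * w) * e = z * (e * (\<Sum>(y, w)\<in>#N. y * e * w) * e)" for N
  proof (induction N)
   case (add p N)
   obtain y w where p: "p = (y, w)" by (cases p)
   have "e * y * e * z = z * (e * y * e)" using z(2)[OF D_I[of y]] by simp
   then have "e * (y * z * w) * e = z * (e * (y * e * w) * e)" using ze by (metis mult.assoc)
   then show ?case using add by (simp add: p distrib_left distrib_right)
  qed simp
  from this[of M] show ?thesis using M ze ee by (simp add: z'_def mult.assoc)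
 qed
 have c: "z' \<in> centre" using comm by (simp add: centre_def)
 have cs: "\<sigma> z' * a = a * \<sigma> z'" for a using comm[of "\<sigma> a"] by (metis involution_involution involution_mult)
 define y where "y = z' - \<sigma> z'"
 have yc: "y \<in> centre" using comm cs by (simp add: y_def centre_def left_diff_distrib right_diff_distrib)
 have "\<sigma> (e * z' * e) = e * \<sigma> z' * e" by (simp add: sg_simps se mult.assoc)
 then have eye: "e * y * e = 0" using ez z(3) by (simp add: y_def left_diff_distrib right_diff_distrib)
 have "y = 0"
 proof (rule ccontr)
  assume "y \<noteq> 0"
  then obtain w where w: "w \<in> centre" "y * w = 1" using centre_field yc by blast
  have "e * y * e = y * e" using yc ee unfolding centre_def by (metis (mono_tags, lifting) mem_Collect_eq mult.assoc)
  then have "w * (y * e) = 0" using eye by simp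
  moreover have "w * y = 1" using w by (simp add: centre_def)
  ultimately show False using e0 by (metis mult.assoc mult.left_neutral)
 qed
 then have "z' \<in> centre \<inter> Sym \<sigma>" using c by (simp add: y_def Sym_def)
 then obtain k where "z' = scale k 1" using base_field by blast
 then have "z = emb k" using ez ee by (simp add: emb_def scale_out)
 then show ?thesis by blast
qed

lemma Findep_independent:
 assumes "DD.Findep xs" "set xs \<subseteq> D" shows "distinct xs \<and> independent (set xs)"
proof -
 have mult: "xs ! i * emb c = scale c (xs ! i)" if "i < length xs" for i c
 proof -
  have "xs ! i * e = xs ! i" using assms(2) nth_mem[OF that] by (auto simp: D_def)
  then show ?thesis by (simp add: emb_mult)
 qed
 have fi: "c i = 0" if c: "(\<Sum>i<length xs. scale (c i) (xs ! i)) = 0" "i < length xs" for c i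
 proof -
  have "(\<Sum>i<length xs. xs ! i * emb (c i)) = 0" using c(1) mult by simp
  then have "\<forall>i<length xs. emb (c i) = 0"
   by (intro assms(1)[unfolded DD.Findep_def, THEN spec[of _ "\<lambda>i. emb (c i)"], THEN HOL.mp, THEN HOL.mp]) auto
  then have "emb (c i) = 0" using c(2) by simp
  then show ?thesis using e0 by (simp add: emb_def)
 qed
 have d: "distinct xs" unfolding distinct_conv_nth
 proof (intro allI impI notI)
  fix i j assume ij: "i < length xs" "j < length xs" "i \<noteq> j" "xs ! i = xs ! j"
  define c where "c = (\<lambda>k. if k = i then 1 else if k = j then - 1 else (0::'f))"
  have "(\<Sum>k<length xs. scale (c k) (xs ! k)) = (\<Sum>k\<in>{i, j}. scale (c k) (xs ! k))"
   by (rule sum.mono_neutral_right) (use ij in \<open>auto simp: c_def\<close>)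
  also have "\<dots> = 0" using ij by (simp add: c_def)
  finally have "c i = 0" using fi ij(1) by blast
  then show False by (simp add: c_def)
 qed
 have "independent (set xs)"
 proof
  assume "dependent (set xs)"
  then obtain u v where u: "v \<in> set xs" "u v \<noteq> 0" "(\<Sum>v\<in>set xs. scale (u v) v) = 0"
   using dependent_finite[of "set xs"] by auto
  have "(\<Sum>i<length xs. scale (u (xs ! i)) (xs ! i)) = (\<Sum>v\<in>set xs. scale (u v) v)"
   by (rule sum.reindex_bij_betw[OF bij_betw_nth[OF d refl refl]])
  then have "\<And>i. i < length xs ==> u (xs ! i) = 0" using fi[of "\<lambda>i. u (xs ! i)"] u(3) by simp
  then show False using u(1,2) by (metis in_set_conv_nth)
 qed
 then show ?thesis using d by simp
qed

sublocale DD: fd_alg D e \<sigma> "range emb" emb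
proof
 obtain N where N: "\<And>S. independent S ==> finite S \<and> card S \<le> N" using finite_dim_bound by blast
 have "length xs \<le> N" if "set xs \<subseteq> D" "DD.Findep xs" for xs
  using Findep_independent[OF that(2,1)] N[of "set xs"] distinct_card[of xs] by metis
 then show "\<exists>N. \<forall>xs. set xs \<subseteq> D \<longrightarrow> DD.Findep xs \<longrightarrow> length xs \<le> N" by blast
 show "e + e \<noteq> 0" by (rule double_nz[OF e0])
 show "emb (a + b) = emb a + emb b" "emb 1 = e" for a b by (auto simp: emb_def scale_left_distrib)
 show "emb (a * b) = emb a * emb b" for a b unfolding emb_mult using ee by (simp add: emb_def scale_mult_right[symmetric])
 show "z \<in> range emb" if "z \<in> D" "\<And>x. x \<in> D ==> z * x = x * z" "\<sigma> z = z" for z using D_cen that by blast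
qed simp

end

section \<open>The cone of sums of hermitian squares\<close>

lemma mset_closed:
 assumes "\<And>m. m \<in># M ==> m \<in> C" "0 \<in> C" "\<And>x y. x \<in> C ==> y \<in> C ==> x + y \<in> C" shows "sum_mset M \<in> C"
 using assms(1) by (induction M) (auto simp: assms(2,3))

context inv_alg
begin

text \<open>The case \<open>w = 1\<close> is the set of sums of hermitian squares. Other
  \<open>w\<close> are needed for the unscaled involution, and for building positive cones from
  elements of \<open>D\<close>.\<close>

definition cone :: "'f set \<Rightarrow> 'a \<Rightarrow> 'a set" where
 "cone S w = {sum_mset M | M. M inside {scale c (\<sigma> x * w * x) | c x. c \<in> S}}"

lemma cone_gen: "c \<in> S ==> scale c (\<sigma> x * w * x) \<in> cone S w"
 unfolding cone_def by (rule CollectI, rule exI[of _ "{#scale c (\<sigma> x * w * x)#}"]) auto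

lemma cone_zero: "0 \<in> cone S w" unfolding cone_def by (rule CollectI, rule exI[of _ "{#}"]) auto

lemma cone_add: "u \<in> cone S w ==> v \<in> cone S w ==> u + v \<in> cone S w"
proof -
 assume "u \<in> cone S w" "v \<in> cone S w"
 then obtain M N where "u = sum_mset M" "v = sum_mset N" "M inside {scale c (\<sigma> x * w * x) | c x. c \<in> S}"
  "N inside {scale c (\<sigma> x * w * x) | c x. c \<in> S}" unfolding cone_def by blast
 then have "u + v = sum_mset (M + N) \<and> (M + N) inside {scale c (\<sigma> x * w * x) | c x. c \<in> S}" by simp
 then show "u + v \<in> cone S w" unfolding cone_def by blast
qed

lemma cone_induct [consumes 1, case_names zero add]:
 assumes "u \<in> cone S w" "Q 0" "\<And>c x v. c \<in> S ==> v \<in> cone S w ==> Q v ==> Q (scale c (\<sigma> x * w * x) + v)"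
 shows "Q u"
proof -
 obtain M where M: "u = sum_mset M" "M inside {scale c (\<sigma> x * w * x) | c x. c \<in> S}" using assms(1) unfolding cone_def by blast
 have "Q (sum_mset M)" using M(2)
 proof (induction M)
  case (add m M)
  then obtain c x where m: "m = scale c (\<sigma> x * w * x)" "c \<in> S" by auto
  have "sum_mset M \<in> cone S w" unfolding cone_def using add.prems by auto
  then show ?case using assms(3)[OF m(2)] add m(1) by simp
 qed (simp add: assms(2))
 then show ?thesis using M(1) by simp
qed

lemma cone_scale: assumes "u \<in> cone S w" "c \<in> S" "\<And>a b. a \<in> S ==> b \<in> S ==> a * b \<in> S" shows "scale c u \<in> cone S w"
 using assms(1)
proof (induction rule: cone_induct)
 case (add b x v)
 then show ?case using cone_add[OF cone_gen[OF assms(3)[OF assms(2) add(1)]] add(3)] by (simp add: scale_right_distrib)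
qed (simp add: cone_zero)

lemma cone_conj: assumes "u \<in> cone S w" shows "\<sigma> y * u * y \<in> cone S w"
 using assms
proof (induction rule: cone_induct)
 case (add b x v)
 have "\<sigma> y * scale b (\<sigma> x * w * x) * y = scale b (\<sigma> (x * y) * w * (x * y))"
  by (simp add: sg_simps scale_out mult.assoc)
 then show ?case using cone_add[OF cone_gen[OF add(1), of "x * y" w] add(3)] by (simp add: distrib_left distrib_right)
qed (simp add: cone_zero)

lemma cone_Sym: assumes "u \<in> cone S w" "\<sigma> w = w" shows "\<sigma> u = u"
 using assms(1)
proof (induction rule: cone_induct)
 case (add b x v)
 then show ?case by (simp add: sg_simps sg_scale assms(2) mult.assoc)
qed simp

lemma cone_in:
 assumes "u \<in> cone S w" "w \<in> C" "0 \<in> C" "\<And>x y. x \<in> C ==> y \<in> C ==> x + y \<in> C"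
  "\<And>x y. x \<in> C ==> \<sigma> y * x * y \<in> C" "\<And>c x. c \<in> S ==> x \<in> C ==> scale c x \<in> C"
 shows "u \<in> C"
 using assms(1) by (induction rule: cone_induct) (use assms in auto)

text \<open>\<open>I0\<close> is an additive group stable under \<open>\<sigma> y * v * y\<close>.
  The \<open>x\<close> all of whose multiples have their symmetrisation
  \<open>y * x * z + \<sigma> (y * x * z)\<close> in \<open>I0\<close> form a two-sided ideal, which
  contains \<open>u\<close> by polarisation and therefore contains \<open>1\<close>.\<close>

lemma cone_improper:
 assumes S: "\<And>a b. a \<in> S ==> b \<in> S ==> a * b \<in> S" "\<And>q. q \<noteq> 0 ==> q * q \<in> S"
  and u: "u \<in> cone S w" "- u \<in> cone S w" "u \<noteq> 0" and w: "\<sigma> w = w"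
 shows "Sym \<sigma> \<subseteq> cone S w"
proof
 fix s assume s: "s \<in> Sym \<sigma>"
 define I0 where "I0 = {v. v \<in> cone S w \<and> - v \<in> cone S w}"
 have add: "v + v' \<in> I0" if "v \<in> I0" "v' \<in> I0" for v v' using that cone_add[of "- v" S w "- v'"] by (auto simp: I0_def cone_add)
 have neg: "- v \<in> I0" if "v \<in> I0" for v using that by (simp add: I0_def)
 have conj: "\<sigma> y * v * y \<in> I0" if "v \<in> I0" for v y
  using that cone_conj[of v S w y] cone_conj[of "- v" S w y] by (simp add: I0_def)
 define J where "J = {x. \<forall>y z. y * x * z + \<sigma> (y * x * z) \<in> I0}"
 have "two_sided_ideal J" unfolding two_sided_ideal_def
 proof (intro conjI ballI allI)
  show "0 \<in> J" by (simp add: J_def I0_def cone_zero)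
 next
  fix x x' assume x: "x \<in> J" "x' \<in> J"
  have "y * (x + x') * z + \<sigma> (y * (x + x') * z) \<in> I0" for y z
  proof -
   have "y * (x + x') * z + \<sigma> (y * (x + x') * z) = (y * x * z + \<sigma> (y * x * z)) + (y * x' * z + \<sigma> (y * x' * z))"
    by (simp add: distrib_left distrib_right sg_simps)
   then show ?thesis using x add by (simp add: J_def)
  qed
  then show "x + x' \<in> J" by (simp add: J_def)
 next
  fix x r assume x: "x \<in> J"
  have "y * (r * x) * z + \<sigma> (y * (r * x) * z) \<in> I0" for y z
   using x[unfolded J_def, simplified, rule_format, of "y * r" z] by (simp add: mult.assoc)
  then show "r * x \<in> J" by (simp add: J_def)
  have "y * (x * r) * z + \<sigma> (y * (x * r) * z) \<in> I0" for y z
   using x[unfolded J_def, simplified, rule_format, of y "r * z"] by (simp add: mult.assoc)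
  then show "x * r \<in> J" by (simp add: J_def)
 qed
 then have "J = {0} \<or> J = UNIV" by (rule simple)
 moreover have "u \<in> J"
 proof -
  have uI: "u \<in> I0" using u by (simp add: I0_def)
  have su: "\<sigma> u = u" by (rule cone_Sym[OF u(1) w])
  have "y * u * z + \<sigma> (y * u * z) \<in> I0" for y z
  proof -
   have "y * u * z + \<sigma> (y * u * z) = \<sigma> (\<sigma> y + z) * u * (\<sigma> y + z) + (- (\<sigma> (\<sigma> y) * u * \<sigma> y) + - (\<sigma> z * u * z))"
    by (simp add: sg_simps su distrib_left distrib_right mult.assoc)
   then show ?thesis using add neg conj[OF uI] by metis
  qed
  then show ?thesis by (simp add: J_def)
 qed
 ultimately have "1 \<in> J" using u(3) by auto
 then have "\<forall>y z. y * 1 * z + \<sigma> (y * 1 * z) \<in> I0" unfolding J_def by blast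
 then have "s * 1 * 1 + \<sigma> (s * 1 * 1) \<in> I0" by blast
 then have "s + s \<in> cone S w" using s by (simp add: I0_def Sym_def)
 \<comment> \<open>Four is a square, so division by it stays in the cone, whereas division by two
   need not.\<close>
 then have "(s + s) + (s + s) \<in> cone S w" by (rule cone_add) fact
 moreover have "inverse (2::'f) \<noteq> 0" using two_nonzero by simp
 then have "inverse (2::'f) * inverse 2 \<in> S" by (rule S(2))
 ultimately have "scale (inverse 2 * inverse 2) ((s + s) + (s + s)) \<in> cone S w"
  by (rule cone_scale) (rule S(1))
 then show "s \<in> cone S w" by (simp only: scale_scale[symmetric] half)
qed

text \<open>If \<open>\<sigma> q q = 0\<close> then \<open>q\<close> and \<open>y\<close> below span a hyperbolic plane, on which the hermitian squares are unrestricted.\<close>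

lemma anisotropic_idempotent:
 assumes S: "1 \<in> S" and proper: "\<And>u. u \<in> cone S 1 ==> - u \<in> cone S 1 ==> u = 0"
  and q: "q * q = q" "q \<noteq> 0"
 shows "\<sigma> q * q \<noteq> 0"
proof
 assume z: "\<sigma> q * q = 0"
 define h where "h = inverse (2::'f)"
 define y where "y = \<sigma> q - scale h (q * \<sigma> q)"
 have hh: "scale h x + scale h x = x" for x
  using half[of x] by (simp add: h_def scale_right_distrib)
 have sq: "\<sigma> q * \<sigma> q = \<sigma> q" using q(1) by (metis involution_mult)
 have sy: "\<sigma> y = q - scale h (q * \<sigma> q)" by (simp add: y_def sg_diff sg_scale sg_simps)
 have yy: "\<sigma> y * y = 0"
 proof -
  have "(q * \<sigma> q) * (q * \<sigma> q) = q * (\<sigma> q * q) * \<sigma> q" by (simp add: mult.assoc)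
  then have 1: "(q * \<sigma> q) * (q * \<sigma> q) = 0" using z by simp
  have 2: "q * (q * \<sigma> q) = q * \<sigma> q" "q * \<sigma> q * \<sigma> q = q * \<sigma> q" using q(1) sq by (metis mult.assoc)+
  have "\<sigma> y * y = q * \<sigma> q - (scale h (q * \<sigma> q) + scale h (q * \<sigma> q))"
   by (subst sy) (simp add: y_def left_diff_distrib right_diff_distrib scale_out 1 2)
  then show ?thesis unfolding hh by simp
 qed
 have qy: "\<sigma> q * y = \<sigma> q" using sq z
  by (simp add: y_def right_diff_distrib scale_mult_right[symmetric] mult.assoc[symmetric])
 have syq: "\<sigma> y * q = q" using arg_cong[OF qy, of \<sigma>] by (simp add: sg_simps)
 \<comment> \<open>Every element \<open>q * r + \<sigma> (q * r)\<close> is a hermitian square.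
   Replacing \<open>r\<close> by \<open>- r\<close> gives its negative as well, so by properness all
   of them vanish.\<close>
 have h: "\<sigma> r * \<sigma> q + q * r \<in> cone S 1" for r
 proof -
  have "\<sigma> (q * r + y) * 1 * (q * r + y) = \<sigma> r * (\<sigma> q * q) * r + \<sigma> r * (\<sigma> q * y) + \<sigma> y * q * r + \<sigma> y * y"
   by (simp add: sg_simps distrib_left distrib_right mult.assoc)
  also have "\<dots> = \<sigma> r * \<sigma> q + q * r" by (simp add: z yy qy syq)
  finally show ?thesis using cone_gen[OF S, of "q * r + y" 1] by simp
 qed
 have r: "\<sigma> r * \<sigma> q + q * r = 0" for r
  by (rule proper[OF h]) (use h[of "- r"] in \<open>simp add: sg_uminus\<close>)
 have "\<sigma> q = - q" using r[of 1] by (simp add: eq_neg_iff_add_eq_0)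
 then have "q * q = 0" using z by simp
 then show False using q by simp
qed

text \<open>A scalar outside \<open>P\<close> has its negative in \<open>P\<close>. If it also
  preserved membership in \<open>C\<close> for a nonzero \<open>p\<close> of \<open>Q\<close>, then
  \<open>C\<close> would contain opposite nonzero elements.\<close>

lemma cone_ordering_mono:
 assumes Q: "prepositive_cone scale \<sigma> Q" and C: "Q \<subseteq> C" "field_ordering P" "P \<inter> uminus ` P = {0}"
  "\<And>c p. c \<in> P ==> p \<in> C ==> scale c p \<in> C" "C \<inter> uminus ` C = {0}"
 shows "cone_ordering scale Q \<subseteq> P" "\<And>c. (\<And>p. p \<in> C ==> scale c p \<in> C) ==> c \<in> P"
proof -
 have fo: "field_ordering (cone_ordering scale Q)" using Q by (simp add: prepositive_cone_def)
 obtain p where p: "p \<in> Q" "p \<noteq> 0"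
 proof (rule ccontr)
  assume "\<not> thesis"
  then have "\<forall>p\<in>Q. p = 0" using that by blast
  moreover have "0 \<in> Q" using Q by (auto simp: prepositive_cone_def)
  ultimately have "cone_ordering scale Q = UNIV" by (auto simp: cone_ordering_def)
  then have "UNIV \<inter> uminus ` (UNIV::'f set) = {0}" using fo by (simp add: field_ordering_def)
  then have "(1::'f) \<in> {0}" by (metis IntI UNIV_I minus_minus rangeI)
  then show False by simp
 qed
 have key: "c \<in> P" if c: "scale c p \<in> C" for c
 proof (rule ccontr)
  assume n: "c \<notin> P"
  then have "- c \<in> P" using C(2) unfolding field_ordering_def by (metis UNIV_I UnE image_iff minus_minus)
  then have "- scale c p \<in> C" using C(4)[of "- c" p] p(1) C(1) by auto
  then have "scale c p \<in> C \<inter> uminus ` C" using c by (metis IntI image_eqI minus_minus)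
  then have "c = 0" using C(5) p(2) by simp
  then show False using n C(3) by blast
 qed
 show "cone_ordering scale Q \<subseteq> P" using key p(1) C(1) by (auto simp: cone_ordering_def)
 show "\<And>c. (\<And>p. p \<in> C ==> scale c p \<in> C) ==> c \<in> P" using key p(1) C(1) by blast
qed

lemma field_ordering_eq: assumes "field_ordering P" "field_ordering Q" "P \<subseteq> Q" shows "P = Q"
proof
 show "Q \<subseteq> P"
 proof
  fix x assume x: "x \<in> Q"
  show "x \<in> P"
  proof (rule ccontr)
   assume n: "x \<notin> P"
   then have "- x \<in> P" using assms(1) unfolding field_ordering_def by (metis UNIV_I UnE image_iff minus_minus)
   then have "x \<in> Q \<inter> uminus ` Q" using assms(3) x by (metis IntI image_eqI minus_minus subsetD)
   moreover have "Q \<inter> uminus ` Q = {0}" using assms(2) by (simp only: field_ordering_def)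
   ultimately have "x = 0" by blast
   then show False using n assms(1) by (auto simp: field_ordering_def)
  qed
 qed
qed fact

text \<open>Enlarging a prepositive cone does not change its ordering, because orderings comparable
  by inclusion are equal. Hence the union of a chain still has a field ordering attached to it, and
  Zorn's lemma applies.\<close>

lemma positive_cone_extends:
 assumes Q: "prepositive_cone scale \<sigma> Q"
 shows "\<exists>\<P>\<in>positive_cones scale \<sigma>. Q \<subseteq> \<P> \<and> cone_ordering scale \<P> = cone_ordering scale Q"
proof -
 have ord: "cone_ordering scale R = cone_ordering scale R'" if R: "prepositive_cone scale \<sigma> R" "prepositive_cone scale \<sigma> R'" "R \<subseteq> R'" for R R'
 proof -
  have f: "field_ordering (cone_ordering scale R)" "field_ordering (cone_ordering scale R')" using R by (auto simp: prepositive_cone_def)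
  have "cone_ordering scale R \<subseteq> cone_ordering scale R'"
   by (rule cone_ordering_mono(1)[OF R(1,3) f(2)]) (use R f in \<open>auto simp: prepositive_cone_def field_ordering_def cone_ordering_def\<close>)
  then show ?thesis by (rule field_ordering_eq[OF f])
 qed
 define A where "A = {R. prepositive_cone scale \<sigma> R \<and> Q \<subseteq> R}"
 have "\<exists>M\<in>A. \<forall>R\<in>A. M \<subseteq> R \<longrightarrow> R = M"
 proof (rule subset_Zorn_nonempty)
  show "A \<noteq> {}" using Q by (auto simp: A_def)
  fix Ch assume Ch: "Ch \<noteq> {}" "subset.chain A Ch"
  have CA: "\<And>R. R \<in> Ch ==> prepositive_cone scale \<sigma> R \<and> Q \<subseteq> R" using Ch(2) by (auto simp: subset.chain_def A_def)
  have CC: "\<And>R R'. R \<in> Ch ==> R' \<in> Ch ==> R \<subseteq> R' \<or> R' \<subseteq> R" using Ch(2) by (auto simp: subset.chain_def)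
  obtain R0 where R0: "R0 \<in> Ch" using Ch(1) by blast
  define U where "U = \<Union>Ch"
  define P where "P = cone_ordering scale Q"
  have fP: "field_ordering P" using Q by (simp add: prepositive_cone_def P_def)
  have oP: "cone_ordering scale R = P" if "R \<in> Ch" for R 
   unfolding P_def by (rule ord[OF Q, symmetric]) (use CA[OF that] in auto)
  have two: "\<exists>R\<in>Ch. x \<in> R \<and> y \<in> R" if xy: "x \<in> U" "y \<in> U" for x y
  proof -
   obtain R R' where R: "R \<in> Ch" "x \<in> R" "R' \<in> Ch" "y \<in> R'" using xy unfolding U_def by blast
   show ?thesis using CC[OF R(1,3)] R by (elim disjE) blast+
  qed
  have PU: "scale c p \<in> U" if cp: "c \<in> P" "p \<in> U" for c p
  proof -
   obtain R where R: "R \<in> Ch" "p \<in> R" using cp by (auto simp: U_def)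
   then show ?thesis using oP[OF R(1)] cp(1) by (auto simp: cone_ordering_def U_def)
  qed
  have proper: "U \<inter> uminus ` U = {0}"
  proof (intro equalityI subsetI)
   fix x assume "x \<in> U \<inter> uminus ` U"
   then have "x \<in> U" "- x \<in> U" by auto
   then obtain R where "R \<in> Ch" "x \<in> R" "- x \<in> R" using two by blast
   then have "x \<in> R \<inter> uminus ` R" by (metis IntI image_eqI minus_minus)
   moreover have "R \<inter> uminus ` R = {0}" using CA[OF \<open>R \<in> Ch\<close>] by (simp only: prepositive_cone_def)
   ultimately show "x \<in> {0}" by blast
  next
   fix x :: 'a assume "x \<in> {0}"
   moreover have "0 \<in> R0" using CA[OF R0] by (auto simp: prepositive_cone_def)
   ultimately show "x \<in> U \<inter> uminus ` U" using R0 by (auto simp: U_def image_iff)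
  qed
  have QU: "Q \<subseteq> U" using CA[OF R0] R0 by (auto simp: U_def)
  have "cone_ordering scale U = P"
  proof
   show "P \<subseteq> cone_ordering scale U" using PU by (auto simp: cone_ordering_def)
   show "cone_ordering scale U \<subseteq> P"
    using cone_ordering_mono(2)[OF Q QU fP _ PU proper] fP by (auto simp: cone_ordering_def field_ordering_def)
  qed
  moreover have "U \<subseteq> Sym \<sigma>" "\<And>p a. p \<in> U ==> \<sigma> a * p * a \<in> U" using CA by (auto simp: U_def prepositive_cone_def) blast+
  moreover have "U \<noteq> {}" using proper by auto
  moreover have "p + q \<in> U" if pq: "p \<in> U" "q \<in> U" for p q
  proof -
   obtain R where "R \<in> Ch" "p \<in> R" "q \<in> R" using two[OF pq] by blast
   moreover from this have "p + q \<in> R" using CA[of R] unfolding prepositive_cone_def by blast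
   ultimately show ?thesis unfolding U_def by blast
  qed
  ultimately have "prepositive_cone scale \<sigma> U" using proper fP by (simp add: prepositive_cone_def)
  then show "\<Union>Ch \<in> A" using QU by (simp add: A_def U_def)
 qed
 then obtain M where M: "M \<in> A" "\<And>R. R \<in> A ==> M \<subseteq> R ==> R = M" by blast
 have "M \<in> positive_cones scale \<sigma>" using M by (auto simp: positive_cones_def A_def)
 then show ?thesis using M(1) ord[OF Q, of M] unfolding A_def by (intro bexI[of _ M]) (auto)
qed

end

section \<open>From the division ring back to the algebra\<close>

context sym_idem
begin

lemma emb_conj: "y \<in> D ==> x * emb c * y = scale c (x * y)"
 by (simp add: D_def emb_def mult.assoc scale_out)

text \<open>By properness a vector of the Lagrangian that vanishes on the block \<open>I2\<close> of
  the entries coming from \<open>- d\<close> is zero. Counting dimensions, some vector is supported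
  on that block at a single index \<open>j0\<close>, and its isotropy writes a multiple of
  \<open>d\<close> as a sum of hermitian squares with coefficients in \<open>S\<close>.\<close>

lemma torsion_in_cone:
 assumes S: "\<And>a b. a \<in> S ==> b \<in> S ==> a * b \<in> S" "\<And>q. q \<noteq> 0 ==> q * q \<in> S" "0 \<notin> S"
  and proper: "\<And>u. u \<in> cone S 1 ==> - u \<in> cone S 1 ==> u = 0"
  and d: "d \<in> DD.Hs" and t: "DD.torsion (emb ` S) {#e, - d#}"
 shows "d \<in> cone S 1"
proof -
 obtain K where K: "K \<noteq> {#}" "K inside emb ` S" "DD.metab (tens K {#e, - d#})"
  using t by (auto simp: DD.torsion_def)
 have eD: "e \<in> D" by (rule DD.e_in)
 have dD: "d \<in> D" "\<sigma> d = d" "d \<noteq> 0" using DD.HsD[OF d] by auto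
 have KD: "k \<in> D" if "k \<in># K" for k using K(2) that DD.F_D by auto
 have tK: "tens N {#e, - d#} = image_mset (\<lambda>k. k * e) N + image_mset (\<lambda>k. k * - d) N" for N
  by (induction N) auto
 obtain I :: "nat set" and dd U where I: "tens K {#e, - d#} = image_mset dd (mset_set I)" "DD.lagr I dd U"
  using K(3) by (auto simp: DD.metab_def)
 have fI: "finite I" and rU: "DD.rsub U" and supp: "\<And>u i. u \<in> U ==> i \<notin> I ==> u i = 0"
  and iso: "\<And>u. u \<in> U ==> DD.hf I dd u u = 0" using I(2) by (auto simp: DD.lagr_def)
 obtain n where n: "card I = 2 * n" "dimge n U" using I(2) by (auto simp: DD.lagr_def)
 have szI: "card I = 2 * size K" using arg_cong[OF I(1), of size] by simp
 obtain A B where AB: "mset_set I = A + B" "image_mset (\<lambda>k. k * e) K = image_mset dd A" "image_mset (\<lambda>k. k * - d) K = image_mset dd B"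
  using image_mset_eq_plusD[of dd "mset_set I"] I(1) unfolding tK by metis
 define I2 where "I2 = set_mset B"
 define I1 where "I1 = set_mset A"
 have I12: "I = I1 \<union> I2" using arg_cong[OF AB(1), of set_mset] fI by (simp add: I1_def I2_def)
 have cnt: "count A i + count B i \<le> 1" for i using arg_cong[OF AB(1), of "\<lambda>M. count M i"] by (simp add: count_mset_set' split: if_splits)
 have disj: "I1 \<inter> I2 = {}"
 proof (rule ccontr)
  assume "I1 \<inter> I2 \<noteq> {}"
  then obtain i where "i \<in># A" "i \<in># B" by (auto simp: I1_def I2_def)
  then have "0 < count A i" "0 < count B i" by simp_all
  then show False using cnt[of i] by linarith
 qed
 have "B = mset_set I2"
 proof (rule multiset_eqI)
  fix i
  have "count B i = 1" if "i \<in># B"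
  proof -
   have "0 < count B i" using that by simp
   then show ?thesis using cnt[of i] by linarith
  qed
  then have "count B i = (if i \<in># B then 1 else 0)" by (auto simp: not_in_iff)
  then show "count B i = count (mset_set I2) i" by (simp add: I2_def count_mset_set')
 qed
 then have cI2: "card I2 = n" using arg_cong[OF AB(3), of size] szI n(1) by simp
 have fin: "finite I1" "finite I2" by (auto simp: I1_def I2_def)
 have d1: "\<exists>s\<in>S. dd i = emb s" if "i \<in> I1" for i
 proof -
  have "dd i \<in># image_mset dd A" using that by (simp add: I1_def)
  then obtain k where "k \<in># K" "dd i = k * e" unfolding AB(2)[symmetric] by auto
  then show ?thesis using K(2) KD DD.e_right by auto
 qed
 have d2: "\<exists>s\<in>S. dd i = emb s * - d" if "i \<in> I2" for i
 proof -
  have "dd i \<in># image_mset dd B" using that by (simp add: I2_def)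
  then obtain k where "k \<in># K" "dd i = k * - d" unfolding AB(3)[symmetric] by auto
  then show ?thesis using K(2) by auto
 qed
 have hfe: "DD.hf I dd u u = (\<Sum>i\<in>I1. \<sigma> (u i) * dd i * u i) + (\<Sum>i\<in>I2. \<sigma> (u i) * dd i * u i)" for u
  unfolding DD.hf_def I12 by (rule sum.union_disjoint[OF fin disj])
 have trm: "\<exists>s\<in>S. \<sigma> (u i) * dd i * u i = scale s (\<sigma> (u i) * 1 * u i)" if ui: "u \<in> U" "i \<in> I1" for u i
 proof -
  obtain s where "s \<in> S" "dd i = emb s" using d1[OF ui(2)] by blast
  then show ?thesis using emb_conj[OF DD.rsubD(1)[OF rU ui(1)], of "\<sigma> (u i)" s] by auto
 qed
 have inC: "(\<Sum>i\<in>J. \<sigma> (u i) * dd i * u i) \<in> cone S 1" if uJ: "u \<in> U" "J \<subseteq> I1" for u J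
 proof -
  have "finite J" using uJ(2) fin finite_subset by blast
  then show ?thesis using uJ(2)
  proof (induction J)
   case (insert j J)
   obtain s where "s \<in> S" "\<sigma> (u j) * dd j * u j = scale s (\<sigma> (u j) * 1 * u j)" using trm[OF uJ(1)] insert by blast
   then have "\<sigma> (u j) * dd j * u j \<in> cone S 1" using cone_gen by metis
   then show ?case using insert cone_add by simp
  qed (simp add: cone_zero)
 qed
 have inj: "u i = 0" if u: "u \<in> U" "\<And>j. j \<in> I2 ==> u j = 0" for u i
 proof (cases "i \<in> I1")
  case True
  define a where "a = \<sigma> (u i) * dd i * u i"
  have "a + (\<Sum>j\<in>I1 - {i}. \<sigma> (u j) * dd j * u j) = 0"
   using iso[OF u(1)] u(2) unfolding hfe a_def by (simp add: sum.remove[OF fin(1) True])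
  then have "- a = (\<Sum>j\<in>I1 - {i}. \<sigma> (u j) * dd j * u j)" by (simp add: neg_eq_iff_add_eq_0)
  then have "- a \<in> cone S 1" using inC[OF u(1), of "I1 - {i}"] by auto
  moreover have "a \<in> cone S 1" using inC[OF u(1), of "{i}"] True by (simp add: a_def)
  ultimately have a0: "a = 0" using proper by blast
  obtain s where s: "s \<in> S" "a = scale s (\<sigma> (u i) * 1 * u i)" using trm[OF u(1) True] a_def by blast
  then have "\<sigma> (u i) * u i = 0" using a0 S(3) by auto
  moreover have "u i \<in> D" using DD.rsubD(1)[OF rU u(1)] .
  ultimately show ?thesis using DD.no_zero_div[OF DD.s_in] DD.s_nz by blast
 next
  case False
  then show ?thesis using supp[OF u(1), of i] u(2)[of i] I12 by (cases "i \<in> I2") auto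
 qed
 have n0: "n > 0" using szI n(1) K(1) by (cases n) auto
 then obtain j0 where j0: "j0 \<in> I2" using cI2 by (metis card.empty equals0I less_numeral_extra(3))
 have "card (I2 - {j0}) < n" using cI2 j0 n0 fin by simp
 then obtain u where u: "u \<in> U" "\<exists>i. u i \<noteq> 0" "\<forall>j\<in>I2-{j0}. u j = 0"
  using DD.dimge_exists[of "I2 - {j0}" U "\<lambda>j u. u j" n] rU n(2) fin DD.rlin_coord[OF rU] by auto
 have uj0: "u j0 \<noteq> 0"
 proof
  assume "u j0 = 0"
  then have "u i = 0" for i using inj[OF u(1)] u(3) by (metis DiffI singletonD)
  then show False using u(2) by blast
 qed
 have uD: "u j0 \<in> D" using DD.rsubD(1)[OF rU u(1)] .
 define v where "v = (\<lambda>i. u i * DD.dinv (u j0))"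
 have vU: "v \<in> U" unfolding v_def by (rule DD.rsubD(4)[OF rU u(1)]) (rule DD.dinv(1)[OF uD uj0])
 have vj: "v j0 = e" "\<And>j. j \<in> I2 - {j0} ==> v j = 0" using u(3) DD.dinv(2)[OF uD uj0] by (auto simp: v_def)
 obtain s where s: "s \<in> S" "dd j0 = emb s * - d" using d2[OF j0] by blast
 have "(\<Sum>i\<in>I2. \<sigma> (v i) * dd i * v i) = - scale s d"
 proof -
  have "(\<Sum>i\<in>I2. \<sigma> (v i) * dd i * v i) = \<sigma> (v j0) * dd j0 * v j0"
   using vj(2) by (subst sum.remove[OF fin(2) j0]) simp
  also have "\<dots> = - scale s d" unfolding vj(1) se s(2) using dD(1)
   by (simp add: emb_mult(1) D_def scale_out)
  finally show ?thesis .
 qed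
 then have "scale s d = (\<Sum>i\<in>I1. \<sigma> (v i) * dd i * v i)" using iso[OF vU] unfolding hfe by simp
 then have sd: "scale s d \<in> cone S 1" using inC[OF vU, of I1] by simp
 have s0: "s \<noteq> 0" using s S(3) by auto
 \<comment> \<open>This is the inverse of \<open>s\<close>, exhibited as \<open>s\<close> times a
   square.\<close>
 then have "s * (inverse s * inverse s) \<in> S" using s(1) S(1,2) by auto
 then have "scale (s * (inverse s * inverse s)) (scale s d) \<in> cone S 1" by (rule cone_scale[OF sd]) (rule S(1))
 moreover have "s * (inverse s * inverse s) * s = 1" using s0 by (simp add: field_simps)
 ultimately show ?thesis by (simp only: scale_scale scale_one)
qed

text \<open>The cone generated in the whole algebra by \<open>w\<close> and the scalars of
  \<open>P\<close> is proper: a vanishing sum is compressed to \<open>D\<close> by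
  \<open>e * \<sigma> r\<close> and \<open>r * e\<close>, anisotropy there kills every summand for
  every \<open>r\<close>, and \<open>sandwich_zero\<close> lifts this back.\<close>

lemma positive_cone_over:
 assumes P: "fordering (range emb) P" and w: "w \<in> DD.Hs" and an: "DD.aniso P {w}"
 shows "\<exists>\<P>\<in>positive_cones scale \<sigma>. cone_ordering scale \<P> = {c. emb c \<in> P}"
proof -
 define Pf where "Pf = {c. emb c \<in> P}"
 have "fordering (range (\<lambda>c. c)) ((\<lambda>c. c) ` {c. emb c \<in> P})"
  by (rule fordering_transport[OF P DD.i_add DD.i_uminus DD.i_mult]) (use DD.i_eq_0 in auto)
 then have fP: "field_ordering Pf" by (simp add: Pf_def fordering_def field_ordering_def)
 have Pfc: "\<And>a b. a \<in> Pf ==> b \<in> Pf ==> a * b \<in> Pf" "0 \<in> Pf" "1 \<in> Pf"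
  using DD.P_props(3,4)[OF P] DD.i_mult DD.i_zero DD.i_one DD.P_e[OF P] by (auto simp: Pf_def)
 have wD: "w \<in> D" "\<sigma> w = w" "w \<noteq> 0" using DD.HsD[OF w] by auto
 define Q where "Q = cone Pf w"
 have key: "M inside {scale c (\<sigma> x * w * x) | c x. c \<in> Pf} ==> sum_mset M = 0 ==> \<forall>m\<in>#M. m = 0" for M
 proof (intro ballI)
  fix m assume M: "M inside {scale c (\<sigma> x * w * x) | c x. c \<in> Pf}" "sum_mset M = 0" and m: "m \<in># M"
  have z: "e * \<sigma> r * m * r * e = 0" for r
  proof -
   define g where "g = (\<lambda>m. e * \<sigma> r * m * r * e)"
   have gs: "sum_mset (image_mset g N) = g (sum_mset N)" for N
    by (induction N) (auto simp: g_def distrib_left distrib_right)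
   have gc: "g n \<in> DD.coneset P {w}" if n: "n \<in># M" "g n \<noteq> 0" for n
   proof -
    obtain c x where c: "n = scale c (\<sigma> x * w * x)" "c \<in> Pf" using M(1) n(1) by blast
    define y where "y = e * (x * r) * e"
    have yD: "y \<in> D" unfolding y_def by (rule D_I)
    have ew: "e * w = w" "w * e = w" using wD by (auto simp: D_def)
    have "\<sigma> y * w * y = e * \<sigma> r * \<sigma> x * (e * w * e) * x * r * e" by (simp add: y_def sg_simps se mult.assoc)
    then have syw: "\<sigma> y * w * y = e * \<sigma> r * \<sigma> x * w * x * r * e" using ew by simp
    have gn: "g n = emb c * (\<sigma> y * w * y)"
     unfolding emb_mult(1) syw g_def c(1)
     by (simp add: scale_out mult.assoc)
      (metis ee mult.assoc)
    have "y \<noteq> 0" "emb c \<noteq> 0" using n(2) gn by auto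
    then show ?thesis using gn yD c(2) unfolding DD.coneset_def Pf_def by blast
   qed
   define N where "N = filter_mset (\<lambda>m. m \<noteq> 0) (image_mset g M)"
   have sf: "sum_mset (filter_mset (\<lambda>m. m \<noteq> 0) Y) = sum_mset Y" for Y :: "'a multiset" by (induction Y) auto
   have "sum_mset N = 0" using gs[of M] M(2) by (simp add: N_def sf g_def)
   moreover have "N inside DD.coneset P {w}" using gc by (auto simp: N_def)
   ultimately have "N = {#}" using an unfolding DD.aniso_def by blast
   then have "g m \<notin># N" by simp
   then show ?thesis using m by (auto simp: N_def g_def)
  qed
  obtain c x where c: "m = scale c (\<sigma> x * w * x)" "c \<in> Pf" using M(1) m by blast
  have xz: "e * x * r * e = 0" if c0: "c \<noteq> 0" for r
  proof -
   define y where "y = e * (x * r) * e"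
   have yD: "y \<in> D" unfolding y_def by (rule D_I)
   have ew: "e * w = w" "w * e = w" using wD by (auto simp: D_def)
   have "\<sigma> y * w * y = e * \<sigma> r * \<sigma> x * (e * w * e) * x * r * e" by (simp add: y_def sg_simps se mult.assoc)
   then have "scale c (\<sigma> y * w * y) = e * \<sigma> r * m * r * e" using ew
    by (simp add: c(1) scale_out mult.assoc)
   then have "\<sigma> y * w * y = 0" using z c0 by auto
   then have "y = 0" using DD.no_zero_div[of "\<sigma> y * w" y] DD.no_zero_div[of "\<sigma> y" w] DD.s_nz[OF yD] yD wD DD.s_in[OF yD] DD.D_mult by blast
   then show ?thesis by (simp add: y_def mult.assoc)
  qed
  show "m = 0"
  proof (cases "c = 0")
   case False
   have "e * x = 0" by (rule sandwich_zero[OF e0]) (rule xz[OF False])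
   moreover have "e * w = w" using wD by (simp add: D_def)
   ultimately have "w * x = 0" using wD by (metis (mono_tags, lifting) D_def mem_Collect_eq mult.assoc mult_zero_right)
   then show ?thesis by (simp add: c(1) mult.assoc)
  qed (simp add: c)
 qed
 have Q0: "u = 0" if u: "u \<in> Q" "- u \<in> Q" for u
 proof -
  obtain M N where MN: "u = sum_mset M" "M inside {scale c (\<sigma> x * w * x) | c x. c \<in> Pf}"
   "- u = sum_mset N" "N inside {scale c (\<sigma> x * w * x) | c x. c \<in> Pf}" using u unfolding Q_def cone_def by blast
  have s0: "sum_mset (M + N) = 0" using MN(1,3) by (metis add.right_inverse sum_mset.union)
  have "\<forall>m\<in>#M + N. m = 0" by (rule key[OF _ s0]) (use MN in auto)
  then have "\<forall>m\<in>#M. m = 0" by simp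
  then have "sum_mset M = 0" by (simp add: sum_mset.neutral)
  then show ?thesis using MN(1) by simp
 qed
 have wQ: "w \<in> Q" using cone_gen[OF Pfc(3), of 1 w] by (simp add: Q_def)
 have co: "cone_ordering scale Q = Pf"
 proof
  show "Pf \<subseteq> cone_ordering scale Q" unfolding cone_ordering_def Q_def using cone_scale Pfc(1) by blast
  show "cone_ordering scale Q \<subseteq> Pf"
  proof
   fix c assume c: "c \<in> cone_ordering scale Q"
   show "c \<in> Pf"
   proof (rule ccontr)
    assume n: "c \<notin> Pf"
    then have "- c \<in> Pf" using fP unfolding field_ordering_def by (metis UNIV_I UnE image_iff minus_minus)
    then have "scale (- c) w \<in> Q" using cone_gen[of "- c" Pf 1 w] by (simp add: Q_def)
    moreover have "scale c w \<in> Q" using c wQ by (simp add: cone_ordering_def)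
    ultimately have "scale c w = 0" using Q0[of "scale c w"] by simp
    then show False using n Pfc(2) wD(3) by simp
   qed
  qed
 qed
 have "prepositive_cone scale \<sigma> Q" unfolding prepositive_cone_def
 proof (intro conjI ballI allI)
  show "Q \<subseteq> Sym \<sigma>" using cone_Sym[OF _ wD(2)] by (auto simp: Q_def Sym_def)
  show "Q \<noteq> {}" using wQ by auto
  show "field_ordering (cone_ordering scale Q)" using co fP by simp
  show "Q \<inter> uminus ` Q = {0}" using Q0 cone_zero[of Pf w] by (force simp: Q_def)
 qed (auto simp: Q_def cone_add cone_conj)
 then show ?thesis using positive_cone_extends co by (metis Pf_def)
qed

lemma uminus_positive_cone:
 assumes "\<P> \<in> positive_cones scale \<sigma>"
 shows "uminus ` \<P> \<in> positive_cones scale \<sigma>" "cone_ordering scale (uminus ` \<P>) = cone_ordering scale \<P>"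
proof -
 have co: "cone_ordering scale (uminus ` Q) = cone_ordering scale Q" for Q :: "'a set"
  by (auto simp: cone_ordering_def image_iff)
 have pp: "prepositive_cone scale \<sigma> (uminus ` Q)" if Q: "prepositive_cone scale \<sigma> Q" for Q
 proof -
  have "uminus ` Q \<inter> uminus ` uminus ` Q = {0}" using Q by (simp add: prepositive_cone_def image_image Int_commute)
  moreover have "- p + - q \<in> uminus ` Q" if "p \<in> Q" "q \<in> Q" for p q
   using Q that by (intro image_eqI[of _ _ "p + q"]) (auto simp: prepositive_cone_def)
  moreover have "\<sigma> a * (- p) * a \<in> uminus ` Q" if "p \<in> Q" for p a
   using Q that by (intro image_eqI[of _ _ "\<sigma> a * p * a"]) (auto simp: prepositive_cone_def)
  ultimately show ?thesis using Q unfolding prepositive_cone_def co by (auto simp: Sym_def sg_uminus)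
 qed
 show "cone_ordering scale (uminus ` \<P>) = cone_ordering scale \<P>" by (rule co)
 have "Q = uminus ` \<P>" if Q: "prepositive_cone scale \<sigma> Q" "uminus ` \<P> \<subseteq> Q" for Q
 proof -
  have "\<P> \<subseteq> uminus ` Q" using Q(2) by (force simp: image_iff)
  then have "uminus ` Q = \<P>" using assms pp[OF Q(1)] by (auto simp: positive_cones_def)
  then show ?thesis by (auto simp: image_image)
 qed
 then show "uminus ` \<P> \<in> positive_cones scale \<sigma>" using assms pp by (auto simp: positive_cones_def)
qed

text \<open>The anisotropic \<open>w'\<close> obtained by maximality is unrelated to
  \<open>e\<close> and \<open>d\<close>. The link is the positive cone above it: up to sign,
  \<open>hyp\<close> puts \<open>1\<close> into that cone, and then also \<open>d\<close>, so that
  \<open>e\<close> and \<open>d\<close> inherit joint anisotropy from it.\<close>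

lemma diagonal_in_cone:
 assumes S: "\<And>a b. a \<in> S ==> b \<in> S ==> a * b \<in> S" "\<And>q. q \<noteq> 0 ==> q * q \<in> S" "0 \<notin> S"
  and proper: "\<And>u. u \<in> cone S 1 ==> - u \<in> cone S 1 ==> u = 0"
  and hyp: "\<And>\<P>. \<P> \<in> positive_cones scale \<sigma> ==> S \<subseteq> cone_ordering scale \<P> ==> 1 \<in> \<P> \<union> uminus ` \<P>"
  and d: "d \<in> DD.Hs" "\<And>\<P>. \<P> \<in> positive_cones scale \<sigma> ==> S \<subseteq> cone_ordering scale \<P> ==> 1 \<in> \<P> ==> d \<in> \<P>"
 shows "d \<in> cone S 1"
proof (cases "DD.torsion (emb ` S) {#e, - d#}")
 case True
 then show ?thesis using torsion_in_cone[OF S proper d(1)] by blast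
next
 case False
 have one: "1 \<in> S" using S(2)[of 1] by simp
 have mc: "DD.mclosed (emb ` S)" unfolding DD.mclosed_def
 proof (intro conjI ballI)
  show "emb ` S \<subseteq> range emb - {0}" using S(3) DD.i_eq_0 by auto
  show "e \<in> emb ` S" using DD.i_one one by (metis imageI)
  fix x y assume "x \<in> emb ` S" "y \<in> emb ` S"
  then show "x * y \<in> emb ` S" using S(1) DD.i_mult by (auto simp: image_iff) metis
 qed
 have H: "{#e, - d#} inside DD.Hs" using DD.e_Hs DD.uminus_Hs[OF d(1)] by simp
 obtain P where P: "fordering (range emb) P" "emb ` S \<subseteq> P" "\<not> DD.torsion (P - {0}) {#e, - d#}"
  using DD.plgp[OF mc H False] by blast
 note mcP = DD.P_mclosed[OF P(1)]
 have "\<exists>w\<in>DD.Hs. \<not> DD.torsion (P - {0}) {#w#}"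
 proof (rule ccontr)
  assume "\<not> (\<exists>w\<in>DD.Hs. \<not> DD.torsion (P - {0}) {#w#})"
  then have t: "DD.torsion (P - {0}) {#e#}" "DD.torsion (P - {0}) {#- d#}" using DD.e_Hs DD.uminus_Hs[OF d(1)] by auto
  have "DD.torsion (P - {0}) ({#e#} + {#- d#})"
   by (rule DD.torsion_add[OF mcP t]) (use H in auto)
  then show False using P(3) by (simp add: add_mset_commute)
 qed
 then obtain w where w: "w \<in> DD.Hs" "\<not> DD.torsion (P - {0}) {#w#}" by blast
 obtain T B where T: "DD.theta P T B" using DD.theta_exists_nontorsion[OF P(1) w] by blast
 obtain w' where w': "w' \<in> DD.Hs" "DD.aniso P {w'}" using DD.theta_aniso_exists[OF P(1) T w] by blast
 obtain \<P>0 where P0: "\<P>0 \<in> positive_cones scale \<sigma>" "cone_ordering scale \<P>0 = {c. emb c \<in> P}"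
  using positive_cone_over[OF P(1) w'] by blast
 have SP: "S \<subseteq> cone_ordering scale \<P>0" using P(2) P0(2) by auto
 obtain \<P> where P1: "\<P> \<in> positive_cones scale \<sigma>" "cone_ordering scale \<P> = {c. emb c \<in> P}" "1 \<in> \<P>"
 proof (cases "1 \<in> \<P>0")
  case False
  then have "1 \<in> uminus ` \<P>0" using hyp[OF P0(1) SP] by simp
  then show ?thesis using that uminus_positive_cone[OF P0(1)] P0(2) by blast
 qed (use that P0 in blast)
 have dP: "d \<in> \<P>" using d(2)[OF P1(1) _ P1(3)] P1(2) P(2) by auto
 have pc: "\<P> \<inter> uminus ` \<P> = {0}" "\<And>p q. p \<in> \<P> ==> q \<in> \<P> ==> p + q \<in> \<P>" "\<And>p a. p \<in> \<P> ==> \<sigma> a * p * a \<in> \<P>"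
  using P1(1) by (auto simp: positive_cones_def prepositive_cone_def)
 have eP: "e \<in> \<P>" using pc(3)[OF P1(3), of e] by (simp add: se ee)
 have zP: "0 \<in> \<P>" using pc(1) by blast
 have csP: "DD.coneset P {e, d} \<subseteq> \<P>"
 proof
  fix m assume "m \<in> DD.coneset P {e, d}"
  then obtain p v x where m: "m = p * (\<sigma> x * v * x)" "p \<in> P" "v \<in> {e, d}" "x \<in> D" unfolding DD.coneset_def by blast
  obtain c where c: "p = emb c" using DD.P_props(1)[OF P(1)] m(2) by blast
  have "\<sigma> x * v * x \<in> \<P>" using pc(3) eP dP m(3) by blast
  moreover have "c \<in> cone_ordering scale \<P>" using P1(2) m(2) c by simp
  ultimately have "scale c (\<sigma> x * v * x) \<in> \<P>" by (simp add: cone_ordering_def)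
  moreover have "e * (\<sigma> x * v * x) = \<sigma> x * v * x" using DD.s_in[OF m(4)] by (simp add: D_def mult.assoc[symmetric])
  ultimately show "m \<in> \<P>" unfolding m(1) c emb_mult(1) by simp
 qed
 have "DD.aniso P {e, d}" unfolding DD.aniso_def
 proof (intro allI impI, rule ccontr)
  fix M assume M: "M inside DD.coneset P {e, d}" "sum_mset M = 0" "M \<noteq> {#}"
  obtain m N where mN: "M = add_mset m N" using M(3) by (cases M) auto
  have "m \<in> \<P>" using M(1) mN csP by auto
  moreover have "sum_mset N \<in> \<P>" by (rule mset_closed) (use M(1) mN csP zP pc(2) in auto)
  moreover have "m = - sum_mset N" using M(2) mN by (simp add: eq_neg_iff_add_eq_0)
  ultimately have "m \<in> \<P> \<inter> uminus ` \<P>" by blast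
  then have "m = 0" using pc(1) by simp
  moreover have "m \<in> DD.Hs" using DD.coneset_Hs[OF P(1), of "{e, d}"] M(1) mN DD.e_Hs d(1) by auto
  ultimately show False using DD.HsD(3) by blast
 qed
 then have "DD.torsion (P - {0}) {#e, - d#}" by (rule DD.theta_aniso_torsion[OF P(1) T d(1)])
 then show ?thesis using P(3) by simp
qed

end

section \<open>Diagonalisation of symmetric elements\<close>

context sym_idem
begin

text \<open>If all values at elements \<open>x\<close> with \<open>x * e = x\<close> vanished,
  polarisation would make the form skew there. A nonzero mixed value could be normalised to
  \<open>e\<close>, which is symmetric, so \<open>e = - e\<close>.\<close>

lemma nonzero_value: assumes u: "\<sigma> u = u" "u \<noteq> 0" shows "\<exists>x. x * e = x \<and> \<sigma> x * u * x \<noteq> 0"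
proof (rule ccontr)
 assume "\<not> ?thesis"
 then have z: "\<sigma> x * u * x = 0" if "x * e = x" for x using that by blast
 have sk: "\<sigma> y * u * x = - (\<sigma> x * u * y)" if "x * e = x" "y * e = y" for x y
 proof -
  have "\<sigma> (x + y) * u * (x + y) = 0" by (rule z) (use that in \<open>simp add: distrib_right\<close>)
  then show ?thesis using z[OF that(1)] z[OF that(2)]
   by (simp add: sg_simps distrib_left distrib_right eq_neg_iff_add_eq_0)
 qed
 have "\<sigma> x * u * y = 0" if xy: "x * e = x" "y * e = y" for x y
 proof (rule ccontr)
  assume n: "\<sigma> x * u * y \<noteq> 0"
  define g where "g = \<sigma> x * u * y"
  have "e * \<sigma> x = \<sigma> x" using arg_cong[OF xy(1), of \<sigma>] by (simp add: sg_simps se)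
  then have "e * g = g" "g * e = g" using xy(2) by (simp_all add: g_def mult.assoc[symmetric]) (simp add: mult.assoc)
  then obtain g' where g': "e * g' = g'" "g' * e = g'" "g * g' = e" using e_div n g_def by blast
  have v: "\<sigma> x * u * (y * g') = e" using g'(3) by (simp add: g_def mult.assoc)
  have "\<sigma> (y * g') * u * x = - e" using sk[of x "y * g'"] xy g' v by (simp add: mult.assoc)
  moreover have "\<sigma> (y * g') * u * x = \<sigma> (\<sigma> x * u * (y * g'))" by (simp add: sg_simps u(1) mult.assoc)
  ultimately have "e = - e" using v se by simp
  then have "e + e = 0" by (simp only: eq_neg_iff_add_eq_0)
  then show False using double_nz[OF e0] by simp
 qed
 then have "\<sigma> (\<sigma> a * e) * u * (b * e) = 0" for a b by (simp add: ee mult.assoc)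
 then have "e * a * u * b * e = 0" for a b by (simp add: sg_simps se mult.assoc)
 then have "u = 0" by (rule sandwich_zero2[OF e0])
 then show False using u(2) by simp
qed

text \<open>Induction on the rank of \<open>u\<close>, measured by the dimension of its right
  annihilator. A value \<open>d\<close> in \<open>D\<close> is split off; the remainder is again of
  the form \<open>\<sigma> k * u * k\<close>, so it stays in every positive cone that contains
  \<open>u\<close>.\<close>

lemma positive_in_cone:
 assumes S: "\<And>a b. a \<in> S ==> b \<in> S ==> a * b \<in> S" "\<And>q. q \<noteq> 0 ==> q * q \<in> S" "0 \<notin> S"
  and proper: "\<And>u. u \<in> cone S 1 ==> - u \<in> cone S 1 ==> u = 0"
  and hyp: "\<And>\<P>. \<P> \<in> positive_cones scale \<sigma> ==> S \<subseteq> cone_ordering scale \<P> ==> 1 \<in> \<P> \<union> uminus ` \<P>"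
  and u: "\<sigma> u = u" "\<And>\<P>. \<P> \<in> positive_cones scale \<sigma> ==> S \<subseteq> cone_ordering scale \<P> ==> 1 \<in> \<P> ==> u \<in> \<P>"
 shows "u \<in> cone S 1"
proof -
 obtain B where "finite_dimensional_vector_space scale B" using finite_dim by blast
 then interpret fv: finite_dimensional_vector_space scale B .
 define ker where "ker = (\<lambda>u::'a. {r. u * r = 0})"
 have sker: "subspace (ker u)" for u :: 'a
  by (auto simp: subspace_def ker_def distrib_left scale_mult_right[symmetric])
 have kle: "dim (ker u) \<le> dim (UNIV :: 'a set)" for u by (rule fv.dim_subset) simp
 define K where "K = {u. \<sigma> u = u \<and> (\<forall>\<P>\<in>positive_cones scale \<sigma>. S \<subseteq> cone_ordering scale \<P> \<longrightarrow> 1 \<in> \<P> \<longrightarrow> u \<in> \<P>)}"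
 have Kc: "\<sigma> y * u * y \<in> K" if "u \<in> K" for u y
  using that by (auto simp: K_def positive_cones_def prepositive_cone_def sg_simps mult.assoc)
 have "u \<in> K ==> u \<in> cone S 1" for u
 proof (induction "dim (UNIV :: 'a set) - dim (ker u)" arbitrary: u rule: less_induct)
  case less
  show ?case
  proof (cases "u = 0")
   case False
   have su: "\<sigma> u = u" using less.prems by (simp add: K_def)
   obtain x where x: "x * e = x" "\<sigma> x * u * x \<noteq> 0" using nonzero_value[OF su False] by blast
   have ex: "e * \<sigma> x = \<sigma> x" using arg_cong[OF x(1), of \<sigma>] by (simp add: sg_simps se)
   define d where "d = \<sigma> x * u * x"
   have dK: "d \<in> K" unfolding d_def by (rule Kc[OF less.prems])
   have "e * d = d" unfolding d_def using ex by (simp add: mult.assoc[symmetric])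
   moreover have "d * e = d" unfolding d_def using x(1) by (simp add: mult.assoc)
   ultimately have dD: "d \<in> D" by (simp add: D_def)
   then have dH: "d \<in> DD.Hs" using dK x(2) by (simp add: DD.Hs_def d_def K_def)
   have dC: "d \<in> cone S 1"
    by (rule diagonal_in_cone[OF S proper hyp dH]) (use dK in \<open>auto simp: K_def\<close>)
   define d' where "d' = DD.dinv d"
   have d': "d * d' = e" "d' * d = e" "\<sigma> d' = d'" "d' * e = d'" "e * d' = d'"
    using DD.dinv[OF dD] DD.HsD[OF DD.dinv_Hs[OF dH]] DD.HsD(3)[OF dH] by (auto simp: d'_def D_def)
   define y where "y = d' * \<sigma> x * u"
   define u1 where "u1 = u - u * x * d' * \<sigma> x * u"
   have sy: "\<sigma> y = u * x * d'" by (simp add: y_def sg_simps su d' mult.assoc)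
   have "\<sigma> y * d * y = u * x * (d' * d * d') * \<sigma> x * u" unfolding sy by (simp add: y_def mult.assoc)
   also have "d' * d * d' = d'" using d' by simp
   finally have uu: "u = u1 + \<sigma> y * d * y" by (simp add: u1_def)
   \<comment> \<open>The projection that kills \<open>x\<close>, onto the complement orthogonal to
     \<open>x\<close> with respect to \<open>u\<close>.\<close>
   define k where "k = 1 - x * d' * \<sigma> x * u"
   have sk: "\<sigma> k = 1 - u * x * d' * \<sigma> x" by (simp add: k_def sg_diff sg_simps su d' mult.assoc)
   have q: "u * x * d' * \<sigma> x * u * x * d' * \<sigma> x * u = u * x * d' * \<sigma> x * u"
   proof -
    have "u * x * d' * \<sigma> x * u * x * d' * \<sigma> x * u = u * x * (d' * (\<sigma> x * u * x) * d') * \<sigma> x * u" by (simp add: mult.assoc)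
    also have "d' * (\<sigma> x * u * x) * d' = d'" using d' by (simp add: d_def[symmetric])
    finally show ?thesis .
   qed
   have "\<sigma> k * u * k = u - u * x * d' * \<sigma> x * u - u * x * d' * \<sigma> x * u + u * x * d' * \<sigma> x * u * x * d' * \<sigma> x * u"
    unfolding sk by (simp add: k_def left_diff_distrib right_diff_distrib mult.assoc)
   then have "u1 = \<sigma> k * u * k" unfolding q by (simp add: u1_def)
   then have u1K: "u1 \<in> K" using Kc[OF less.prems] by simp
   have sub: "ker u \<subseteq> ker u1"
   proof
    fix r assume "r \<in> ker u"
    then have "u * r = 0" by (simp add: ker_def)
    then show "r \<in> ker u1" by (simp add: ker_def u1_def left_diff_distrib mult.assoc)
   qed
   have "u1 * x = u * x - u * x * (d' * (\<sigma> x * u * x))" by (simp add: u1_def left_diff_distrib mult.assoc)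
   also have "\<dots> = 0" unfolding d_def[symmetric] d'(2) using x(1) by (simp add: mult.assoc)
   finally have "x \<in> ker u1" by (simp add: ker_def)
   moreover have "x \<notin> ker u" using x(2) by (auto simp: ker_def mult.assoc)
   ultimately have "ker u \<noteq> ker u1" by blast
   then have "dim (ker u) \<noteq> dim (ker u1)" using fv.subspace_dim_equal[OF sker sker sub] by auto
   moreover have "dim (ker u) \<le> dim (ker u1)" by (rule fv.dim_subset[OF sub])
   ultimately have "dim (UNIV :: 'a set) - dim (ker u1) < dim (UNIV :: 'a set) - dim (ker u)"
    using kle[of u1] by linarith
   then have "u1 \<in> cone S 1" using less.hyps u1K by blast
   then show ?thesis using uu cone_add[OF _ cone_conj[OF dC, of y], of u1] by simp
  qed (simp add: cone_zero)
 qed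
 then show ?thesis using u by (simp add: K_def)
qed

end

context inv_alg
begin

lemma positive_in_cone_one:
 assumes S: "\<And>a b. a \<in> S ==> b \<in> S ==> a * b \<in> S" "\<And>q. q \<noteq> 0 ==> q * q \<in> S" "0 \<notin> S"
  and hyp: "\<And>\<P>. \<P> \<in> positive_cones scale \<sigma> ==> S \<subseteq> cone_ordering scale \<P> ==> 1 \<in> \<P> \<union> uminus ` \<P>"
  and u: "\<sigma> u = u" "\<And>\<P>. \<P> \<in> positive_cones scale \<sigma> ==> S \<subseteq> cone_ordering scale \<P> ==> 1 \<in> \<P> ==> u \<in> \<P>"
 shows "u \<in> cone S 1"
proof (cases "\<exists>v. v \<in> cone S 1 \<and> - v \<in> cone S 1 \<and> v \<noteq> 0")
 case True
 then show ?thesis using cone_improper[OF S(1,2), of _ 1] u(1) by (auto simp: Sym_def)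
next
 case False
 have one: "1 \<in> S" using S(2)[of 1] by simp
 have proper: "v = 0" if "v \<in> cone S 1" "- v \<in> cone S 1" for v using False that by blast
 obtain e where e: "e * e = e" "\<sigma> e = e" "e \<noteq> 0"
  "\<forall>d. e * d = d \<longrightarrow> d * e = d \<longrightarrow> d \<noteq> 0 \<longrightarrow> (\<exists>d'. e * d' = d' \<and> d' * e = d' \<and> d * d' = e)"
  using symmetric_idempotent_exists[OF anisotropic_idempotent[OF one proper]] by blast
 interpret sym_idem scale \<sigma> e by unfold_locales (use e in auto)
 show ?thesis by (rule positive_in_cone[OF S proper hyp u])
qed

end

section \<open>Scaling the involution\<close>

text \<open>Multiplication by \<open>c\<close> carries elements symmetric for \<sigma> to elements
  symmetric for \<tau>, and \<open>a\<close> to \<open>1\<close>.\<close>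

locale twisted = inv_alg scale \<sigma> for scale :: "'f::field \<Rightarrow> 'b::ring_1 \<Rightarrow> 'b" and \<sigma> :: "'b \<Rightarrow> 'b" +
 fixes a c :: "'b" and \<tau> :: "'b \<Rightarrow> 'b"
 assumes a: "\<sigma> a = a" "a * c = 1" "c * a = 1" and tau: "\<tau> x = c * \<sigma> x * a"
begin

lemma sc: "\<sigma> c = c"
proof -
 have "\<sigma> c * a = 1" using arg_cong[OF a(2), of \<sigma>] a(1) by (simp add: sg_simps)
 then show ?thesis using a(2) by (metis mult.assoc mult.left_neutral mult.right_neutral)
qed

lemma ac: "a * (c * x) = x" "c * (a * x) = x" using a by (simp_all add: mult.assoc[symmetric])

lemma twist_involution: "algebra_with_involution scale \<tau>"
proof
 show "scale k (x * y) = scale k x * y" "scale k (x * y) = x * scale k y" for k x y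
  by (rule scale_mult_left scale_mult_right)+
 show "\<exists>B. finite B \<and> span B = UNIV" by (rule finite_dimensional)
 show "two_sided_ideal I ==> I = {0} \<or> I = UNIV" for I :: "'b set" by (rule simple)
 show "z \<in> centre ==> z \<noteq> 0 ==> \<exists>w\<in>centre. z * w = 1" for z :: 'b by (rule centre_field)
 show "\<tau> (x + y) = \<tau> x + \<tau> y" for x y by (simp add: tau sg_simps distrib_left distrib_right)
 show "\<tau> (x * y) = \<tau> y * \<tau> x" for x y by (simp add: tau sg_simps mult.assoc ac)
 show "\<tau> (\<tau> x) = x" for x by (simp add: tau sg_simps a(1,3) sc mult.assoc ac)
 \<comment> \<open>The two involutions agree on the centre, so the base field is unchanged.\<close>
 have "\<tau> z = \<sigma> z" if "z \<in> centre" for z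
 proof -
  have "\<sigma> z * x = x * \<sigma> z" for x
  proof -
   have "\<sigma> (\<sigma> x * z) = \<sigma> (z * \<sigma> x)" using that by (simp add: centre_def)
   then show ?thesis by (simp add: sg_simps)
  qed
  then show ?thesis by (simp add: tau mult.assoc ac)
 qed
 then have "centre \<inter> Sym \<tau> = centre \<inter> Sym \<sigma>" by (auto simp: Sym_def)
 then show "range (\<lambda>c. scale c 1) = centre \<inter> Sym \<tau>" using base_field by simp
qed

lemma twist_prepositive:
 assumes "prepositive_cone scale \<sigma> P"
 shows "prepositive_cone scale \<tau> ((*) c ` P)" "cone_ordering scale ((*) c ` P) = cone_ordering scale P"
proof -
 have inj: "c * x = c * y \<longleftrightarrow> x = y" for x y by (metis ac(1))
 show co: "cone_ordering scale ((*) c ` P) = cone_ordering scale P"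
  by (auto simp: cone_ordering_def scale_mult_right image_iff inj)
 have P: "P \<subseteq> Sym \<sigma>" "P \<noteq> {}" "\<And>p q. p \<in> P ==> q \<in> P ==> p + q \<in> P" "\<And>p x. p \<in> P ==> \<sigma> x * p * x \<in> P"
  "field_ordering (cone_ordering scale P)" "P \<inter> uminus ` P = {0}" using assms by (auto simp: prepositive_cone_def)
 have "(*) c ` P \<inter> uminus ` (*) c ` P = (*) c ` (P \<inter> uminus ` P)"
  by (auto simp: image_iff mult_minus_right[symmetric] inj simp del: mult_minus_right)
 then have "(*) c ` P \<inter> uminus ` (*) c ` P = {0}" using P(6) by simp
 moreover have "(*) c ` P \<subseteq> Sym \<tau>" using P(1) by (auto simp: Sym_def tau sg_simps sc mult.assoc a(3))
 moreover have "\<tau> x * (c * p) * x = c * (\<sigma> x * p * x)" for x p by (simp add: tau mult.assoc ac)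
 ultimately show "prepositive_cone scale \<tau> ((*) c ` P)" using P(2-5) unfolding prepositive_cone_def co
  by (auto simp: distrib_left[symmetric])
qed

end

context twisted
begin

lemma twist_inv_alg: "inv_alg scale \<tau>"
 by (rule inv_alg.intro[OF twist_involution]) (unfold_locales, rule two_nonzero)

text \<open>Twisting back exchanges \<open>a\<close> and \<open>c\<close>. This is how maximality of
  a cone is transported: a larger cone for \<tau> is pulled back to \<sigma>.\<close>

lemma twist_symmetric: "twisted scale \<tau> c a \<sigma>"
proof -
 interpret T: inv_alg scale \<tau> by (rule twist_inv_alg)
 show ?thesis by unfold_locales (simp_all add: a tau sc mult.assoc ac)
qed

lemma twist_positive:
 assumes "P \<in> positive_cones scale \<sigma>" shows "(*) c ` P \<in> positive_cones scale \<tau>"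
proof -
 interpret T: twisted scale \<tau> c a \<sigma> by (rule twist_symmetric)
 have im: "(*) c ` (*) a ` Q = Q" "(*) a ` (*) c ` Q = Q" for Q by (auto simp: image_image ac)
 have "Q = (*) c ` P" if Q: "prepositive_cone scale \<tau> Q" "(*) c ` P \<subseteq> Q" for Q
 proof -
  have "P \<subseteq> (*) a ` Q" using image_mono[OF Q(2), of "(*) a"] im by simp
  then have "(*) a ` Q = P" using assms T.twist_prepositive(1)[OF Q(1)] by (auto simp: positive_cones_def)
  then show ?thesis using im by metis
 qed
 then show ?thesis using assms twist_prepositive(1) by (auto simp: positive_cones_def)
qed

end

section \<open>Pfister forms and the elements represented by their multiples\<close>

lemma pfister_Cons: "set (pfister (b # bs)) = set (pfister bs) \<union> (*) b ` set (pfister bs)"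
 by (simp add: pfister_def diag_tensor_def)

lemma one_pfister: "1 \<in> set (pfister bs)"
 by (induction bs) (auto simp: pfister_Cons, simp add: pfister_def)

lemma set_subset_pfister: "set bs \<subseteq> set (pfister bs)"
proof (induction bs)
 case (Cons b bs)
 have "b * 1 \<in> (*) b ` set (pfister bs)" using one_pfister by (rule imageI)
 then show ?case using Cons by (auto simp: pfister_Cons)
qed simp

text \<open>A slot occurring in both factors contributes its square; modulo squares the entries are
  closed under products.\<close>

lemma pfister_mult:
 "c \<in> set (pfister bs) ==> d \<in> set (pfister bs) ==> 0 \<notin> set bs ==> \<exists>k\<in>set (pfister bs). \<exists>q. q \<noteq> 0 \<and> c * d = k * (q * q)"
proof (induction bs arbitrary: c d)
 case Nil
 then show ?case by (auto simp: pfister_def intro!: exI[of _ 1])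
next
 case (Cons b bs)
 obtain i c' where c: "c = (if i then b * c' else c')" "c' \<in> set (pfister bs)"
  using Cons.prems(1) unfolding pfister_Cons by (metis Un_iff imageE)
 obtain j d' where d: "d = (if j then b * d' else d')" "d' \<in> set (pfister bs)"
  using Cons.prems(2) unfolding pfister_Cons by (metis Un_iff imageE)
 obtain k q where k: "k \<in> set (pfister bs)" "q \<noteq> 0" "c' * d' = k * (q * q)" using Cons.IH[OF c(2) d(2)] Cons.prems(3) by auto
 have b0: "b \<noteq> 0" using Cons.prems(3) by auto
 have k2: "k \<in> set (pfister (b # bs))" "b * k \<in> set (pfister (b # bs))" using k(1) by (auto simp: pfister_Cons)
 consider "i \<and> j" | "i \<noteq> j" | "\<not> i \<and> \<not> j" by blast
 then show ?case
 proof cases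
  case 1
  then have "c * d = k * ((b * q) * (b * q))" using c d k(3) by (simp add: algebra_simps)
  then show ?thesis using k2(1) k(2) b0 by (metis mult_eq_0_iff)
 next
  case 2
  then have "c * d = (b * k) * (q * q)" using c d k(3) by (auto simp: algebra_simps)
  then show ?thesis using k2(2) k(2) by blast
 next
  case 3
  then have "c * d = k * (q * q)" using c d k(3) by simp
  then show ?thesis using k2(1) k(2) by blast
 qed
qed

lemma pfister_nonzero: "0 \<notin> set bs ==> 0 \<notin> set (pfister bs)"
proof (induction bs)
 case Nil
 then show ?case by (simp add: pfister_def)
next
 case (Cons b bs)
 then show ?case by (auto simp: pfister_Cons)
qed

text \<open>The multiplicative set \<open>S\<close> of the overview.\<close>

definition pfister_squares :: "'f::field list \<Rightarrow> 'f set" where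
 "pfister_squares bs = {c * (q * q) | c q. c \<in> set (pfister bs) \<and> q \<noteq> 0}"

lemma pfister_squares:
 assumes "0 \<notin> set bs"
 shows "a \<in> pfister_squares bs ==> b \<in> pfister_squares bs ==> a * b \<in> pfister_squares bs"
  "q \<noteq> 0 ==> q * q \<in> pfister_squares bs" "0 \<notin> pfister_squares bs" "set (pfister bs) \<subseteq> pfister_squares bs"
proof -
 show "a * b \<in> pfister_squares bs" if ab: "a \<in> pfister_squares bs" "b \<in> pfister_squares bs"
 proof -
  obtain c q d r where c: "a = c * (q * q)" "c \<in> set (pfister bs)" "q \<noteq> 0" and d: "b = d * (r * r)" "d \<in> set (pfister bs)" "r \<noteq> 0"
   using ab by (auto simp: pfister_squares_def)
  obtain k s where k: "k \<in> set (pfister bs)" "s \<noteq> 0" "c * d = k * (s * s)" using pfister_mult[OF c(2) d(2) assms] by blast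
  have "a * b = (c * d) * ((q * r) * (q * r))" by (simp add: c(1) d(1) algebra_simps)
  also have "\<dots> = k * ((s * q * r) * (s * q * r))" unfolding k(3) by (simp add: algebra_simps)
  finally show ?thesis unfolding pfister_squares_def using k(1,2) c(3) d(3)
   by (intro CollectI exI[of _ k] exI[of _ "s * q * r"]) simp
 qed
 show "q * q \<in> pfister_squares bs" if "q \<noteq> 0"
  unfolding pfister_squares_def using one_pfister[of bs] that by (intro CollectI exI[of _ 1] exI[of _ q]) simp
 show "0 \<notin> pfister_squares bs" using pfister_nonzero[OF assms] by (auto simp: pfister_squares_def)
 show "set (pfister bs) \<subseteq> pfister_squares bs"
 proof
  fix c assume "c \<in> set (pfister bs)"
  then show "c \<in> pfister_squares bs" unfolding pfister_squares_def by (intro CollectI exI[of _ c] exI[of _ 1]) simp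
 qed
qed

lemma pfister_squares_ordering:
 assumes "field_ordering P" "0 \<notin> set bs" shows "pfister_squares bs \<subseteq> P \<longleftrightarrow> set bs \<subseteq> P"
proof
 show "pfister_squares bs \<subseteq> P ==> set bs \<subseteq> P"
  using set_subset_pfister[of bs] pfister_squares(4)[OF assms(2)] by blast
 assume bs: "set bs \<subseteq> P"
 have mult: "\<And>x y. x \<in> P ==> y \<in> P ==> x * y \<in> P" and tot: "\<And>x. x \<in> P \<or> - x \<in> P"
 proof -
  show "\<And>x y. x \<in> P ==> y \<in> P ==> x * y \<in> P" using assms(1) by (simp add: field_ordering_def)
  have "P \<union> uminus ` P = UNIV" using assms(1) by (simp add: field_ordering_def)
  then show "x \<in> P \<or> - x \<in> P" for x by (metis UNIV_I UnE image_iff minus_minus)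
 qed
 have sq: "q * q \<in> P" for q using mult[of q q] mult[of "- q" "- q"] tot[of q] by auto
 have one: "1 \<in> P" using sq[of 1] by simp
 have "set (pfister bs) \<subseteq> P" using bs
 proof (induction bs)
  case Nil
  then show ?case using one by (simp add: pfister_def)
 qed (auto simp: pfister_Cons mult)
 then show "pfister_squares bs \<subseteq> P" using mult sq by (auto simp: pfister_squares_def)
qed

lemma (in inv_alg) represented_multiple:
 "u \<in> represented \<sigma> (multiple_form s (diag_tensor_herm scale \<sigma> cs a)) \<longleftrightarrow>
   \<sigma> u = u \<and> (\<exists>xs. length xs = s \<and> (\<forall>x\<in>set xs. length x = length cs) \<and>
    u = (\<Sum>j<s. \<Sum>i<length cs. scale (cs ! i) (\<sigma> (xs ! j ! i) * a * xs ! j ! i)))"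
proof -
 have "\<sigma> x * scale k a * x = scale k (\<sigma> x * a * x)" for x k
  by (simp add: scale_out)
 then have "snd (diag_tensor_herm scale \<sigma> cs a) x x = (\<Sum>i<length cs. scale (cs ! i) (\<sigma> (x ! i) * a * x ! i))" for x
  by (simp add: diag_tensor_herm_def diag_form_def)
 then show ?thesis
  by (auto simp: represented_def multiple_form_def Sym_def diag_tensor_herm_def diag_form_def subset_iff)
qed

lemma (in inv_alg) cone_represented:
 assumes a: "\<sigma> a = a" and bs: "0 \<notin> set bs"
 shows "cone (pfister_squares bs) a = (\<Union>s\<in>{1..}. represented \<sigma> (multiple_form s (diag_tensor_herm scale \<sigma> (pfister bs) a)))"
proof (intro equalityI subsetI)
 let ?cs = "pfister bs"
 fix u assume u: "u \<in> cone (pfister_squares bs) a"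
 have "\<exists>xs. xs \<noteq> [] \<and> (\<forall>x\<in>set xs. length x = length ?cs) \<and>
    u = (\<Sum>j<length xs. \<Sum>i<length ?cs. scale (?cs ! i) (\<sigma> (xs ! j ! i) * a * xs ! j ! i))"
  using u
 proof (induction rule: cone_induct)
  case zero
  \<comment> \<open>The empty sum is represented by one copy at the zero vector, because the union
    starts at \<open>s = 1\<close>.\<close>
  show ?case by (rule exI[of _ "[replicate (length ?cs) 0]"]) simp
 next
  case (add c x v)
  then obtain xs where xs: "\<forall>x\<in>set xs. length x = length ?cs"
    "v = (\<Sum>j<length xs. \<Sum>i<length ?cs. scale (?cs ! i) (\<sigma> (xs ! j ! i) * a * xs ! j ! i))" by blast
  obtain k q where k: "c = k * (q * q)" "k \<in> set ?cs" using add.hyps(1) by (auto simp: pfister_squares_def)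
  obtain i0 where i0: "i0 < length ?cs" "?cs ! i0 = k" using k(2) by (auto simp: in_set_conv_nth)
  \<comment> \<open>The square factor \<open>q * q\<close> of the coefficient is moved into the
    vector.\<close>
  define y where "y = (replicate (length ?cs) (0 :: 'a))[i0 := scale q x]"
  have "(\<Sum>i<length ?cs. scale (?cs ! i) (\<sigma> (y ! i) * a * y ! i)) = (\<Sum>i<length ?cs. if i = i0 then scale c (\<sigma> x * a * x) else 0)"
  proof (rule sum.cong)
   fix i assume "i \<in> {..<length ?cs}"
   then show "scale (?cs ! i) (\<sigma> (y ! i) * a * y ! i) = (if i = i0 then scale c (\<sigma> x * a * x) else 0)"
    using i0 by (auto simp: y_def nth_list_update k(1) sg_scale scale_out)
  qed simp
  then have y: "(\<Sum>i<length ?cs. scale (?cs ! i) (\<sigma> (y ! i) * a * y ! i)) = scale c (\<sigma> x * a * x)" using i0 by simp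
  show ?case
   by (rule exI[of _ "y # xs"]) (use xs y in \<open>auto simp: sum.lessThan_Suc_shift y_def simp del: sum.lessThan_Suc\<close>)
 qed
 then obtain xs where xs: "xs \<noteq> []" "\<forall>x\<in>set xs. length x = length ?cs"
    "u = (\<Sum>j<length xs. \<Sum>i<length ?cs. scale (?cs ! i) (\<sigma> (xs ! j ! i) * a * xs ! j ! i))" by blast
 have "u \<in> represented \<sigma> (multiple_form (length xs) (diag_tensor_herm scale \<sigma> ?cs a))"
  unfolding represented_multiple by (intro conjI exI[of _ xs] cone_Sym[OF u a] refl xs(2,3))
 moreover have "length xs \<in> {1..}" using xs(1) by (simp add: Suc_le_eq)
 ultimately show "u \<in> (\<Union>s\<in>{1..}. represented \<sigma> (multiple_form s (diag_tensor_herm scale \<sigma> ?cs a)))" by blast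
next
 let ?cs = "pfister bs"
 fix u assume "u \<in> (\<Union>s\<in>{1..}. represented \<sigma> (multiple_form s (diag_tensor_herm scale \<sigma> ?cs a)))"
 then obtain s xs where u: "u = (\<Sum>j<s. \<Sum>i<length ?cs. scale (?cs ! i) (\<sigma> (xs ! j ! i) * a * xs ! j ! i))"
  unfolding UN_iff represented_multiple by blast
 have sum_in: "sum f I \<in> cone (pfister_squares bs) a" if "\<And>i. i \<in> I ==> f i \<in> cone (pfister_squares bs) a" for f :: "nat \<Rightarrow> 'a" and I
  using that by (induction I rule: infinite_finite_induct) (auto simp: cone_zero cone_add)
 have "?cs ! i \<in> pfister_squares bs" if "i < length ?cs" for i using pfister_squares(4)[OF bs] nth_mem[OF that] by blast
 then show "u \<in> cone (pfister_squares bs) a" unfolding u by (intro sum_in cone_gen) auto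
qed

theorem theorem7p14:
  fixes scale :: "'f::field \<Rightarrow> 'a::ring_1 \<Rightarrow> 'a"
    and \<sigma> :: "'a \<Rightarrow> 'a"
    and bs :: "'f list"
    and a :: 'a
  assumes "CHAR('f) \<noteq> 2"
    and "algebra_with_involution scale \<sigma>"
    and "0 \<notin> set bs"
    and "a \<in> Sym_units \<sigma>"
    and "\<And>\<P>. \<P> \<in> positive_cones scale \<sigma> \<Longrightarrow> cone_ordering scale \<P> \<in> harrison bs \<Longrightarrow>
           a \<in> \<P> \<union> uminus ` \<P>"
  shows "Sym \<sigma> \<inter> \<Inter>{\<P> \<in> positive_cones scale \<sigma>. cone_ordering scale \<P> \<in> harrison bs \<and> a \<in> \<P>}
       = (\<Union>s\<in>{1..}. represented \<sigma>
            (multiple_form s (diag_tensor_herm scale \<sigma> (pfister bs) a)))"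
proof -
 have two: "(2::'f) \<noteq> 0"
 proof
  assume "(2::'f) = 0"
  then have "(of_nat 2 :: 'f) = 0" by simp
  then have "CHAR('f) dvd 2" by (simp only: of_nat_eq_0_iff_char_dvd)
  moreover from this have "CHAR('f) \<le> 2" by (rule dvd_imp_le) simp
  moreover have "CHAR('f) \<noteq> 0"
  proof
   assume "CHAR('f) = 0"
   then show False using \<open>CHAR('f) dvd 2\<close> by simp
  qed
  ultimately have "CHAR('f) = 1" using assms(1) by linarith
  then have "(of_nat 1 :: 'f) = 0" by (metis of_nat_CHAR)
  then show False by simp
 qed
 interpret inv_alg scale \<sigma> by (rule inv_alg.intro[OF assms(2)]) (unfold_locales, rule two)
 obtain c where aU: "\<sigma> a = a" "a * c = 1" "c * a = 1" using assms(4) by (auto simp: Sym_units_def Sym_def)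
 define \<tau> where "\<tau> = (\<lambda>x. c * \<sigma> x * a)"
 interpret twisted scale \<sigma> a c \<tau> by unfold_locales (simp_all add: aU \<tau>_def)
 interpret T: twisted scale \<tau> c a \<sigma> by (rule twist_symmetric)
 define S where "S = pfister_squares bs"
 note S = pfister_squares(1,2,3)[OF assms(3), folded S_def]
 have har: "cone_ordering scale P \<in> harrison bs \<longleftrightarrow> S \<subseteq> cone_ordering scale P"
  if "P \<in> positive_cones scale \<sigma>" for P
 proof -
  have "field_ordering (cone_ordering scale P)" using that by (simp add: positive_cones_def prepositive_cone_def)
  then show ?thesis using pfister_squares_ordering[OF _ assms(3)] by (simp add: harrison_def S_def)
 qed
 have tco: "cone_ordering scale ((*) a ` Q) = cone_ordering scale Q" "(*) a ` Q \<in> positive_cones scale \<sigma>"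
  if "Q \<in> positive_cones scale \<tau>" for Q
  using T.twist_prepositive(2)[of Q] T.twist_positive[OF that] that by (auto simp: positive_cones_def)
 have inj: "a * x \<in> (*) a ` Q \<longleftrightarrow> x \<in> Q" for x Q by (metis T.ac(1) T.ac(2) imageE imageI)
 have "Sym \<sigma> \<inter> \<Inter>{\<P> \<in> positive_cones scale \<sigma>. cone_ordering scale \<P> \<in> harrison bs \<and> a \<in> \<P>} = cone S a"
 proof (intro equalityI subsetI)
  fix u assume u: "u \<in> Sym \<sigma> \<inter> \<Inter>{\<P> \<in> positive_cones scale \<sigma>. cone_ordering scale \<P> \<in> harrison bs \<and> a \<in> \<P>}"
  \<comment> \<open>For \<tau> the element \<open>a\<close> has become \<open>1\<close>; positive
    cones for \<tau> are compared with those for \<sigma> through multiplication by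
    \<open>a\<close>.\<close>
  have "c * u \<in> T.cone S 1"
  proof (rule T.positive_in_cone_one[OF S])
   show "\<tau> (c * u) = c * u" using u by (simp add: tau sg_simps sc aU mult.assoc Sym_def)
   fix Q assume Q: "Q \<in> positive_cones scale \<tau>" "S \<subseteq> cone_ordering scale Q"
   have h: "cone_ordering scale ((*) a ` Q) \<in> harrison bs" using har[OF tco(2)[OF Q(1)]] tco(1)[OF Q(1)] Q(2) by simp
   have "a \<in> (*) a ` Q \<union> uminus ` (*) a ` Q" by (rule assms(5)[OF tco(2)[OF Q(1)] h])
   then have "a \<in> (*) a ` Q \<or> - a \<in> (*) a ` Q" by (metis Un_iff imageE minus_minus)
   then have "a * 1 \<in> (*) a ` Q \<or> a * - 1 \<in> (*) a ` Q" by simp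
   then have "1 \<in> Q \<or> - 1 \<in> Q" unfolding inj .
   then show "1 \<in> Q \<union> uminus ` Q" by (metis UnI1 UnI2 imageI minus_minus)
   assume "1 \<in> Q"
   then have "a \<in> (*) a ` Q" using inj[of 1 Q] by simp
   then have "u \<in> (*) a ` Q" using u tco(2)[OF Q(1)] h by blast
   then have "a * (c * u) \<in> (*) a ` Q" by (simp add: mult.assoc[symmetric] aU)
   then show "c * u \<in> Q" unfolding inj .
  qed
  then have "a * (c * u) \<in> cone S a"
  proof (induction rule: T.cone_induct)
   case (add b x v)
   have "a * scale b (\<tau> x * 1 * x) = scale b (\<sigma> x * a * x)"
    by (simp add: tau scale_mult_right[symmetric] mult.assoc[symmetric] aU)
   then show ?case using cone_add[OF cone_gen[OF add(1), of x a] add(3)] by (simp add: distrib_left)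
  qed (simp add: cone_zero)
  then show "u \<in> cone S a" by (simp add: mult.assoc[symmetric] aU)
 next
  fix u assume u: "u \<in> cone S a"
  have "u \<in> \<P>" if P: "\<P> \<in> positive_cones scale \<sigma>" "cone_ordering scale \<P> \<in> harrison bs" "a \<in> \<P>" for \<P>
  proof (rule cone_in[OF u P(3)])
   have pp: "prepositive_cone scale \<sigma> \<P>" using P(1) by (simp add: positive_cones_def)
   show "0 \<in> \<P>" using pp by (auto simp: prepositive_cone_def)
   show "x + y \<in> \<P>" "\<sigma> z * x * z \<in> \<P>" if "x \<in> \<P>" "y \<in> \<P>" for x y z using pp that by (auto simp: prepositive_cone_def)
   show "scale k x \<in> \<P>" if "k \<in> S" "x \<in> \<P>" for k x using har[OF P(1)] P(2) that by (auto simp: cone_ordering_def)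
  qed
  then show "u \<in> Sym \<sigma> \<inter> \<Inter>{\<P> \<in> positive_cones scale \<sigma>. cone_ordering scale \<P> \<in> harrison bs \<and> a \<in> \<P>}"
   using cone_Sym[OF u aU(1)] by (auto simp: Sym_def)
 qed
 then show ?thesis unfolding S_def cone_represented[OF aU(1) assms(3)] .
qed

end
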